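(* Let $(\mathfrak g,\mathfrak k)$ be a Hermitian symmetric pair, let $\mathfrak q=\mathfrak l\oplus\mathfrak u$ be a $\theta$-stable parabolic subalgebra of $\mathfrak g$ with $\mathfrak l\subset\mathfrak k$ and $\mathfrak u\supset\mathfrak p^+$, and let $V$ be an admissible unitary $(\mathfrak g,K)$-module. Let $C$ be the operator on $V\otimes S$ defined in the context (the $\bar{\mathfrak u}$-cohomology differential), $C^{adj}$ its adjoint, and $\Delta=CC^{adj}+C^{adj}C$. Then: (a) $\operatorname{Ker}\Delta=\operatorname{Ker}C\cap\operatorname{Ker}C^{adj}$; (b) $V\otimes S=\operatorname{Ker}\Delta\oplus\operatorname{Im}C\oplus\operatorname{Im}C^{adj}$; (c) $\operatorname{Ker}C=\operatorname{Ker}\Delta\oplus\operatorname{Im}C$; (d) $\operatorname{Ker}C^{adj}=\operatorname{Ker}\Delta\oplus\operatorname{Im}C^{adj}$.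
   Context: $G$ is a connected semisimple Lie group with finite center, Lie algebra $\mathfrak g_0$, complexification $\mathfrak g$; $\theta$ a Cartan involution, $K=G^\theta$, $\mathfrak g=\mathfrak k\oplus\mathfrak p$ the complexified Cartan decomposition, $B$ the Killing form, bar denotes conjugation with respect to $\mathfrak g_0$. Hermitian symmetric: $\mathfrak p=\mathfrak p^+\oplus\mathfrak p^-$ with $\mathfrak p^\pm$ $K$-stable abelian subalgebras, conjugate to each other, and $\mathfrak k\oplus\mathfrak p^{+}$ parabolic with Levi factor $\mathfrak k$ and nilradical $\mathfrak p^+$. The $\theta$-stable parabolic $\mathfrak q=\mathfrak l\oplus\mathfrak u$ has Levi factor $\mathfrak l=\bar{\mathfrak l}$, nilradical $\mathfrak u$, and opposite parabolic $\mathfrak l\oplus\bar{\mathfrak u}$; $\mathfrak s=\mathfrak u\oplus\bar{\mathfrak u}$. $V$ is unitary if it carries a positive definite $K$-invariant Hermitian form for which $\mathfrak g_0$ acts by skew-Hermitian operators. $C(\mathfrak s)$ is the Clifford algebra with relations $vw+wv=2B(v,w)$, acting on $S=\bigwedge^\cdot\mathfrak u$ by $u\cdot Y=u\wedge Y$ ($u\in\mathfrak u$) and $u^*\cdot(Y_1\wedge\dots\wedge Y_p)=2\sum_i(-1)^{i+1}B(u^*,Y_i)Y_1\wedge\dots\widehat{Y_i}\dots\wedge Y_p$ ($u^*\in\bar{\mathfrak u}$). With $u_1,\dots,u_n$ a basis of $\mathfrak u$ and $u_i^*$ the $B$-dual basis of $\bar{\mathfrak u}$, $C$ is the action on $V\otimes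 S$ of $$C=\sum_iu_i^*\otimes u_i-\tfrac14\sum_{i,j}1\otimes[u_i^*,u_j^*]u_iu_j\in U(\mathfrak g)\otimes C(\mathfrak s).$$ $\langle X,Y\rangle=-2B(X,\theta\bar Y)$ is a positive definite Hermitian form on $\mathfrak u$, extended to $S=\bigwedge^\cdot\mathfrak u$ by determinants; $V\otimes S$ carries the tensor product of this form with the unitary form on $V$. $C^{adj}$ is the adjoint of $C$ with respect to this form. *)

theory Defs
  imports "HOL-Analysis.Analysis" "HOL-Algebra.Group" "HOL-Library.Function_Algebras"
begin

section \<open>Linear algebra over an explicit scalar multiplication\<close>

definition fin_dim :: "('k::comm_ring_1 \<Rightarrow> 'v::ab_group_add \<Rightarrow> 'v) \<Rightarrow> 'v set \<Rightarrow> bool" where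
  "fin_dim s W \<longleftrightarrow> (\<exists>F. finite F \<and> W \<subseteq> module.span s F)"

text \<open>
  \<open>listset [A, B, C]\<close> consists of the lists \<open>[a, b, c]\<close> with \<open>a \<in> A\<close>, \<open>b \<in> B\<close>, \<open>c \<in> C\<close>; so this says
  that every element of \<open>W\<close> is such a sum in exactly one way, and all such sums are in \<open>W\<close>.
\<close>
definition internal_direct_sum :: "'v::monoid_add set list \<Rightarrow> 'v set \<Rightarrow> bool" where
  "internal_direct_sum Ws W \<longleftrightarrow> bij_betw sum_list (listset Ws) W"

definition sesquilinear_on ::
  "(complex \<Rightarrow> 'v::ab_group_add \<Rightarrow> 'v) \<Rightarrow> 'v set \<Rightarrow> ('v \<Rightarrow> 'v \<Rightarrow> complex) \<Rightarrow> bool" where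
  "sesquilinear_on s W h \<longleftrightarrow>
     (\<forall>x\<in>W. \<forall>y\<in>W. \<forall>z\<in>W. h (x + y) z = h x z + h y z \<and> h x (y + z) = h x y + h x z) \<and>
     (\<forall>c. \<forall>x\<in>W. \<forall>y\<in>W. h (s c x) y = c * h x y \<and> h x (s c y) = cnj c * h x y)"

definition pos_def_hermitian ::
  "(complex \<Rightarrow> 'v::ab_group_add \<Rightarrow> 'v) \<Rightarrow> ('v \<Rightarrow> 'v \<Rightarrow> complex) \<Rightarrow> bool" where
  "pos_def_hermitian s h \<longleftrightarrow> sesquilinear_on s UNIV h \<and>
     (\<forall>x y. h y x = cnj (h x y)) \<and> (\<forall>x. x \<noteq> 0 \<longrightarrow> 0 < Re (h x x))"

text \<open>For a positive definite form \<open>h\<close> the adjoint is unique on \<open>W\<close>; its values off \<open>W\<close> are irrelevant.\<close>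
definition adjoint_op :: "'w set \<Rightarrow> ('w \<Rightarrow> 'w \<Rightarrow> complex) \<Rightarrow> ('w \<Rightarrow> 'w) \<Rightarrow> 'w \<Rightarrow> 'w" where
  "adjoint_op W h C =
     (SOME A. (\<forall>y\<in>W. A y \<in> W) \<and> (\<forall>x\<in>W. \<forall>y\<in>W. h (C x) y = h x (A y)))"


section \<open>Lie algebras\<close>

definition lie_algebra ::
  "('k::comm_ring_1 \<Rightarrow> 'a::ab_group_add \<Rightarrow> 'a) \<Rightarrow> ('a \<Rightarrow> 'a \<Rightarrow> 'a) \<Rightarrow> bool" where
  "lie_algebra s br \<longleftrightarrow> module s \<and>
     (\<forall>x. Modules.module_hom s s (br x)) \<and> (\<forall>y. Modules.module_hom s s (\<lambda>x. br x y)) \<and>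
     (\<forall>x. br x x = 0) \<and>
     (\<forall>x y z. br x (br y z) + br y (br z x) + br z (br x y) = 0)"

definition bracket_span ::
  "('k::comm_ring_1 \<Rightarrow> 'a::ab_group_add \<Rightarrow> 'a) \<Rightarrow> ('a \<Rightarrow> 'a \<Rightarrow> 'a) \<Rightarrow> 'a set \<Rightarrow> 'a set \<Rightarrow> 'a set" where
  "bracket_span s br A B = module.span s {br a b | a b. a \<in> A \<and> b \<in> B}"

definition lie_subalgebra where
  "lie_subalgebra s br h \<longleftrightarrow> module.subspace s h \<and> (\<forall>x\<in>h. \<forall>y\<in>h. br x y \<in> h)"

definition lie_ideal where
  "lie_ideal s br q I \<longleftrightarrow> module.subspace s I \<and> I \<subseteq> q \<and> (\<forall>x\<in>q. \<forall>y\<in>I. br x y \<in> I)"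

definition lie_solvable where
  "lie_solvable s br h \<longleftrightarrow> (\<exists>m. ((\<lambda>A. bracket_span s br A A) ^^ m) h = {0})"

definition lie_nilpotent where
  "lie_nilpotent s br h \<longleftrightarrow> (\<exists>m. ((\<lambda>A. bracket_span s br h A) ^^ m) h = {0})"

definition semisimple_lie_algebra where
  "semisimple_lie_algebra s br \<longleftrightarrow> lie_algebra s br \<and>
     (\<forall>I. lie_ideal s br UNIV I \<and> lie_solvable s br I \<longrightarrow> I = {0})"

definition borel_subalgebra where
  "borel_subalgebra s br b \<longleftrightarrow> lie_subalgebra s br b \<and> lie_solvable s br b \<and>
     (\<forall>b'. lie_subalgebra s br b' \<and> lie_solvable s br b' \<and> b \<subseteq> b' \<longrightarrow> b' = b)"

definition parabolic_subalgebra where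
  "parabolic_subalgebra s br q \<longleftrightarrow> lie_subalgebra s br q \<and> (\<exists>b. borel_subalgebra s br b \<and> b \<subseteq> q)"

definition is_nilradical where
  "is_nilradical s br q u \<longleftrightarrow> lie_ideal s br q u \<and> lie_nilpotent s br u \<and>
     (\<forall>I. lie_ideal s br q I \<and> lie_nilpotent s br I \<longrightarrow> I \<subseteq> u)"

text \<open>
  For a parabolic subalgebra \<open>q\<close> of a complex semisimple Lie algebra, a subalgebra complementary to the
  nilradical is isomorphic to the quotient of \<open>q\<close> by the nilradical, hence reductive: a Levi factor.
\<close>
definition levi_decomposition where
  "levi_decomposition s br q l u \<longleftrightarrow>
     lie_subalgebra s br l \<and> is_nilradical s br q u \<and> internal_direct_sum [l, u] q"

definition killing_form :: "('a::field ^ 'n \<Rightarrow> 'a ^ 'n \<Rightarrow> 'a ^ 'n) \<Rightarrow> 'a ^ 'n \<Rightarrow> 'a ^ 'n \<Rightarrow> 'a" where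
  "killing_form br x y = trace (matrix (\<lambda>z. br x (br y z)))"

definition cartan_involution ::
  "(real ^ 'n \<Rightarrow> real ^ 'n \<Rightarrow> real ^ 'n) \<Rightarrow> (real ^ 'n \<Rightarrow> real ^ 'n) \<Rightarrow> bool" where
  "cartan_involution br th \<longleftrightarrow> linear th \<and> (\<forall>x. th (th x) = x) \<and>
     (\<forall>x y. th (br x y) = br (th x) (th y)) \<and>
     (\<forall>x. x \<noteq> 0 \<longrightarrow> killing_form br x (th x) < 0)"


section \<open>Complexification\<close>

text \<open>The complexification of \<open>real ^ 'n\<close> is \<open>complex ^ 'n\<close>, with scalar multiplication \<open>(*s)\<close>.\<close>

definition cplx :: "real ^ 'n \<Rightarrow> complex ^ 'n" where
  "cplx x = (\<chi> k. complex_of_real (x $ k))"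

definition re_part :: "complex ^ 'n \<Rightarrow> real ^ 'n" where
  "re_part z = (\<chi> k. Re (z $ k))"

definition im_part :: "complex ^ 'n \<Rightarrow> real ^ 'n" where
  "im_part z = (\<chi> k. Im (z $ k))"

definition conj_vec :: "complex ^ 'n \<Rightarrow> complex ^ 'n" where
  "conj_vec z = (\<chi> k. cnj (z $ k))"

definition complexify :: "(real ^ 'n \<Rightarrow> real ^ 'n) \<Rightarrow> complex ^ 'n \<Rightarrow> complex ^ 'n" where
  "complexify f z = cplx (f (re_part z)) + \<i> *s cplx (f (im_part z))"

definition complexify2 ::
  "(real ^ 'n \<Rightarrow> real ^ 'n \<Rightarrow> real ^ 'n) \<Rightarrow> complex ^ 'n \<Rightarrow> complex ^ 'n \<Rightarrow> complex ^ 'n" where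
  "complexify2 br z w =
     cplx (br (re_part z) (re_part w) - br (im_part z) (im_part w)) +
     \<i> *s cplx (br (re_part z) (im_part w) + br (im_part z) (re_part w))"


section \<open>Lie groups\<close>

primrec Ck_on :: "nat \<Rightarrow> ('a::euclidean_space \<Rightarrow> 'b::euclidean_space) \<Rightarrow> 'a set \<Rightarrow> bool" where
  "Ck_on 0 f S \<longleftrightarrow> continuous_on S f"
| "Ck_on (Suc k) f S \<longleftrightarrow> (\<forall>x\<in>S. f differentiable (at x)) \<and>
     (\<forall>v. Ck_on k (\<lambda>x. frechet_derivative f (at x) v) S)"

definition smooth_on :: "'a set \<Rightarrow> ('a::euclidean_space \<Rightarrow> 'b::euclidean_space) \<Rightarrow> bool" where
  "smooth_on S f \<longleftrightarrow> (\<forall>k. Ck_on k f S)"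

text \<open>
  A chart is a pair \<open>(U, \<phi>)\<close> of an open set and a coordinate map; \<open>inv_into U \<phi>\<close> is its inverse.
\<close>
definition smooth_manifold :: "'g topology \<Rightarrow> ('g set \<times> ('g \<Rightarrow> 'e::euclidean_space)) set \<Rightarrow> bool" where
  "smooth_manifold T A \<longleftrightarrow> Hausdorff_space T \<and> second_countable T \<and>
     (\<Union>(U, \<phi>)\<in>A. U) = topspace T \<and>
     (\<forall>(U, \<phi>)\<in>A. openin T U \<and> open (\<phi> ` U) \<and>
        homeomorphic_map (subtopology T U) (top_of_set (\<phi> ` U)) \<phi>) \<and>
     (\<forall>(U, \<phi>)\<in>A. \<forall>(W, \<psi>)\<in>A. smooth_on (\<phi> ` (U \<inter> W)) (\<lambda>x. \<psi> (inv_into U \<phi> x)))"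

definition smooth_map where
  "smooth_map T A T' A' f \<longleftrightarrow> continuous_map T T' f \<and>
     (\<forall>(U, \<phi>)\<in>A. \<forall>(W, \<psi>)\<in>A'. smooth_on (\<phi> ` {x \<in> U. f x \<in> W}) (\<lambda>x. \<psi> (f (inv_into U \<phi> x))))"

definition product_atlas where
  "product_atlas A A' = {(U \<times> W, map_prod \<phi> \<psi>) | U \<phi> W \<psi>. (U, \<phi>) \<in> A \<and> (W, \<psi>) \<in> A'}"

definition lie_group ::
  "('g, 'm) monoid_scheme \<Rightarrow> 'g topology \<Rightarrow> ('g set \<times> ('g \<Rightarrow> 'e::euclidean_space)) set \<Rightarrow> bool" where
  "lie_group G T A \<longleftrightarrow> group G \<and> topspace T = carrier G \<and> smooth_manifold T A \<and>
     smooth_map (prod_topology T T) (product_atlas A A) T A (\<lambda>(x, y). x \<otimes>\<^bsub>G\<^esub> y) \<and>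
     smooth_map T A T A (\<lambda>x. inv\<^bsub>G\<^esub> x)"

definition group_center :: "('g, 'm) monoid_scheme \<Rightarrow> 'g set" where
  "group_center G = {z \<in> carrier G. \<forall>x\<in>carrier G. z \<otimes>\<^bsub>G\<^esub> x = x \<otimes>\<^bsub>G\<^esub> z}"

text \<open>
  A chart \<open>(U, \<phi>)\<close> around the identity identifies the tangent space at the identity with the model space.
  \<open>diff_at_one\<close> is the differential at the identity of a map fixing the identity; the Lie bracket is
  the differential \<open>ad\<close> of the adjoint representation \<open>Ad\<close>, which is the bracket of left
  invariant vector fields.
\<close>
definition diff_at_one ::
  "('g, 'm) monoid_scheme \<Rightarrow> 'g set \<Rightarrow> ('g \<Rightarrow> 'e::euclidean_space) \<Rightarrow> ('g \<Rightarrow> 'g) \<Rightarrow> 'e \<Rightarrow> 'e" where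
  "diff_at_one G U \<phi> f =
     frechet_derivative (\<lambda>x. \<phi> (f (inv_into U \<phi> x))) (at (\<phi> \<one>\<^bsub>G\<^esub>))"

definition Ad ::
  "('g, 'm) monoid_scheme \<Rightarrow> 'g set \<Rightarrow> ('g \<Rightarrow> 'e::euclidean_space) \<Rightarrow> 'g \<Rightarrow> 'e \<Rightarrow> 'e" where
  "Ad G U \<phi> g = diff_at_one G U \<phi> (\<lambda>x. g \<otimes>\<^bsub>G\<^esub> x \<otimes>\<^bsub>G\<^esub> inv\<^bsub>G\<^esub> g)"

definition lie_bracket ::
  "('g, 'm) monoid_scheme \<Rightarrow> 'g set \<Rightarrow> ('g \<Rightarrow> 'e::euclidean_space) \<Rightarrow> 'e \<Rightarrow> 'e \<Rightarrow> 'e" where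
  "lie_bracket G U \<phi> X Y =
     frechet_derivative (\<lambda>x. Ad G U \<phi> (inv_into U \<phi> x) Y) (at (\<phi> \<one>\<^bsub>G\<^esub>)) X"


section \<open>Hermitian symmetric pairs and theta-stable parabolic subalgebras\<close>

text \<open>
  Below, \<open>br\<close> is the bracket of the complexified Lie algebra, \<open>th\<close> the complexified Cartan involution,
  and \<open>AdK\<close> the complexified adjoint action.
\<close>

definition hermitian_symmetric ::
  "(complex ^ 'n \<Rightarrow> complex ^ 'n \<Rightarrow> complex ^ 'n) \<Rightarrow> (complex ^ 'n \<Rightarrow> complex ^ 'n) \<Rightarrow>
   'g set \<Rightarrow> ('g \<Rightarrow> complex ^ 'n \<Rightarrow> complex ^ 'n) \<Rightarrow> (complex ^ 'n) set \<Rightarrow> (complex ^ 'n) set \<Rightarrow> bool" where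
  "hermitian_symmetric br th K AdK pplus pminus \<longleftrightarrow>
     lie_subalgebra (*s) br pplus \<and> lie_subalgebra (*s) br pminus \<and>
     pminus = conj_vec ` pplus \<and>
     internal_direct_sum [pplus, pminus] {x. th x = - x} \<and>
     (\<forall>k\<in>K. AdK k ` pplus \<subseteq> pplus \<and> AdK k ` pminus \<subseteq> pminus) \<and>
     (\<forall>x\<in>pplus. \<forall>y\<in>pplus. br x y = 0) \<and> (\<forall>x\<in>pminus. \<forall>y\<in>pminus. br x y = 0) \<and>
     (let q = {x + y | x y. th x = x \<and> y \<in> pplus} in
        parabolic_subalgebra (*s) br q \<and> levi_decomposition (*s) br q {x. th x = x} pplus)"

definition theta_stable_parabolic ::
  "(complex ^ 'n \<Rightarrow> complex ^ 'n \<Rightarrow> complex ^ 'n) \<Rightarrow> (complex ^ 'n \<Rightarrow> complex ^ 'n) \<Rightarrow>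
   (complex ^ 'n) set \<Rightarrow> (complex ^ 'n) set \<Rightarrow> (complex ^ 'n) set \<Rightarrow> bool" where
  "theta_stable_parabolic br th q l u \<longleftrightarrow>
     parabolic_subalgebra (*s) br q \<and> th ` q = q \<and>
     levi_decomposition (*s) br q l u \<and> conj_vec ` l = l \<and>
     internal_direct_sum [conj_vec ` u, l, u] UNIV"


section \<open>Modules\<close>

text \<open>
  The representation space is the whole type \<open>'v\<close>, with scalar multiplication \<open>s\<close>.  Since \<open>K\<close> acts
  locally finitely, continuity and differentiability on the finite-dimensional invariant subspaces can be
  tested with linear functionals \<open>f\<close> on \<open>'v\<close>.  The last clause says that the differential of the action
  of \<open>K\<close> is the action of its Lie algebra; \<open>c\<close> is a curve in \<open>K\<close> through the identity
  with tangent vector \<open>X\<close>.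
\<close>
definition gK_module ::
  "('g, 'm) monoid_scheme \<Rightarrow> 'g topology \<Rightarrow> 'g set \<Rightarrow> ('g \<Rightarrow> real ^ 'n) \<Rightarrow> 'g set \<Rightarrow>
   (complex \<Rightarrow> 'v::ab_group_add \<Rightarrow> 'v) \<Rightarrow> (complex ^ 'n \<Rightarrow> 'v \<Rightarrow> 'v) \<Rightarrow> ('g \<Rightarrow> 'v \<Rightarrow> 'v) \<Rightarrow> bool" where
  "gK_module G T U \<phi> K s \<pi> \<rho> \<longleftrightarrow>
     vector_space s \<and>
     (\<forall>x. Vector_Spaces.linear s s (\<pi> x)) \<and> (\<forall>v. Vector_Spaces.linear (*s) s (\<lambda>x. \<pi> x v)) \<and>
     (\<forall>x y v. \<pi> (complexify2 (lie_bracket G U \<phi>) x y) v = \<pi> x (\<pi> y v) - \<pi> y (\<pi> x v)) \<and>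
     (\<forall>k\<in>K. Vector_Spaces.linear s s (\<rho> k)) \<and> (\<forall>v. \<rho> \<one>\<^bsub>G\<^esub> v = v) \<and>
     (\<forall>k\<in>K. \<forall>k'\<in>K. \<forall>v. \<rho> (k \<otimes>\<^bsub>G\<^esub> k') v = \<rho> k (\<rho> k' v)) \<and>
     (\<forall>v. fin_dim s ((\<lambda>k. \<rho> k v) ` K)) \<and>
     (\<forall>v f. Vector_Spaces.linear s (*) f \<longrightarrow>
        continuous_map (subtopology T K) euclidean (\<lambda>k. f (\<rho> k v) :: complex)) \<and>
     (\<forall>k\<in>K. \<forall>x v. \<rho> k (\<pi> x v) = \<pi> (complexify (Ad G U \<phi> k) x) (\<rho> k v)) \<and>
     (\<forall>c X v f. (\<forall>t::real. c t \<in> K \<inter> U) \<and> c 0 = \<one>\<^bsub>G\<^esub> \<and>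
        ((\<lambda>t. \<phi> (c t)) has_vector_derivative X) (at 0) \<and> Vector_Spaces.linear s (*) f \<longrightarrow>
        ((\<lambda>t. f (\<rho> (c t) v) :: complex) has_vector_derivative f (\<pi> (cplx X) v)) (at 0))"

definition K_stable where
  "K_stable s K \<rho> F \<longleftrightarrow> module.subspace s F \<and> (\<forall>k\<in>K. \<rho> k ` F \<subseteq> F)"

definition K_irreducible where
  "K_irreducible s K \<rho> F \<longleftrightarrow> K_stable s K \<rho> F \<and> F \<noteq> {0} \<and> fin_dim s F \<and>
     (\<forall>F'. K_stable s K \<rho> F' \<and> F' \<subseteq> F \<longrightarrow> F' = {0} \<or> F' = F)"

text \<open>A linear map on a subspace extends to the whole space, so \<open>h\<close> may be taken linear everywhere.\<close>
definition K_equivalent where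
  "K_equivalent s K \<rho> F F' \<longleftrightarrow> (\<exists>h. Vector_Spaces.linear s s h \<and> bij_betw h F F' \<and>
     (\<forall>k\<in>K. \<forall>v\<in>F. h (\<rho> k v) = \<rho> k (h v)))"

definition isotypic_component where
  "isotypic_component s K \<rho> F =
     module.span s (\<Union>{F'. K_irreducible s K \<rho> F' \<and> K_equivalent s K \<rho> F F'})"

text \<open>Only types occurring in the module matter: the others have multiplicity zero.\<close>
definition admissible where
  "admissible s K \<rho> \<longleftrightarrow> (\<forall>F. K_irreducible s K \<rho> F \<longrightarrow> fin_dim s (isotypic_component s K \<rho> F))"

definition unitary_form ::
  "'g set \<Rightarrow> (complex \<Rightarrow> 'v::ab_group_add \<Rightarrow> 'v) \<Rightarrow> (complex ^ 'n \<Rightarrow> 'v \<Rightarrow> 'v) \<Rightarrow> ('g \<Rightarrow> 'v \<Rightarrow> 'v) \<Rightarrow>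
   ('v \<Rightarrow> 'v \<Rightarrow> complex) \<Rightarrow> bool" where
  "unitary_form K s \<pi> \<rho> H \<longleftrightarrow> pos_def_hermitian s H \<and>
     (\<forall>k\<in>K. \<forall>v w. H (\<rho> k v) (\<rho> k w) = H v w) \<and>
     (\<forall>X v w. H (\<pi> (cplx X) v) w = - H v (\<pi> (cplx X) w))"


section \<open>Exterior algebra and spin module\<close>

text \<open>
  The exterior algebra of \<open>complex ^ 'n\<close> is realised by alternating multilinear functions of
  finite lists of covectors, a covector being given by its coordinates: \<open>Y\<^sub>1 \<and> \<dots> \<and> Y\<^sub>p\<close>
  sends \<open>[a\<^sub>1, \<dots>, a\<^sub>p]\<close> to the determinant of the matrix of pairings \<open>a\<^sub>i(Y\<^sub>j)\<close>, and lists of any other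
  length to 0.  Replacing the values by vectors of \<open>V\<close> gives the tensor product with \<open>V\<close>, where \<open>v \<otimes> \<omega>\<close> is
  \<open>as \<mapsto> \<omega>(as) v\<close>.  The operators below are defined for functions with values in any space with scalar
  multiplication \<open>s\<close>; on the exterior algebra itself \<open>s\<close> is \<open>(*)\<close>.
\<close>

definition fun_scale :: "('k \<Rightarrow> 'v \<Rightarrow> 'v) \<Rightarrow> 'k \<Rightarrow> ('a \<Rightarrow> 'v) \<Rightarrow> 'a \<Rightarrow> 'v" where
  "fun_scale s c f = (\<lambda>a. s c (f a))"

definition pairing :: "complex ^ 'n \<Rightarrow> complex ^ 'n \<Rightarrow> complex" where
  "pairing a x = (\<Sum>k\<in>UNIV. a $ k * x $ k)"

definition covector :: "(complex ^ 'n \<Rightarrow> complex) \<Rightarrow> complex ^ 'n" where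
  "covector f = (\<chi> k. f (axis k 1))"

definition delete_nth :: "nat \<Rightarrow> 'a list \<Rightarrow> 'a list" where
  "delete_nth i xs = take i xs @ drop (Suc i) xs"

text \<open>Left exterior multiplication by \<open>x\<close>: Laplace expansion along the column of \<open>x\<close>.\<close>
definition wedge_mult ::
  "(complex \<Rightarrow> 'v \<Rightarrow> 'v) \<Rightarrow> complex ^ 'n \<Rightarrow> ((complex ^ 'n) list \<Rightarrow> 'v::ab_group_add) \<Rightarrow> (complex ^ 'n) list \<Rightarrow> 'v" where
  "wedge_mult s x \<Phi> = (\<lambda>as. \<Sum>i<length as. s ((-1) ^ i * pairing (as ! i) x) (\<Phi> (delete_nth i as)))"

definition wedge :: "(complex ^ 'n) list \<Rightarrow> (complex ^ 'n) list \<Rightarrow> complex" where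
  "wedge Ys = foldr (wedge_mult (*)) Ys (\<lambda>as. if as = [] then 1 else 0)"

definition exterior_algebra :: "(complex ^ 'n) set \<Rightarrow> ((complex ^ 'n) list \<Rightarrow> complex) set" where
  "exterior_algebra u = module.span (fun_scale (*)) {wedge Ys | Ys. set Ys \<subseteq> u}"

text \<open>
  Clifford action of an element of the opposite nilradical: contraction with \<open>2 B(x, -)\<close>.  See
  \<open>cliff_opp_wedge\<close> below for its values on decomposable elements.
\<close>
definition cliff_opp ::
  "(complex \<Rightarrow> 'v \<Rightarrow> 'v) \<Rightarrow> (complex ^ 'n \<Rightarrow> complex ^ 'n \<Rightarrow> complex) \<Rightarrow> complex ^ 'n \<Rightarrow>
   ((complex ^ 'n) list \<Rightarrow> 'v) \<Rightarrow> (complex ^ 'n) list \<Rightarrow> 'v" where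
  "cliff_opp s B x \<Phi> = (\<lambda>as. s 2 (\<Phi> (covector (B x) # as)))"

definition tensor :: "(complex \<Rightarrow> 'v \<Rightarrow> 'v) \<Rightarrow> 'v \<Rightarrow> ('a \<Rightarrow> complex) \<Rightarrow> 'a \<Rightarrow> 'v" where
  "tensor s v \<omega> = (\<lambda>a. s (\<omega> a) v)"

text \<open>\<open>V \<otimes> S\<close> for \<open>S\<close> the exterior algebra of \<open>u\<close>.\<close>
definition VS_space ::
  "(complex \<Rightarrow> 'v::ab_group_add \<Rightarrow> 'v) \<Rightarrow> (complex ^ 'n) set \<Rightarrow> ((complex ^ 'n) list \<Rightarrow> 'v) set" where
  "VS_space s u = module.span (fun_scale s) {tensor s v \<omega> | v \<omega>. \<omega> \<in> exterior_algebra u}"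

definition C_op ::
  "(complex \<Rightarrow> 'v::ab_group_add \<Rightarrow> 'v) \<Rightarrow> (complex ^ 'n \<Rightarrow> complex ^ 'n \<Rightarrow> complex ^ 'n) \<Rightarrow>
   (complex ^ 'n \<Rightarrow> 'v \<Rightarrow> 'v) \<Rightarrow> (complex ^ 'n) list \<Rightarrow> (complex ^ 'n) list \<Rightarrow>
   ((complex ^ 'n) list \<Rightarrow> 'v) \<Rightarrow> (complex ^ 'n) list \<Rightarrow> 'v" where
  "C_op s br \<pi> us ds \<Phi> =
     (\<Sum>i<length us. wedge_mult s (us ! i) (\<lambda>as. \<pi> (ds ! i) (\<Phi> as)))
     - fun_scale s (1/4) (\<Sum>i<length us. \<Sum>j<length us.
         cliff_opp s (killing_form br) (br (ds ! i) (ds ! j))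
           (wedge_mult s (us ! i) (wedge_mult s (us ! j) \<Phi>)))"

text \<open>\<open>us\<close> is a basis of \<open>u\<close>, and \<open>ds\<close> the dual basis of \<open>ubar\<close> with respect to \<open>B\<close>.\<close>
definition dual_bases ::
  "(complex ^ 'n \<Rightarrow> complex ^ 'n \<Rightarrow> complex) \<Rightarrow> (complex ^ 'n) set \<Rightarrow> (complex ^ 'n) set \<Rightarrow>
   (complex ^ 'n) list \<Rightarrow> (complex ^ 'n) list \<Rightarrow> bool" where
  "dual_bases B u ubar us ds \<longleftrightarrow>
     distinct us \<and> vec.independent (set us) \<and> vec.span (set us) = u \<and>
     distinct ds \<and> vec.independent (set ds) \<and> vec.span (set ds) = ubar \<and>
     length ds = length us \<and>
     (\<forall>i<length us. \<forall>j<length us. B (us ! i) (ds ! j) = (if i = j then 1 else 0))"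


section \<open>Hermitian forms\<close>

definition u_form ::
  "(complex ^ 'n \<Rightarrow> complex ^ 'n \<Rightarrow> complex ^ 'n) \<Rightarrow> (complex ^ 'n \<Rightarrow> complex ^ 'n) \<Rightarrow>
   complex ^ 'n \<Rightarrow> complex ^ 'n \<Rightarrow> complex" where
  "u_form br th X Y = - 2 * killing_form br X (th (conj_vec Y))"

text \<open>
  The next two forms are determined by the stated properties on \<open>S\<close> and on \<open>V \<otimes> S\<close> respectively;
  their values elsewhere are irrelevant.  The sum over permutations is a determinant of variable size.
\<close>
definition S_form ::
  "(complex ^ 'n \<Rightarrow> complex ^ 'n \<Rightarrow> complex) \<Rightarrow> (complex ^ 'n) set \<Rightarrow>
   ((complex ^ 'n) list \<Rightarrow> complex) \<Rightarrow> ((complex ^ 'n) list \<Rightarrow> complex) \<Rightarrow> complex" where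
  "S_form h u = (SOME hS. sesquilinear_on (fun_scale (*)) (exterior_algebra u) hS \<and>
     (\<forall>Ys Zs. set Ys \<subseteq> u \<and> set Zs \<subseteq> u \<longrightarrow>
        hS (wedge Ys) (wedge Zs) =
          (if length Ys = length Zs
           then \<Sum>\<sigma> | \<sigma> permutes {..<length Ys}.
                  of_int (sign \<sigma>) * (\<Prod>i<length Ys. h (Ys ! i) (Zs ! \<sigma> i))
           else 0)))"

definition VS_form ::
  "(complex \<Rightarrow> 'v::ab_group_add \<Rightarrow> 'v) \<Rightarrow> ('v \<Rightarrow> 'v \<Rightarrow> complex) \<Rightarrow>
   (complex ^ 'n \<Rightarrow> complex ^ 'n \<Rightarrow> complex) \<Rightarrow> (complex ^ 'n) set \<Rightarrow>
   ((complex ^ 'n) list \<Rightarrow> 'v) \<Rightarrow> ((complex ^ 'n) list \<Rightarrow> 'v) \<Rightarrow> complex" where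
  "VS_form s H h u = (SOME hVS. sesquilinear_on (fun_scale s) (VS_space s u) hVS \<and>
     (\<forall>v w. \<forall>\<omega>\<in>exterior_algebra u. \<forall>\<eta>\<in>exterior_algebra u.
        hVS (tensor s v \<omega>) (tensor s w \<eta>) = H v w * S_form h u \<omega> \<eta>))"


section \<open>The operators on decomposable elements\<close>

lemma wedge_Nil: "wedge [] = (\<lambda>as. if as = [] then 1 else 0)"
  by (simp add: wedge_def)

lemma wedge_Cons: "wedge (x # Ys) = wedge_mult (*) x (wedge Ys)"
  by (simp add: wedge_def)

lemma pairing_covector:
  fixes f :: "complex ^ 'n \<Rightarrow> complex"
  assumes "Vector_Spaces.linear (*s) (*) f"
  shows "pairing (covector f) x = f x"
proof -
  interpret Vector_Spaces.linear "(*s)" "(*)" f by (rule assms)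
  have "f x = f (\<Sum>k\<in>UNIV. x $ k *s axis k 1)" by (simp add: basis_expansion)
  also have "\<dots> = (\<Sum>k\<in>UNIV. x $ k * f (axis k 1))" by (simp add: sum scale)
  finally show ?thesis by (simp add: pairing_def covector_def mult.commute)
qed

lemma cliff_opp_wedge:
  fixes B :: "complex ^ 'n \<Rightarrow> complex ^ 'n \<Rightarrow> complex"
  assumes lin: "Vector_Spaces.linear (*s) (*) (B x)"
  shows "cliff_opp (*) B x (wedge Ys) =
    (\<lambda>as. \<Sum>i<length Ys. 2 * (-1) ^ i * B x (Ys ! i) * wedge (delete_nth i Ys) as)"
proof (induction Ys)
  case Nil
  show ?case by (simp add: cliff_opp_def wedge_Nil fun_eq_iff)
next
  case (Cons y Ys)
  show ?case
  proof
    fix as :: "(complex ^ 'n) list"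
    let ?c = "covector (B x)"
    have IH: "2 * wedge Ys (?c # bs) =
        (\<Sum>i<length Ys. 2 * (-1) ^ i * B x (Ys ! i) * wedge (delete_nth i Ys) bs)" for bs
      using fun_cong[OF Cons.IH, of bs] by (simp add: cliff_opp_def)
    have "cliff_opp (*) B x (wedge (y # Ys)) as =
        2 * (B x y * wedge Ys as) +
        (\<Sum>j<length as. - ((-1) ^ j * pairing (as ! j) y * (2 * wedge Ys (?c # delete_nth j as))))"
      by (simp add: cliff_opp_def wedge_Cons wedge_mult_def sum.lessThan_Suc_shift delete_nth_def
          pairing_covector[OF lin] algebra_simps sum_distrib_left sum_negf del: sum.lessThan_Suc)
    also have "(\<Sum>j<length as. - ((-1) ^ j * pairing (as ! j) y * (2 * wedge Ys (?c # delete_nth j as)))) =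
        (\<Sum>j<length as. \<Sum>i<length Ys. - ((-1) ^ j * pairing (as ! j) y *
           (2 * (-1) ^ i * B x (Ys ! i) * wedge (delete_nth i Ys) (delete_nth j as))))"
      by (simp only: IH sum_distrib_left sum_negf)
    also have "\<dots> = (\<Sum>i<length Ys. 2 * (-1) ^ Suc i * B x (Ys ! i) * wedge (y # delete_nth i Ys) as)"
      by (subst sum.swap)
         (simp add: wedge_Cons wedge_mult_def sum_distrib_left sum_negf algebra_simps)
    finally show "cliff_opp (*) B x (wedge (y # Ys)) as =
        (\<Sum>i<length (y # Ys). 2 * (-1) ^ i * B x ((y # Ys) ! i) * wedge (delete_nth i (y # Ys)) as)"
      by (simp add: sum.lessThan_Suc_shift delete_nth_def algebra_simps del: sum.lessThan_Suc)
  qed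
qed

lemma C_op_tensor:
  assumes s: "vector_space s" and lin: "\<And>x. Vector_Spaces.linear s s (\<pi> x)"
  shows "C_op s br \<pi> us ds (tensor s v \<omega>) =
    (\<Sum>i<length us. tensor s (\<pi> (ds ! i) v) (wedge_mult (*) (us ! i) \<omega>))
    - fun_scale s (1/4) (\<Sum>i<length us. \<Sum>j<length us.
        tensor s v (cliff_opp (*) (killing_form br) (br (ds ! i) (ds ! j))
          (wedge_mult (*) (us ! i) (wedge_mult (*) (us ! j) \<omega>))))"
proof -
  interpret V: vector_space s by (rule s)
  have wm: "wedge_mult s x (tensor s w \<eta>) = tensor s w (wedge_mult (*) x \<eta>)" for x w \<eta>
    by (auto simp: wedge_mult_def tensor_def V.scale_sum_left)
  have co: "cliff_opp s B x (tensor s w \<eta>) = tensor s w (cliff_opp (*) B x \<eta>)" for B x w \<eta>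
    by (auto simp: cliff_opp_def tensor_def)
  have pi: "(\<lambda>as. \<pi> x (tensor s v \<omega> as)) = tensor s (\<pi> x v) \<omega>" for x
    by (auto simp: tensor_def module_hom.scale[OF Vector_Spaces.linear.axioms(3)[OF lin]])
  show ?thesis by (simp add: C_op_def wm co pi)
qed

end

theory Submission
  imports Defs
begin

text \<open>
  In an orthonormal basis of \<open>u\<close> adapted to \<open>u = p\<^sup>+ \<oplus> (u \<inter> k)\<close>, the operator \<open>C\<close> is a Chevalley--Eilenberg
  differential: \<open>C\<^sup>2 = 0\<close>, and unitarity of \<open>V\<close> gives an explicit formula for its adjoint. If \<open>C\<close> and its
  adjoint preserve finite-dimensional subspaces exhausting \<open>V \<otimes> S\<close>, the decomposition is the linear
  algebra of a finite-dimensional complex. Such subspaces exist because the part of \<open>C\<close> that involves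
  \<open>p\<^sup>+\<close> is \<open>K\<close>-equivariant on \<open>V \<otimes> \<Lambda>p\<^sup>+\<close>: since \<open>V\<close> is admissible and unitary, every finite-dimensional
  \<open>K\<close>-stable subspace has a finite-dimensional hull under the equivariant operators, while the
  remaining part acts through \<open>u \<inter> k\<close> and preserves \<open>K\<close>-stable subspaces, as one sees by differentiating along
  curves in \<open>K\<close>.
\<close>

section \<open>Linear algebra and Hermitian forms\<close>

text \<open>Two obstacles shape the proof. \<open>V\<close> is infinite-dimensional, so the image of
  the Laplacian has no orthogonal complement for free. And \<open>K\<close> need not preserve
  \<open>u\<close>: it acts on p+ but in general moves u \<inter> k, so V \<otimes> S carries no
  action of \<open>K\<close> to which admissibility could be applied. Hence V \<otimes> S is built
  in two layers, as a Fock space with modes in u \<inter> k over the bottom space V \<otimes>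
  \<Lambda>p+. On the bottom \<open>K\<close> acts unitarily and all finiteness is proved there; the
  upper layer adds finitely many creation operators, which cost no finiteness. Admissibility speaks
  of \<open>V\<close> alone, so maps into V \<otimes> \<Lambda>p+ are turned into maps into
  \<open>V\<close> by moving the finite-dimensional exterior factor to the source. Orthogonal
  projections for the invariant form do the work of complete reducibility. Since tangent vectors of
  \<open>K\<close> are real while u \<inter> k is complex, curves are constructed for real and
  imaginary parts separately. The forms and the adjoint in the statement are fixed by choice
  operators; explicit formulas in the frame are shown to agree with them.\<close>

lemma vector_space_fun_scale:
  assumes "vector_space s"
  shows "vector_space (fun_scale s)"
proof -
  interpret V: vector_space s by fact
  show ?thesis
    by unfold_locales
      (auto simp: fun_scale_def fun_eq_iff V.scale_right_distrib V.scale_left_distrib)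
qed

context vector_space begin

lemma fin_dim_mono: "fin_dim scale B \<Longrightarrow> A \<subseteq> B \<Longrightarrow> fin_dim scale A"
  unfolding fin_dim_def by blast

lemma fin_dim_span: "fin_dim scale A \<Longrightarrow> fin_dim scale (span A)"
  unfolding fin_dim_def by (meson span_minimal subspace_span)

lemma fin_dim_Un:
  assumes "fin_dim scale A" "fin_dim scale B"
  shows "fin_dim scale (span (A \<union> B))"
proof -
  from assms obtain F F' where "finite F" "A \<subseteq> span F" "finite F'" "B \<subseteq> span F'"
    unfolding fin_dim_def by blast
  then have "finite (F \<union> F')" "A \<union> B \<subseteq> span (F \<union> F')"
    using span_mono[of F "F \<union> F'"] span_mono[of F' "F \<union> F'"] by auto
  then show ?thesis
    using fin_dim_span fin_dim_def by blast
qed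

lemma fin_dim_basis:
  assumes "fin_dim scale A" "subspace A"
  obtains B where "finite B" "independent B" "span B = A"
proof -
  obtain B where B: "B \<subseteq> A" "independent B" "A \<subseteq> span B"
    using maximal_independent_subset by blast
  have "finite B"
    using assms(1) B independent_span_bound unfolding fin_dim_def by blast
  moreover have "span B = A"
    using B assms(2) by (simp add: span_minimal subset_antisym)
  ultimately show ?thesis using B that by blast
qed

lemma dim_proper_subspace:
  assumes "fin_dim scale A" "subspace A" "subspace B" "B \<subset> A"
  shows "dim B < dim A"
proof -
  obtain BA where BA: "finite BA" "independent BA" "span BA = A"
    using fin_dim_basis assms by blast
  obtain BB where BB: "finite BB" "independent BB" "span BB = B"
    using fin_dim_basis[of B] assms fin_dim_mono[OF assms(1), of B] by blast
  obtain x where x: "x \<in> A" "x \<notin> B" using assms by blast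
  have "independent (insert x BB)"
    using BB x independent_insert by auto
  moreover have "insert x BB \<subseteq> span BA"
    using x BB BA assms span_superset by blast
  ultimately have "card (insert x BB) \<le> card BA"
    using independent_span_bound BA by blast
  moreover have "x \<notin> BB" using x BB span_superset by blast
  ultimately have "card BB < card BA" using BB by simp
  then show ?thesis
    using BA BB dim_eq_card_independent[of BA] dim_eq_card_independent[of BB] dim_span by metis
qed

end

lemma linearD:
  assumes "Vector_Spaces.linear s t f"
  shows "f 0 = 0" "f (x + y) = f x + f y" "f (x - y) = f x - f y" "f (- x) = - f x"
    "f (s c x) = t c (f x)" "f (\<Sum>i\<in>I. g i) = (\<Sum>i\<in>I. f (g i))"
proof -
  interpret Vector_Spaces.linear s t f by fact
  show "f 0 = 0" "f (x + y) = f x + f y" "f (x - y) = f x - f y" "f (- x) = - f x"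
    "f (s c x) = t c (f x)" "f (\<Sum>i\<in>I. g i) = (\<Sum>i\<in>I. f (g i))"
    by (simp_all add: zero add diff neg scale sum)
qed

lemma linear_image_fin_dim:
  assumes "Vector_Spaces.linear s t f" "fin_dim s A"
  shows "fin_dim t (f ` A)"
proof -
  interpret Vector_Spaces.linear s t f by fact
  show ?thesis using assms(2) unfolding fin_dim_def
    by (metis finite_imageI image_mono span_image)
qed

text \<open>The algebraic rules hold on the whole type but positivity only on \<open>W\<close>: the
  form on list functions constructed later degenerates outside the Fock space.\<close>

locale hermitian_space = vector_space scale
  for scale :: "complex \<Rightarrow> 'v::ab_group_add \<Rightarrow> 'v" (infixr \<open>*\<^sub>h\<close> 75) +
  fixes h :: "'v \<Rightarrow> 'v \<Rightarrow> complex" and W :: "'v set"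
  assumes sesq: "sesquilinear_on scale UNIV h"
    and herm: "h y x = cnj (h x y)"
    and subspace_W: "subspace W"
    and pos: "x \<in> W \<Longrightarrow> x \<noteq> 0 \<Longrightarrow> 0 < Re (h x x)"
begin

lemma h_add [simp]: "h (x + y) z = h x z + h y z" "h x (y + z) = h x y + h x z"
  and h_scale [simp]: "h (c *\<^sub>h x) y = c * h x y" "h x (c *\<^sub>h y) = cnj c * h x y"
  using sesq unfolding sesquilinear_on_def by auto

lemma h_zero [simp]: "h 0 x = 0" "h x 0 = 0"
  using h_add(1)[of 0 0 x] h_add(2)[of x 0 0] by simp_all

lemma h_minus [simp]: "h (- x) y = - h x y" "h x (- y) = - h x y"
  using h_add(1)[of x "- x" y] h_add(2)[of x y "- y"] by (simp_all add: eq_neg_iff_add_eq_0 add.commute)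

lemma h_diff [simp]: "h (x - y) z = h x z - h y z" "h x (y - z) = h x y - h x z"
  using h_add(1)[of x "- y" z] h_add(2)[of x y "- z"] by simp_all

lemma h_sum: "h (\<Sum>i\<in>I. f i) z = (\<Sum>i\<in>I. h (f i) z)" "h z (\<Sum>i\<in>I. f i) = (\<Sum>i\<in>I. h z (f i))"
  by (induction I rule: infinite_finite_induct) auto

lemma h_self_real: "h x x = of_real (Re (h x x))"
  using herm[of x x] by (simp add: complex_eq_iff)

lemma h_self_eq_0: "x \<in> W \<Longrightarrow> h x x = 0 \<Longrightarrow> x = 0"
  using pos[of x] by force

lemma h_eq_0_swap: "h x y = 0 \<Longrightarrow> h y x = 0"
  using herm[of y x] by simp

definition orthonormal :: "'v list \<Rightarrow> bool" where
  "orthonormal fs \<longleftrightarrow>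
     (\<forall>i<length fs. \<forall>j<length fs. h (fs ! i) (fs ! j) = (if i = j then 1 else 0))"

lemma orthonormalD:
  assumes "orthonormal fs"
  shows "distinct fs" "a \<in> set fs \<Longrightarrow> b \<in> set fs \<Longrightarrow> h a b = (if a = b then 1 else 0)"
proof -
  show "distinct fs"
    unfolding distinct_conv_nth
    using assms unfolding orthonormal_def by (metis zero_neq_one)
  then show "a \<in> set fs \<Longrightarrow> b \<in> set fs \<Longrightarrow> h a b = (if a = b then 1 else 0)"
    using assms unfolding orthonormal_def in_set_conv_nth
    by (auto simp: nth_eq_iff_index_eq)
qed

lemma orthonormalI:
  assumes "distinct fs"
    and "\<And>a b. a \<in> set fs \<Longrightarrow> b \<in> set fs \<Longrightarrow> h a b = (if a = b then 1 else 0)"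
  shows "orthonormal fs"
  using assms unfolding orthonormal_def by (auto simp: nth_eq_iff_index_eq)

definition proj :: "'v list \<Rightarrow> 'v \<Rightarrow> 'v" where
  "proj fs x = (\<Sum>f\<in>set fs. h x f *\<^sub>h f)"

lemma linear_proj: "Vector_Spaces.linear scale scale (proj fs)"
  unfolding Vector_Spaces.linear_iff proj_def
  by (auto simp: scale_left_distrib sum.distrib scale_sum_right vector_space_axioms)

lemma proj_in_span: "proj fs x \<in> span (set fs)"
  unfolding proj_def by (intro span_sum span_scale span_base)

lemma proj_orth:
  assumes "orthonormal fs" "y \<in> span (set fs)"
  shows "h (x - proj fs x) y = 0"
  using assms(2)
proof (induction rule: span_induct_alt)
  case base then show ?case by simp
next
  case (step c g y)
  have "h (proj fs x) g = (\<Sum>f\<in>set fs. h x f * (if f = g then 1 else 0))"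
    unfolding proj_def h_sum
    by (intro sum.cong) (use orthonormalD(2)[OF assms(1)] step in auto)
  also have "\<dots> = h x g" using step by (simp add: sum.delta' if_distrib cong: if_cong)
  finally have "h (x - proj fs x) g = 0" by simp
  with step show ?case by (simp only: h_add h_scale) simp
qed

lemma proj_id:
  assumes "orthonormal fs" "x \<in> span (set fs)" "set fs \<subseteq> W"
  shows "proj fs x = x"
proof -
  have "x - proj fs x \<in> span (set fs)" using assms proj_in_span span_diff by blast
  then have "h (x - proj fs x) (x - proj fs x) = 0" using proj_orth[OF assms(1)] by blast
  moreover have "x - proj fs x \<in> W"
    using \<open>x - proj fs x \<in> span (set fs)\<close> assms(3) span_minimal subspace_W by blast
  ultimately show ?thesis using h_self_eq_0 by fastforce
qed

lemma gram_schmidt: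
  assumes "finite B" "B \<subseteq> W"
  shows "\<exists>fs. orthonormal fs \<and> span (set fs) = span B"
  using assms
proof (induction B rule: finite_induct)
  case empty
  have "orthonormal []" by (simp add: orthonormal_def)
  then show ?case by (metis list.set(1))
next
  case (insert b B)
  then obtain fs where fs: "orthonormal fs" "span (set fs) = span B" by auto
  have fsW: "set fs \<subseteq> W"
    using insert fs(2) span_superset span_minimal[OF _ subspace_W] by (metis insert_subset order_trans)
  show ?case
  proof (cases "b \<in> span B")
    case True
    then show ?thesis using fs by (metis span_redundant)
  next
    case False
    define c where "c = b - proj fs b"
    have ps: "proj fs b \<in> span B" using proj_in_span fs by blast
    have "c \<noteq> 0" using False ps c_def by auto
    have "c \<in> W"
      unfolding c_def using insert ps subspace_W span_minimal[of B W]
      by (meson insert_subset subsetD subspace_diff)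
    define r where "r = Re (h c c)"
    have r: "r > 0" using pos \<open>c \<in> W\<close> \<open>c \<noteq> 0\<close> r_def by blast
    have hc: "h c c = of_real r" using h_self_real r_def by simp
    define d where "d = complex_of_real (1 / sqrt r) *\<^sub>h c"
    have dd: "h d d = 1"
      using r by (simp add: d_def hc flip: of_real_mult of_real_divide)
    have df: "h d f = 0" if "f \<in> span (set fs)" for f
      using proj_orth[OF fs(1) that, of b] by (simp add: d_def c_def)
    have fd: "h f d = 0" if "f \<in> span (set fs)" for f
      using df[OF that] h_eq_0_swap by blast
    have dn: "d \<notin> set fs" using df dd span_base by (metis zero_neq_one)
    have o: "orthonormal (d # fs)"
    proof (rule orthonormalI)
      show "distinct (d # fs)" using dn orthonormalD(1)[OF fs(1)] by simp
      show "h a b = (if a = b then 1 else 0)" if "a \<in> set (d # fs)" "b \<in> set (d # fs)" for a b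
        using that dd df fd dn orthonormalD(2)[OF fs(1)] span_base[of _ "set fs"] by auto
    qed
    have "span (set (d # fs)) = span (insert b B)"
    proof (rule span_eq[THEN iffD2], intro conjI subsetI)
      fix x assume "x \<in> set (d # fs)"
      moreover have "span B \<subseteq> span (insert b B)" by (intro span_mono) auto
      moreover have "d \<in> span (insert b B)"
        unfolding d_def c_def using ps calculation(2) by (intro span_scale span_diff) (auto intro: span_base)
      ultimately show "x \<in> span (insert b B)" using fs(2) span_superset by fastforce
    next
      fix x assume x: "x \<in> insert b B"
      have s: "span (set fs) \<subseteq> span (set (d # fs))" by (intro span_mono) auto
      have "b = complex_of_real (sqrt r) *\<^sub>h d + proj fs b"
        using r by (simp add: d_def c_def flip: of_real_mult)
      moreover have "complex_of_real (sqrt r) *\<^sub>h d + proj fs b \<in> span (set (d # fs))"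
        using subsetD[OF s proj_in_span] by (intro span_add span_scale) (auto intro: span_base)
      ultimately have "b \<in> span (set (d # fs))" by simp
      moreover have "B \<subseteq> span (set (d # fs))"
        using s fs(2) span_superset[of B] by auto
      ultimately show "x \<in> span (set (d # fs))"
        using x by auto
    qed
    then show ?thesis using o by blast
  qed
qed

lemma orthonormal_basis:
  assumes "fin_dim scale E" "subspace E" "E \<subseteq> W"
  obtains fs where "orthonormal fs" "span (set fs) = E"
proof -
  obtain B where B: "finite B" "span B = E" using fin_dim_basis[OF assms(1,2)] by blast
  then have "B \<subseteq> W" using assms(3) span_superset[of B] by auto
  then show ?thesis using gram_schmidt[OF B(1)] B(2) that by auto
qed

lemma orthonormal_expansion:
  assumes "orthonormal fs" "x \<in> span (set fs)" "set fs \<subseteq> W"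
  shows "x = (\<Sum>i<length fs. h x (fs ! i) *\<^sub>h fs ! i)"
proof -
  have "bij_betw ((!) fs) {..<length fs} (set fs)"
    using orthonormalD(1)[OF assms(1)] by (simp add: bij_betw_nth)
  then have "(\<Sum>i<length fs. h x (fs ! i) *\<^sub>h fs ! i) = proj fs x"
    unfolding proj_def by (rule sum.reindex_bij_betw)
  then show ?thesis using proj_id[OF assms] by simp
qed

lemma orthogonal_decomposition:
  assumes "fin_dim scale E" "subspace E" "E \<subseteq> W" "x \<in> W"
  obtains p where "p \<in> E" "x - p \<in> W" "\<And>y. y \<in> E \<Longrightarrow> h (x - p) y = 0"
proof -
  obtain fs where fs: "orthonormal fs" "span (set fs) = E" using orthonormal_basis assms by blast
  show ?thesis
  proof
    show "proj fs x \<in> E" using proj_in_span fs by blast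
    then show "x - proj fs x \<in> W" using assms subspace_W subspace_diff by blast
    show "h (x - proj fs x) y = 0" if "y \<in> E" for y using proj_orth fs that by blast
  qed
qed

end

lemma pos_def_hermitian_space:
  assumes "vector_space s" "pos_def_hermitian s H"
  shows "hermitian_space s H UNIV"
proof -
  interpret vector_space s by fact
  show ?thesis
    using assms unfolding pos_def_hermitian_def
    by unfold_locales (simp, blast, simp, blast)
qed

section \<open>Hodge decomposition for locally finite operators\<close>

lemma internal_direct_sum_2:
  assumes "\<And>a b. a \<in> A \<Longrightarrow> b \<in> B \<Longrightarrow> a + b \<in> X"
    and "\<And>x. x \<in> X \<Longrightarrow> \<exists>a\<in>A. \<exists>b\<in>B. x = a + b"
    and "\<And>a b a' b'. a \<in> A \<Longrightarrow> b \<in> B \<Longrightarrow> a' \<in> A \<Longrightarrow> b' \<in> B \<Longrightarrow> a + b = a' + b' \<Longrightarrow>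
      a = a' \<and> b = b'"
  shows "internal_direct_sum [A, B] X"
proof -
  have ls: "listset [A, B] = {[a, b] | a b. a \<in> A \<and> b \<in> B}" by (auto simp: set_Cons_def)
  show ?thesis
    unfolding internal_direct_sum_def ls bij_betw_def
  proof
    show "inj_on sum_list {[a, b] | a b. a \<in> A \<and> b \<in> B}"
      by (rule inj_onI) (use assms(3) in force)
    show "sum_list ` {[a, b] | a b. a \<in> A \<and> b \<in> B} = X"
    proof (intro subset_antisym subsetI)
      fix x assume "x \<in> X"
      then obtain a b where "a \<in> A" "b \<in> B" "x = a + b" using assms(2) by blast
      then have "x = sum_list [a, b]" "[a, b] \<in> {[a, b] | a b. a \<in> A \<and> b \<in> B}" by auto
      then show "x \<in> sum_list ` {[a, b] | a b. a \<in> A \<and> b \<in> B}" by blast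
    qed (use assms(1) in auto)
  qed
qed

text \<open>The bracketing \<open>a + (b + c)\<close> is the one produced by
  \<open>sum_list\<close>.\<close>

lemma internal_direct_sum_3:
  assumes "\<And>a b c. a \<in> A \<Longrightarrow> b \<in> B \<Longrightarrow> c \<in> C \<Longrightarrow> a + (b + c) \<in> X"
    and "\<And>x. x \<in> X \<Longrightarrow> \<exists>a\<in>A. \<exists>b\<in>B. \<exists>c\<in>C. x = a + (b + c)"
    and "\<And>a b c a' b' c'. a \<in> A \<Longrightarrow> b \<in> B \<Longrightarrow> c \<in> C \<Longrightarrow> a' \<in> A \<Longrightarrow> b' \<in> B \<Longrightarrow> c' \<in> C \<Longrightarrow>
      a + (b + c) = a' + (b' + c') \<Longrightarrow> a = a' \<and> b = b' \<and> c = c'"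
  shows "internal_direct_sum [A, B, C] X"
proof -
  have ls: "listset [A, B, C] = {[a, b, c] | a b c. a \<in> A \<and> b \<in> B \<and> c \<in> C}"
    by (auto simp: set_Cons_def)
  show ?thesis
    unfolding internal_direct_sum_def ls bij_betw_def
  proof
    show "inj_on sum_list {[a, b, c] | a b c. a \<in> A \<and> b \<in> B \<and> c \<in> C}"
      by (rule inj_onI) (use assms(3) in force)
    show "sum_list ` {[a, b, c] | a b c. a \<in> A \<and> b \<in> B \<and> c \<in> C} = X"
    proof (intro subset_antisym subsetI)
      fix x assume "x \<in> X"
      then obtain a b c where "a \<in> A" "b \<in> B" "c \<in> C" "x = a + (b + c)" using assms(2) by blast
      then have "x = sum_list [a, b, c]"
        "[a, b, c] \<in> {[a, b, c] | a b c. a \<in> A \<and> b \<in> B \<and> c \<in> C}" by auto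
      then show "x \<in> sum_list ` {[a, b, c] | a b c. a \<in> A \<and> b \<in> B \<and> c \<in> C}" by blast
    qed (use assms(1) in auto)
  qed
qed

lemma internal_direct_sum_2D:
  assumes "internal_direct_sum [A, B] X"
  shows "a \<in> A \<Longrightarrow> b \<in> B \<Longrightarrow> a + b \<in> X"
    and "x \<in> X \<Longrightarrow> \<exists>a\<in>A. \<exists>b\<in>B. x = a + b"
    and "a \<in> A \<Longrightarrow> b \<in> B \<Longrightarrow> a' \<in> A \<Longrightarrow> b' \<in> B \<Longrightarrow> a + b = a' + b' \<Longrightarrow> a = a' \<and> b = b'"
proof -
  have ls: "listset [A, B] = {[a, b] | a b. a \<in> A \<and> b \<in> B}" by (auto simp: set_Cons_def)
  note bij = assms[unfolded internal_direct_sum_def ls bij_betw_def]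
  show "a + b \<in> X" if "a \<in> A" "b \<in> B"
  proof -
    have "[a, b] \<in> {[a, b] | a b. a \<in> A \<and> b \<in> B}" using that by auto
    then have "sum_list [a, b] \<in> X" using bij by blast
    then show ?thesis by simp
  qed
  show "\<exists>a\<in>A. \<exists>b\<in>B. x = a + b" if "x \<in> X"
    using bij that by force
  show "a = a' \<and> b = b'" if "a \<in> A" "b \<in> B" "a' \<in> A" "b' \<in> B" "a + b = a' + b'"
  proof -
    have "[a, b] = [a', b']"
      by (rule inj_onD[OF conjunct1[OF bij]]) (use that in auto)
    then show ?thesis by simp
  qed
qed

lemma internal_direct_sum_3D:
  assumes "internal_direct_sum [A, B, C] X"
    and "a \<in> A" "b \<in> B" "c \<in> C" "a' \<in> A" "b' \<in> B" "c' \<in> C" "a + (b + c) = a' + (b' + c')"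
  shows "a = a' \<and> b = b' \<and> c = c'"
proof -
  have ls: "listset [A, B, C] = {[a, b, c] | a b c. a \<in> A \<and> b \<in> B \<and> c \<in> C}"
    by (auto simp: set_Cons_def)
  note bij = assms(1)[unfolded internal_direct_sum_def ls bij_betw_def]
  have "[a, b, c] = [a', b', c']"
    by (rule inj_onD[OF conjunct1[OF bij]]) (use assms in auto)
  then show ?thesis by simp
qed

context hermitian_space begin

lemma sum_eq_0_orthogonal:
  assumes "x \<in> W" "x + y = 0" "h y x = 0"
  shows "x = 0"
proof -
  have "h x x + h y x = 0" using assms(2) by (metis h_add(1) h_zero(1))
  then show ?thesis using assms h_self_eq_0 by simp
qed

lemma orthogonal_direct_sum_unique:
  assumes "subspace A" "subspace B" "subspace C" "A \<subseteq> W" "B \<subseteq> W" "C \<subseteq> W"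
    and AB: "\<And>a b. a \<in> A \<Longrightarrow> b \<in> B \<Longrightarrow> h a b = 0" and AC: "\<And>a c. a \<in> A \<Longrightarrow> c \<in> C \<Longrightarrow> h a c = 0"
    and BC: "\<And>b c. b \<in> B \<Longrightarrow> c \<in> C \<Longrightarrow> h b c = 0"
    and m: "a \<in> A" "b \<in> B" "c \<in> C" "a' \<in> A" "b' \<in> B" "c' \<in> C" "a + (b + c) = a' + (b' + c')"
  shows "a = a' \<and> b = b' \<and> c = c'"
proof -
  have d: "a - a' \<in> A" "b - b' \<in> B" "c - c' \<in> C" using m assms(1-3) subspace_diff by blast+
  have z: "(a - a') + ((b - b') + (c - c')) = 0" using m(7) by (simp add: algebra_simps)
  note sw = h_eq_0_swap
  have "h ((b - b') + (c - c')) (a - a') = 0"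
    using sw[OF AB[OF d(1,2)]] sw[OF AC[OF d(1,3)]] by (simp only: h_add add_0)
  then have "a - a' = 0"
    by (rule sum_eq_0_orthogonal[OF _ z, rotated]) (use d assms(4) in auto)
  moreover have "(b - b') + ((a - a') + (c - c')) = 0" using z by (simp add: algebra_simps)
  moreover have "h ((a - a') + (c - c')) (b - b') = 0"
    using AB[OF d(1,2)] sw[OF BC[OF d(2,3)]] by (simp only: h_add add_0)
  ultimately have "a - a' = 0" "b - b' = 0"
    using sum_eq_0_orthogonal[of "b - b'"] d assms(5) by auto
  then show ?thesis using z by simp
qed

text \<open>Every vector lies in a finite-dimensional \<open>E\<close> stable under \<open>C\<close>
  and \<open>D\<close>. Inside \<open>E\<close> the image of the self-adjoint
  \<open>\<Delta>\<close> has an orthogonal complement, and \<open>\<Delta>\<close> kills it. The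
  decompositions for different vectors need no matching, because the three summands are defined
  globally and are mutually orthogonal.\<close>

theorem hodge_decomposition:
  assumes C: "Vector_Spaces.linear scale scale C" "\<And>x. x \<in> W \<Longrightarrow> C x \<in> W"
    and D: "Vector_Spaces.linear scale scale D" "\<And>x. x \<in> W \<Longrightarrow> D x \<in> W"
    and adj: "\<And>x y. x \<in> W \<Longrightarrow> y \<in> W \<Longrightarrow> h (C x) y = h x (D y)"
    and CC: "\<And>x. x \<in> W \<Longrightarrow> C (C x) = 0"
    and loc_fin: "\<And>x. x \<in> W \<Longrightarrow> \<exists>E. subspace E \<and> fin_dim scale E \<and> E \<subseteq> W \<and> x \<in> E \<and>
      C ` E \<subseteq> E \<and> D ` E \<subseteq> E"
  defines "\<Delta> \<equiv> \<lambda>x. C (D x) + D (C x)"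
  shows "{x \<in> W. \<Delta> x = 0} = {x \<in> W. C x = 0} \<inter> {x \<in> W. D x = 0}"
    and "internal_direct_sum [{x \<in> W. \<Delta> x = 0}, C ` W, D ` W] W"
    and "internal_direct_sum [{x \<in> W. \<Delta> x = 0}, C ` W] {x \<in> W. C x = 0}"
    and "internal_direct_sum [{x \<in> W. \<Delta> x = 0}, D ` W] {x \<in> W. D x = 0}"
proof -
  interpret C: Vector_Spaces.linear scale scale C by (rule C)
  interpret D: Vector_Spaces.linear scale scale D by (rule D)
  have adj': "h (D x) y = h x (C y)" if "x \<in> W" "y \<in> W" for x y
    using adj[OF that(2,1)] herm[of "D x" y] herm[of x "C y"] by simp
  have DD: "D (D x) = 0" if "x \<in> W" for x
  proof -
    have "h (D (D x)) (D (D x)) = h x (C (C (D (D x))))" using that by (simp add: adj' C D)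
    also have "\<dots> = 0" using that by (simp add: CC D)
    finally show ?thesis using that h_self_eq_0 D by blast
  qed
  have ker: "C x = 0" "D x = 0" if "x \<in> W" "\<Delta> x = 0" for x
  proof -
    \<comment> \<open>The energy identity: pairing \<open>\<Delta> x\<close> with \<open>x\<close>
      gives the sum of the squared norms of \<open>D x\<close> and \<open>C x\<close>.\<close>
    have "0 = h (\<Delta> x) x" using that by simp
    also have "\<dots> = h (D x) (D x) + h (C x) (C x)"
      unfolding \<Delta>_def using that by (simp add: adj adj' C D)
    finally have "Re (h (D x) (D x)) + Re (h (C x) (C x)) = 0" by (metis plus_complex.sel(1) zero_complex.sel(1))
    moreover have "Re (h y y) \<ge> 0" if "y \<in> W" for y using pos[OF that] by (cases "y = 0") auto
    ultimately have "\<not> 0 < Re (h (D x) (D x))" "\<not> 0 < Re (h (C x) (C x))"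
      using C(2) D(2) that(1) by (smt (verit))+
    then show "C x = 0" "D x = 0" using pos C(2) D(2) that(1) by blast+
  qed
  show ker_eq: "{x \<in> W. \<Delta> x = 0} = {x \<in> W. C x = 0} \<inter> {x \<in> W. D x = 0}"
    using ker by (auto simp: \<Delta>_def)
  have self_adj: "h (\<Delta> y) z = h y (\<Delta> z)" if "y \<in> W" "z \<in> W" for y z
    unfolding \<Delta>_def using that by (simp add: adj adj' C D)
  have decomp: "\<exists>a\<in>{x \<in> W. \<Delta> x = 0}. \<exists>b\<in>W. \<exists>c\<in>W. x = a + (C b + D c)" if x: "x \<in> W" for x
  proof -
    obtain E where E: "subspace E" "fin_dim scale E" "E \<subseteq> W" "x \<in> E" "C ` E \<subseteq> E" "D ` E \<subseteq> E"
      using loc_fin[OF x] by blast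
    have CE: "y \<in> E \<Longrightarrow> C y \<in> E" and DE: "y \<in> E \<Longrightarrow> D y \<in> E" for y using E by auto
    have lin: "Vector_Spaces.linear scale scale \<Delta>"
      unfolding Vector_Spaces.linear_iff \<Delta>_def
      by (auto simp: C.add D.add C.scale D.scale scale_right_distrib vector_space_axioms)
    interpret L: Vector_Spaces.linear scale scale \<Delta> by (rule lin)
    have \<Delta>E: "\<Delta> ` E \<subseteq> E" unfolding \<Delta>_def using CE DE subspace_add[OF E(1)] by auto
    obtain p where p: "p \<in> \<Delta> ` E" "x - p \<in> W" "\<And>y. y \<in> \<Delta> ` E \<Longrightarrow> h (x - p) y = 0"
      using orthogonal_decomposition[of "\<Delta> ` E" x] L.subspace_image[OF E(1)]
        fin_dim_mono[OF E(2) \<Delta>E] \<Delta>E E(3) x by (metis order_trans)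
    obtain y where y: "y \<in> E" "p = \<Delta> y" using p by blast
    have a: "x - p \<in> E" using E(1,4) p \<Delta>E subspace_diff by blast
    \<comment> \<open>The remainder \<open>x - p\<close> stays in \<open>E\<close>, so
      \<open>\<Delta> (\<Delta> (x - p))\<close> lies in the image to which the remainder is
      orthogonal.\<close>
    have "h (\<Delta> (x - p)) (\<Delta> (x - p)) = h (x - p) (\<Delta> (\<Delta> (x - p)))"
      by (rule self_adj) (use a E(3) \<Delta>E in auto)
    also have "\<dots> = 0" using p(3) a \<Delta>E by blast
    finally have "\<Delta> (x - p) = 0" using a \<Delta>E E(3) h_self_eq_0 by (meson image_subset_iff subsetD)
    moreover have "x = (x - p) + (C (D y) + D (C y))" using y \<Delta>_def by simp
    ultimately show ?thesis
      using p(2) y E(3) CE DE by (metis (mono_tags, lifting) mem_Collect_eq subsetD)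
  qed
  have sub: "subspace {x \<in> W. \<Delta> x = 0}" "subspace (C ` W)" "subspace (D ` W)"
  proof -
    show "subspace {x \<in> W. \<Delta> x = 0}"
      unfolding ker_eq subspace_def
      using subspace_0 subspace_add subspace_scale subspace_W
      by (auto simp: C.add D.add C.scale D.scale C.zero D.zero)
  qed (auto intro: C.subspace_image D.subspace_image subspace_W)
  have o1: "h a b = 0" if "a \<in> {x \<in> W. \<Delta> x = 0}" "b \<in> C ` W" for a b
    using that ker adj' by fastforce
  have o2: "h a b = 0" if "a \<in> {x \<in> W. \<Delta> x = 0}" "b \<in> D ` W" for a b
    using that ker adj by fastforce
  have o3: "h a b = 0" if "a \<in> C ` W" "b \<in> D ` W" for a b
    using that DD adj D by fastforce
  have inc: "{x \<in> W. \<Delta> x = 0} \<subseteq> W" "C ` W \<subseteq> W" "D ` W \<subseteq> W" "{0} \<subseteq> W"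
    using C D subspace_0 subspace_W by auto
  show "internal_direct_sum [{x \<in> W. \<Delta> x = 0}, C ` W, D ` W] W"
  proof (rule internal_direct_sum_3)
    show "a + (b + c) \<in> W" if "a \<in> {x \<in> W. \<Delta> x = 0}" "b \<in> C ` W" "c \<in> D ` W" for a b c
      using that inc subspace_add[OF subspace_W] by (meson subsetD)
    show "\<exists>a\<in>{x \<in> W. \<Delta> x = 0}. \<exists>b\<in>C ` W. \<exists>c\<in>D ` W. x = a + (b + c)" if "x \<in> W" for x
      using decomp[OF that] by blast
  qed (rule orthogonal_direct_sum_unique[OF sub inc(1-3) o1 o2 o3])
  show "internal_direct_sum [{x \<in> W. \<Delta> x = 0}, C ` W] {x \<in> W. C x = 0}"
  proof (rule internal_direct_sum_2)
    show "a + b \<in> {x \<in> W. C x = 0}" if "a \<in> {x \<in> W. \<Delta> x = 0}" "b \<in> C ` W" for a b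
      using that inc subspace_add[OF subspace_W] ker CC by (auto simp: C.add)
    show "\<exists>a\<in>{x \<in> W. \<Delta> x = 0}. \<exists>b\<in>C ` W. x = a + b" if x: "x \<in> {x \<in> W. C x = 0}" for x
    proof -
      obtain a b c where abc: "a \<in> W" "\<Delta> a = 0" "b \<in> W" "c \<in> W" "x = a + (C b + D c)"
        using decomp[of x] x by blast
      \<comment> \<open>For \<open>x\<close> in the kernel of \<open>C\<close> the third component
        must vanish: \<open>C (D c) = 0\<close> makes \<open>D c\<close> orthogonal to
        itself.\<close>
      have "C (D c) = C x - C a - C (C b)" by (simp add: abc(5) C.add)
      also have "\<dots> = 0" using that ker(1) abc CC by simp
      finally have "h (D c) (D c) = 0" using adj' abc D by simp
      then have "D c = 0" using h_self_eq_0 D abc by blast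
      then show ?thesis using abc by auto
    qed
    \<comment> \<open>Uniqueness for two summands is the case of three with \<open>{0}\<close> as
      the last one.\<close>
    show "a = a' \<and> b = b'" if "a \<in> {x \<in> W. \<Delta> x = 0}" "b \<in> C ` W" "a' \<in> {x \<in> W. \<Delta> x = 0}"
      "b' \<in> C ` W" "a + b = a' + b'" for a b a' b'
      using orthogonal_direct_sum_unique[OF sub(1,2) subspace_single_0 inc(1,2,4), of a b 0 a' b' 0]
        o1 that by auto
  qed
  show "internal_direct_sum [{x \<in> W. \<Delta> x = 0}, D ` W] {x \<in> W. D x = 0}"
  proof (rule internal_direct_sum_2)
    show "a + b \<in> {x \<in> W. D x = 0}" if "a \<in> {x \<in> W. \<Delta> x = 0}" "b \<in> D ` W" for a b
      using that inc subspace_add[OF subspace_W] ker DD by (auto simp: D.add)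
    show "\<exists>a\<in>{x \<in> W. \<Delta> x = 0}. \<exists>b\<in>D ` W. x = a + b" if x: "x \<in> {x \<in> W. D x = 0}" for x
    proof -
      obtain a b c where abc: "a \<in> W" "\<Delta> a = 0" "b \<in> W" "c \<in> W" "x = a + (C b + D c)"
        using decomp[of x] x by blast
      have "D (C b) = D x - D a - D (D c)" by (simp add: abc(5) D.add)
      also have "\<dots> = 0" using that ker(2) abc DD by simp
      finally have "h (C b) (C b) = 0" using adj abc C by simp
      then have "C b = 0" using h_self_eq_0 C abc by blast
      then show ?thesis using abc by auto
    qed
    show "a = a' \<and> b = b'" if "a \<in> {x \<in> W. \<Delta> x = 0}" "b \<in> D ` W" "a' \<in> {x \<in> W. \<Delta> x = 0}"
      "b' \<in> D ` W" "a + b = a' + b'" for a b a' b'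
      using orthogonal_direct_sum_unique[OF sub(1,3) subspace_single_0 inc(1,3,4), of a b 0 a' b' 0]
        o2 that by auto
  qed
qed

end

section \<open>Equivariant maps into an admissible module\<close>

text \<open>\<open>K\<close> is a bare index set: of the group only right inverses of the operators
  are kept, which is what moving \<open>\<rho> k\<close> across the invariant form requires.\<close>

locale admissible_rep = hermitian_space s H UNIV
  for s :: "complex \<Rightarrow> 'v::ab_group_add \<Rightarrow> 'v" and H +
  fixes K :: "'g set" and \<rho> :: "'g \<Rightarrow> 'v \<Rightarrow> 'v"
  assumes linear_\<rho>: "k \<in> K \<Longrightarrow> Vector_Spaces.linear s s (\<rho> k)"
    and isometry: "k \<in> K \<Longrightarrow> H (\<rho> k v) (\<rho> k w) = H v w"
    and right_inverse: "k \<in> K \<Longrightarrow> \<exists>k'\<in>K. \<forall>v. \<rho> k (\<rho> k' v) = v"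
    and adm: "admissible s K \<rho>"
begin

lemma exists_irreducible:
  assumes "K_stable s K \<rho> X" "X \<noteq> {0}" "fin_dim s X"
  obtains F where "K_irreducible s K \<rho> F" "F \<subseteq> X"
proof -
  let ?P = "\<lambda>F. K_stable s K \<rho> F \<and> F \<noteq> {0} \<and> F \<subseteq> X"
  have "?P X" using assms by blast
  then obtain F where F: "?P F" "\<And>F'. ?P F' \<Longrightarrow> dim F \<le> dim F'"
    using ex_has_least_nat[of ?P X dim] by blast
  have "fin_dim s F" using F assms fin_dim_mono by blast
  moreover have "F' = {0} \<or> F' = F" if "K_stable s K \<rho> F'" "F' \<subseteq> F" for F'
  proof (rule ccontr)
    assume ne: "\<not> ?thesis"
    then have "dim F' < dim F"
      using that F \<open>fin_dim s F\<close> unfolding K_stable_def by (intro dim_proper_subspace) auto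
    moreover have "?P F'" using that F ne by blast
    ultimately show False using F(2) by fastforce
  qed
  ultimately have "K_irreducible s K \<rho> F" using F unfolding K_irreducible_def by blast
  then show ?thesis using F that by blast
qed

text \<open>Orthogonal projection for the invariant form. \<open>\<rho> k (proj fs x)\<close> lies
  in \<open>F\<close> and differs from \<open>\<rho> k x\<close> by a vector orthogonal to
  \<open>F\<close>; these two properties characterise the projection of
  \<open>\<rho> k x\<close>.\<close>

lemma equivariant_projection:
  assumes "K_stable s K \<rho> F" "fin_dim s F"
  obtains P where "Vector_Spaces.linear s s P" "\<And>x. P x \<in> F" "\<And>x. x \<in> F \<Longrightarrow> P x = x"
    "\<And>k x. k \<in> K \<Longrightarrow> P (\<rho> k x) = \<rho> k (P x)"
proof -
  have F: "subspace F" "\<And>k x. k \<in> K \<Longrightarrow> x \<in> F \<Longrightarrow> \<rho> k x \<in> F"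
    using assms(1) unfolding K_stable_def by auto
  obtain fs where fs: "orthonormal fs" "span (set fs) = F"
    using orthonormal_basis assms(2) F(1) by blast
  have "proj fs (\<rho> k x) = \<rho> k (proj fs x)" if k: "k \<in> K" for k x
  proof -
    interpret r: Vector_Spaces.linear s s "\<rho> k" by (rule linear_\<rho>[OF k])
    let ?y = "\<rho> k (proj fs x)"
    have yF: "?y \<in> F" using F(2)[OF k] proj_in_span fs(2) by blast
    have "H (\<rho> k x - ?y) z = 0" if z: "z \<in> F" for z
    proof -
      obtain k' where k': "k' \<in> K" "\<And>v. \<rho> k (\<rho> k' v) = v" using right_inverse[OF k] by blast
      have "H (\<rho> k x - ?y) z = H (\<rho> k (x - proj fs x)) (\<rho> k (\<rho> k' z))" by (simp only: k' r.diff)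
      also have "\<dots> = H (x - proj fs x) (\<rho> k' z)" by (rule isometry[OF k])
      also have "\<dots> = 0" using proj_orth[OF fs(1)] F(2)[OF k'(1) z] fs(2) by blast
      finally show ?thesis .
    qed
    moreover have "H (\<rho> k x - proj fs (\<rho> k x)) z = 0" if "z \<in> F" for z
      using proj_orth[OF fs(1)] that fs(2) by blast
    ultimately have "H (?y - proj fs (\<rho> k x)) z = 0" if "z \<in> F" for z
      using that by fastforce
    moreover have "?y - proj fs (\<rho> k x) \<in> F" using yF proj_in_span fs(2) subspace_diff F(1) by blast
    ultimately have "?y - proj fs (\<rho> k x) = 0" using h_self_eq_0 by blast
    then show ?thesis by simp
  qed
  moreover have "proj fs x = x" if "x \<in> F" for x using proj_id[OF fs(1)] that fs(2) by blast
  ultimately show ?thesis using that linear_proj proj_in_span fs(2) by blast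
qed

text \<open>One half of Schur's lemma. Preimages in \<open>F\<close> of stable subspaces are stable,
  hence zero or all of \<open>F\<close>; applied to \<open>{0}\<close> this gives injectivity,
  applied to a stable part of the image it gives irreducibility.\<close>

lemma irreducible_image:
  assumes F: "K_irreducible s K \<rho> F" and h: "Vector_Spaces.linear s s h"
    and eq: "\<And>k v. k \<in> K \<Longrightarrow> v \<in> F \<Longrightarrow> h (\<rho> k v) = \<rho> k (h v)" and nz: "h ` F \<noteq> {0}"
  shows "K_irreducible s K \<rho> (h ` F)" "K_equivalent s K \<rho> F (h ` F)"
proof -
  interpret h: Vector_Spaces.linear s s h by (rule h)
  have Fs: "subspace F" "\<And>k x. k \<in> K \<Longrightarrow> x \<in> F \<Longrightarrow> \<rho> k x \<in> F" "fin_dim s F"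
    and irr: "\<And>F'. K_stable s K \<rho> F' \<Longrightarrow> F' \<subseteq> F \<Longrightarrow> F' = {0} \<or> F' = F"
    using F unfolding K_irreducible_def K_stable_def by auto
  have pre: "K_stable s K \<rho> {v \<in> F. h v \<in> X}" if "K_stable s K \<rho> X" for X
    using that Fs eq unfolding K_stable_def subspace_def
    by (auto simp: h.add h.scale h.zero image_subset_iff)
  have "K_stable s K \<rho> {0}"
    using linearD(1)[OF linear_\<rho>] unfolding K_stable_def by (auto simp: subspace_single_0)
  then have ker_alt: "{v \<in> F. h v \<in> {0}} = {0} \<or> {v \<in> F. h v \<in> {0}} = F" using pre irr by blast
  have ker: "v = 0" if v: "v \<in> F" "h v = 0" for v
  proof (rule ccontr)
    assume "v \<noteq> 0"
    then have "{v \<in> F. h v \<in> {0}} = F" using ker_alt v by auto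
    then have "h ` F = {0}" using v by auto
    then show False using nz by simp
  qed
  have "inj_on h F"
  proof (rule inj_onI)
    fix x y assume "x \<in> F" "y \<in> F" "h x = h y"
    then have "x - y = 0" using ker[of "x - y"] subspace_diff Fs(1) by (simp add: h.diff)
    then show "x = y" by simp
  qed
  then show "K_equivalent s K \<rho> F (h ` F)"
    unfolding K_equivalent_def using h eq by (auto simp: bij_betw_def)
  have "K_stable s K \<rho> (h ` F)"
    unfolding K_stable_def using Fs h.subspace_image eq by (auto simp flip: eq)
  moreover have "X = {0} \<or> X = h ` F" if X: "K_stable s K \<rho> X" "X \<subseteq> h ` F" for X
  proof -
    have "{v \<in> F. h v \<in> X} = {0} \<or> {v \<in> F. h v \<in> X} = F" using pre[OF X(1)] irr by blast
    moreover have "X = h ` {v \<in> F. h v \<in> X}" using X by auto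
    ultimately show ?thesis using h.zero by auto
  qed
  ultimately show "K_irreducible s K \<rho> (h ` F)"
    unfolding K_irreducible_def using nz linear_image_fin_dim[OF h Fs(3)] by blast
qed

text \<open>Linearity is asked on the whole type and equivariance only on \<open>N\<close>, so an
  intertwiner for \<open>N\<close> is one for every subset of \<open>N\<close> without a restriction
  map.\<close>

definition intertwiners ::
  "(complex \<Rightarrow> 'w::ab_group_add \<Rightarrow> 'w) \<Rightarrow> 'w set \<Rightarrow> ('g \<Rightarrow> 'w \<Rightarrow> 'w) \<Rightarrow> ('w \<Rightarrow> 'v) set" where
  "intertwiners sN N r = {T. Vector_Spaces.linear sN s T \<and> (\<forall>k\<in>K. \<forall>n\<in>N. T (r k n) = \<rho> k (T n))}"

text \<open>
  Induction on the dimension of \<open>N\<close>: a quotient of \<open>N\<close> isomorphic to an irreducible \<open>F\<close> contributes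
  to the images at most the isotypic component of \<open>F\<close>, up to images of the kernel of \<open>N \<rightarrow> F\<close>.
\<close>
lemma fin_dim_images:
  fixes sN :: "complex \<Rightarrow> 'w::ab_group_add \<Rightarrow> 'w"
  assumes "vector_space sN" "fin_dim sN N" "module.subspace sN N"
    and "\<And>k n. k \<in> K \<Longrightarrow> n \<in> N \<Longrightarrow> r k n \<in> N"
  shows "fin_dim s (span (\<Union>T\<in>intertwiners sN N r. T ` N))"
  using assms(2-4)
proof (induction "vector_space.dim sN N" arbitrary: N rule: less_induct)
  case less
  interpret N: vector_space sN by (rule assms(1))
  interpret NV: vector_space_pair sN s by unfold_locales
  note Nsub = less.prems(2) and Nst = less.prems(3)
  show ?case
  proof (cases "\<forall>T\<in>intertwiners sN N r. T ` N \<subseteq> {0}")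
    case True
    then have "(\<Union>T\<in>intertwiners sN N r. T ` N) \<subseteq> span {}" by auto
    then show ?thesis
      using fin_dim_span fin_dim_def by (metis finite.emptyI)
  next
    case False
    then obtain T0 where T0: "T0 \<in> intertwiners sN N r" "\<not> T0 ` N \<subseteq> {0}" by blast
    have stN: "K_stable s K \<rho> (T ` N)" if "T \<in> intertwiners sN N r" for T
    proof -
      interpret T: Vector_Spaces.linear sN s T using that unfolding intertwiners_def by simp
      have "\<rho> k (T n) \<in> T ` N" if "k \<in> K" "n \<in> N" for k n
        using that \<open>T \<in> _\<close> Nst unfolding intertwiners_def by (metis (mono_tags, lifting) imageI mem_Collect_eq)
      then show ?thesis unfolding K_stable_def using T.subspace_image[OF Nsub] by auto
    qed
    have linT0: "Vector_Spaces.linear sN s T0" using T0 unfolding intertwiners_def by simp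
    obtain F where F: "K_irreducible s K \<rho> F" "F \<subseteq> T0 ` N"
      using exists_irreducible[OF stN[OF T0(1)]] T0(2) linear_image_fin_dim[OF linT0 less.prems(1)] by blast
    have Fst: "K_stable s K \<rho> F" "fin_dim s F" "F \<noteq> {0}" using F unfolding K_irreducible_def by auto
    obtain P0 where P0: "Vector_Spaces.linear s s P0" "\<And>x. P0 x \<in> F" "\<And>x. x \<in> F \<Longrightarrow> P0 x = x"
      "\<And>k x. k \<in> K \<Longrightarrow> P0 (\<rho> k x) = \<rho> k (P0 x)"
      using equivariant_projection[OF Fst(1,2)] by metis
    \<comment> \<open>An equivariant surjection of \<open>N\<close> onto an irreducible
      \<open>F\<close>. Its kernel \<open>N1\<close> has smaller dimension, and the induction
      hypothesis bounds all images of \<open>N1\<close>.\<close>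
    define P where "P = P0 \<circ> T0"
    have linP: "Vector_Spaces.linear sN s P"
      unfolding P_def by (rule Vector_Spaces.linear_compose[OF linT0 P0(1)])
    interpret P: Vector_Spaces.linear sN s P by (rule linP)
    have Peq: "P (r k n) = \<rho> k (P n)" if "k \<in> K" "n \<in> N" for k n
      using T0 that P0(4) unfolding P_def intertwiners_def by simp
    have PF: "P n \<in> F" for n using P0 by (simp add: P_def)
    have Psurj: "P ` N = F"
    proof (intro subset_antisym subsetI)
      fix x assume x: "x \<in> F"
      then obtain n where n: "n \<in> N" "x = T0 n" using F(2) by auto
      then have "x = P n" using x P0(3) by (simp add: P_def)
      then show "x \<in> P ` N" using n by blast
    qed (use PF in blast)
    define N1 where "N1 = {n \<in> N. P n = 0}"
    have N1: "N.subspace N1" "N1 \<subseteq> N"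
      unfolding N1_def N.subspace_def
      using N.subspace_0[OF Nsub] N.subspace_add[OF Nsub] N.subspace_scale[OF Nsub]
      by (auto simp: P.add P.scale P.zero)
    have \<rho>0: "\<rho> k 0 = 0" if "k \<in> K" for k
      by (rule linearD(1)[OF linear_\<rho>[OF that]])
    have N1st: "r k n \<in> N1" if "k \<in> K" "n \<in> N1" for k n
      using that Nst Peq \<rho>0 unfolding N1_def by simp
    have "0 \<in> F" using Fst unfolding K_stable_def subspace_def by blast
    then have "N1 \<noteq> N" using Psurj Fst(3) unfolding N1_def by auto
    then have "N.dim N1 < N.dim N"
      using N.dim_proper_subspace[OF less.prems(1,2) N1(1)] N1(2) by blast
    then have IH: "fin_dim s (span (\<Union>T\<in>intertwiners sN N1 r. T ` N1))"
      using less.hyps N1 N.fin_dim_mono[OF less.prems(1)] N1st by blast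
    define V1 where "V1 = span (\<Union>T\<in>intertwiners sN N1 r. T ` N1)"
    have V1: "subspace V1" "fin_dim s V1" using IH V1_def by auto
    have V1st: "K_stable s K \<rho> V1"
      unfolding K_stable_def
    proof (intro conjI ballI image_subsetI)
      fix k x assume k: "k \<in> K" and x: "x \<in> V1"
      interpret rk: Vector_Spaces.linear s s "\<rho> k" by (rule linear_\<rho>[OF k])
      have "\<rho> k ` (\<Union>T\<in>intertwiners sN N1 r. T ` N1) \<subseteq> (\<Union>T\<in>intertwiners sN N1 r. T ` N1)"
      proof clarify
        fix T n assume T: "T \<in> intertwiners sN N1 r" and n: "n \<in> N1"
        then have "\<rho> k (T n) = T (r k n)" using k unfolding intertwiners_def by simp
        then show "\<rho> k (T n) \<in> (\<Union>T\<in>intertwiners sN N1 r. T ` N1)" using T N1st[OF k n] by auto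
      qed
      then show "\<rho> k x \<in> V1"
        using x unfolding V1_def by (metis imageI rk.span_image span_mono subsetD)
    qed (rule V1)
    obtain P1 where P1: "Vector_Spaces.linear s s P1" "\<And>x. P1 x \<in> V1" "\<And>x. x \<in> V1 \<Longrightarrow> P1 x = x"
      "\<And>k x. k \<in> K \<Longrightarrow> P1 (\<rho> k x) = \<rho> k (P1 x)"
      using equivariant_projection[OF V1st V1(2)] by metis
    interpret P1: Vector_Spaces.linear s s P1 by (rule P1)
    have "T n \<in> span (V1 \<union> isotypic_component s K \<rho> F)"
      if T: "T \<in> intertwiners sN N r" and n: "n \<in> N" for T n
    proof -
      have linT: "Vector_Spaces.linear sN s T" and Teq: "\<And>k n. k \<in> K \<Longrightarrow> n \<in> N \<Longrightarrow> T (r k n) = \<rho> k (T n)"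
        using T unfolding intertwiners_def by auto
      interpret T: Vector_Spaces.linear sN s T by (rule linT)
      \<comment> \<open>Removing the projection to \<open>V1\<close> makes \<open>T'\<close> vanish
        on the kernel of \<open>P\<close>. It therefore factors through \<open>F\<close> by the map
        \<open>h\<close> below, and the image of \<open>F\<close> is zero or a copy of
        \<open>F\<close>.\<close>
      define T' where "T' n = T n - P1 (T n)" for n
      have linT': "Vector_Spaces.linear sN s T'"
        unfolding Vector_Spaces.linear_iff T'_def
        by (auto simp: T.add T.scale P1.add P1.scale scale_right_diff_distrib
            vector_space_axioms N.vector_space_axioms)
      interpret T': Vector_Spaces.linear sN s T' by (rule linT')
      have T'0: "T' n = 0" if "n \<in> N1" for n
      proof -
        have "T \<in> intertwiners sN N1 r" using T N1(2) unfolding intertwiners_def by auto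
        then have "T n \<in> V1" unfolding V1_def using that by (intro span_base) auto
        then show ?thesis unfolding T'_def using P1(3) by simp
      qed
      obtain g where g: "range g \<subseteq> N" "Vector_Spaces.linear s sN g" "\<forall>v\<in>P ` N. P (g v) = v"
        using NV.linear_exists_right_inverse_on[OF linP Nsub] by blast
      define h where "h = T' \<circ> g"
      have linh: "Vector_Spaces.linear s s h"
        unfolding h_def by (rule Vector_Spaces.linear_compose[OF g(2) linT'])
      have hP: "h (P n) = T' n" if n: "n \<in> N" for n
      proof -
        have gN: "g (P n) \<in> N" using g(1) by blast
        moreover have "P (g (P n)) = P n" using g(3) n by blast
        ultimately have "n - g (P n) \<in> N1"
          unfolding N1_def using N.subspace_diff[OF Nsub n gN] by (simp add: P.diff)
        then show ?thesis using T'0 T'.diff unfolding h_def by fastforce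
      qed
      have heq: "h (\<rho> k v) = \<rho> k (h v)" if k: "k \<in> K" and v: "v \<in> F" for k v
      proof -
        interpret rk: Vector_Spaces.linear s s "\<rho> k" by (rule linear_\<rho>[OF k])
        obtain n where n: "n \<in> N" "v = P n" using v Psurj by auto
        have "h (\<rho> k v) = T' (r k n)" using n hP Nst[OF k] Peq[OF k] by metis
        also have "\<dots> = \<rho> k (T' n)" unfolding T'_def using Teq[OF k n(1)] P1(4)[OF k] rk.diff by simp
        finally show ?thesis using n hP by simp
      qed
      have "h ` F \<subseteq> isotypic_component s K \<rho> F"
      proof (cases "h ` F = {0}")
        case True
        then show ?thesis using span_zero unfolding isotypic_component_def by simp
      next
        case False
        have "h ` F \<in> {F'. K_irreducible s K \<rho> F' \<and> K_equivalent s K \<rho> F F'}"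
          using irreducible_image[OF F(1) linh heq False] by blast
        then show ?thesis
          unfolding isotypic_component_def by (meson Union_upper order_trans span_superset)
      qed
      then have "T' n \<in> isotypic_component s K \<rho> F" using hP[OF n] PF by (metis imageI subsetD)
      moreover have "T n = P1 (T n) + T' n" unfolding T'_def by simp
      moreover have "P1 (T n) \<in> V1" by (rule P1(2))
      ultimately show ?thesis using span_add[OF span_base span_base] by (metis Un_iff)
    qed
    then have "(\<Union>T\<in>intertwiners sN N r. T ` N) \<subseteq> span (V1 \<union> isotypic_component s K \<rho> F)" by blast
    moreover have "fin_dim s (span (V1 \<union> isotypic_component s K \<rho> F))"
      using fin_dim_Un V1(2) F(1) adm unfolding admissible_def by blast
    ultimately show ?thesis using fin_dim_span fin_dim_mono by blast
  qed
qed

end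

section \<open>Creation and annihilation operators\<close>

text \<open>Elements of V \<otimes> S are functions of lists, and operator identities are computed
  with such functions as single objects; evaluation at a list happens only on request, through
  \<open>fun_apply\<close>.\<close>

declare plus_fun_apply [simp del] zero_fun_apply [simp del] minus_apply [simp del] uminus_apply [simp del]

lemmas fun_apply = plus_fun_apply zero_fun_apply minus_apply uminus_apply

text \<open>Interior multiplication by the covector \<open>c\<close>; \<open>cliff_opp\<close> is
  twice this operator for the covector of \<open>B x\<close>.\<close>

definition contract :: "'a \<Rightarrow> ('a list \<Rightarrow> 'v) \<Rightarrow> 'a list \<Rightarrow> 'v" where
  "contract c \<Phi> = (\<lambda>as. \<Phi> (c # as))"

lemma contract_apply: "contract c \<Phi> as = \<Phi> (c # as)"
  by (simp add: contract_def)

lemma contract_add [simp]: "contract c (\<Phi> + \<Psi>) = contract c \<Phi> + contract c \<Psi>"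
  and contract_diff [simp]: "contract c (\<Phi> - \<Psi>) = contract c \<Phi> - contract c (\<Psi> :: _ \<Rightarrow> 'v::ab_group_add)"
  and contract_minus [simp]: "contract c (- \<Psi>) = - contract c \<Psi>"
  and contract_0 [simp]: "contract c 0 = 0"
  and contract_scale [simp]: "contract c (fun_scale s r \<Phi>') = fun_scale s r (contract c \<Phi>')"
  by (auto simp: fun_eq_iff fun_apply fun_scale_def contract_apply)

lemma contract_sum: "contract c (\<Sum>i\<in>I. f i :: _ \<Rightarrow> 'v::ab_group_add) = (\<Sum>i\<in>I. contract c (f i))"
  by (induction I rule: infinite_finite_induct) auto

lemma pairing_simps [simp]:
  "pairing (a + b) x = pairing a x + pairing b x" "pairing a (x + y) = pairing a x + pairing a y"
  "pairing (c *s a) x = c * pairing a x" "pairing a (c *s x) = c * pairing a x"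
  "pairing 0 x = 0" "pairing a 0 = 0"
  by (simp_all add: pairing_def distrib_left distrib_right sum.distrib sum_distrib_left mult_ac)

lemma vector_space_complex: "vector_space ((*) :: complex \<Rightarrow> complex \<Rightarrow> complex)"
  by unfold_locales (auto simp: algebra_simps)

locale complex_space = vector_space s for s :: "complex \<Rightarrow> 'v::ab_group_add \<Rightarrow> 'v"
begin

sublocale FS: vector_space "fun_scale s" by (rule vector_space_fun_scale) unfold_locales

lemma tensor_add: "tensor s v (\<omega> + \<eta>) = tensor s v \<omega> + tensor s v \<eta>"
  and tensor_add_left: "tensor s (v + w) \<omega> = tensor s v \<omega> + tensor s w \<omega>"
  and tensor_scale: "tensor s v (fun_scale (*) c \<omega>) = fun_scale s c (tensor s v \<omega>)"
  and tensor_scale_left: "tensor s (s c v) \<omega> = fun_scale s c (tensor s v \<omega>)"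
  and tensor_0: "tensor s v 0 = 0" and tensor_0_left: "tensor s 0 \<omega> = 0"
  by (auto simp: tensor_def fun_eq_iff fun_apply fun_scale_def scale_left_distrib scale_right_distrib mult.commute)

abbreviation e :: "complex ^ 'n \<Rightarrow> ((complex ^ 'n) list \<Rightarrow> 'v) \<Rightarrow> (complex ^ 'n) list \<Rightarrow> 'v" where
  "e \<equiv> wedge_mult s"

lemma e_Nil: "e x \<Phi> [] = 0"
  by (simp add: wedge_mult_def)

lemma e_Cons: "e x \<Phi> (a # as) = s (pairing a x) (\<Phi> as) - e x (contract a \<Phi>) as"
  unfolding wedge_mult_def
  by (simp add: sum.lessThan_Suc_shift delete_nth_def contract_apply del: sum.lessThan_Suc flip: sum_negf)

text \<open>The anticommutation relation of creation and annihilation operators. It comes from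
  splitting off the first term of the Laplace expansion and holds for every function of lists,
  alternating or not.\<close>

lemma contract_e: "contract c (e x \<Phi>) = fun_scale s (pairing c x) \<Phi> - e x (contract c \<Phi>)"
  by (simp add: fun_eq_iff fun_apply e_Cons fun_scale_def contract_apply)

lemma linear_e: "Vector_Spaces.linear (fun_scale s) (fun_scale s) (e x)"
  unfolding Vector_Spaces.linear_iff
  by (auto simp: FS.vector_space_axioms wedge_mult_def fun_eq_iff fun_apply fun_scale_def
      scale_right_distrib scale_sum_right sum.distrib mult.commute)

lemmas e_simps [simp] = linearD(1-5)[OF linear_e]

lemma e_sum: "e x (\<Sum>i\<in>I. f i) = (\<Sum>i\<in>I. e x (f i))"
  by (rule linearD(6)[OF linear_e])

lemma linear_e_left: "Vector_Spaces.linear (*s) (fun_scale s) (\<lambda>x. e x \<Phi>)"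
  unfolding Vector_Spaces.linear_iff
  by (auto simp: FS.vector_space_axioms vec.vector_space_axioms wedge_mult_def fun_eq_iff fun_apply fun_scale_def
      scale_left_distrib scale_sum_right sum.distrib distrib_left mult_ac)

lemmas e_left_simps [simp] = linearD(1-5)[OF linear_e_left]

lemma e_sum_left: "e (\<Sum>i\<in>I. f i) \<Phi> = (\<Sum>i\<in>I. e (f i) \<Phi>)"
  by (rule linearD(6)[OF linear_e_left])

text \<open>Peeling off the first argument leaves pairing terms antisymmetric in \<open>x\<close>
  and \<open>y\<close> and passes to the contracted function, which is why \<open>\<Phi>\<close>
  varies in the induction.\<close>

lemma e_anticommute: "e x (e y \<Phi>) = - e y (e x \<Phi>)"
proof
  fix as show "e x (e y \<Phi>) as = (- e y (e x \<Phi>)) as"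
  proof (induction as arbitrary: \<Phi>)
    case Nil then show ?case by (simp add: e_Nil fun_apply)
  next
    case (Cons a as)
    have "e x (e y (contract a \<Phi>)) as = - e y (e x (contract a \<Phi>)) as"
      using Cons.IH by (simp add: fun_apply)
    then show ?case
      by (simp add: e_Cons contract_e fun_apply) (simp add: fun_scale_def)
  qed
qed

lemma e_e_same: "e x (e x \<Phi>) = 0"
proof -
  have "e x (e x \<Phi>) + e x (e x \<Phi>) = 0" using e_anticommute[of x x \<Phi>] by (simp add: eq_neg_iff_add_eq_0)
  then show ?thesis
    using FS.scale_left_distrib[of 1 1 "e x (e x \<Phi>)"] FS.scale_eq_0_iff[of "1 + 1" "e x (e x \<Phi>)"] by simp
qed

lemma wedge_mult_tensor: "e x (tensor s v \<omega>) = tensor s v (wedge_mult (*) x \<omega>)"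
  by (auto simp: wedge_mult_def tensor_def scale_sum_left)

lemma contract_tensor: "contract c (tensor s v \<omega>) = tensor s v (contract c \<omega>)"
  by (simp add: fun_eq_iff fun_apply tensor_def contract_apply)

text \<open>Models E \<otimes> \<Lambda>(span fs), generated by ordered products of creation
  operators applied to \<open>E\<close>. The bottom \<open>E\<close> is a parameter, so that one
  Fock space can serve as the bottom of another.\<close>

primrec fock :: "((complex ^ 'n) list \<Rightarrow> 'v) set \<Rightarrow> (complex ^ 'n) list \<Rightarrow> ((complex ^ 'n) list \<Rightarrow> 'v) set" where
  "fock E [] = E"
| "fock E (a # fs) = {\<Phi> + e a \<Psi> | \<Phi> \<Psi>. \<Phi> \<in> fock E fs \<and> \<Psi> \<in> fock E fs}"

definition vac :: "((complex ^ 'n) list \<Rightarrow> 'v) set" where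
  "vac = range (\<lambda>v. tensor s v (wedge []))"

lemma subspace_vac: "FS.subspace vac"
  unfolding FS.subspace_def vac_def
  using tensor_0_left[of "wedge []"]
  by (auto simp flip: tensor_add_left tensor_scale_left simp: image_iff)

lemma subspace_fock:
  assumes "FS.subspace E"
  shows "FS.subspace (fock E fs)"
proof (induction fs)
  case (Cons a fs)
  note I = FS.subspace_0[OF Cons] FS.subspace_add[OF Cons] FS.subspace_scale[OF Cons]
  show ?case
  proof (rule FS.subspaceI)
    have "0 = 0 + e a 0" by simp
    then show "0 \<in> fock E (a # fs)" using I(1) unfolding fock.simps by blast
    fix x y assume "x \<in> fock E (a # fs)"
    then obtain p q where x: "x = p + e a q" "p \<in> fock E fs" "q \<in> fock E fs" by auto
    { fix c
      have "fun_scale s c x = fun_scale s c p + e a (fun_scale s c q)" using x by (simp add: FS.scale_right_distrib)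
      then show "fun_scale s c x \<in> fock E (a # fs)" using x I unfolding fock.simps by blast }
    assume "y \<in> fock E (a # fs)"
    then obtain p' q' where y: "y = p' + e a q'" "p' \<in> fock E fs" "q' \<in> fock E fs" by auto
    have "x + y = (p + p') + e a (q + q')" using x y by simp
    then show "x + y \<in> fock E (a # fs)" using x y I unfolding fock.simps by blast
  qed
qed (simp add: assms)

lemma fock_mono: "E \<subseteq> E' \<Longrightarrow> fock E fs \<subseteq> fock E' fs"
  by (induction fs) (simp, fastforce)

text \<open>Later entries act first: the bottom layer of an iterated Fock space is the last block of
  the list.\<close>

lemma fock_append: "fock E (fs @ gs) = fock (fock E gs) fs"
  by (induction fs) simp_all

lemma fock_Cons_superset:
  assumes "FS.subspace E"
  shows "fock E fs \<subseteq> fock E (a # fs)"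
proof
  fix x assume "x \<in> fock E fs"
  moreover have "x = x + e a 0" by simp
  ultimately show "x \<in> fock E (a # fs)" using FS.subspace_0[OF subspace_fock[OF assms]]
    unfolding fock.simps by blast
qed

lemma fock_superset: "FS.subspace E \<Longrightarrow> E \<subseteq> fock E fs"
  by (induction fs) (simp, metis fock_Cons_superset order_trans)

lemma fin_dim_fock:
  assumes "FS.subspace E" "fin_dim (fun_scale s) E"
  shows "fin_dim (fun_scale s) (fock E fs)"
proof (induction fs)
  case (Cons a fs)
  have "fock E (a # fs) \<subseteq> FS.span (fock E fs \<union> e a ` fock E fs)"
    by (auto intro!: FS.span_add intro: FS.span_base)
  then show ?case
    using FS.fin_dim_Un[OF Cons linear_image_fin_dim[OF linear_e Cons]] FS.fin_dim_mono by blast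
qed (simp add: assms)

text \<open>Write \<open>x\<close> as a multiple of \<open>a\<close> plus a vector \<open>y\<close>
  in the span of the tail. Anticommuting \<open>e y\<close> past \<open>e a\<close> and using
  \<open>e_e_same\<close> leaves an expression of the shape required by \<open>fock\<close>.\<close>

lemma fock_e:
  assumes "FS.subspace E" "x \<in> vec.span (set fs)" "\<Phi> \<in> fock E fs"
  shows "e x \<Phi> \<in> fock E fs"
  using assms(2,3)
proof (induction fs arbitrary: x \<Phi>)
  case (Cons a fs)
  obtain p q where \<Phi>: "\<Phi> = p + e a q" "p \<in> fock E fs" "q \<in> fock E fs" using Cons.prems by auto
  note sub = subspace_fock[OF assms(1), of fs]
  obtain k where k: "x - k *s a \<in> vec.span (set fs)"
    using Cons.prems(1) by (auto simp: vec.span_insert)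
  define y where "y = x - k *s a"
  have x: "x = k *s a + y" by (simp add: y_def)
  have y: "e y p \<in> fock E fs" "e y q \<in> fock E fs"
    using Cons.IH[OF k] \<Phi> unfolding y_def by blast+
  have "e x \<Phi> = fun_scale s k (e a p) + fun_scale s k (e a (e a q)) + e y p - e a (e y q)"
    unfolding x \<Phi> using e_anticommute[of y a q] by (simp add: FS.scale_right_distrib)
  also have "\<dots> = e y p + e a (fun_scale s k p - e y q)" by (simp add: e_e_same)
  finally show ?case
    using y(1) FS.subspace_diff[OF sub FS.subspace_scale[OF sub \<Phi>(2)] y(2)] unfolding fock.simps by blast
qed (simp add: FS.subspace_0[OF assms(1)])

lemma VS_space_closed:
  assumes "x \<in> u" "\<Phi> \<in> VS_space s u"
  shows "e x \<Phi> \<in> VS_space s u"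
proof -
  interpret S: complex_space "(*)" unfolding complex_space_def by (rule vector_space_complex)
  have ext: "wedge_mult (*) x \<omega> \<in> exterior_algebra u" if "\<omega> \<in> exterior_algebra u" for \<omega>
  proof -
    have "wedge_mult (*) x ` {wedge Ys | Ys. set Ys \<subseteq> u} \<subseteq> {wedge Ys | Ys. set Ys \<subseteq> u}"
      using assms(1) by (auto simp flip: wedge_Cons) (metis insert_subset list.simps(15))
    then show ?thesis
      using that module_hom.span_image[OF S.linear_e[of x, unfolded Vector_Spaces.linear_def, THEN conjunct2, THEN conjunct2]]
      unfolding exterior_algebra_def by (metis (no_types, lifting) S.FS.span_mono imageI subsetD)
  qed
  have "e x ` {tensor s v \<omega> | v \<omega>. \<omega> \<in> exterior_algebra u} \<subseteq> {tensor s v \<omega> | v \<omega>. \<omega> \<in> exterior_algebra u}"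
    using ext by (force simp: wedge_mult_tensor)
  then show ?thesis
    using assms(2) module_hom.span_image[OF linear_e[of x, unfolded Vector_Spaces.linear_def, THEN conjunct2, THEN conjunct2]]
    unfolding VS_space_def by (metis (no_types, lifting) FS.span_mono imageI subsetD)
qed

text \<open>The left side depends only on the span, hence so does \<open>fock vac fs\<close>; this
  later permits reordering the frame.\<close>

lemma VS_space_eq_fock: "VS_space s (vec.span (set fs)) = fock vac fs"
proof
  let ?u = "vec.span (set fs)"
  interpret S: vector_space "fun_scale (*) :: complex \<Rightarrow> ((complex ^ 'a) list \<Rightarrow> complex) \<Rightarrow> _"
    by (rule vector_space_fun_scale[OF vector_space_complex])
  note sub = subspace_fock[OF subspace_vac, of fs]
  have w: "tensor s v (wedge Ys) \<in> fock vac fs" if "set Ys \<subseteq> ?u" for v Ys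
    using that
  proof (induction Ys)
    case Nil
    then show ?case using fock_superset[OF subspace_vac, of fs] unfolding vac_def by blast
  next
    case (Cons y Ys)
    then show ?case
      by (simp add: wedge_Cons flip: wedge_mult_tensor) (simp add: fock_e[OF subspace_vac])
  qed
  have "tensor s v \<omega> \<in> fock vac fs" if "\<omega> \<in> exterior_algebra ?u" for v \<omega>
    using that unfolding exterior_algebra_def
  proof (induction rule: S.span_induct_alt)
    case base then show ?case by (simp add: tensor_0 FS.subspace_0[OF sub])
  next
    case (step c x y)
    then show ?case
      using w FS.subspace_add[OF sub FS.subspace_scale[OF sub]] by (auto simp: tensor_add tensor_scale)
  qed
  then show "VS_space s ?u \<subseteq> fock vac fs"
    unfolding VS_space_def by (intro FS.span_minimal sub) auto
  have "FS.subspace (VS_space s ?u)" unfolding VS_space_def by simp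
  then show "fock vac fs \<subseteq> VS_space s ?u"
  proof -
    have "fock vac gs \<subseteq> VS_space s ?u" if "set gs \<subseteq> ?u" for gs
      using that
    proof (induction gs)
      case Nil
      have "wedge [] \<in> exterior_algebra ?u"
        unfolding exterior_algebra_def by (rule S.span_base) (force intro: exI[of _ "[]"])
      then show ?case unfolding VS_space_def vac_def by (auto intro: FS.span_base)
    next
      case (Cons a gs)
      then show ?case
        using FS.subspace_add[OF \<open>FS.subspace (VS_space s ?u)\<close>] VS_space_closed[of a ?u]
        by (auto simp: subset_iff)
    qed
    then show ?thesis using vec.span_superset by blast
  qed
qed

lemma contract_vac: "\<Phi> \<in> vac \<Longrightarrow> contract c \<Phi> = 0"
  by (auto simp: vac_def fun_eq_iff fun_apply tensor_def wedge_Nil contract_apply)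

lemma fock_contract:
  assumes "FS.subspace E" "\<And>\<Phi>. \<Phi> \<in> E \<Longrightarrow> contract c \<Phi> \<in> E" "\<Phi> \<in> fock E fs"
  shows "contract c \<Phi> \<in> fock E fs"
  using assms(3)
proof (induction fs arbitrary: \<Phi>)
  case Nil
  then show ?case using assms by simp
next
  case (Cons a fs)
  note sub = subspace_fock[OF assms(1), of fs]
  obtain p q where \<Phi>: "\<Phi> = p + e a q" "p \<in> fock E fs" "q \<in> fock E fs" using Cons.prems by auto
  have "contract c \<Phi> = (contract c p + fun_scale s (pairing c a) q) + e a (- contract c q)"
    using \<Phi> by (simp add: contract_e)
  moreover have "contract c p + fun_scale s (pairing c a) q \<in> fock E fs" "- contract c q \<in> fock E fs"
    using \<Phi> Cons.IH FS.subspace_add[OF sub] FS.subspace_scale[OF sub] FS.subspace_neg[OF sub] by auto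
  ultimately show ?case unfolding fock.simps by blast
qed

lemma fock_vac_contract: "\<Phi> \<in> fock vac fs \<Longrightarrow> contract c \<Phi> \<in> fock vac fs"
  using fock_contract[OF subspace_vac] contract_vac FS.subspace_0[OF subspace_vac] by metis

text \<open>A function of lists need not be linear in its first argument. On the Fock space it is,
  because contractions kill the vacuum and \<open>contract_e\<close> carries linearity past each
  creation operator.\<close>

lemma contract_fock_linear:
  assumes "\<Phi> \<in> fock vac fs"
  shows "contract (c + d) \<Phi> = contract c \<Phi> + contract d \<Phi>" "contract (k *s c) \<Phi> = fun_scale s k (contract c \<Phi>)"
  using assms
proof (induction fs arbitrary: \<Phi>)
  case Nil
  { case 1 then show ?case by (simp add: contract_vac)
  next case 2 then show ?case by (simp add: contract_vac) }
next
  case (Cons a fs)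
  { case 1 with Cons.IH(1) show ?case
      by (auto simp: contract_e FS.scale_left_distrib)
  next
    case 2 with Cons.IH(2) show ?case
      by (auto simp: contract_e FS.scale_right_diff_distrib FS.scale_right_distrib) }
qed

lemma contract_fock_sum:
  assumes "\<Phi> \<in> fock vac fs"
  shows "contract (\<Sum>i\<in>I. k i *s c i) \<Phi> = (\<Sum>i\<in>I. fun_scale s (k i) (contract (c i) \<Phi>))"
proof (induction I rule: infinite_finite_induct)
  have "contract 0 \<Phi> = 0" using contract_fock_linear(2)[OF assms, of 0 0] by simp
  then show "contract (\<Sum>i\<in>{}. k i *s c i) \<Phi> = (\<Sum>i\<in>{}. fun_scale s (k i) (contract (c i) \<Phi>))"
    "infinite A \<Longrightarrow> contract (\<Sum>i\<in>A. k i *s c i) \<Phi> = (\<Sum>i\<in>A. fun_scale s (k i) (contract (c i) \<Phi>))" for A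
    by auto
qed (simp add: contract_fock_linear[OF assms])

text \<open>The alternating property, again propagated from the vacuum by
  \<open>contract_e\<close>.\<close>

lemma contract_anticommute:
  assumes "\<Phi> \<in> fock vac fs"
  shows "contract c (contract d \<Phi>) = - contract d (contract c \<Phi>)"
  using assms
proof (induction fs arbitrary: \<Phi>)
  case Nil then show ?case by (simp add: contract_vac)
next
  case (Cons a fs)
  then show ?case by (auto simp: contract_e)
qed

lemma contract_fock_eq_0:
  assumes "\<Phi> \<in> fock vac fs" "\<And>a. a \<in> set fs \<Longrightarrow> pairing c a = 0"
  shows "contract c \<Phi> = 0"
  using assms
proof (induction fs arbitrary: \<Phi>)
  case Nil then show ?case by (simp add: contract_vac)
next
  case (Cons a fs)
  then show ?case by (auto simp: contract_e)
qed

lemma contract_fock_cong: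
  assumes "\<Phi> \<in> fock vac fs" "\<And>a. a \<in> set fs \<Longrightarrow> pairing c a = pairing d a"
  shows "contract c \<Phi> = contract d \<Phi>"
proof -
  have "contract (c + (-1) *s d) \<Phi> = 0"
    using assms(2) by (intro contract_fock_eq_0[OF assms(1)]) (simp only: pairing_simps, simp)
  then show ?thesis by (simp only: contract_fock_linear[OF assms(1)]) simp
qed

end

lemma fun_scale_apply: "fun_scale s c \<Phi> x = s c (\<Phi> x)"
  by (simp add: fun_scale_def)

section \<open>The Hermitian form on the exterior algebra\<close>

text \<open>The forms of the statement are picked by \<open>SOME\<close> from their values on
  generators; this lemma lets an explicit form with the same values replace them.\<close>

lemma sesquilinear_on_unique:
  fixes s :: "complex \<Rightarrow> 'b::ab_group_add \<Rightarrow> 'b"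
  assumes m: "module s"
    and h: "sesquilinear_on s (module.span s B) h" and g: "sesquilinear_on s (module.span s B) g"
    and eq: "\<And>x y. x \<in> B \<Longrightarrow> y \<in> B \<Longrightarrow> h x y = g x y"
    and x: "x \<in> module.span s B" and y: "y \<in> module.span s B"
  shows "h x y = g x y"
proof -
  interpret module s by (rule m)
  have z: "f 0 z = 0" "f z 0 = 0" if f: "sesquilinear_on s (span B) f" and "z \<in> span B" for f z
  proof -
    have "s 0 0 = (0 :: 'b)" by simp
    then show "f 0 z = 0" "f z 0 = 0"
      using f that(2) span_zero unfolding sesquilinear_on_def
      by (metis complex_cnj_zero mult_zero_left)+
  qed
  note D = h[unfolded sesquilinear_on_def] g[unfolded sesquilinear_on_def]
  have bx: "h x b = g x b" if b: "b \<in> B" for b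
  proof -
    \<comment> \<open>Membership travels through the induction because sesquilinearity is known only
      inside the span.\<close>
    have "x \<in> span B \<and> h x b = g x b"
      using x
    proof (induction rule: span_induct_alt)
      case base then show ?case using z[OF h] z[OF g] span_base[OF b] span_zero by metis
    next
      case (step c a w)
      have "s c a + w \<in> span B" using step by (intro span_add span_scale) (auto intro: span_base)
      moreover have "h (s c a + w) b = g (s c a + w) b"
      proof -
        have m: "a \<in> span B" "b \<in> span B" "s c a \<in> span B" "w \<in> span B"
          using step b span_base span_scale by blast+
        then have "h (s c a + w) b = c * h a b + h w b" "g (s c a + w) b = c * g a b + g w b"
          using D by simp_all
        then show ?thesis using step eq[OF step(1) b] by simp
      qed
      ultimately show ?case by blast
    qed
    then show ?thesis by blast
  qed
  have "y \<in> span B \<and> h x y = g x y"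
    using y
  proof (induction rule: span_induct_alt)
    case base then show ?case using z[OF h] z[OF g] x span_zero by metis
  next
    case (step c a w)
    have "s c a + w \<in> span B" using step by (intro span_add span_scale) (auto intro: span_base)
    moreover have "h x (s c a + w) = g x (s c a + w)"
    proof -
      have m: "a \<in> span B" "s c a \<in> span B" "w \<in> span B"
        using step span_base span_scale by blast+
      then have "h x (s c a + w) = cnj c * h x a + h x w" "g x (s c a + w) = cnj c * g x a + g x w"
        using D x by simp_all
      then show ?thesis using step bx[OF step(1)] by simp
    qed
    ultimately show ?case by blast
  qed
  then show ?thesis by blast
qed

locale exterior_form = complex_space s + V: hermitian_space s H UNIV + U: hermitian_space "(*s)" h UNIV
  for s :: "complex \<Rightarrow> 'v::ab_group_add \<Rightarrow> 'v" and H
    and h :: "complex ^ 'n \<Rightarrow> complex ^ 'n \<Rightarrow> complex"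
begin

text \<open>The Riesz covector of \<open>a\<close>, conjugate-linear in \<open>a\<close>;
  contraction with it is the annihilation operator adjoint to creation by \<open>a\<close>.\<close>

definition flat :: "complex ^ 'n \<Rightarrow> complex ^ 'n" where
  "flat a = covector (\<lambda>y. h y a)"

lemma pairing_flat [simp]: "pairing (flat a) x = h x a"
  unfolding flat_def
  by (rule pairing_covector)
    (simp add: Vector_Spaces.linear_iff vec.vector_space_axioms vector_space_complex)

lemma flat_sum: "flat (\<Sum>i\<in>I. c i *s a i) = (\<Sum>i\<in>I. cnj (c i) *s flat (a i))"
  by (simp add: flat_def covector_def vec_eq_iff U.h_sum)

abbreviation i :: "complex ^ 'n \<Rightarrow> ((complex ^ 'n) list \<Rightarrow> 'v) \<Rightarrow> (complex ^ 'n) list \<Rightarrow> 'v" where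
  "i a \<equiv> contract (flat a)"

text \<open>Unfolded, this is the sum over all sublists \<open>J\<close> of \<open>fs\<close> of
  \<open>H (\<Phi> (map flat J)) (\<Psi> (map flat J))\<close>: the Parseval sum over the basis of
  wedge products of frame vectors.\<close>

primrec form :: "(complex ^ 'n) list \<Rightarrow> ((complex ^ 'n) list \<Rightarrow> 'v) \<Rightarrow> ((complex ^ 'n) list \<Rightarrow> 'v) \<Rightarrow> complex" where
  "form [] \<Phi> \<Psi> = H (\<Phi> []) (\<Psi> [])"
| "form (a # fs) \<Phi> \<Psi> = form fs \<Phi> \<Psi> + form fs (i a \<Phi>) (i a \<Psi>)"

lemma sesquilinear_form: "sesquilinear_on (fun_scale s) UNIV (form fs)"
proof -
  have "form fs (\<Phi> + \<Psi>) \<Xi> = form fs \<Phi> \<Xi> + form fs \<Psi> \<Xi>" "form fs \<Xi> (\<Phi> + \<Psi>) = form fs \<Xi> \<Phi> + form fs \<Xi> \<Psi>"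
    "form fs (fun_scale s c \<Phi>) \<Psi> = c * form fs \<Phi> \<Psi>" "form fs \<Phi> (fun_scale s c \<Psi>) = cnj c * form fs \<Phi> \<Psi>"
    for \<Phi> \<Psi> \<Xi> c
    by (induction fs arbitrary: \<Phi> \<Psi> \<Xi>) (auto simp: fun_apply fun_scale_apply algebra_simps)
  then show ?thesis unfolding sesquilinear_on_def by blast
qed

lemma form_hermitian: "form fs \<Psi> \<Phi> = cnj (form fs \<Phi> \<Psi>)"
proof (induction fs arbitrary: \<Phi> \<Psi>)
  case Nil show ?case unfolding form.simps by (rule V.herm)
next
  case (Cons a fs)
  show ?case unfolding form.simps Cons[of \<Psi> \<Phi>] Cons[of "i a \<Psi>" "i a \<Phi>"] by simp
qed

text \<open>Positivity on \<open>{0}\<close> is vacuous, so the calculation rules of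
  \<open>hermitian_space\<close> become available for \<open>form fs\<close> with an arbitrary
  list.\<close>

lemma hermitian_form_0: "hermitian_space (fun_scale s) (form fs) {0}"
  by unfold_locales (rule sesquilinear_form, rule form_hermitian, auto simp: FS.subspace_single_0)

lemma form_nonneg: "0 \<le> Re (form fs \<Phi> \<Phi>)"
proof (induction fs arbitrary: \<Phi>)
  case Nil show ?case using V.pos[of "\<Phi> []"] by (cases "\<Phi> [] = 0") auto
qed simp

text \<open>Creation and annihilation are adjoint. The argument uses that \<open>\<Psi>\<close> is
  alternating, which membership in the Fock space of any list guarantees; \<open>\<Phi>\<close> is
  arbitrary.\<close>

lemma form_e:
  assumes "U.orthonormal fs" "b \<in> set fs" "\<Psi> \<in> fock vac gs"
  shows "form fs (e b \<Phi>) \<Psi> = form fs \<Phi> (i b \<Psi>)"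
  using assms
proof (induction fs arbitrary: \<Phi> \<Psi>)
  case (Cons a fs)
  have d: "distinct (a # fs)" and o: "\<And>x y. x \<in> set (a # fs) \<Longrightarrow> y \<in> set (a # fs) \<Longrightarrow> h x y = (if x = y then 1 else 0)"
    using U.orthonormalD[OF Cons.prems(1)] by blast+
  have on: "U.orthonormal fs"
    by (rule U.orthonormalI) (use d o in auto)
  interpret F: hermitian_space "fun_scale s" "form fs" "{0}"
    by (rule hermitian_form_0)
  note IH = Cons.IH[OF on]
  show ?case
  proof (cases "b = a")
    case True
    \<comment> \<open>A term with \<open>e a\<close> survives only if some covector of the argument
      list pairs nontrivially with \<open>a\<close>, and the remaining frame vectors are orthogonal
      to \<open>a\<close>.\<close>
    have vanish: "form gs' (e a \<Phi>') \<Psi>' = 0" if "\<forall>x\<in>set gs'. h a x = 0" for gs' \<Phi>' \<Psi>'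
      using that
    proof (induction gs' arbitrary: \<Phi>' \<Psi>')
      case Nil then show ?case by (simp add: e_Nil)
    next
      case (Cons x gs')
      then show ?case
        using Cons.IH[of "- i x \<Phi>'"] by (simp add: contract_e)
    qed
    have z: "\<forall>x\<in>set fs. h a x = 0" using d o by auto
    have "i a (i a \<Psi>) = 0"
    proof -
      have "i a (i a \<Psi>) + i a (i a \<Psi>) = 0"
        using contract_anticommute[OF Cons.prems(3), of "flat a" "flat a"] by (simp add: eq_neg_iff_add_eq_0)
      then show ?thesis
        using FS.scale_left_distrib[of 1 1 "i a (i a \<Psi>)"] FS.scale_eq_0_iff[of "1 + 1" "i a (i a \<Psi>)"] by simp
    qed
    then show ?thesis
      using True o[of a a] vanish[OF z] by (simp add: contract_e)
  next
    case False
    then have b: "b \<in> set fs" using Cons.prems by simp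
    have "h b a = 0" using o[of b a] False b by simp
    moreover have "form fs (e b (i a \<Phi>)) (i a \<Psi>) = form fs (i a \<Phi>) (i b (i a \<Psi>))"
      by (rule IH[OF b fock_vac_contract[OF Cons.prems(3)]])
    ultimately show ?thesis
      using IH[OF b Cons.prems(3)] contract_anticommute[OF Cons.prems(3), of "flat b" "flat a"]
      by (simp add: contract_e)
  qed
qed simp

lemma form_e_span:
  assumes "U.orthonormal fs" "x \<in> vec.span (set fs)" "\<Psi> \<in> fock vac gs"
  shows "form fs (e x \<Phi>) \<Psi> = form fs \<Phi> (i x \<Psi>)"
proof -
  interpret F: hermitian_space "fun_scale s" "form fs" "{0}"
    by (rule hermitian_form_0)
  have x: "x = (\<Sum>k<length fs. h x (fs ! k) *s fs ! k)"
    by (rule U.orthonormal_expansion[OF assms(1,2)]) simp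
  have fx: "i x \<Psi> = (\<Sum>k<length fs. fun_scale s (cnj (h x (fs ! k))) (i (fs ! k) \<Psi>))"
    by (subst x, subst flat_sum, rule contract_fock_sum[OF assms(3)])
  have "form fs (e x \<Phi>) \<Psi> = (\<Sum>k<length fs. h x (fs ! k) * form fs (e (fs ! k) \<Phi>) \<Psi>)"
    by (subst x, simp add: e_sum_left F.h_sum)
  also have "\<dots> = (\<Sum>k<length fs. h x (fs ! k) * form fs \<Phi> (i (fs ! k) \<Psi>))"
    using form_e[OF assms(1) _ assms(3)] by simp
  also have "\<dots> = form fs \<Phi> (i x \<Psi>)" by (simp add: fx F.h_sum)
  finally show ?thesis .
qed

text \<open>Both summands of \<open>form\<close> are nonnegative, so both vanish with their sum.
  Contraction with the first frame vector isolates the \<open>e a\<close> component of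
  \<open>\<Phi>\<close>, and the induction treats the two components in turn.\<close>

lemma form_definite:
  assumes "U.orthonormal fs" "\<Phi> \<in> fock vac fs" "\<Phi> \<noteq> 0"
  shows "0 < Re (form fs \<Phi> \<Phi>)"
proof -
  have "\<Phi> = 0" if "Re (form fs \<Phi> \<Phi>) = 0" "\<Phi> \<in> fock vac fs" "U.orthonormal fs" for fs \<Phi>
    using that
  proof (induction fs arbitrary: \<Phi>)
    case Nil
    then obtain v where v: "\<Phi> = tensor s v (wedge [])" by (auto simp: vac_def)
    then have "Re (H v v) = 0" using Nil by (simp add: tensor_def wedge_Nil)
    then have "v = 0" using V.pos[of v] by auto
    then show ?case using v tensor_0_left by simp
  next
    case (Cons a fs)
    have o: "distinct (a # fs)" "\<And>x y. x \<in> set (a # fs) \<Longrightarrow> y \<in> set (a # fs) \<Longrightarrow> h x y = (if x = y then 1 else 0)"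
      using U.orthonormalD[OF Cons.prems(3)] by blast+
    have on: "U.orthonormal fs"
      by (rule U.orthonormalI) (use o in auto)
    obtain p q where pq: "\<Phi> = p + e a q" "p \<in> fock vac fs" "q \<in> fock vac fs" using Cons.prems by auto
    have z: "i a \<Psi> = 0" if "\<Psi> \<in> fock vac fs" for \<Psi>
      by (rule contract_fock_eq_0[OF that]) (use o in auto)
    have "i a \<Phi> = q" using z[OF pq(2)] z[OF pq(3)] o(2)[of a a] by (simp add: pq contract_e)
    then have "Re (form fs \<Phi> \<Phi>) = 0" "Re (form fs q q) = 0"
      using Cons.prems(1) form_nonneg[of fs \<Phi>] form_nonneg[of fs q] by simp_all
    then have "q = 0" using Cons.IH pq(3) on by blast
    then have "\<Phi> = p" using pq by simp
    then show ?case using Cons.IH[of p] \<open>Re (form fs \<Phi> \<Phi>) = 0\<close> pq on by simp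
  qed
  then show ?thesis using form_nonneg[of fs \<Phi>] assms by fastforce
qed

lemma hermitian_form:
  assumes "U.orthonormal fs"
  shows "hermitian_space (fun_scale s) (form fs) (fock vac fs)"
  by unfold_locales
    (rule sesquilinear_form, rule form_hermitian, rule subspace_fock[OF subspace_vac], rule form_definite[OF assms])

end

lemma hermitian_complex: "hermitian_space (*) (\<lambda>a b. a * cnj b) UNIV"
proof -
  interpret vector_space "(*) :: complex \<Rightarrow> complex \<Rightarrow> complex" by (rule vector_space_complex)
  show ?thesis
    by unfold_locales
      (auto simp: sesquilinear_on_def algebra_simps complex_mult_cnj sum_power2_gt_zero_iff complex_eq_iff)
qed

section \<open>Identification of the forms\<close>

text \<open>The cycle that sends 0 to \<open>k\<close> and lowers 1, ..., \<open>k\<close> by one.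
  These cycles represent the cosets of the permutations fixing 0; as products of \<open>k\<close>
  adjacent transpositions they produce the Laplace signs.\<close>

definition rotation :: "nat \<Rightarrow> nat \<Rightarrow> nat" where
  "rotation k j = (if j = 0 then k else if j \<le> k then j - 1 else j)"

lemma rotation_permutes: "rotation k permutes {..k}"
  and sign_rotation: "sign (rotation k) = (-1) ^ k"
proof (induction k)
  case 0
  have "rotation 0 = id" by (auto simp: rotation_def)
  { case 1 show ?case unfolding \<open>rotation 0 = id\<close> by (rule permutes_id)
  next case 2 show ?case unfolding \<open>rotation 0 = id\<close> by simp }
next
  case (Suc k)
  have r: "rotation (Suc k) = Transposition.transpose k (Suc k) \<circ> rotation k"
    by (auto simp: rotation_def fun_eq_iff Transposition.transpose_def)
  have p: "rotation k permutes {..Suc k}"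
    by (rule permutes_subset[OF Suc(1)]) auto
  have t: "Transposition.transpose k (Suc k) permutes {..Suc k}" by (rule permutes_swap_id) auto
  have "permutation (rotation k)" "permutation (Transposition.transpose k (Suc k))"
    using p t unfolding permutation_permutes by blast+
  then show "rotation (Suc k) permutes {..Suc k}" "sign (rotation (Suc k)) = (-1) ^ Suc k"
    unfolding r using permutes_compose[OF p t] Suc(2) by (simp_all add: sign_compose sign_swap_id)
qed

text \<open>Laplace expansion of a determinant along row 0. Every permutation is uniquely a cycle
  \<open>rotation k\<close> after a permutation of the positive indices, and the conditional index
  skips column \<open>k\<close>.\<close>

lemma sum_permutations_Suc:
  fixes M :: "nat \<Rightarrow> nat \<Rightarrow> 'a::comm_ring_1"
  shows "(\<Sum>\<sigma> | \<sigma> permutes {..<Suc p}. of_int (sign \<sigma>) * (\<Prod>j<Suc p. M j (\<sigma> j))) =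
    (\<Sum>k<Suc p. (-1) ^ k * M 0 k * (\<Sum>\<tau> | \<tau> permutes {..<p}.
       of_int (sign \<tau>) * (\<Prod>j<p. M (Suc j) (if \<tau> j < k then \<tau> j else Suc (\<tau> j)))))"
    (is "?L = ?R")
proof -
  define L where "L \<tau> = map_permutation {..<p} Suc \<tau>" for \<tau>
  define g where "g = (\<lambda>(k, \<tau>). rotation k \<circ> L \<tau>)"
  let ?A = "{..<Suc p} \<times> {\<tau>. \<tau> permutes {..<p}}" and ?B = "{\<sigma>. \<sigma> permutes {..<Suc p}}"
  have L0: "L \<tau> 0 = 0" for \<tau> by (simp add: L_def map_permutation_def restrict_id_def image_iff)
  have LS: "L \<tau> (Suc j) = Suc (\<tau> j)" if "j < p" for \<tau> j
    using that by (simp add: L_def map_permutation_def restrict_id_def inv_into_f_f)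
  have Lp: "L \<tau> permutes {..<Suc p}" if "\<tau> permutes {..<p}" for \<tau>
  proof -
    have "L \<tau> permutes Suc ` {..<p}"
      unfolding L_def by (rule map_permutation_permutes[OF _ that]) (simp add: bij_betw_def)
    then show ?thesis by (rule permutes_subset) auto
  qed
  have Ls: "sign (L \<tau>) = sign \<tau>" if "\<tau> permutes {..<p}" for \<tau>
    unfolding L_def by (rule sign_map_permutation) (use that in auto)
  have rp: "rotation k permutes {..<Suc p}" if "k < Suc p" for k
    by (rule permutes_subset[OF rotation_permutes]) (use that in auto)
  have gB: "g x \<in> ?B" if "x \<in> ?A" for x
    using that permutes_compose[OF Lp rp] by (auto simp: g_def)
  have g0: "g (k, \<tau>) 0 = k" and gS: "j < p \<Longrightarrow> g (k, \<tau>) (Suc j) = (if \<tau> j < k then \<tau> j else Suc (\<tau> j))" for k \<tau> j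
    by (auto simp: g_def L0 LS rotation_def)
  have inj: "inj_on g ?A"
  proof (rule inj_onI, clarify)
    fix k \<tau> k' \<tau>' assume \<tau>: "\<tau> permutes {..<p}" "\<tau>' permutes {..<p}" and eq: "g (k, \<tau>) = g (k', \<tau>')"
    have k: "k = k'" using g0 eq by metis
    have "\<tau> j = \<tau>' j" for j
    proof (cases "j < p")
      case True
      then have "(if \<tau> j < k then \<tau> j else Suc (\<tau> j)) = (if \<tau>' j < k then \<tau>' j else Suc (\<tau>' j))"
        using gS eq k by metis
      then show ?thesis by (auto split: if_splits)
    qed (use \<tau> permutes_not_in in \<open>metis lessThan_iff\<close>)
    then show "k = k' \<and> \<tau> = \<tau>'" using k by auto
  qed
  \<comment> \<open>Surjectivity by counting: there are p + 1 choices of \<open>k\<close>, and p + 1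
    times p! is (p + 1)!.\<close>
  have "card (g ` ?A) = card ?B"
    by (simp add: card_image[OF inj] card_cartesian_product card_permutations)
  then have "g ` ?A = ?B"
    using gB by (intro card_subset_eq) (auto simp: finite_permutations)
  then have "?L = (\<Sum>x\<in>?A. of_int (sign (g x)) * (\<Prod>j<Suc p. M j (g x j)))"
    using sum.reindex[OF inj, of "\<lambda>\<sigma>. of_int (sign \<sigma>) * (\<Prod>j<Suc p. M j (\<sigma> j))"] by (simp add: o_def)
  also have "\<dots> = (\<Sum>k<Suc p. \<Sum>\<tau> | \<tau> permutes {..<p}. of_int (sign (g (k, \<tau>))) * (\<Prod>j<Suc p. M j (g (k, \<tau>) j)))"
    by (simp add: sum.cartesian_product)
  also have "\<dots> = ?R"
    unfolding sum_distrib_left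
  proof (intro sum.cong refl, goal_cases)
    case (1 k \<tau>)
    then have k: "k < Suc p" and \<tau>: "\<tau> permutes {..<p}" by auto
    have "permutation (rotation k)" "permutation (L \<tau>)"
      using rp[OF k] Lp[OF \<tau>] unfolding permutation_permutes by blast+
    then have "sign (g (k, \<tau>)) = (-1) ^ k * sign \<tau>"
      by (simp add: g_def sign_compose sign_rotation Ls[OF \<tau>])
    then show ?case
      by (simp add: prod.lessThan_Suc_shift g0 gS mult_ac del: prod.lessThan_Suc)
  qed
  finally show ?thesis .
qed

lemma nth_delete_nth:
  assumes "k < length xs" "j < length xs - 1"
  shows "delete_nth k xs ! j = xs ! (if j < k then j else Suc j)"
  using assms by (auto simp: delete_nth_def nth_append min_def)

lemma length_delete_nth: "k < length xs \<Longrightarrow> length (delete_nth k xs) = length xs - 1"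
  by (auto simp: delete_nth_def)

lemma set_delete_nth: "set (delete_nth k xs) \<subseteq> set xs"
  using set_take_subset set_drop_subset by (fastforce simp: delete_nth_def)

definition gram :: "('a \<Rightarrow> 'a \<Rightarrow> complex) \<Rightarrow> 'a list \<Rightarrow> 'a list \<Rightarrow> complex" where
  "gram h Ys Zs = (if length Ys = length Zs
     then \<Sum>\<sigma> | \<sigma> permutes {..<length Ys}. of_int (sign \<sigma>) * (\<Prod>i<length Ys. h (Ys ! i) (Zs ! \<sigma> i))
     else 0)"

text \<open>Expansion along the first row. When the lengths do not match, both sides are zero, so
  the recursion covers all pairs of lists.\<close>

lemma gram_Cons:
  "gram h (y # Ys) Zs = (\<Sum>k<length Zs. (-1) ^ k * h y (Zs ! k) * gram h Ys (delete_nth k Zs))"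
proof (cases "length Zs = Suc (length Ys)")
  case True
  let ?p = "length Ys"
  have "gram h (y # Ys) Zs = (\<Sum>\<sigma> | \<sigma> permutes {..<Suc ?p}. of_int (sign \<sigma>) *
      (\<Prod>j<Suc ?p. (\<lambda>i k. h ((y # Ys) ! i) (Zs ! k)) j (\<sigma> j)))"
    using True by (simp add: gram_def del: prod.lessThan_Suc)
  also have "\<dots> = (\<Sum>k<Suc ?p. (-1) ^ k * h y (Zs ! k) * (\<Sum>\<tau> | \<tau> permutes {..<?p}.
       of_int (sign \<tau>) * (\<Prod>j<?p. h (Ys ! j) (Zs ! (if \<tau> j < k then \<tau> j else Suc (\<tau> j))))))"
    by (subst sum_permutations_Suc) (simp del: sum.lessThan_Suc prod.lessThan_Suc)
  also have "\<dots> = (\<Sum>k<length Zs. (-1) ^ k * h y (Zs ! k) * gram h Ys (delete_nth k Zs))"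
  proof (intro sum.cong)
    fix k assume "k \<in> {..<length Zs}"
    then have k: "k < length Zs" by simp
    have "gram h Ys (delete_nth k Zs) = (\<Sum>\<tau> | \<tau> permutes {..<?p}.
       of_int (sign \<tau>) * (\<Prod>j<?p. h (Ys ! j) (Zs ! (if \<tau> j < k then \<tau> j else Suc (\<tau> j)))))"
      unfolding gram_def length_delete_nth[OF k]
    proof (simp add: True, intro sum.cong refl arg_cong2[where f = "(*)"] prod.cong, goal_cases)
      case (1 \<tau> j)
      then have "\<tau> j < length Zs - 1" using True permutes_in_image[of \<tau> "{..<?p}" j] by auto
      then show ?case by (simp add: nth_delete_nth[OF k])
    qed
    then show "(-1) ^ k * h y (Zs ! k) * (\<Sum>\<tau> | \<tau> permutes {..<?p}.
       of_int (sign \<tau>) * (\<Prod>j<?p. h (Ys ! j) (Zs ! (if \<tau> j < k then \<tau> j else Suc (\<tau> j))))) =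
      (-1) ^ k * h y (Zs ! k) * gram h Ys (delete_nth k Zs)" by simp
  qed (simp add: True)
  finally show ?thesis .
next
  case False
  then have "gram h Ys (delete_nth k Zs) = 0" if "k < length Zs" for k
    using that by (auto simp: gram_def length_delete_nth)
  then show ?thesis using False by (simp add: gram_def)
qed

context exterior_form begin

lemma scalar_exterior_form: "exterior_form (*) (\<lambda>a b. a * cnj b) h"
  unfolding exterior_form_def complex_space_def
  by (intro conjI vector_space_complex hermitian_complex U.hermitian_space_axioms)

definition sform :: "(complex ^ 'n) list \<Rightarrow> ((complex ^ 'n) list \<Rightarrow> complex) \<Rightarrow> ((complex ^ 'n) list \<Rightarrow> complex) \<Rightarrow> complex" where
  "sform = exterior_form.form (\<lambda>a b. a * cnj b) h"

lemma form_vac: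
  assumes "\<Phi> \<in> vac"
  shows "form fs \<Phi> \<Psi> = H (\<Phi> []) (\<Psi> [])"
proof (cases fs)
  case (Cons a gs)
  have z: "form gs 0 \<Psi> = 0" for gs \<Psi>
  proof -
    interpret F: hermitian_space "fun_scale s" "form gs" "{0}" by (rule hermitian_form_0)
    show ?thesis by simp
  qed
  show ?thesis by (induction fs) (simp_all add: contract_vac[OF assms] z)
qed simp

lemma tensor_apply: "tensor s v \<omega> a = s (\<omega> a) v"
  by (simp add: tensor_def)

lemma form_tensor: "form fs (tensor s v \<omega>) (tensor s w \<eta>) = H v w * sform fs \<omega> \<eta>"
proof -
  interpret S: exterior_form "(*)" "\<lambda>a b. a * cnj b" h by (rule scalar_exterior_form)
  show ?thesis
    by (induction fs arbitrary: \<omega> \<eta>)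
      (auto simp: sform_def tensor_apply contract_tensor S.flat_def flat_def algebra_simps)
qed

text \<open>Adjointness moves the first factor of the left wedge to the right one as a contraction,
  and contraction expands a wedge product by the Laplace rule; this is the recursion
  \<open>gram_Cons\<close>.\<close>

lemma sform_wedge:
  assumes "U.orthonormal fs" "set Ys \<subseteq> vec.span (set fs)" "set Zs \<subseteq> vec.span (set fs)"
  shows "sform fs (wedge Ys) (wedge Zs) = gram h Ys Zs"
proof -
  interpret S: exterior_form "(*)" "\<lambda>a b. a * cnj b" h by (rule scalar_exterior_form)
  have v: "(wedge [] :: (complex ^ 'n) list \<Rightarrow> complex) \<in> S.vac"
    unfolding S.vac_def by (rule range_eqI[of _ _ 1]) (simp add: tensor_def)
  have mem: "wedge Zs \<in> S.fock S.vac fs" if "set Zs \<subseteq> vec.span (set fs)" for Zs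
    using that
  proof (induction Zs)
    case Nil then show ?case using v S.fock_superset[OF S.subspace_vac] by blast
  next
    case (Cons z Zs)
    then show ?case by (simp add: wedge_Cons S.fock_e[OF S.subspace_vac])
  qed
  have con: "contract c (wedge Zs) = (\<Sum>k<length Zs. fun_scale (*) ((-1) ^ k * pairing c (Zs ! k)) (wedge (delete_nth k Zs)))"
    for c and Zs :: "(complex ^ 'n) list"
  proof (induction Zs)
    case Nil then show ?case by (simp add: S.contract_vac[OF v])
  next
    case (Cons z Zs)
    have "delete_nth 0 (z # Zs) = Zs" "delete_nth (Suc k) (z # Zs) = z # delete_nth k Zs" for k
      by (simp_all add: delete_nth_def)
    then show ?case
      by (simp add: wedge_Cons S.contract_e Cons S.e_sum sum.lessThan_Suc_shift sum_negf del: sum.lessThan_Suc)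
  qed
  interpret F: hermitian_space "fun_scale (*)" "S.form fs" "{0}" by (rule S.hermitian_form_0)
  show ?thesis
    using assms(2,3) unfolding sform_def
  proof (induction Ys arbitrary: Zs)
    case Nil
    show ?case
    proof (cases Zs)
      case Nil
      show ?thesis unfolding Nil S.form_vac[OF v] by (simp add: gram_def wedge_Nil)
    next
      case (Cons z Zs')
      then show ?thesis using S.form_vac[OF v] by (simp add: gram_def wedge_Cons S.e_Nil)
    qed
  next
    case (Cons y Ys)
    have hc: "cnj (h z y) = h y z" for z by (rule U.herm[symmetric])
    have "S.form fs (wedge (y # Ys)) (wedge Zs) = S.form fs (wedge Ys) (contract (flat y) (wedge Zs))"
      using S.form_e_span[OF assms(1) _ mem] Cons.prems unfolding wedge_Cons
      by (simp add: S.flat_def flat_def)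
    also have "\<dots> = (\<Sum>k<length Zs. (-1) ^ k * h y (Zs ! k) * S.form fs (wedge Ys) (wedge (delete_nth k Zs)))"
      unfolding con F.h_sum by (intro sum.cong refl) (simp add: hc)
    also have "\<dots> = (\<Sum>k<length Zs. (-1) ^ k * h y (Zs ! k) * gram h Ys (delete_nth k Zs))"
    proof (intro sum.cong refl)
      fix k assume "k \<in> {..<length Zs}"
      have "set (delete_nth k Zs) \<subseteq> vec.span (set fs)" by (rule order_trans[OF set_delete_nth Cons.prems(2)])
      then show "(-1) ^ k * h y (Zs ! k) * S.form fs (wedge Ys) (wedge (delete_nth k Zs)) =
          (-1) ^ k * h y (Zs ! k) * gram h Ys (delete_nth k Zs)"
        using Cons by simp
    qed
    finally show ?case by (simp add: gram_Cons)
  qed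
qed

lemma sesquilinear_on_subset: "sesquilinear_on t UNIV g \<Longrightarrow> sesquilinear_on t W g"
  unfolding sesquilinear_on_def by blast

text \<open>The explicit form is used twice: as a witness that the description under
  \<open>SOME\<close> is satisfiable, and as the value forced by uniqueness on generators.\<close>

lemma S_form_eq:
  assumes "U.orthonormal fs" "u = vec.span (set fs)" "\<omega> \<in> exterior_algebra u" "\<eta> \<in> exterior_algebra u"
  shows "S_form h u \<omega> \<eta> = sform fs \<omega> \<eta>"
proof -
  interpret S: exterior_form "(*)" "\<lambda>a b. a * cnj b" h by (rule scalar_exterior_form)
  let ?P = "\<lambda>hS. sesquilinear_on (fun_scale (*)) (exterior_algebra u) hS \<and>
     (\<forall>Ys Zs. set Ys \<subseteq> u \<and> set Zs \<subseteq> u \<longrightarrow> hS (wedge Ys) (wedge Zs) = gram h Ys Zs)"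
  have "?P (sform fs)"
    using sform_wedge[OF assms(1)] sesquilinear_on_subset[OF S.sesquilinear_form] assms(2)
    unfolding sform_def by blast
  then have "?P (SOME hS. ?P hS)" by (rule someI[of ?P])
  moreover have "S_form h u = (SOME hS. ?P hS)" unfolding S_form_def gram_def ..
  ultimately have P: "?P (S_form h u)" by simp
  show ?thesis
    using assms(3,4) unfolding exterior_algebra_def
  proof (rule sesquilinear_on_unique[OF S.FS.module_axioms, rotated 3])
    show "sesquilinear_on (fun_scale (*)) (S.FS.span {wedge Ys |Ys. set Ys \<subseteq> u}) (S_form h u)"
      using P unfolding exterior_algebra_def by blast
    show "sesquilinear_on (fun_scale (*)) (S.FS.span {wedge Ys |Ys. set Ys \<subseteq> u}) (sform fs)"
      unfolding sform_def by (rule sesquilinear_on_subset[OF S.sesquilinear_form])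
    show "S_form h u x y = sform fs x y"
      if "x \<in> {wedge Ys |Ys. set Ys \<subseteq> u}" "y \<in> {wedge Ys |Ys. set Ys \<subseteq> u}" for x y
      using that P sform_wedge[OF assms(1)] assms(2) by auto
  qed
qed

theorem VS_form_eq:
  assumes "U.orthonormal fs" "u = vec.span (set fs)" "\<Phi> \<in> VS_space s u" "\<Psi> \<in> VS_space s u"
  shows "VS_form s H h u \<Phi> \<Psi> = form fs \<Phi> \<Psi>"
proof -
  let ?P = "\<lambda>hVS. sesquilinear_on (fun_scale s) (VS_space s u) hVS \<and>
     (\<forall>v w. \<forall>\<omega>\<in>exterior_algebra u. \<forall>\<eta>\<in>exterior_algebra u.
        hVS (tensor s v \<omega>) (tensor s w \<eta>) = H v w * S_form h u \<omega> \<eta>)"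
  have "?P (form fs)"
    using sesquilinear_on_subset[OF sesquilinear_form, of "VS_space s u" fs] form_tensor[of fs]
      S_form_eq[OF assms(1,2)] by simp
  then have "?P (SOME g. ?P g)" by (rule someI[of ?P])
  moreover have "VS_form s H h u = (SOME g. ?P g)" unfolding VS_form_def ..
  ultimately have P: "?P (VS_form s H h u)" by simp
  show ?thesis
    using assms(3,4) unfolding VS_space_def
  proof (rule sesquilinear_on_unique[OF FS.module_axioms, rotated 3])
    show "sesquilinear_on (fun_scale s) (FS.span {tensor s v \<omega> |v \<omega>. \<omega> \<in> exterior_algebra u}) (VS_form s H h u)"
      using P unfolding VS_space_def by blast
    show "sesquilinear_on (fun_scale s) (FS.span {tensor s v \<omega> |v \<omega>. \<omega> \<in> exterior_algebra u}) (form fs)"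
      by (rule sesquilinear_on_subset[OF sesquilinear_form])
    show "VS_form s H h u x y = form fs x y"
      if "x \<in> {tensor s v \<omega> |v \<omega>. \<omega> \<in> exterior_algebra u}" "y \<in> {tensor s v \<omega> |v \<omega>. \<omega> \<in> exterior_algebra u}" for x y
      using that P form_tensor S_form_eq[OF assms(1,2)] by auto
  qed
qed

end

section \<open>The cohomology differential\<close>

lemma sum_cyclic:
  "(\<Sum>b\<in>A. \<Sum>p\<in>A. \<Sum>q\<in>A. F b p q) = (\<Sum>b\<in>A. \<Sum>p\<in>A. \<Sum>q\<in>A. (F p q b :: 'a::comm_monoid_add))"
proof -
  have "(\<Sum>p\<in>A. \<Sum>q\<in>A. \<Sum>b\<in>A. F p q b) = (\<Sum>p\<in>A. \<Sum>b\<in>A. \<Sum>q\<in>A. F p q b)"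
    by (intro sum.cong refl sum.swap)
  also have "\<dots> = (\<Sum>b\<in>A. \<Sum>p\<in>A. \<Sum>q\<in>A. F p q b)" by (rule sum.swap)
  finally show ?thesis .
qed

lemma fun_sum_apply: "(\<Sum>i\<in>I. f i) x = (\<Sum>i\<in>I. f i x :: 'a::comm_monoid_add)"
  by (induction I rule: infinite_finite_induct) (auto simp: fun_apply)

definition vmap :: "('v \<Rightarrow> 'v) \<Rightarrow> ('a \<Rightarrow> 'v) \<Rightarrow> 'a \<Rightarrow> 'v" where
  "vmap p \<Phi> = (\<lambda>as. p (\<Phi> as))"

lemma contract_vmap: "contract c (vmap p \<Phi>) = vmap p (contract c \<Phi>)"
  by (simp add: vmap_def contract_def)

context complex_space begin

lemma linear_vmap:
  assumes "Vector_Spaces.linear s s p"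
  shows "Vector_Spaces.linear (fun_scale s) (fun_scale s) (vmap p)"
  unfolding Vector_Spaces.linear_iff
  by (auto simp: FS.vector_space_axioms vmap_def fun_eq_iff fun_apply fun_scale_apply linearD[OF assms])

lemma e_vmap:
  assumes "Vector_Spaces.linear s s p"
  shows "e x (vmap p \<Phi>) = vmap p (e x \<Phi>)"
  by (simp add: fun_eq_iff vmap_def wedge_mult_def linearD[OF assms])

lemma vmap_tensor:
  assumes "Vector_Spaces.linear s s p"
  shows "vmap p (tensor s v \<omega>) = tensor s (p v) \<omega>"
  by (simp add: vmap_def tensor_def linearD[OF assms])

lemma vmap_vac:
  assumes "Vector_Spaces.linear s s p" "\<Phi> \<in> vac"
  shows "vmap p \<Phi> \<in> vac"
  using assms(2) vmap_tensor[OF assms(1)] unfolding vac_def by auto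

lemma fock_vmap:
  assumes "Vector_Spaces.linear s s p" "\<And>\<Phi>. \<Phi> \<in> E \<Longrightarrow> vmap p \<Phi> \<in> E" "\<Phi> \<in> fock E fs"
  shows "vmap p \<Phi> \<in> fock E fs"
  using assms(3)
proof (induction fs arbitrary: \<Phi>)
  case (Cons a fs)
  then obtain x y where "\<Phi> = x + e a y" "x \<in> fock E fs" "y \<in> fock E fs" by auto
  then have "vmap p \<Phi> = vmap p x + e a (vmap p y)" "vmap p x \<in> fock E fs" "vmap p y \<in> fock E fs"
    using Cons.IH by (auto simp: linearD[OF linear_vmap[OF assms(1)]] e_vmap[OF assms(1)])
  then show ?case unfolding fock.simps by blast
qed (simp add: assms)

end

lemma (in exterior_form) form_vmap:
  assumes "\<And>v w. H (p v) w = H v (p' w)"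
  shows "form fs (vmap p \<Phi>) \<Psi> = form fs \<Phi> (vmap p' \<Psi>)"
  by (induction fs arbitrary: \<Phi> \<Psi>) (simp_all add: contract_vmap, simp add: vmap_def assms)

text \<open>
  \<open>c a b k\<close> are the structure constants of the Lie algebra in the basis dual to \<open>fs\<close>, and
  \<open>p a\<close> is the action of the \<open>a\<close>-th basis element on \<open>V\<close>, with adjoint \<open>p' a\<close>.
\<close>
locale cohomology_operator = exterior_form s H h
  for s :: "complex \<Rightarrow> 'v::ab_group_add \<Rightarrow> 'v" and H
    and h :: "complex ^ 'n \<Rightarrow> complex ^ 'n \<Rightarrow> complex" +
  fixes fs :: "(complex ^ 'n) list"
    and c :: "nat \<Rightarrow> nat \<Rightarrow> nat \<Rightarrow> complex"
    and p p' :: "nat \<Rightarrow> 'v \<Rightarrow> 'v"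
  assumes orthonormal_fs: "U.orthonormal fs"
    and linear_p: "Vector_Spaces.linear s s (p a)"
    and linear_p': "Vector_Spaces.linear s s (p' a)"
    and p_adjoint: "H (p a v) w = H v (p' a w)"
    and c_antisym: "c a b k = - c b a k"
    and jacobi: "a < length fs \<Longrightarrow> b < length fs \<Longrightarrow> d < length fs \<Longrightarrow> m < length fs \<Longrightarrow>
      (\<Sum>k<length fs. c a b k * c k d m + c b d k * c k a m + c d a k * c k b m) = 0"
    and p_bracket: "a < length fs \<Longrightarrow> b < length fs \<Longrightarrow>
      p a (p b v) - p b (p a v) = (\<Sum>k<length fs. s (c a b k) (p k v))"
begin

abbreviation scl (infixr "*f" 75) where "scl \<equiv> fun_scale s"

abbreviation N where "N \<equiv> {..<length fs}"
abbreviation E where "E a \<equiv> e (fs ! a)"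
abbreviation I where "I a \<equiv> i (fs ! a)"
abbreviation P where "P a \<equiv> vmap (p a)"
abbreviation P' where "P' a \<equiv> vmap (p' a)"

lemmas P_simps = linearD[OF linear_vmap[OF linear_p]] linearD[OF linear_vmap[OF linear_p']]

lemma E_P: "P b (E a \<Phi>) = E a (P b \<Phi>)"
  by (rule e_vmap[OF linear_p, symmetric])

lemma I_E: "k \<in> N \<Longrightarrow> a \<in> N \<Longrightarrow> I k (E a \<Phi>) = (if a = k then \<Phi> else 0) - E a (I k \<Phi>)"
  using orthonormal_fs unfolding U.orthonormal_def by (simp add: contract_e)

text \<open>The Chevalley-Eilenberg differential. The factor 1/2 is the 1/4 of \<open>C_op\<close>
  times the 2 in \<open>cliff_opp\<close>, and the contraction stands to the left of the creation
  operators as in the Clifford product.\<close>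

definition d :: "((complex ^ 'n) list \<Rightarrow> 'v) \<Rightarrow> (complex ^ 'n) list \<Rightarrow> 'v" where
  "d \<Phi> = (\<Sum>a\<in>N. E a (P a \<Phi>)) - (1/2) *f (\<Sum>a\<in>N. \<Sum>b\<in>N. \<Sum>k\<in>N. c a b k *f I k (E a (E b \<Phi>)))"

text \<open>Term by term the formal adjoint: creation and contraction trade places, the order of the
  factors is reversed and the constants are conjugated.\<close>

definition d_adj :: "((complex ^ 'n) list \<Rightarrow> 'v) \<Rightarrow> (complex ^ 'n) list \<Rightarrow> 'v" where
  "d_adj \<Phi> = (\<Sum>a\<in>N. P' a (I a \<Phi>)) - (1/2) *f (\<Sum>a\<in>N. \<Sum>b\<in>N. \<Sum>k\<in>N. cnj (c a b k) *f I b (I a (E k \<Phi>)))"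

text \<open>Exterior multiplication by the differential of the \<open>m\<close>-th frame vector,
  viewed as a one-form; by \<open>d_E\<close> it is the anticommutator of \<open>d\<close> with
  \<open>E m\<close>.\<close>

definition \<delta> :: "nat \<Rightarrow> ((complex ^ 'n) list \<Rightarrow> 'v) \<Rightarrow> (complex ^ 'n) list \<Rightarrow> 'v" where
  "\<delta> m \<Phi> = (- 1/2) *f (\<Sum>a\<in>N. \<Sum>b\<in>N. c a b m *f E a (E b \<Phi>))"

lemma linear_d: "Vector_Spaces.linear (fun_scale s) (fun_scale s) d"
  unfolding Vector_Spaces.linear_iff d_def
  by (auto simp: FS.vector_space_axioms P_simps sum.distrib FS.scale_right_distrib
      FS.scale_right_diff_distrib FS.scale_sum_right FS.scale_left_commute mult.commute)

lemma linear_d_adj: "Vector_Spaces.linear (fun_scale s) (fun_scale s) d_adj"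
  unfolding Vector_Spaces.linear_iff d_adj_def
  by (auto simp: FS.vector_space_axioms P_simps sum.distrib FS.scale_right_distrib
      FS.scale_right_diff_distrib FS.scale_sum_right FS.scale_left_commute mult.commute)

lemma linear_\<delta>: "Vector_Spaces.linear (fun_scale s) (fun_scale s) (\<delta> m)"
  unfolding Vector_Spaces.linear_iff \<delta>_def
  by (auto simp: FS.vector_space_axioms P_simps sum.distrib FS.scale_right_distrib
      FS.scale_right_diff_distrib FS.scale_sum_right FS.scale_left_commute mult.commute)

lemmas d_simps = linearD[OF linear_d]
lemmas \<delta>_simps = linearD[OF linear_\<delta>]

lemma E_swap: "E a (E b (E m \<Phi>)) = E m (E a (E b \<Phi>))"
  using e_anticommute[of "fs ! b" "fs ! m" \<Phi>] e_anticommute[of "fs ! a" "fs ! m" "E b \<Phi>"] by simp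

lemma d_E:
  assumes "m \<in> N"
  shows "d (E m \<Phi>) = \<delta> m \<Phi> - E m (d \<Phi>)"
proof -
  have 1: "(\<Sum>a\<in>N. E a (P a (E m \<Phi>))) = - E m (\<Sum>a\<in>N. E a (P a \<Phi>))"
    unfolding e_sum sum_negf[symmetric]
    by (intro sum.cong refl) (simp add: E_P e_anticommute[of _ "fs ! m"])
  have "(\<Sum>a\<in>N. \<Sum>b\<in>N. \<Sum>k\<in>N. c a b k *f I k (E a (E b (E m \<Phi>)))) =
     (\<Sum>a\<in>N. \<Sum>b\<in>N. \<Sum>k\<in>N. (if m = k then c a b k *f E a (E b \<Phi>) else 0) - E m (c a b k *f I k (E a (E b \<Phi>))))"
    by (intro sum.cong refl) (simp add: E_swap[of _ _ m] I_E[OF _ assms] FS.scale_right_diff_distrib)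
  also have "\<dots> = (\<Sum>a\<in>N. \<Sum>b\<in>N. c a b m *f E a (E b \<Phi>)) - E m (\<Sum>a\<in>N. \<Sum>b\<in>N. \<Sum>k\<in>N. c a b k *f I k (E a (E b \<Phi>)))"
    unfolding sum_subtractf e_sum using assms by (simp add: sum.delta)
  finally show ?thesis
    unfolding d_def 1 \<delta>_def by (simp add: FS.scale_right_diff_distrib)
qed

lemma \<delta>_E: "\<delta> m (E a \<Phi>) = E a (\<delta> m \<Phi>)"
  unfolding \<delta>_def by (simp add: E_swap[of _ _ a] e_sum)

text \<open>A product of three creation operators is unchanged by cyclic rotation, so the triple sum
  \<open>Y\<close> equals each of its cyclic shifts. The three shifted coefficients add up to a
  Jacobi expression, whence three times \<open>Y\<close> is 0.\<close>

lemma jacobi_e: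
  assumes m: "m \<in> N"
  shows "(\<Sum>a\<in>N. \<Sum>b\<in>N. c a b m *f E b (\<delta> a \<Phi>)) = 0"
proof -
  define J where "J b q r = (\<Sum>a\<in>N. c a b m * c q r a)" for b q r
  define Y where "Y = (\<Sum>b\<in>N. \<Sum>q\<in>N. \<Sum>r\<in>N. J b q r *f E b (E q (E r \<Phi>)))"
  have cyc: "E q (E r (E b \<Phi>)) = E b (E q (E r \<Phi>))" for b q r by (rule E_swap)
  have Y1: "Y = (\<Sum>b\<in>N. \<Sum>q\<in>N. \<Sum>r\<in>N. J q r b *f E b (E q (E r \<Phi>)))"
    unfolding Y_def by (subst sum_cyclic) (simp only: cyc)
  have Y2: "Y = (\<Sum>b\<in>N. \<Sum>q\<in>N. \<Sum>r\<in>N. J r b q *f E b (E q (E r \<Phi>)))"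
    unfolding Y1 by (subst sum_cyclic) (simp only: cyc)
  have "Y + (Y + Y) = (\<Sum>b\<in>N. \<Sum>q\<in>N. \<Sum>r\<in>N. (J b q r + (J q r b + J r b q)) *f E b (E q (E r \<Phi>)))"
    by (subst (1) Y_def, subst (1) Y1, subst Y2) (simp add: sum.distrib FS.scale_left_distrib)
  also have "\<dots> = 0"
  proof (intro sum.neutral ballI)
    fix b q r assume bqr: "b \<in> N" "q \<in> N" "r \<in> N"
    have "J b q r + (J q r b + J r b q) = (\<Sum>k\<in>N. c q r k * c k b m + c r b k * c k q m + c b q k * c k r m)"
      unfolding J_def by (simp add: sum.distrib mult.commute)
    also have "\<dots> = 0" using jacobi[of q r b m] bqr m by simp
    finally show "(J b q r + (J q r b + J r b q)) *f E b (E q (E r \<Phi>)) = 0" by simp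
  qed
  finally have "Y = 0"
    using FS.scale_left_distrib[of 1 "1 + 1" Y] FS.scale_left_distrib[of 1 1 Y] FS.scale_eq_0_iff[of 3 Y] by simp
  have "(\<Sum>a\<in>N. \<Sum>b\<in>N. c a b m *f E b (\<delta> a \<Phi>)) =
      (- 1/2) *f (\<Sum>a\<in>N. \<Sum>b\<in>N. \<Sum>q\<in>N. \<Sum>r\<in>N. (c a b m * c q r a) *f E b (E q (E r \<Phi>)))"
    unfolding \<delta>_def by (simp add: e_sum FS.scale_sum_right FS.scale_left_commute mult_ac)
  also have "(\<Sum>a\<in>N. \<Sum>b\<in>N. \<Sum>q\<in>N. \<Sum>r\<in>N. (c a b m * c q r a) *f E b (E q (E r \<Phi>))) = Y"
  proof -
    have "(\<Sum>a\<in>N. \<Sum>b\<in>N. \<Sum>q\<in>N. \<Sum>r\<in>N. (c a b m * c q r a) *f E b (E q (E r \<Phi>))) =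
       (\<Sum>b\<in>N. \<Sum>a\<in>N. \<Sum>q\<in>N. \<Sum>r\<in>N. (c a b m * c q r a) *f E b (E q (E r \<Phi>)))" by (rule sum.swap)
    also have "\<dots> = (\<Sum>b\<in>N. \<Sum>q\<in>N. \<Sum>a\<in>N. \<Sum>r\<in>N. (c a b m * c q r a) *f E b (E q (E r \<Phi>)))"
      by (intro sum.cong refl sum.swap)
    also have "\<dots> = (\<Sum>b\<in>N. \<Sum>q\<in>N. \<Sum>r\<in>N. \<Sum>a\<in>N. (c a b m * c q r a) *f E b (E q (E r \<Phi>)))"
      by (intro sum.cong refl sum.swap)
    finally show ?thesis unfolding Y_def J_def by (simp add: FS.scale_sum_left)
  qed
  finally show ?thesis using \<open>Y = 0\<close> by simp
qed

lemma d_\<delta>: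
  assumes "m \<in> N"
  shows "d (\<delta> m \<Phi>) = \<delta> m (d \<Phi>)"
proof -
  have dEE: "d (E a (E b \<Phi>)) = E b (\<delta> a \<Phi>) - E a (\<delta> b \<Phi>) + E a (E b (d \<Phi>))" if "a \<in> N" "b \<in> N" for a b
    using that by (simp add: d_E \<delta>_E)
  have sw: "(\<Sum>a\<in>N. \<Sum>b\<in>N. c a b m *f E a (\<delta> b \<Phi>)) = - (\<Sum>a\<in>N. \<Sum>b\<in>N. c a b m *f E b (\<delta> a \<Phi>))"
    unfolding sum_negf[symmetric]
    by (subst sum.swap) (intro sum.cong refl, subst c_antisym, simp)
  have "d (\<delta> m \<Phi>) = (- 1/2) *f (\<Sum>a\<in>N. \<Sum>b\<in>N. c a b m *f d (E a (E b \<Phi>)))"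
    unfolding \<delta>_def by (simp add: d_simps)
  also have "(\<Sum>a\<in>N. \<Sum>b\<in>N. c a b m *f d (E a (E b \<Phi>))) =
     (\<Sum>a\<in>N. \<Sum>b\<in>N. c a b m *f E b (\<delta> a \<Phi>)) - (\<Sum>a\<in>N. \<Sum>b\<in>N. c a b m *f E a (\<delta> b \<Phi>)) +
     (\<Sum>a\<in>N. \<Sum>b\<in>N. c a b m *f E a (E b (d \<Phi>)))"
    by (simp add: dEE FS.scale_right_distrib FS.scale_right_diff_distrib sum.distrib sum_subtractf)
  also have "\<dots> = (\<Sum>a\<in>N. \<Sum>b\<in>N. c a b m *f E a (E b (d \<Phi>)))"
    unfolding sw jacobi_e[OF assms] by simp
  finally show ?thesis unfolding \<delta>_def .
qed

text \<open>The two \<open>\<delta>\<close> terms cancel, so \<open>d\<close> applied twice commutes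
  with creation and is determined by its values on the vacuum.\<close>

lemma d_d_E:
  assumes "m \<in> N"
  shows "d (d (E m \<Phi>)) = E m (d (d \<Phi>))"
  by (simp add: d_E[OF assms] d_simps d_\<delta>[OF assms])

text \<open>Up to sign the trace of the adjoint action of the \<open>b\<close>-th basis element. It
  arises because the contractions in \<open>d\<close> stand to the left of the creation
  operators.\<close>

definition \<tau> :: "nat \<Rightarrow> complex" where "\<tau> b = (\<Sum>a\<in>N. c a b a)"

text \<open>The trace of a commutator vanishes: set the third lower index of the Jacobi identity
  equal to the upper one and sum; two of the terms cancel after renaming.\<close>

lemma \<tau>_bracket:
  assumes "a \<in> N" "b \<in> N"
  shows "(\<Sum>k\<in>N. c a b k * \<tau> k) = 0"
proof -
  have "0 = (\<Sum>m\<in>N. \<Sum>k\<in>N. c a b k * c k m m + c b m k * c k a m + c m a k * c k b m)"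
    using jacobi[of a b] assms by simp
  also have "\<dots> = (\<Sum>m\<in>N. \<Sum>k\<in>N. c a b k * c k m m) + (\<Sum>m\<in>N. \<Sum>k\<in>N. c b m k * c k a m)
      + (\<Sum>m\<in>N. \<Sum>k\<in>N. c m a k * c k b m)"
    by (simp add: sum.distrib)
  also have "(\<Sum>m\<in>N. \<Sum>k\<in>N. c m a k * c k b m) = - (\<Sum>m\<in>N. \<Sum>k\<in>N. c b m k * c k a m)"
    unfolding sum_negf[symmetric]
    by (subst sum.swap, intro sum.cong refl, subst (2) c_antisym) simp
  also have "(\<Sum>m\<in>N. \<Sum>k\<in>N. c a b k * c k m m) = - (\<Sum>k\<in>N. c a b k * \<tau> k)"
    unfolding \<tau>_def sum_distrib_left sum_negf[symmetric]
    by (subst sum.swap, intro sum.cong refl, subst (2) c_antisym) simp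
  finally show ?thesis by simp
qed

lemma d_vac:
  assumes "\<Phi> \<in> vac"
  shows "d \<Phi> = (\<Sum>b\<in>N. E b (P b \<Phi> - \<tau> b *f \<Phi>))"
proof -
  have "c a b k *f I k (E a (E b \<Phi>)) = (if a = k then c a b k *f E b \<Phi> else 0) - (if b = k then c a b k *f E a \<Phi> else 0)"
    if "a \<in> N" "b \<in> N" "k \<in> N" for a b k
    using that by (simp add: I_E contract_vac[OF assms] FS.scale_right_diff_distrib)
  then have "(\<Sum>a\<in>N. \<Sum>b\<in>N. \<Sum>k\<in>N. c a b k *f I k (E a (E b \<Phi>))) =
     (\<Sum>a\<in>N. \<Sum>b\<in>N. \<Sum>k\<in>N. (if a = k then c a b k *f E b \<Phi> else 0) - (if b = k then c a b k *f E a \<Phi> else 0))"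
    by (intro sum.cong refl) auto
  also have "\<dots> = (\<Sum>a\<in>N. \<Sum>b\<in>N. c a b a *f E b \<Phi>) - (\<Sum>a\<in>N. \<Sum>b\<in>N. c a b b *f E a \<Phi>)"
    by (simp add: sum_subtractf)
  also have "(\<Sum>a\<in>N. \<Sum>b\<in>N. c a b a *f E b \<Phi>) = (\<Sum>b\<in>N. \<tau> b *f E b \<Phi>)"
    by (subst sum.swap) (simp add: \<tau>_def FS.scale_sum_left)
  also have "(\<Sum>a\<in>N. \<Sum>b\<in>N. c a b b *f E a \<Phi>) = - (\<Sum>b\<in>N. \<tau> b *f E b \<Phi>)"
    unfolding \<tau>_def FS.scale_sum_left sum_negf[symmetric]
    by (intro sum.cong refl, subst c_antisym) simp
  finally have "(1/2) *f (\<Sum>a\<in>N. \<Sum>b\<in>N. \<Sum>k\<in>N. c a b k *f I k (E a (E b \<Phi>))) = (\<Sum>b\<in>N. \<tau> b *f E b \<Phi>)"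
    by (simp add: FS.scale_right_distrib flip: FS.scale_left_distrib)
  then show ?thesis by (simp add: d_def sum_subtractf)
qed

text \<open>On the vacuum \<open>d\<close> is built from the action \<open>P\<close> shifted by the
  character \<open>\<tau>\<close>. Commutators of the shifted operators \<open>Q\<close> give back
  \<open>P\<close>, the \<open>\<delta>\<close> terms contain \<open>Q\<close>, and the discrepancy
  is \<open>\<tau>\<close> evaluated on brackets.\<close>

lemma d_d_vac:
  assumes vac: "\<Phi> \<in> vac"
  shows "d (d \<Phi>) = 0"
proof -
  define Q where "Q b \<Psi> = P b \<Psi> - \<tau> b *f \<Psi>" for b and \<Psi> :: "(complex ^ 'n) list \<Rightarrow> 'v"
  have Qvac: "Q b \<Phi> \<in> vac" for b
    unfolding Q_def
    by (intro FS.subspace_diff FS.subspace_scale subspace_vac vmap_vac linear_p vac)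
  have "d (d \<Phi>) = (\<Sum>b\<in>N. d (E b (Q b \<Phi>)))"
    unfolding d_vac[OF vac] Q_def d_simps(6) ..
  also have "\<dots> = (\<Sum>b\<in>N. \<delta> b (Q b \<Phi>)) - (\<Sum>b\<in>N. E b (d (Q b \<Phi>)))"
    by (simp add: d_E sum_subtractf)
  also have "(\<Sum>b\<in>N. E b (d (Q b \<Phi>))) = (\<Sum>b\<in>N. \<Sum>a\<in>N. E b (E a (Q a (Q b \<Phi>))))"
    unfolding d_vac[OF Qvac] Q_def[symmetric] e_sum ..
  also have "\<dots> = (- 1/2) *f (\<Sum>a\<in>N. \<Sum>b\<in>N. \<Sum>k\<in>N. c a b k *f E a (E b (P k \<Phi>)))" (is "?Z = _")
  proof -
    have com: "Q a (Q b \<Phi>) - Q b (Q a \<Phi>) = (\<Sum>k\<in>N. c a b k *f P k \<Phi>)" if "a \<in> N" "b \<in> N" for a b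
    proof -
      have "P a (P b \<Phi>) - P b (P a \<Phi>) = (\<Sum>k\<in>N. c a b k *f P k \<Phi>)"
      proof
        fix as
        have "(\<Sum>k\<in>N. c a b k *f P k \<Phi>) as = (\<Sum>k\<in>N. s (c a b k) (p k (\<Phi> as)))"
          by (simp add: fun_sum_apply fun_scale_apply vmap_def)
        then show "(P a (P b \<Phi>) - P b (P a \<Phi>)) as = (\<Sum>k\<in>N. c a b k *f P k \<Phi>) as"
          using p_bracket[of a b] that by (simp add: fun_apply vmap_def)
      qed
      moreover have "Q a (Q b \<Phi>) - Q b (Q a \<Phi>) = P a (P b \<Phi>) - P b (P a \<Phi>)"
        unfolding Q_def by (simp add: P_simps FS.scale_right_diff_distrib mult.commute)
      ultimately show ?thesis by simp
    qed
    \<comment> \<open>Adding the sum with \<open>a\<close> and \<open>b\<close> exchanged turns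
      products of the operators \<open>Q\<close> into commutators, since the creation operators
      anticommute.\<close>
    have "?Z + ?Z = (\<Sum>b\<in>N. \<Sum>a\<in>N. E b (E a (Q a (Q b \<Phi>)))) + (\<Sum>b\<in>N. \<Sum>a\<in>N. E a (E b (Q b (Q a \<Phi>))))"
      by (subst (2) sum.swap) simp
    also have "\<dots> = (\<Sum>b\<in>N. \<Sum>a\<in>N. - E a (E b (Q a (Q b \<Phi>) - Q b (Q a \<Phi>))))"
      unfolding sum.distrib[symmetric]
      by (intro sum.cong refl) (subst e_anticommute, simp)
    also have "\<dots> = - (\<Sum>a\<in>N. \<Sum>b\<in>N. \<Sum>k\<in>N. c a b k *f E a (E b (P k \<Phi>)))"
      unfolding sum_negf by (subst sum.swap) (simp add: com e_sum)
    finally have "(1/2) *f (?Z + ?Z) = (1/2) *f - (\<Sum>a\<in>N. \<Sum>b\<in>N. \<Sum>k\<in>N. c a b k *f E a (E b (P k \<Phi>)))"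
      by simp
    then show ?thesis by (simp add: FS.scale_right_distrib flip: FS.scale_left_distrib)
  qed
  also have "(\<Sum>b\<in>N. \<delta> b (Q b \<Phi>)) = (- 1/2) *f (\<Sum>a\<in>N. \<Sum>b\<in>N. \<Sum>k\<in>N. c a b k *f E a (E b (Q k \<Phi>)))"
  proof -
    have "(\<Sum>k\<in>N. \<delta> k (Q k \<Phi>)) = (- 1/2) *f (\<Sum>k\<in>N. \<Sum>a\<in>N. \<Sum>b\<in>N. c a b k *f E a (E b (Q k \<Phi>)))"
      unfolding \<delta>_def FS.scale_sum_right ..
    also have "(\<Sum>k\<in>N. \<Sum>a\<in>N. \<Sum>b\<in>N. c a b k *f E a (E b (Q k \<Phi>))) =
        (\<Sum>a\<in>N. \<Sum>b\<in>N. \<Sum>k\<in>N. c a b k *f E a (E b (Q k \<Phi>)))"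
      by (rule sum_cyclic[symmetric])
    finally show ?thesis .
  qed
  also have "(- 1/2) *f (\<Sum>a\<in>N. \<Sum>b\<in>N. \<Sum>k\<in>N. c a b k *f E a (E b (Q k \<Phi>))) -
     (- 1/2) *f (\<Sum>a\<in>N. \<Sum>b\<in>N. \<Sum>k\<in>N. c a b k *f E a (E b (P k \<Phi>))) =
     (1/2) *f (\<Sum>a\<in>N. \<Sum>b\<in>N. (\<Sum>k\<in>N. c a b k * \<tau> k) *f E a (E b \<Phi>))"
    unfolding FS.scale_right_diff_distrib[symmetric] sum_subtractf[symmetric] Q_def
    by (simp add: FS.scale_right_diff_distrib sum_negf FS.scale_sum_left)
  also have "\<dots> = 0"
    using \<tau>_bracket by simp
  finally show ?thesis .
qed

lemma d_d:
  assumes "\<Phi> \<in> fock vac fs"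
  shows "d (d \<Phi>) = 0"
proof -
  have "d (d \<Phi>) = 0" if "\<Phi> \<in> fock vac gs" "set gs \<subseteq> set fs" for gs \<Phi>
    using that
  proof (induction gs arbitrary: \<Phi>)
    case (Cons a gs)
    obtain x y where xy: "\<Phi> = x + e a y" "x \<in> fock vac gs" "y \<in> fock vac gs" using Cons.prems by auto
    obtain m where "m \<in> N" "a = fs ! m" using Cons.prems(2) by (auto simp: in_set_conv_nth)
    then show ?case
      using Cons.IH[OF xy(2)] Cons.IH[OF xy(3)] Cons.prems(2) by (simp add: xy(1) d_simps d_d_E)
  qed (simp add: d_d_vac)
  then show ?thesis using assms by blast
qed

lemma fs_in_span: "a \<in> N \<Longrightarrow> fs ! a \<in> vec.span (set fs)"
  by (intro vec.span_base nth_mem) simp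

lemmas fock_E = fock_e[OF subspace_vac fs_in_span]
lemmas fock_P = fock_vmap[OF linear_p vmap_vac[OF linear_p]] fock_vmap[OF linear_p' vmap_vac[OF linear_p']]

lemma d_fock: "\<Phi> \<in> fock vac fs \<Longrightarrow> d \<Phi> \<in> fock vac fs"
  unfolding d_def
  by (intro FS.subspace_diff FS.subspace_scale FS.subspace_sum subspace_fock subspace_vac
      fock_vac_contract fock_E fock_P)

lemma d_adj_fock: "\<Phi> \<in> fock vac fs \<Longrightarrow> d_adj \<Phi> \<in> fock vac fs"
  unfolding d_adj_def
  by (intro FS.subspace_diff FS.subspace_scale FS.subspace_sum subspace_fock subspace_vac
      fock_vac_contract fock_E fock_P)

lemma form_E: "\<Psi> \<in> fock vac fs \<Longrightarrow> a \<in> N \<Longrightarrow> form fs (E a \<Phi>) \<Psi> = form fs \<Phi> (I a \<Psi>)"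
  using form_e[OF orthonormal_fs] by simp

lemma form_I:
  assumes "\<Phi> \<in> fock vac fs" "a \<in> N"
  shows "form fs (I a \<Phi>) \<Psi> = form fs \<Phi> (E a \<Psi>)"
  using form_E[OF assms, of \<Psi>] form_hermitian[of fs "I a \<Phi>" \<Psi>] form_hermitian[of fs \<Phi> "E a \<Psi>"] by simp

lemma form_d:
  assumes "\<Phi> \<in> fock vac fs" "\<Psi> \<in> fock vac fs"
  shows "form fs (d \<Phi>) \<Psi> = form fs \<Phi> (d_adj \<Psi>)"
proof -
  interpret F: hermitian_space "fun_scale s" "form fs" "fock vac fs" by (rule hermitian_form[OF orthonormal_fs])
  have 1: "form fs (E a (P a \<Phi>)) \<Psi> = form fs \<Phi> (P' a (I a \<Psi>))" if "a \<in> N" for a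
    using form_E[OF assms(2) that] form_vmap[of "p a" "p' a", OF p_adjoint] by simp
  have 2: "form fs (I k (E a (E b \<Phi>))) \<Psi> = form fs \<Phi> (I b (I a (E k \<Psi>)))" if "a \<in> N" "b \<in> N" "k \<in> N" for a b k
  proof -
    have "form fs (I k (E a (E b \<Phi>))) \<Psi> = form fs (E a (E b \<Phi>)) (E k \<Psi>)"
      by (rule form_I[OF fock_E[OF that(1) fock_E[OF that(2) assms(1)]] that(3)])
    also have "\<dots> = form fs (E b \<Phi>) (I a (E k \<Psi>))"
      by (rule form_E[OF fock_E[OF that(3) assms(2)] that(1)])
    also have "\<dots> = form fs \<Phi> (I b (I a (E k \<Psi>)))"
      by (rule form_E[OF fock_vac_contract[OF fock_E[OF that(3) assms(2)]] that(2)])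
    finally show ?thesis .
  qed
  show ?thesis
    unfolding d_def d_adj_def by (simp add: F.h_sum 1 2)
qed

end

section \<open>Splitting of the differential along an abelian ideal\<close>

context complex_space begin

lemma fock_map:
  assumes lin: "Vector_Spaces.linear (fun_scale s) (fun_scale s) T"
    and E: "FS.subspace E" "\<And>\<Phi>. \<Phi> \<in> E \<Longrightarrow> T \<Phi> \<in> E"
    and com: "(\<forall>a\<in>set fs. \<forall>\<Phi>. T (e a \<Phi>) = e a (T \<Phi>)) \<or> (\<forall>a\<in>set fs. \<forall>\<Phi>. T (e a \<Phi>) = - e a (T \<Phi>))"
    and \<Phi>: "\<Phi> \<in> fock E fs"
  shows "T \<Phi> \<in> fock E fs"
  using com \<Phi>
proof (induction fs arbitrary: \<Phi>)
  case Nil then show ?case using E by simp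
next
  case (Cons a fs)
  obtain x y where xy: "\<Phi> = x + e a y" "x \<in> fock E fs" "y \<in> fock E fs" using Cons.prems by auto
  have IH: "T x \<in> fock E fs" "T y \<in> fock E fs" "- T y \<in> fock E fs"
    using Cons xy FS.subspace_neg[OF subspace_fock[OF E(1)]] by auto
  have "T \<Phi> = T x + e a (T y) \<or> T \<Phi> = T x + e a (- T y)"
    using Cons.prems(1) by (auto simp: xy(1) linearD[OF lin])
  then show ?case using IH unfolding fock.simps by blast
qed

end

context cohomology_operator begin

text \<open>\<open>dP m\<close> is the linear part of \<open>d\<close> for the first
  \<open>m\<close> indices. \<open>A m b\<close> collects the action of the \<open>b\<close>-th
  basis element on the coefficients and on the first \<open>m\<close> exterior directions; the
  primed operators are the formal adjoints.\<close>

definition dP where "dP m \<Phi> = (\<Sum>a<m. E a (P a \<Phi>))"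
definition dP' where "dP' m \<Phi> = (\<Sum>a<m. P' a (I a \<Phi>))"
definition A where "A m b \<Phi> = P b \<Phi> - (\<Sum>a<m. \<Sum>k<m. c a b k *f I k (E a \<Phi>))"
definition A' where "A' m b \<Phi> = P' b \<Phi> - (\<Sum>a<m. \<Sum>k<m. cnj (c a b k) *f I a (E k \<Phi>))"

lemma linear_dP: "Vector_Spaces.linear (fun_scale s) (fun_scale s) (dP m)"
  and linear_dP': "Vector_Spaces.linear (fun_scale s) (fun_scale s) (dP' m)"
  and linear_A: "Vector_Spaces.linear (fun_scale s) (fun_scale s) (A m b)"
  and linear_A': "Vector_Spaces.linear (fun_scale s) (fun_scale s) (A' m b)"
  unfolding Vector_Spaces.linear_iff dP_def dP'_def A_def A'_def
  by (auto simp: FS.vector_space_axioms P_simps sum.distrib FS.scale_right_distrib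
      FS.scale_right_diff_distrib FS.scale_sum_right FS.scale_left_commute mult.commute)

text \<open>
  The vectors with index below \<open>m\<close> span an abelian ideal, the others a complementary subalgebra.
\<close>
lemma d_split:
  assumes m: "m \<le> length fs"
    and PP: "\<And>a b k. a < m \<Longrightarrow> b < m \<Longrightarrow> k < length fs \<Longrightarrow> c a b k = 0"
    and PQ: "\<And>a b k. a < m \<Longrightarrow> b < length fs \<Longrightarrow> k \<in> {m..<length fs} \<Longrightarrow> c a b k = 0"
    and QQ: "\<And>a b k. a \<in> {m..<length fs} \<Longrightarrow> b \<in> {m..<length fs} \<Longrightarrow> k < m \<Longrightarrow> c a b k = 0"
  defines "Q \<equiv> {m..<length fs}"
  shows "d \<Phi> = dP m \<Phi> + (\<Sum>b\<in>Q. A m b (E b \<Phi>)) - (1/2) *f (\<Sum>a\<in>Q. \<Sum>b\<in>Q. \<Sum>k\<in>Q. c a b k *f I k (E a (E b \<Phi>)))"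
    and "\<Phi> \<in> fock vac fs \<Longrightarrow> d_adj \<Phi> = dP' m \<Phi> + (\<Sum>b\<in>Q. I b (A' m b \<Phi>)) -
      (1/2) *f (\<Sum>a\<in>Q. \<Sum>b\<in>Q. \<Sum>k\<in>Q. cnj (c a b k) *f I b (I a (E k \<Phi>)))"
proof -
  have N: "N = {..<m} \<union> Q" "{..<m} \<inter> Q = {}" using m by (auto simp: Q_def)
  have split: "(\<Sum>a\<in>N. F a) = (\<Sum>a<m. F a) + (\<Sum>a\<in>Q. F a)" for F :: "nat \<Rightarrow> (complex ^ 'n) list \<Rightarrow> 'v"
    unfolding N(1) by (rule sum.union_disjoint) (use N(2) in \<open>auto simp: Q_def\<close>)
  have QP: "c a b k = 0" if "a \<in> Q" "b < m" "k \<in> Q" for a b k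
    using PQ[of b a k] c_antisym[of a b k] that m by (simp add: Q_def)
  \<comment> \<open>Of the eight index blocks, the vanishing conditions leave the two mixed ones
    with \<open>k < m\<close> and the one that lies entirely in \<open>Q\<close>.\<close>
  have triple: "(\<Sum>a\<in>N. \<Sum>b\<in>N. \<Sum>k\<in>N. F a b k) = (\<Sum>b\<in>Q. \<Sum>a<m. \<Sum>k<m. F a b k + F b a k)
      + (\<Sum>a\<in>Q. \<Sum>b\<in>Q. \<Sum>k\<in>Q. F a b k)"
    if F: "\<And>a b k. c a b k = 0 \<Longrightarrow> F a b k = 0" for F :: "nat \<Rightarrow> nat \<Rightarrow> nat \<Rightarrow> (complex ^ 'n) list \<Rightarrow> 'v"
  proof -
    have z1: "(\<Sum>k\<in>N. F a b k) = 0" if "a < m" "b < m" for a b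
      using PP that by (intro sum.neutral ballI F) auto
    have z2: "(\<Sum>k\<in>N. F a b k) = (\<Sum>k<m. F a b k)" if "a < m" "b \<in> Q" for a b
      unfolding split using PQ that by (simp add: F Q_def)
    have z3: "(\<Sum>k\<in>N. F a b k) = (\<Sum>k<m. F a b k)" if "a \<in> Q" "b < m" for a b
      unfolding split using QP that by (simp add: F)
    have z4: "(\<Sum>k\<in>N. F a b k) = (\<Sum>k\<in>Q. F a b k)" if "a \<in> Q" "b \<in> Q" for a b
      unfolding split using QQ that by (simp add: F Q_def)
    have "(\<Sum>a\<in>N. \<Sum>b\<in>N. \<Sum>k\<in>N. F a b k) = (\<Sum>a<m. \<Sum>b\<in>Q. \<Sum>k<m. F a b k) + ((\<Sum>a\<in>Q. \<Sum>b<m. \<Sum>k<m. F a b k)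
      + (\<Sum>a\<in>Q. \<Sum>b\<in>Q. \<Sum>k\<in>Q. F a b k))"
    proof -
      have 1: "(\<Sum>b\<in>N. \<Sum>k\<in>N. F a b k) = (\<Sum>b\<in>Q. \<Sum>k<m. F a b k)" if "a < m" for a
        using that by (subst split) (simp add: z1 z2)
      have 2: "(\<Sum>b\<in>N. \<Sum>k\<in>N. F a b k) = (\<Sum>b<m. \<Sum>k<m. F a b k) + (\<Sum>b\<in>Q. \<Sum>k\<in>Q. F a b k)" if "a \<in> Q" for a
        using that by (subst split) (simp add: z3 z4)
      show ?thesis by (subst split) (simp add: 1 2 sum.distrib)
    qed
    also have "(\<Sum>a<m. \<Sum>b\<in>Q. \<Sum>k<m. F a b k) = (\<Sum>b\<in>Q. \<Sum>a<m. \<Sum>k<m. F a b k)" by (rule sum.swap)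
    finally show ?thesis by (simp add: sum.distrib)
  qed
  have half: "(1/2) *f (x + x + y) = x + (1/2) *f y" for x y
    by (simp add: FS.scale_right_distrib flip: FS.scale_left_distrib)
  \<comment> \<open>The two mixed blocks agree, since the constants and the creation operators both
    change sign under exchange; together they absorb the factor 1/2.\<close>
  have "(\<Sum>b\<in>Q. \<Sum>a<m. \<Sum>k<m. c a b k *f I k (E a (E b \<Phi>)) + c b a k *f I k (E b (E a \<Phi>))) =
    (\<Sum>b\<in>Q. \<Sum>a<m. \<Sum>k<m. c a b k *f I k (E a (E b \<Phi>))) + (\<Sum>b\<in>Q. \<Sum>a<m. \<Sum>k<m. c a b k *f I k (E a (E b \<Phi>)))"
    unfolding sum.distrib[symmetric]
    by (intro sum.cong refl, subst c_antisym, subst (2) e_anticommute) simp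
  then show "d \<Phi> = dP m \<Phi> + (\<Sum>b\<in>Q. A m b (E b \<Phi>)) - (1/2) *f (\<Sum>a\<in>Q. \<Sum>b\<in>Q. \<Sum>k\<in>Q. c a b k *f I k (E a (E b \<Phi>)))"
    unfolding d_def dP_def A_def
    by (subst triple, simp) (simp add: split sum_subtractf E_P half)
  assume \<Phi>: "\<Phi> \<in> fock vac fs"
  have "(\<Sum>b\<in>Q. \<Sum>a<m. \<Sum>k<m. cnj (c a b k) *f I b (I a (E k \<Phi>)) + cnj (c b a k) *f I a (I b (E k \<Phi>))) =
    (\<Sum>b\<in>Q. \<Sum>a<m. \<Sum>k<m. cnj (c a b k) *f I b (I a (E k \<Phi>))) + (\<Sum>b\<in>Q. \<Sum>a<m. \<Sum>k<m. cnj (c a b k) *f I b (I a (E k \<Phi>)))"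
    unfolding sum.distrib[symmetric]
  proof (intro sum.cong refl)
    fix b a k assume "b \<in> Q" "a \<in> {..<m}" "k \<in> {..<m}"
    then have "E k \<Phi> \<in> fock vac fs" using m by (intro fock_E \<Phi>) auto
    \<comment> \<open>Unlike creation operators, contractions are known to anticommute only on the
      Fock space.\<close>
    then have "I a (I b (E k \<Phi>)) = - I b (I a (E k \<Phi>))" by (rule contract_anticommute)
    then show "cnj (c a b k) *f I b (I a (E k \<Phi>)) + cnj (c b a k) *f I a (I b (E k \<Phi>)) =
      cnj (c a b k) *f I b (I a (E k \<Phi>)) + cnj (c a b k) *f I b (I a (E k \<Phi>))"
      by (subst (2) c_antisym) simp
  qed
  then show "d_adj \<Phi> = dP' m \<Phi> + (\<Sum>b\<in>Q. I b (A' m b \<Phi>)) -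
      (1/2) *f (\<Sum>a\<in>Q. \<Sum>b\<in>Q. \<Sum>k\<in>Q. cnj (c a b k) *f I b (I a (E k \<Phi>)))"
    unfolding d_adj_def dP'_def A'_def
    by (subst triple, simp) (simp add: split sum_subtractf contract_vmap contract_sum half)
qed

text \<open>Each operator in the split form of \<open>d\<close> is either creation or contraction
  along \<open>fQ\<close>, which preserves the upper layer, or commutes up to sign with creation
  along \<open>fQ\<close> and so is controlled by its action on the bottom \<open>X\<close>.\<close>

lemma fock_stable:
  assumes fs: "fs = fP @ fQ" and m: "m = length fP"
    and PP: "\<And>a b k. a < m \<Longrightarrow> b < m \<Longrightarrow> k < length fs \<Longrightarrow> c a b k = 0"
    and PQ: "\<And>a b k. a < m \<Longrightarrow> b < length fs \<Longrightarrow> k \<in> {m..<length fs} \<Longrightarrow> c a b k = 0"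
    and QQ: "\<And>a b k. a \<in> {m..<length fs} \<Longrightarrow> b \<in> {m..<length fs} \<Longrightarrow> k < m \<Longrightarrow> c a b k = 0"
    and X: "FS.subspace X" "X \<subseteq> fock vac fP"
    and dPX: "\<And>\<Phi>. \<Phi> \<in> X \<Longrightarrow> dP m \<Phi> \<in> X" "\<And>\<Phi>. \<Phi> \<in> X \<Longrightarrow> dP' m \<Phi> \<in> X"
    and AX: "\<And>b \<Phi>. b \<in> {m..<length fs} \<Longrightarrow> \<Phi> \<in> X \<Longrightarrow> A m b \<Phi> \<in> X"
      "\<And>b \<Phi>. b \<in> {m..<length fs} \<Longrightarrow> \<Phi> \<in> X \<Longrightarrow> A' m b \<Phi> \<in> X"
    and \<Phi>: "\<Phi> \<in> fock X fQ"
  shows "d \<Phi> \<in> fock X fQ" "d_adj \<Phi> \<in> fock X fQ"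
proof -
  let ?Q = "{m..<length fs}"
  have mfs: "m \<le> length fs" using fs m by simp
  have inQ: "\<exists>q\<in>?Q. a = fs ! q" if a: "a \<in> set fQ" for a
  proof -
    obtain j where "j < length fQ" "a = fQ ! j" using a by (auto simp: in_set_conv_nth)
    then have "m + j \<in> ?Q" "a = fs ! (m + j)" using fs m by (auto simp: nth_append)
    then show ?thesis by blast
  qed
  have Qin: "fs ! q \<in> vec.span (set fQ)" if "q \<in> ?Q" for q
    using that fs m by (intro vec.span_base) (auto simp: nth_append)
  have sub: "FS.subspace (fock X fQ)" by (rule subspace_fock[OF X(1)])
  have eQ: "E q \<Psi> \<in> fock X fQ" if "q \<in> ?Q" "\<Psi> \<in> fock X fQ" for q \<Psi>
    by (rule fock_e[OF X(1) Qin[OF that(1)] that(2)])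
  have iQ: "I q \<Psi> \<in> fock X fQ" if q: "q \<in> ?Q" and "\<Psi> \<in> fock X fQ" for q \<Psi>
  proof (rule fock_contract[OF X(1) _ that(2)])
    fix \<Xi> assume "\<Xi> \<in> X"
    have "I q \<Xi> = 0"
    proof (rule contract_fock_eq_0)
      show "\<Xi> \<in> fock vac fP" using \<open>\<Xi> \<in> X\<close> X by blast
      show "pairing (flat (fs ! q)) a = 0" if "a \<in> set fP" for a
      proof -
        obtain j where j: "j < m" "a = fs ! j" using \<open>a \<in> set fP\<close> fs m by (auto simp: in_set_conv_nth nth_append)
        then show ?thesis
          using orthonormal_fs[unfolded U.orthonormal_def, rule_format, of j q] q by auto
      qed
    qed
    then show "I q \<Xi> \<in> X" using FS.subspace_0[OF X(1)] by simp
  qed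
  have IEc: "I k (E q \<Psi>) = - E q (I k \<Psi>)" if "k < m" "q \<in> ?Q" for k q \<Psi>
    using I_E[of k q \<Psi>] that mfs by simp
  have c1: "dP m (E q \<Psi>) = - E q (dP m \<Psi>)" "dP' m (E q \<Psi>) = - E q (dP' m \<Psi>)"
    "A m b (E q \<Psi>) = E q (A m b \<Psi>)" "A' m b (E q \<Psi>) = E q (A' m b \<Psi>)" if q: "q \<in> ?Q" for q \<Psi> b
  proof -
    show "dP m (E q \<Psi>) = - E q (dP m \<Psi>)"
      unfolding dP_def e_sum sum_negf[symmetric]
      by (intro sum.cong refl) (simp add: E_P e_anticommute[of _ "fs ! q"])
    show "dP' m (E q \<Psi>) = - E q (dP' m \<Psi>)"
      unfolding dP'_def e_sum sum_negf[symmetric]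
      by (intro sum.cong refl) (simp add: IEc[OF _ q] P_simps e_vmap[OF linear_p'])
    show "A m b (E q \<Psi>) = E q (A m b \<Psi>)"
      unfolding A_def e_simps e_sum
      by (intro arg_cong2[where f = minus] sum.cong refl)
        (simp_all add: E_P e_anticommute[of _ "fs ! q"] IEc[OF _ q])
    show "A' m b (E q \<Psi>) = E q (A' m b \<Psi>)"
      unfolding A'_def e_simps e_sum
      by (intro arg_cong2[where f = minus] sum.cong refl)
        (simp_all add: e_vmap[OF linear_p'] e_anticommute[of _ "fs ! q"] IEc[OF _ q])
  qed
  have st: "dP m \<Psi> \<in> fock X fQ" "dP' m \<Psi> \<in> fock X fQ"
    "b \<in> ?Q \<Longrightarrow> A m b \<Psi> \<in> fock X fQ" "b \<in> ?Q \<Longrightarrow> A' m b \<Psi> \<in> fock X fQ" if "\<Psi> \<in> fock X fQ" for \<Psi> b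
  proof -
    have n1: "\<forall>a\<in>set fQ. \<forall>\<Phi>. dP m (e a \<Phi>) = - e a (dP m \<Phi>)" "\<forall>a\<in>set fQ. \<forall>\<Phi>. dP' m (e a \<Phi>) = - e a (dP' m \<Phi>)"
      "\<forall>a\<in>set fQ. \<forall>\<Phi>. A m b (e a \<Phi>) = e a (A m b \<Phi>)" "\<forall>a\<in>set fQ. \<forall>\<Phi>. A' m b (e a \<Phi>) = e a (A' m b \<Phi>)" for b
      using inQ c1 by metis+
    show "dP m \<Psi> \<in> fock X fQ" by (rule fock_map[OF linear_dP X(1) dPX(1) _ that]) (use n1 in auto)
    show "dP' m \<Psi> \<in> fock X fQ" by (rule fock_map[OF linear_dP' X(1) dPX(2) _ that]) (use n1 in auto)
    show "A m b \<Psi> \<in> fock X fQ" if b: "b \<in> ?Q"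
      by (rule fock_map[OF linear_A X(1) AX(1)[OF b] _ \<open>\<Psi> \<in> _\<close>]) (use n1 in auto)
    show "A' m b \<Psi> \<in> fock X fQ" if b: "b \<in> ?Q"
      by (rule fock_map[OF linear_A' X(1) AX(2)[OF b] _ \<open>\<Psi> \<in> _\<close>]) (use n1 in auto)
  qed
  note intros = FS.subspace_diff[OF sub] FS.subspace_add[OF sub] FS.subspace_scale[OF sub] FS.subspace_sum[OF sub]
  have "d \<Phi> = dP m \<Phi> + (\<Sum>b\<in>?Q. A m b (E b \<Phi>)) -
      (1/2) *f (\<Sum>a\<in>?Q. \<Sum>b\<in>?Q. \<Sum>k\<in>?Q. c a b k *f I k (E a (E b \<Phi>)))"
    by (rule d_split(1)[OF mfs PP PQ QQ])
  then show "d \<Phi> \<in> fock X fQ"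
    by (simp only:) (intro intros st eQ iQ \<Phi>; assumption)
  have vac: "\<Phi> \<in> fock vac fs"
  proof -
    have "fock X fQ \<subseteq> fock (fock vac fP) fQ" by (rule fock_mono[OF X(2)])
    also have "\<dots> = fock vac (fQ @ fP)" by (simp add: fock_append)
    \<comment> \<open>The two blocks are in the opposite order here, but only their common span
      matters.\<close>
    also have "\<dots> = fock vac fs" unfolding VS_space_eq_fock[symmetric] fs by (simp add: Un_commute)
    finally show ?thesis using \<Phi> by blast
  qed
  have "d_adj \<Phi> = dP' m \<Phi> + (\<Sum>b\<in>?Q. I b (A' m b \<Phi>)) -
      (1/2) *f (\<Sum>a\<in>?Q. \<Sum>b\<in>?Q. \<Sum>k\<in>?Q. cnj (c a b k) *f I b (I a (E k \<Phi>)))"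
    by (rule d_split(2)[OF mfs PP PQ QQ vac])
  then show "d_adj \<Phi> \<in> fock X fQ"
    by (simp only:) (intro intros st eQ iQ \<Phi>; assumption)
qed

end

section \<open>The group action on the coefficient module\<close>

text \<open>The transpose of \<open>M\<close> on covectors. Precomposing with it extends
  \<open>M\<close> multiplicatively to the exterior algebra, as \<open>precompose_wedge\<close>
  shows.\<close>

definition dual_map :: "(complex ^ 'n \<Rightarrow> complex ^ 'n) \<Rightarrow> complex ^ 'n \<Rightarrow> complex ^ 'n" where
  "dual_map M a = covector (\<lambda>x. pairing a (M x))"

lemma pairing_dual_map:
  assumes "Vector_Spaces.linear (*s) (*s) M"
  shows "pairing (dual_map M a) x = pairing a (M x)"
  unfolding dual_map_def
  by (rule pairing_covector)
    (simp add: Vector_Spaces.linear_iff vec.vector_space_axioms vector_space_complex linearD[OF assms])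

definition precompose :: "('a \<Rightarrow> 'b) \<Rightarrow> ('b list \<Rightarrow> 'v) \<Rightarrow> 'a list \<Rightarrow> 'v" where
  "precompose g \<Phi> = (\<lambda>as. \<Phi> (map g as))"

lemma precompose_wedge_mult:
  assumes "Vector_Spaces.linear (*s) (*s) M"
  shows "precompose (dual_map M) (wedge_mult s x \<Phi>) = wedge_mult s (M x) (precompose (dual_map M) \<Phi>)"
  by (auto simp: precompose_def wedge_mult_def pairing_dual_map[OF assms] delete_nth_def take_map drop_map
      intro!: sum.cong)

lemma precompose_wedge:
  assumes "Vector_Spaces.linear (*s) (*s) M"
  shows "precompose (dual_map M) (wedge Ys) = wedge (map M Ys)"
proof (induction Ys)
  case Nil then show ?case by (auto simp: precompose_def wedge_Nil)
qed (simp add: wedge_Cons precompose_wedge_mult[OF assms])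

lemma linear_span_image:
  assumes "Vector_Spaces.linear s t f" "f ` A \<subseteq> module.span t B" "x \<in> module.span s A"
  shows "f x \<in> module.span t B"
proof -
  interpret Vector_Spaces.linear s t f by fact
  have "f ` vs1.span A \<subseteq> vs2.span B"
    unfolding span_image[symmetric] by (rule vs2.span_minimal[OF assms(2)]) simp
  then show ?thesis using assms(3) by blast
qed

text \<open>Derivatives in \<open>V\<close> are observed only through linear functionals; this lemma
  turns such information back into membership in a subspace.\<close>

lemma (in vector_space) separating_functional:
  fixes Y :: "'b set"
  assumes "subspace Y" "y \<notin> Y"
  obtains F where "Vector_Spaces.linear scale (*) F" "\<And>x. x \<in> Y \<Longrightarrow> F x = 0" "F y \<noteq> 0"
proof -
  interpret K: vector_space "(*) :: 'a \<Rightarrow> 'a \<Rightarrow> 'a" by unfold_locales (auto simp: algebra_simps)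
  interpret VP: vector_space_pair scale "(*)" by unfold_locales
  obtain B where B: "B \<subseteq> Y" "independent B" "Y \<subseteq> span B" using maximal_independent_subset by blast
  have sB: "span B = Y" using B assms(1) by (simp add: span_minimal subset_antisym)
  have "y \<notin> span B" using sB assms(2) by simp
  then have ind: "independent (insert y B)" "y \<notin> B" using B(1,2) assms(2) by (auto simp: independent_insert)
  define F where "F = VP.construct (insert y B) (\<lambda>b. if b = y then 1 else 0)"
  have lin: "Vector_Spaces.linear scale (*) F" unfolding F_def by (rule VP.linear_construct[OF ind(1)])
  have "F x = 0" if "x \<in> Y" for x
  proof -
    have "x \<in> span B" using that sB by simp
    then show ?thesis
    proof (induction rule: span_induct_alt)
      case base then show ?case by (rule linearD(1)[OF lin])
    next
      case (step c b z)
      have "F b = 0"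
        unfolding F_def by (subst VP.construct_basis[OF ind(1)]) (use step(1) ind(2) in auto)
      then show ?case using step by (simp add: linearD[OF lin])
    qed
  qed
  moreover have "F y = 1" unfolding F_def by (subst VP.construct_basis[OF ind(1)]) simp_all
  ultimately show ?thesis using that[OF lin] by simp
qed

section \<open>Coordinates and the vector-valued pairing\<close>

context complex_space begin

definition vacs :: "'v set \<Rightarrow> ((complex ^ 'n) list \<Rightarrow> 'v) set" where
  "vacs X = (\<lambda>v. tensor s v (wedge [])) ` X"

lemma vac_eq_vacs: "vac = vacs UNIV"
  by (simp add: vac_def vacs_def)

lemma linear_tensor_left: "Vector_Spaces.linear s (fun_scale s) (\<lambda>v. tensor s v \<omega>)"
  unfolding Vector_Spaces.linear_iff
  by (simp add: tensor_add_left tensor_scale_left FS.vector_space_axioms vector_space_axioms)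

lemma subspace_vacs: "subspace X \<Longrightarrow> FS.subspace (vacs X)"
proof -
  interpret Vector_Spaces.linear s "fun_scale s" "\<lambda>v. tensor s v (wedge [])" by (rule linear_tensor_left)
  show "subspace X \<Longrightarrow> FS.subspace (vacs X)" unfolding vacs_def by (rule subspace_image)
qed

lemma fin_dim_vacs: "fin_dim s X \<Longrightarrow> fin_dim (fun_scale s) (vacs X)"
  unfolding vacs_def by (rule linear_image_fin_dim[OF linear_tensor_left])

end

context exterior_form begin

lemma e_orthogonal: "\<forall>b\<in>set bs. h a b = 0 \<Longrightarrow> e a \<Phi> (map flat bs) = 0"
  by (induction bs arbitrary: \<Phi>) (simp_all add: e_Nil e_Cons)

text \<open>The values on lists of frame covectors are the coefficients of \<open>\<Phi>\<close>.
  Contraction with \<open>a\<close> extracts the \<open>e a\<close> component, and on lists avoiding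
  \<open>a\<close> the other component has the same values as \<open>\<Phi>\<close>.\<close>

lemma fock_vacs_coordinates:
  assumes "U.orthonormal fs" "\<Phi> \<in> fock vac fs" "subspace X"
    and "\<And>J. set J \<subseteq> set fs \<Longrightarrow> \<Phi> (map flat J) \<in> X"
  shows "\<Phi> \<in> fock (vacs X) fs"
  using assms(1,2,4)
proof (induction fs arbitrary: \<Phi>)
  case Nil
  then obtain v where "\<Phi> = tensor s v (wedge [])" by (auto simp: vac_def)
  moreover have "v \<in> X" using Nil(3)[of "[]"] calculation by (simp add: tensor_def wedge_Nil)
  ultimately show ?case by (simp add: vacs_def)
next
  case (Cons a fs)
  have o: "distinct (a # fs)" "\<And>x y. x \<in> set (a # fs) \<Longrightarrow> y \<in> set (a # fs) \<Longrightarrow> h x y = (if x = y then 1 else 0)"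
    using U.orthonormalD[OF Cons.prems(1)] by blast+
  have on: "U.orthonormal fs"
    by (rule U.orthonormalI) (use o in auto)
  obtain x y where xy: "\<Phi> = x + e a y" "x \<in> fock vac fs" "y \<in> fock vac fs" using Cons.prems by auto
  have z: "i a \<Psi> = 0" if "\<Psi> \<in> fock vac fs" for \<Psi>
    by (rule contract_fock_eq_0[OF that]) (use o in auto)
  have y: "y = i a \<Phi>" using z[OF xy(2)] z[OF xy(3)] o(2)[of a a] by (simp add: xy(1) contract_e)
  have "x \<in> fock (vacs X) fs"
  proof (rule Cons.IH[OF on xy(2)])
    fix J assume J: "set J \<subseteq> set fs"
    have "e a y (map flat J) = 0" by (rule e_orthogonal) (use J o in auto)
    then have "\<Phi> (map flat J) = x (map flat J)" by (simp add: xy(1) fun_apply)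
    then show "x (map flat J) \<in> X" using Cons.prems(3)[of J] J by auto
  qed
  moreover have "y \<in> fock (vacs X) fs"
  proof (rule Cons.IH[OF on xy(3)])
    fix J assume J: "set J \<subseteq> set fs"
    show "y (map flat J) \<in> X" using Cons.prems(3)[of "a # J"] J by (simp add: y contract_apply) blast
  qed
  ultimately show ?case using xy(1) by auto
qed

lemma fin_dim_exterior_algebra:
  fixes fs :: "(complex ^ 'n) list"
  shows "fin_dim (fun_scale (*)) (exterior_algebra (vec.span (set fs)))"
proof -
  interpret S: exterior_form "(*)" "\<lambda>a b. a * cnj b" h by (rule scalar_exterior_form)
  have "fin_dim (*) (UNIV :: complex set)"
    unfolding fin_dim_def
  proof (intro exI[of _ "{1}"] conjI subsetI)
    fix x :: complex
    have "x * 1 \<in> module.span (*) {1}"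
      by (intro vector_space_over_itself.span_scale vector_space_over_itself.span_base) simp
    then show "x \<in> module.span (*) {1}" by simp
  qed simp
  then have "fin_dim (fun_scale (*)) (S.vac :: ((complex ^ 'n) list \<Rightarrow> complex) set)" unfolding S.vac_eq_vacs by (rule S.fin_dim_vacs)
  then have "fin_dim (fun_scale (*)) (S.fock S.vac fs)" by (rule S.fin_dim_fock[OF S.subspace_vac])
  moreover have "exterior_algebra (vec.span (set fs)) \<subseteq> S.fock S.vac fs"
  proof
    fix \<omega> assume "\<omega> \<in> exterior_algebra (vec.span (set fs))"
    then have "tensor (*) 1 \<omega> \<in> VS_space (*) (vec.span (set fs))"
      unfolding VS_space_def by (intro S.FS.span_base) blast
    then show "\<omega> \<in> S.fock S.vac fs" unfolding S.VS_space_eq_fock by (simp add: tensor_def)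
  qed
  ultimately show ?thesis using S.FS.fin_dim_mono by blast
qed

text \<open>\<open>trace_form fs (box \<Phi> \<omega>)\<close> is the \<open>V\<close>-valued pairing of \<open>\<Phi>\<close> with \<open>\<omega>\<close>.\<close>

primrec trace_form :: "(complex ^ 'n) list \<Rightarrow> ((complex ^ 'n) list \<Rightarrow> (complex ^ 'n) list \<Rightarrow> 'v) \<Rightarrow> 'v" where
  "trace_form [] X = X [] []"
| "trace_form (a # fs) X = trace_form fs X + trace_form fs (\<lambda>bs as. X (flat a # bs) (flat a # as))"

text \<open>The tensor of \<open>\<Phi>\<close> with the conjugate of \<open>\<omega>\<close>, as a
  function of two lists. Keeping the exterior factor as a separate argument gives a space on which
  \<open>K\<close> acts and which can be the source of maps into \<open>V\<close>.\<close>

definition box :: "((complex ^ 'n) list \<Rightarrow> 'v) \<Rightarrow> ((complex ^ 'n) list \<Rightarrow> complex) \<Rightarrow> (complex ^ 'n) list \<Rightarrow> (complex ^ 'n) list \<Rightarrow> 'v" where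
  "box \<Phi> \<omega> = (\<lambda>bs. fun_scale s (cnj (\<omega> bs)) \<Phi>)"

lemma box_simps:
  "box (\<Phi> + \<Psi>) \<omega> = box \<Phi> \<omega> + box \<Psi> \<omega>" "box (fun_scale s c \<Phi>) \<omega> = fun_scale (fun_scale s) c (box \<Phi> \<omega>)"
  "box \<Phi> (\<omega> + \<eta>) = box \<Phi> \<omega> + box \<Phi> \<eta>" "box \<Phi> (fun_scale (*) c \<omega>) = fun_scale (fun_scale s) (cnj c) (box \<Phi> \<omega>)"
  "box 0 \<omega> = 0" "box \<Phi> 0 = 0"
  by (simp_all add: box_def fun_eq_iff fun_apply fun_scale_apply scale_right_distrib scale_left_distrib mult.commute)

lemma H_trace_form_box: "H (trace_form fs (box \<Phi> \<omega>)) v = form fs \<Phi> (tensor s v \<omega>)"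
proof (induction fs arbitrary: \<Phi> \<omega>)
  case Nil show ?case by (simp add: box_def fun_scale_apply tensor_def)
next
  case (Cons a fs)
  have "(\<lambda>bs as. box \<Phi> \<omega> (flat a # bs) (flat a # as)) = box (i a \<Phi>) (contract (flat a) \<omega>)"
    by (simp add: box_def fun_scale_def contract_def)
  then show ?case by (simp add: Cons contract_tensor)
qed

lemma trace_form_simps:
  "trace_form fs (X + Y) = trace_form fs X + trace_form fs Y"
  "trace_form fs (fun_scale (fun_scale s) c X) = s c (trace_form fs X)"
proof -
  show "trace_form fs (X + Y) = trace_form fs X + trace_form fs Y"
  proof (induction fs arbitrary: X Y)
    case (Cons a fs)
    have "(\<lambda>bs as. (X + Y) (flat a # bs) (flat a # as)) =
      (\<lambda>bs as. X (flat a # bs) (flat a # as)) + (\<lambda>bs as. Y (flat a # bs) (flat a # as))"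
      by (simp add: fun_eq_iff fun_apply)
    then show ?case by (simp add: Cons)
  qed (simp add: fun_apply)
  show "trace_form fs (fun_scale (fun_scale s) c X) = s c (trace_form fs X)"
  proof (induction fs arbitrary: X)
    case (Cons a fs)
    have "(\<lambda>bs as. fun_scale (fun_scale s) c X (flat a # bs) (flat a # as)) =
      fun_scale (fun_scale s) c (\<lambda>bs as. X (flat a # bs) (flat a # as))"
      by (simp add: fun_eq_iff fun_scale_apply)
    then show ?case by (simp add: Cons scale_right_distrib)
  qed (simp add: fun_scale_apply)
qed

lemma H_eqI: "(\<And>w. H v w = H v' w) \<Longrightarrow> v = v'"
  using V.h_self_eq_0[of "v - v'"] by simp

lemma form_e_right:
  assumes "U.orthonormal fs" "a \<in> set fs" "\<Phi> \<in> fock vac gs"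
  shows "form fs \<Phi> (e a \<Psi>) = form fs (i a \<Phi>) \<Psi>"
  using form_e[OF assms, of \<Psi>] form_hermitian[of fs "i a \<Phi>" \<Psi>] form_hermitian[of fs \<Phi> "e a \<Psi>"] by simp

text \<open>Pairing with a basis wedge returns a coefficient: its factors are moved across the form
  one by one as contractions.\<close>

lemma trace_form_wedge:
  assumes "U.orthonormal fs" "\<Phi> \<in> fock vac fs" "set J \<subseteq> set fs"
  shows "trace_form fs (box \<Phi> (wedge J)) = \<Phi> (map flat J)"
  using assms(2,3)
proof (induction J arbitrary: \<Phi>)
  case Nil
  have t: "tensor s v (wedge []) \<in> vac" for v unfolding vac_def by blast
  have "form fs \<Phi> (tensor s v (wedge [])) = H (\<Phi> []) v" for v
  proof -
    have "form fs \<Phi> (tensor s v (wedge [])) = cnj (form fs (tensor s v (wedge [])) \<Phi>)"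
      by (rule form_hermitian)
    also have "form fs (tensor s v (wedge [])) \<Phi> = H v (\<Phi> [])"
      by (simp only: form_vac[OF t]) (simp add: tensor_def wedge_Nil)
    also have "cnj (H v (\<Phi> [])) = H (\<Phi> []) v" by (rule V.herm[symmetric])
    finally show ?thesis .
  qed
  then show ?case by (intro H_eqI) (simp add: H_trace_form_box)
next
  case (Cons b J)
  have "trace_form fs (box \<Phi> (wedge (b # J))) = trace_form fs (box (i b \<Phi>) (wedge J))"
    using Cons.prems form_e_right[OF assms(1) _ Cons.prems(1)]
    by (intro H_eqI) (simp add: H_trace_form_box wedge_Cons flip: wedge_mult_tensor)
  also have "\<dots> = i b \<Phi> (map flat J)"
    using Cons.prems(2) by (intro Cons.IH[OF fock_vac_contract[OF Cons.prems(1)]]) simp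
  finally show ?case by (simp only: contract_apply list.map)
qed

end

text \<open>Here \<open>fs\<close> stands for the frame of p+ and \<open>M\<close> for the adjoint
  action of \<open>K\<close>; stability and isometry of \<open>M\<close> are asked on the span of
  \<open>fs\<close> only.\<close>

locale twisted_rep = exterior_form s H h + R: admissible_rep s H K \<rho>
  for s :: "complex \<Rightarrow> 'v::ab_group_add \<Rightarrow> 'v" and H
    and h :: "complex ^ 'n \<Rightarrow> complex ^ 'n \<Rightarrow> complex" and K :: "'g set" and \<rho> +
  fixes fs :: "(complex ^ 'n) list" and M :: "'g \<Rightarrow> complex ^ 'n \<Rightarrow> complex ^ 'n"
  assumes orthonormal_fs: "U.orthonormal fs"
    and linear_M: "k \<in> K \<Longrightarrow> Vector_Spaces.linear (*s) (*s) (M k)"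
    and M_span: "k \<in> K \<Longrightarrow> x \<in> vec.span (set fs) \<Longrightarrow> M k x \<in> vec.span (set fs)"
    and M_isometry: "k \<in> K \<Longrightarrow> x \<in> vec.span (set fs) \<Longrightarrow> y \<in> vec.span (set fs) \<Longrightarrow> h (M k x) (M k y) = h x y"
    and right_inverse: "k \<in> K \<Longrightarrow> \<exists>k'\<in>K. (\<forall>v. \<rho> k (\<rho> k' v) = v) \<and> (\<forall>x. M k (M k' x) = x)"
    and locally_finite: "\<exists>X. K_stable s K \<rho> X \<and> fin_dim s X \<and> v \<in> X"
begin

abbreviation W where "W \<equiv> fock vac fs"
abbreviation u where "u \<equiv> vec.span (set fs)"

definition \<rho>W :: "'g \<Rightarrow> ((complex ^ 'n) list \<Rightarrow> 'v) \<Rightarrow> (complex ^ 'n) list \<Rightarrow> 'v" where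
  "\<rho>W k \<Phi> = vmap (\<rho> k) (precompose (dual_map (M k)) \<Phi>)"

lemma subspace_W: "FS.subspace W" by (rule subspace_fock[OF subspace_vac])

lemma set_fs_u: "set fs \<subseteq> u" by (rule vec.span_superset)

lemma linear_\<rho>W:
  assumes "k \<in> K"
  shows "Vector_Spaces.linear (fun_scale s) (fun_scale s) (\<rho>W k)"
  unfolding Vector_Spaces.linear_iff
  by (auto simp: FS.vector_space_axioms \<rho>W_def vmap_def precompose_def fun_eq_iff fun_apply fun_scale_apply
      linearD[OF R.linear_\<rho>[OF assms]])

lemma \<rho>W_e:
  assumes "k \<in> K"
  shows "\<rho>W k (e x \<Phi>) = e (M k x) (\<rho>W k \<Phi>)"
  unfolding \<rho>W_def precompose_wedge_mult[OF linear_M[OF assms]] e_vmap[OF R.linear_\<rho>[OF assms]] ..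

lemma \<rho>W_tensor:
  assumes "k \<in> K"
  shows "\<rho>W k (tensor s v \<omega>) = tensor s (\<rho> k v) (precompose (dual_map (M k)) \<omega>)"
  by (simp add: \<rho>W_def vmap_def precompose_def tensor_def linearD[OF R.linear_\<rho>[OF assms]])

lemma \<rho>W_vac:
  assumes "k \<in> K"
  shows "\<rho>W k (tensor s v (wedge [])) = tensor s (\<rho> k v) (wedge [])"
  using \<rho>W_tensor[OF assms] precompose_wedge[OF linear_M[OF assms], of "[]"] by simp

lemma \<rho>W_fock:
  assumes k: "k \<in> K" and E: "FS.subspace E" "\<And>\<Phi>. \<Phi> \<in> E \<Longrightarrow> \<rho>W k \<Phi> \<in> E" and \<Phi>: "\<Phi> \<in> fock E fs"
  shows "\<rho>W k \<Phi> \<in> fock E fs"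
proof -
  have "\<rho>W k \<Phi> \<in> fock E fs" if "\<Phi> \<in> fock E gs" "set gs \<subseteq> u" for gs \<Phi>
    using that
  proof (induction gs arbitrary: \<Phi>)
    case Nil then show ?case using E fock_superset by auto
  next
    case (Cons a gs)
    then obtain x y where xy: "\<Phi> = x + e a y" "x \<in> fock E gs" "y \<in> fock E gs" by auto
    have "e (M k a) (\<rho>W k y) \<in> fock E fs"
      using Cons xy M_span[OF k] by (intro fock_e[OF E(1)]) auto
    then show ?case
      using Cons xy by (simp add: linearD[OF linear_\<rho>W[OF k]] \<rho>W_e[OF k] FS.subspace_add[OF subspace_fock[OF E(1)]])
  qed
  then show ?thesis using \<Phi> set_fs_u by blast
qed

lemma \<rho>W_W: "k \<in> K \<Longrightarrow> \<Phi> \<in> W \<Longrightarrow> \<rho>W k \<Phi> \<in> W"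
  by (rule \<rho>W_fock[OF _ subspace_vac]) (auto simp: vac_def \<rho>W_vac)

text \<open>Because \<open>M k\<close> is isometric on \<open>u\<close>, its transpose carries the
  Riesz covector of \<open>M k a\<close> to one that agrees on \<open>u\<close> with that of
  \<open>a\<close>, and elements of the Fock space see no more of a covector than that.\<close>

lemma i_\<rho>W:
  assumes k: "k \<in> K" and "\<Phi> \<in> W" "a \<in> u"
  shows "i (M k a) (\<rho>W k \<Phi>) = \<rho>W k (i a \<Phi>)"
proof -
  have "i (M k a) (\<rho>W k \<Phi>) = \<rho>W k (contract (dual_map (M k) (flat (M k a))) \<Phi>)"
    by (simp add: \<rho>W_def vmap_def precompose_def contract_def)
  also have "contract (dual_map (M k) (flat (M k a))) \<Phi> = i a \<Phi>"
    by (rule contract_fock_cong[OF assms(2)])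
      (simp add: pairing_dual_map[OF linear_M[OF k]] M_isometry[OF k _ assms(3)] vec.span_base)
  finally show ?thesis .
qed

lemma form_\<rho>W:
  assumes k: "k \<in> K" and \<Phi>: "\<Phi> \<in> W" and \<Psi>: "\<Psi> \<in> W"
  shows "form fs (\<rho>W k \<Phi>) (\<rho>W k \<Psi>) = form fs \<Phi> \<Psi>"
proof -
  have "form fs (\<rho>W k \<Phi>) (\<rho>W k \<Psi>) = form fs \<Phi> \<Psi>" if "\<Phi> \<in> fock vac gs" "set gs \<subseteq> u" "\<Psi> \<in> W" for gs \<Phi> \<Psi>
    using that
  proof (induction gs arbitrary: \<Phi> \<Psi>)
    case Nil
    then obtain v where v: "\<Phi> = tensor s v (wedge [])" by (auto simp: vac_def)
    have f: "form fs (tensor s w (wedge [])) \<Xi> = H w (\<Xi> [])" for w \<Xi>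
    proof -
      have "(tensor s w (wedge []) :: (complex ^ 'n) list \<Rightarrow> 'v) \<in> vac" unfolding vac_def by blast
      then show ?thesis by (simp only: form_vac) (simp add: tensor_def wedge_Nil)
    qed
    have "\<rho>W k \<Psi> [] = \<rho> k (\<Psi> [])" by (simp add: \<rho>W_def vmap_def precompose_def)
    then show ?case by (simp only: v \<rho>W_vac[OF k] f R.isometry[OF k])
  next
    case (Cons a gs)
    interpret F: hermitian_space "fun_scale s" "form fs" W by (rule hermitian_form[OF orthonormal_fs])
    obtain x y where xy: "\<Phi> = x + e a y" "x \<in> fock vac gs" "y \<in> fock vac gs" using Cons.prems by auto
    have a: "a \<in> u" "set gs \<subseteq> u" using Cons.prems by auto
    have "form fs (\<rho>W k (e a y)) (\<rho>W k \<Psi>) = form fs (\<rho>W k y) (i (M k a) (\<rho>W k \<Psi>))"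
      unfolding \<rho>W_e[OF k]
      by (rule form_e_span[OF orthonormal_fs M_span[OF k a(1)] \<rho>W_W[OF k Cons.prems(3)]])
    also have "\<dots> = form fs (\<rho>W k y) (\<rho>W k (i a \<Psi>))" by (simp only: i_\<rho>W[OF k Cons.prems(3) a(1)])
    also have "\<dots> = form fs y (i a \<Psi>)"
      by (rule Cons.IH[OF xy(3) a(2) fock_vac_contract[OF Cons.prems(3)]])
    also have "\<dots> = form fs (e a y) \<Psi>"
      by (rule form_e_span[OF orthonormal_fs a(1) Cons.prems(3), symmetric])
    finally show ?case
      using Cons.IH[OF xy(2) a(2) Cons.prems(3)] by (simp add: xy(1) linearD[OF linear_\<rho>W[OF k]])
  qed
  then show ?thesis using assms set_fs_u by blast
qed

lemma \<rho>W_right_inverse: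
  assumes "k \<in> K"
  obtains k' where "k' \<in> K" "\<And>\<Phi>. \<Phi> \<in> W \<Longrightarrow> \<rho>W k (\<rho>W k' \<Phi>) = \<Phi>" "\<And>v. \<rho> k (\<rho> k' v) = v"
proof -
  obtain k' where k': "k' \<in> K" "\<And>v. \<rho> k (\<rho> k' v) = v" "\<And>x. M k (M k' x) = x" using right_inverse[OF assms] by blast
  have "\<rho>W k (\<rho>W k' \<Phi>) = \<Phi>" if "\<Phi> \<in> fock vac gs" for gs \<Phi>
    using that
  proof (induction gs arbitrary: \<Phi>)
    case Nil then show ?case using k' assms by (auto simp: vac_def \<rho>W_vac)
  next
    case (Cons a gs)
    then show ?case using k' assms by (auto simp: \<rho>W_e linearD[OF linear_\<rho>W])
  qed
  then show ?thesis using that k' by blast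
qed

definition homs where
  "homs M0 = {T. Vector_Spaces.linear (fun_scale s) (fun_scale s) T \<and> T ` M0 \<subseteq> W \<and>
     (\<forall>k\<in>K. \<forall>m\<in>M0. T (\<rho>W k m) = \<rho>W k (T m))}"

text \<open>Test against \<open>w\<close>, written as an image under \<open>\<rho> k\<close>, and
  use the invariance of the form on \<open>W\<close>.\<close>

lemma trace_form_equivariant:
  assumes k: "k \<in> K" and "\<Phi> \<in> W" "\<omega> \<in> exterior_algebra u"
  shows "trace_form fs (box (\<rho>W k \<Phi>) (precompose (dual_map (M k)) \<omega>)) = \<rho> k (trace_form fs (box \<Phi> \<omega>))"
proof (rule H_eqI)
  fix w
  obtain k' where k': "k' \<in> K" "\<rho> k (\<rho> k' w) = w" using right_inverse[OF k] by blast
  have t: "tensor s v \<omega> \<in> W" for v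
    unfolding VS_space_eq_fock[symmetric] VS_space_def using assms(3) by (intro FS.span_base) blast
  have "H (trace_form fs (box (\<rho>W k \<Phi>) (precompose (dual_map (M k)) \<omega>))) (\<rho> k (\<rho> k' w)) =
      form fs (\<rho>W k \<Phi>) (\<rho>W k (tensor s (\<rho> k' w) \<omega>))"
    by (simp only: H_trace_form_box \<rho>W_tensor[OF k])
  also have "\<dots> = H (trace_form fs (box \<Phi> \<omega>)) (\<rho> k' w)"
    by (simp only: form_\<rho>W[OF k assms(2) t] H_trace_form_box)
  also have "\<dots> = H (\<rho> k (trace_form fs (box \<Phi> \<omega>))) (\<rho> k (\<rho> k' w))" by (rule R.isometry[OF k, symmetric])
  finally show "H (trace_form fs (box (\<rho>W k \<Phi>) (precompose (dual_map (M k)) \<omega>))) w =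
      H (\<rho> k (trace_form fs (box \<Phi> \<omega>))) w" using k' by simp
qed

lemma precompose_exterior:
  assumes k: "k \<in> K" and "\<omega> \<in> exterior_algebra u"
  shows "precompose (dual_map (M k)) \<omega> \<in> exterior_algebra u"
proof -
  interpret S: exterior_form "(*)" "\<lambda>a b. a * cnj b" h by (rule scalar_exterior_form)
  show ?thesis
    using assms(2) unfolding exterior_algebra_def
  proof (induction rule: S.FS.span_induct_alt)
    case base
    have "precompose (dual_map (M k)) 0 = (0 :: _ \<Rightarrow> complex)" by (simp add: precompose_def fun_eq_iff fun_apply)
    then show ?case by (simp add: S.FS.span_zero)
  next
    case (step c x y)
    then obtain Ys where Ys: "x = wedge Ys" "set Ys \<subseteq> u" by blast
    have "precompose (dual_map (M k)) (fun_scale (*) c x + y) =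
      fun_scale (*) c (wedge (map (M k) Ys)) + precompose (dual_map (M k)) y"
      unfolding precompose_wedge[OF linear_M[OF k], symmetric] Ys(1)
      by (simp add: precompose_def fun_eq_iff fun_apply fun_scale_apply)
    moreover have "wedge (map (M k) Ys) \<in> {wedge Ys | Ys. set Ys \<subseteq> u}"
      using Ys(2) M_span[OF k] by fastforce
    ultimately show ?case using step(2) by (simp add: S.FS.span_add S.FS.span_scale S.FS.span_base step)
  qed
qed

text \<open>
  The values of the coordinates of an equivariant map into \<open>W\<close> are values of equivariant maps into \<open>V\<close>
  on the finite-dimensional module spanned by the elements \<open>box m \<omega>\<close>.
\<close>
lemma fin_dim_homs:
  assumes M0: "FS.subspace M0" "fin_dim (fun_scale s) M0" and "M0 \<subseteq> W"
    and M0_stable: "\<And>k m. k \<in> K \<Longrightarrow> m \<in> M0 \<Longrightarrow> \<rho>W k m \<in> M0"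
  shows "fin_dim (fun_scale s) (FS.span (\<Union>T\<in>homs M0. T ` M0))"
proof -
  interpret S: exterior_form "(*)" "\<lambda>a b. a * cnj b" h by (rule scalar_exterior_form)
  interpret NS: vector_space "fun_scale (fun_scale s) :: complex \<Rightarrow> ((complex ^ 'n) list \<Rightarrow> (complex ^ 'n) list \<Rightarrow> 'v) \<Rightarrow> _"
    by (rule vector_space_fun_scale[OF FS.vector_space_axioms])
  interpret NP: vector_space_pair "fun_scale (fun_scale s) :: complex \<Rightarrow> ((complex ^ 'n) list \<Rightarrow> (complex ^ 'n) list \<Rightarrow> 'v) \<Rightarrow> _" s
    by unfold_locales
  define G where "G = {box m \<omega> | m \<omega>. m \<in> M0 \<and> \<omega> \<in> exterior_algebra u}"
  define N where "N = NS.span G"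
  define rN where "rN k n = (\<lambda>bs. \<rho>W k (n (map (dual_map (M k)) bs)))" for k and n :: "(complex ^ 'n) list \<Rightarrow> (complex ^ 'n) list \<Rightarrow> 'v"
  have rN_box: "rN k (box m \<omega>) = box (\<rho>W k m) (precompose (dual_map (M k)) \<omega>)" if "k \<in> K" for k m \<omega>
    by (simp add: rN_def box_def precompose_def linearD[OF linear_\<rho>W[OF that]])
  have linrN: "Vector_Spaces.linear (fun_scale (fun_scale s)) (fun_scale (fun_scale s)) (rN k)" if "k \<in> K" for k
    unfolding Vector_Spaces.linear_iff rN_def
    by (auto simp: NS.vector_space_axioms fun_eq_iff fun_apply fun_scale_apply[of "fun_scale s"] linearD[OF linear_\<rho>W[OF that]])
  have Nfin: "fin_dim (fun_scale (fun_scale s)) N"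
  proof -
    obtain B1 where B1: "finite B1" "M0 \<subseteq> FS.span B1" using M0(2) unfolding fin_dim_def by blast
    obtain B2 where B2: "finite B2" "exterior_algebra u \<subseteq> S.FS.span B2"
      using fin_dim_exterior_algebra[of fs] unfolding fin_dim_def by blast
    let ?B = "(\<lambda>(x, y). box x y) ` (B1 \<times> B2)"
    have 1: "box x y \<in> NS.span ?B" if "x \<in> FS.span B1" "y \<in> B2" for x y
      using that(1)
    proof (induction rule: FS.span_induct_alt)
      case base then show ?case by (simp add: box_simps NS.span_zero)
    next
      case (step c a w)
      have "box a y \<in> NS.span ?B" using step(1) that(2) by (intro NS.span_base) auto
      then show ?case unfolding box_simps using step(2) by (intro NS.span_add NS.span_scale)
    qed
    have "box x y \<in> NS.span ?B" if x: "x \<in> FS.span B1" and "y \<in> S.FS.span B2" for x y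
      using that(2)
    proof (induction rule: S.FS.span_induct_alt)
      case base then show ?case by (simp add: box_simps NS.span_zero)
    next
      case (step c a w)
      then show ?case unfolding box_simps using 1[OF x step(1)] by (intro NS.span_add NS.span_scale)
    qed
    then have "G \<subseteq> NS.span ?B" unfolding G_def using B1(2) B2(2) by blast
    then have "N \<subseteq> NS.span ?B" unfolding N_def by (simp add: NS.span_minimal)
    moreover have "finite ?B" using B1 B2 by blast
    ultimately show ?thesis unfolding fin_dim_def by blast
  qed
  have Nst: "rN k n \<in> N" if k: "k \<in> K" and n: "n \<in> N" for k n
  proof -
    have "rN k ` G \<subseteq> G"
      unfolding G_def using rN_box[OF k] M0_stable[OF k] precompose_exterior[OF k] by blast
    then show ?thesis
      using linear_span_image[OF linrN[OF k], of G G n] n NS.span_superset[of G] unfolding N_def by blast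
  qed
  define X where "X = span (\<Union>T\<in>R.intertwiners (fun_scale (fun_scale s)) N rN. T ` N)"
  have Xfin: "fin_dim s X"
    unfolding X_def
    by (rule R.fin_dim_images[OF NS.vector_space_axioms Nfin _ Nst]) (auto simp: N_def)
  have Tm: "T m \<in> fock (vacs X) fs" if T: "T \<in> homs M0" and m: "m \<in> M0" for T m
  proof (rule fock_vacs_coordinates[OF orthonormal_fs])
    have linT: "Vector_Spaces.linear (fun_scale s) (fun_scale s) T" and TW: "\<And>m. m \<in> M0 \<Longrightarrow> T m \<in> W"
      and Teq: "\<And>k m. k \<in> K \<Longrightarrow> m \<in> M0 \<Longrightarrow> T (\<rho>W k m) = \<rho>W k (T m)"
      using T unfolding homs_def by auto
    show "T m \<in> W" by (rule TW[OF m])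
    show "subspace X" unfolding X_def by simp
    fix J assume J: "set J \<subseteq> set fs"
    \<comment> \<open>Applying \<open>T\<close> in the inner slot turns an equivariant map into
      \<open>W\<close> into an intertwiner from \<open>N\<close> to \<open>V\<close>; its value at
      \<open>box m (wedge J)\<close> is the coordinate of \<open>T m\<close> at
      \<open>J\<close>.\<close>
    define \<tau> where "\<tau> n = trace_form fs (\<lambda>bs. T (n bs))" for n
    have \<tau>_box: "\<tau> (box m \<omega>) = trace_form fs (box (T m) \<omega>)" for m \<omega>
      by (simp add: \<tau>_def box_def linearD[OF linT])
    have lin\<tau>: "Vector_Spaces.linear (fun_scale (fun_scale s)) s \<tau>"
    proof -
      have e: "(\<lambda>bs. T ((n + n') bs)) = (\<lambda>bs. T (n bs)) + (\<lambda>bs. T (n' bs))"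
        "(\<lambda>bs. T (fun_scale (fun_scale s) c n bs)) = fun_scale (fun_scale s) c (\<lambda>bs. T (n bs))" for n n' c
        by (rule ext, simp only: plus_fun_apply linearD[OF linT],
            rule ext, simp only: fun_scale_apply[of "fun_scale s"] linearD[OF linT])
      show ?thesis
        unfolding Vector_Spaces.linear_iff \<tau>_def
        by (intro conjI allI NS.vector_space_axioms vector_space_axioms) (simp_all only: e trace_form_simps)
    qed
    have "\<tau> (rN k n) = \<rho> k (\<tau> n)" if k: "k \<in> K" and n: "n \<in> N" for k n
    proof -
      have l1: "Vector_Spaces.linear (fun_scale (fun_scale s)) s (\<tau> \<circ> rN k)"
        by (rule Vector_Spaces.linear_compose[OF linrN[OF k] lin\<tau>])
      have l2: "Vector_Spaces.linear (fun_scale (fun_scale s)) s (\<rho> k \<circ> \<tau>)"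
        by (rule Vector_Spaces.linear_compose[OF lin\<tau> R.linear_\<rho>[OF k]])
      have "(\<tau> \<circ> rN k) n = (\<rho> k \<circ> \<tau>) n"
      proof (rule NP.linear_eq_on[OF l1 l2])
        show "n \<in> NS.span G" using n N_def by simp
        fix g assume "g \<in> G"
        then obtain m \<omega> where g: "g = box m \<omega>" "m \<in> M0" "\<omega> \<in> exterior_algebra u" unfolding G_def by blast
        show "(\<tau> \<circ> rN k) g = (\<rho> k \<circ> \<tau>) g"
          using trace_form_equivariant[OF k TW[OF g(2)] g(3)]
          by (simp add: g(1) rN_box[OF k] \<tau>_box Teq[OF k g(2)])
      qed
      then show ?thesis by simp
    qed
    then have "\<tau> \<in> R.intertwiners (fun_scale (fun_scale s)) N rN"
      unfolding R.intertwiners_def using lin\<tau> by blast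
    moreover have "box m (wedge J) \<in> N"
    proof -
      have "wedge J \<in> exterior_algebra u"
        unfolding exterior_algebra_def using J set_fs_u by (intro S.FS.span_base) blast
      then show ?thesis unfolding N_def G_def using m by (intro NS.span_base) blast
    qed
    ultimately have "\<tau> (box m (wedge J)) \<in> X" unfolding X_def by (intro span_base) blast
    then show "T m (map flat J) \<in> X"
      by (simp add: \<tau>_box trace_form_wedge[OF orthonormal_fs TW[OF m] J])
  qed
  have sX: "subspace X" unfolding X_def by simp
  have "(\<Union>T\<in>homs M0. T ` M0) \<subseteq> fock (vacs X) fs" using Tm by blast
  moreover have "fin_dim (fun_scale s) (fock (vacs X) fs)"
    by (rule fin_dim_fock[OF subspace_vacs[OF sX] fin_dim_vacs[OF Xfin]])
  ultimately show ?thesis using FS.fin_dim_span FS.fin_dim_mono by blast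
qed

lemma exists_stable_module:
  assumes "w \<in> W"
  obtains M0 where "FS.subspace M0" "fin_dim (fun_scale s) M0" "M0 \<subseteq> W" "w \<in> M0"
    "\<And>k m. k \<in> K \<Longrightarrow> m \<in> M0 \<Longrightarrow> \<rho>W k m \<in> M0"
proof -
  have "\<exists>X. K_stable s K \<rho> X \<and> fin_dim s X \<and> w \<in> fock (vacs X) gs" if "w \<in> fock vac gs" for gs w
    using that
  proof (induction gs arbitrary: w)
    case Nil
    then obtain v where v: "w = tensor s v (wedge [])" by (auto simp: vac_def)
    then show ?case using locally_finite[of v] by (auto simp: vacs_def)
  next
    case (Cons a gs)
    then obtain x y where xy: "w = x + e a y" "x \<in> fock vac gs" "y \<in> fock vac gs" by auto
    obtain X Y where X: "K_stable s K \<rho> X" "fin_dim s X" "x \<in> fock (vacs X) gs"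
      and Y: "K_stable s K \<rho> Y" "fin_dim s Y" "y \<in> fock (vacs Y) gs"
      using Cons.IH xy by meson
    let ?Z = "span (X \<union> Y)"
    have "K_stable s K \<rho> ?Z"
      unfolding K_stable_def
    proof (intro conjI ballI)
      fix k assume k: "k \<in> K"
      interpret r: Vector_Spaces.linear s s "\<rho> k" by (rule R.linear_\<rho>[OF k])
      have "\<rho> k ` (X \<union> Y) \<subseteq> X \<union> Y" using X(1) Y(1) k unfolding K_stable_def by blast
      then show "\<rho> k ` ?Z \<subseteq> ?Z" by (metis r.span_image span_mono)
    qed simp
    moreover have "vacs X \<subseteq> vacs ?Z" "vacs Y \<subseteq> vacs ?Z"
      unfolding vacs_def by (auto intro: span_base)
    then have "x \<in> fock (vacs ?Z) gs" "y \<in> fock (vacs ?Z) gs" using X(3) Y(3) fock_mono by blast+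
    ultimately show ?case using fin_dim_Un[OF X(2) Y(2)] xy(1) by auto
  qed
  then obtain X where X: "K_stable s K \<rho> X" "fin_dim s X" "w \<in> fock (vacs X) fs" using assms by blast
  have sX: "FS.subspace (vacs X)" using X(1) unfolding K_stable_def by (simp add: subspace_vacs)
  show ?thesis
  proof
    show "FS.subspace (fock (vacs X) fs)" by (rule subspace_fock[OF sX])
    show "fin_dim (fun_scale s) (fock (vacs X) fs)" by (rule fin_dim_fock[OF sX fin_dim_vacs[OF X(2)]])
    show "fock (vacs X) fs \<subseteq> W" by (rule fock_mono) (auto simp: vacs_def vac_def)
    show "\<rho>W k m \<in> fock (vacs X) fs" if "k \<in> K" "m \<in> fock (vacs X) fs" for k m
      by (rule \<rho>W_fock[OF that(1) sX _ that(2)])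
        (use X(1) that(1) in \<open>auto simp: K_stable_def vacs_def \<rho>W_vac image_subset_iff\<close>)
  qed (rule X(3))
qed

text \<open>The hull is spanned by the images of one finite-dimensional stable module under all
  equivariant maps into \<open>W\<close>. It contains \<open>w\<close> through the inclusion and is
  closed under equivariant operators because these can be composed.\<close>

lemma finite_hull:
  assumes "w \<in> W"
  obtains E where "FS.subspace E" "fin_dim (fun_scale s) E" "E \<subseteq> W" "w \<in> E"
    "\<And>k \<Phi>. k \<in> K \<Longrightarrow> \<Phi> \<in> E \<Longrightarrow> \<rho>W k \<Phi> \<in> E"
    "\<And>T \<Phi>. T \<in> homs W \<Longrightarrow> \<Phi> \<in> E \<Longrightarrow> T \<Phi> \<in> E"
proof -
  obtain M0 where M0: "FS.subspace M0" "fin_dim (fun_scale s) M0" "M0 \<subseteq> W" "w \<in> M0"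
    "\<And>k m. k \<in> K \<Longrightarrow> m \<in> M0 \<Longrightarrow> \<rho>W k m \<in> M0"
    using exists_stable_module[OF assms] by blast
  let ?U = "\<Union>T\<in>homs M0. T ` M0"
  have image: "T \<Phi> \<in> FS.span ?U" if "Vector_Spaces.linear (fun_scale s) (fun_scale s) T" "T ` ?U \<subseteq> ?U" "\<Phi> \<in> FS.span ?U" for T \<Phi>
    by (rule linear_span_image[OF that(1) order_trans[OF that(2) FS.span_superset] that(3)])
  show ?thesis
  proof
    show "FS.subspace (FS.span ?U)" by simp
    show "fin_dim (fun_scale s) (FS.span ?U)" by (rule fin_dim_homs[OF M0(1-3,5)])
    show "FS.span ?U \<subseteq> W"
      by (rule FS.span_minimal[OF _ subspace_W]) (auto simp: homs_def)
    have "(\<lambda>x. x) \<in> homs M0"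
      using M0(3) unfolding homs_def Vector_Spaces.linear_iff by (auto simp: FS.vector_space_axioms)
    then show "w \<in> FS.span ?U" using M0(4) by (intro FS.span_base) blast
    show "\<rho>W k \<Phi> \<in> FS.span ?U" if "k \<in> K" "\<Phi> \<in> FS.span ?U" for k \<Phi>
    proof (rule image[OF linear_\<rho>W[OF that(1)] _ that(2)], clarify)
      fix T m assume T: "T \<in> homs M0" and m: "m \<in> M0"
      then have "\<rho>W k (T m) = T (\<rho>W k m)" using that(1) unfolding homs_def by simp
      then show "\<rho>W k (T m) \<in> ?U" using T M0(5)[OF that(1) m] by blast
    qed
    show "T \<Phi> \<in> FS.span ?U" if T: "T \<in> homs W" and "\<Phi> \<in> FS.span ?U" for T \<Phi>
    proof (rule image[OF _ _ that(2)])
      show linT: "Vector_Spaces.linear (fun_scale s) (fun_scale s) T" using T unfolding homs_def by blast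
      have "T \<circ> T' \<in> homs M0" if T': "T' \<in> homs M0" for T'
      proof -
        have "Vector_Spaces.linear (fun_scale s) (fun_scale s) T'" using T' unfolding homs_def by blast
        then have "Vector_Spaces.linear (fun_scale s) (fun_scale s) (T \<circ> T')" using linT Vector_Spaces.linear_compose by blast
        then show ?thesis using T T' unfolding homs_def by (auto simp: image_subset_iff)
      qed
      then have "T (T' m) \<in> ?U" if "T' \<in> homs M0" "m \<in> M0" for T' m
        using that by (intro UN_I[of "T \<circ> T'"]) auto
      then show "T ` ?U \<subseteq> ?U" by auto
    qed
  qed
qed

end

section \<open>Equivariant adjoints and the infinitesimal action\<close>

context twisted_rep begin

lemma perp_stable:
  assumes k: "k \<in> K" and Y: "Y \<subseteq> W" "\<And>k \<Phi>. k \<in> K \<Longrightarrow> \<Phi> \<in> Y \<Longrightarrow> \<rho>W k \<Phi> \<in> Y"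
    and x: "x \<in> W" "\<And>y. y \<in> Y \<Longrightarrow> form fs x y = 0" and y: "y \<in> Y"
  shows "form fs (\<rho>W k x) y = 0"
proof -
  obtain k' where k': "k' \<in> K" "\<And>\<Phi>. \<Phi> \<in> W \<Longrightarrow> \<rho>W k (\<rho>W k' \<Phi>) = \<Phi>"
    using \<rho>W_right_inverse[OF k] by metis
  have "form fs (\<rho>W k x) y = form fs (\<rho>W k x) (\<rho>W k (\<rho>W k' y))"
    using k'(2) Y(1) y by auto
  also have "\<dots> = form fs x (\<rho>W k' y)"
    using form_\<rho>W[OF k x(1)] Y y k'(1) by blast
  also have "\<dots> = 0" using x(2) Y(2) k'(1) y by blast
  finally show ?thesis .
qed

lemma adjoint_homs:
  assumes T: "T \<in> homs W"
    and T': "Vector_Spaces.linear (fun_scale s) (fun_scale s) T'" "\<And>\<Phi>. \<Phi> \<in> W \<Longrightarrow> T' \<Phi> \<in> W"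
    and adj: "\<And>\<Phi> \<Psi>. \<Phi> \<in> W \<Longrightarrow> \<Psi> \<in> W \<Longrightarrow> form fs (T \<Phi>) \<Psi> = form fs \<Phi> (T' \<Psi>)"
  shows "T' \<in> homs W"
proof -
  interpret F: hermitian_space "fun_scale s" "form fs" W by (rule hermitian_form[OF orthonormal_fs])
  have TW: "T \<Phi> \<in> W" if "\<Phi> \<in> W" for \<Phi> using T that unfolding homs_def by blast
  have "T' (\<rho>W k m) = \<rho>W k (T' m)" if k: "k \<in> K" and m: "m \<in> W" for k m
  proof -
    let ?z = "T' (\<rho>W k m) - \<rho>W k (T' m)"
    have z: "?z \<in> W" using T'(2) \<rho>W_W[OF k] m FS.subspace_diff[OF subspace_W] by blast
    have "form fs w ?z = 0" if w: "w \<in> W" for w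
    proof -
      obtain k' where k': "k' \<in> K" "\<And>\<Phi>. \<Phi> \<in> W \<Longrightarrow> \<rho>W k (\<rho>W k' \<Phi>) = \<Phi>"
        using \<rho>W_right_inverse[OF k] by metis
      define v where "v = \<rho>W k' w"
      have v: "v \<in> W" "w = \<rho>W k v" using k' w \<rho>W_W by (auto simp: v_def)
      have "form fs w (T' (\<rho>W k m)) = form fs (T (\<rho>W k v)) (\<rho>W k m)"
        using adj[OF w] \<rho>W_W[OF k m] v by simp
      also have "\<dots> = form fs (\<rho>W k (T v)) (\<rho>W k m)" using T v k unfolding homs_def by simp
      also have "\<dots> = form fs (T v) m" by (rule form_\<rho>W[OF k TW[OF v(1)] m])
      also have "\<dots> = form fs v (T' m)" by (rule adj[OF v(1) m])
      also have "\<dots> = form fs w (\<rho>W k (T' m))" unfolding v(2) by (rule form_\<rho>W[OF k v(1) T'(2)[OF m], symmetric])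
      finally show ?thesis by simp
    qed
    then have "?z = 0" using F.h_self_eq_0[OF z] z by blast
    then show ?thesis by simp
  qed
  then show ?thesis using T' unfolding homs_def by blast
qed

text \<open>The derivative of \<open>\<rho>W\<close> along a curve: \<open>p\<close> on the
  coefficients plus the derivation of the exterior algebra that extends \<open>D\<close>.\<close>

definition \<pi>W :: "(complex ^ 'n \<Rightarrow> complex ^ 'n) \<Rightarrow> ('v \<Rightarrow> 'v) \<Rightarrow> ((complex ^ 'n) list \<Rightarrow> 'v) \<Rightarrow> (complex ^ 'n) list \<Rightarrow> 'v" where
  "\<pi>W D p \<Phi> = vmap p \<Phi> + (\<Sum>j<length fs. e (D (fs ! j)) (i (fs ! j) \<Phi>))"

lemma linear_\<pi>W:
  assumes "Vector_Spaces.linear s s p"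
  shows "Vector_Spaces.linear (fun_scale s) (fun_scale s) (\<pi>W D p)"
  unfolding Vector_Spaces.linear_iff \<pi>W_def
  by (auto simp: FS.vector_space_axioms linearD[OF linear_vmap[OF assms]] sum.distrib FS.scale_right_distrib FS.scale_sum_right)

lemma \<pi>W_e:
  assumes p: "Vector_Spaces.linear s s p" and "a \<in> set fs"
  shows "\<pi>W D p (e a \<Phi>) = e a (\<pi>W D p \<Phi>) + e (D a) \<Phi>"
proof -
  obtain k where k: "k < length fs" "a = fs ! k" using assms(2) by (auto simp: in_set_conv_nth)
  have h: "h a (fs ! j) = (if j = k then 1 else 0)" if "j < length fs" for j
    using orthonormal_fs[unfolded U.orthonormal_def, rule_format, OF k(1) that] k(2) by auto
  have "(\<Sum>j<length fs. e (D (fs ! j)) (i (fs ! j) (e a \<Phi>))) =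
      (\<Sum>j<length fs. (if j = k then e (D a) \<Phi> else 0) + e a (e (D (fs ! j)) (i (fs ! j) \<Phi>)))"
  proof (intro sum.cong refl)
    fix j assume "j \<in> {..<length fs}"
    then have "i (fs ! j) (e a \<Phi>) = (if j = k then \<Phi> else 0) - e a (i (fs ! j) \<Phi>)"
      by (simp add: contract_e h)
    then show "e (D (fs ! j)) (i (fs ! j) (e a \<Phi>)) =
        (if j = k then e (D a) \<Phi> else 0) + e a (e (D (fs ! j)) (i (fs ! j) \<Phi>))"
      using e_anticommute[of "D (fs ! j)" a] k(2) by simp
  qed
  also have "\<dots> = e (D a) \<Phi> + e a (\<Sum>j<length fs. e (D (fs ! j)) (i (fs ! j) \<Phi>))"
    using k(1) by (simp add: sum.distrib e_sum)
  finally show ?thesis by (simp add: \<pi>W_def e_vmap[OF p])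
qed

text \<open>The product rule, one creation operator at a time. The functional varies in the
  induction, since it has to absorb the creation operators that are split off.\<close>

lemma weak_derivative:
  fixes kt :: "real \<Rightarrow> 'g"
  assumes kt: "\<And>t. kt t \<in> K" and \<rho>0: "\<And>v. \<rho> (kt 0) v = v" and M0: "\<And>x. M (kt 0) x = x"
    and p: "Vector_Spaces.linear s s p" and D: "\<And>x. x \<in> u \<Longrightarrow> D x \<in> u"
    and d\<rho>: "\<And>v f. Vector_Spaces.linear s (*) f \<Longrightarrow>
      ((\<lambda>t. f (\<rho> (kt t) v) :: complex) has_vector_derivative f (p v)) (at 0)"
    and dM: "\<And>x. ((\<lambda>t. M (kt t) x) has_vector_derivative D x) (at 0)"
    and F: "Vector_Spaces.linear (fun_scale s) (*) F" and \<Phi>: "\<Phi> \<in> W"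
  shows "((\<lambda>t. F (\<rho>W (kt t) \<Phi>) :: complex) has_vector_derivative F (\<pi>W D p \<Phi>)) (at 0)"
proof -
  have id: "\<rho>W (kt 0) \<Phi> = \<Phi>" for \<Phi>
  proof -
    have "dual_map (M (kt 0)) a = a" for a
      by (simp add: dual_map_def M0 covector_def pairing_def axis_def vec_eq_iff if_distrib cong: if_cong)
    then have "dual_map (M (kt 0)) = (\<lambda>a. a)" by blast
    then show ?thesis by (simp add: \<rho>W_def vmap_def precompose_def \<rho>0)
  qed
  have "((\<lambda>t. F (\<rho>W (kt t) \<Phi>)) has_vector_derivative F (\<pi>W D p \<Phi>)) (at 0)"
    if "Vector_Spaces.linear (fun_scale s) (*) F" "\<Phi> \<in> fock vac gs" "set gs \<subseteq> set fs" for F :: "_ \<Rightarrow> complex" and gs \<Phi>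
    using that
  proof (induction gs arbitrary: \<Phi> F)
    case Nil
    then obtain v where v: "\<Phi> = tensor s v (wedge [])" by (auto simp: vac_def)
    have "\<Phi> \<in> vac" using Nil by simp
    then have "\<pi>W D p \<Phi> = tensor s (p v) (wedge [])"
      by (simp add: \<pi>W_def contract_vac) (simp add: v vmap_tensor[OF p])
    moreover have "Vector_Spaces.linear s (*) (\<lambda>v. F (tensor s v (wedge [])))"
      using Vector_Spaces.linear_compose[OF linear_tensor_left Nil(1)] by (simp add: o_def)
    ultimately show ?case using d\<rho> v by (simp add: \<rho>W_vac[OF kt])
  next
    case (Cons a gs)
    obtain x y where xy: "\<Phi> = x + e a y" "x \<in> fock vac gs" "y \<in> fock vac gs" using Cons.prems(2) by auto
    have gs: "set gs \<subseteq> set fs" and a: "a \<in> set fs" "a \<in> u" using Cons.prems(3) set_fs_u by auto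
    note linF = linearD[OF Cons.prems(1)]
    \<comment> \<open>Expansion in the frame replaces the moving creation operator by scalar
      functions times functionals of the tail, so the product rule for complex-valued functions
      suffices.\<close>
    have exp: "F (e z \<Psi>) = (\<Sum>j<length fs. h z (fs ! j) * F (e (fs ! j) \<Psi>))" if "z \<in> u" for z \<Psi>
    proof -
      have "z = (\<Sum>j<length fs. h z (fs ! j) *s fs ! j)"
        by (rule U.orthonormal_expansion[OF orthonormal_fs that]) simp
      then have "e z \<Psi> = (\<Sum>j<length fs. fun_scale s (h z (fs ! j)) (e (fs ! j) \<Psi>))"
        by (metis (no_types, lifting) e_left_simps(5) e_sum_left sum.cong)
      then show ?thesis by (simp add: linF)
    qed
    have dh: "((\<lambda>t. h (M (kt t) a) b) has_vector_derivative h (D a) b) (at 0)" for b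
    proof -
      have "linear (pairing (flat b))"
        by (rule linearI) (simp_all add: pairing_def distrib_left sum.distrib scaleR_sum_right del: pairing_flat)
      then have "bounded_linear (pairing (flat b))" by (rule linear_conv_bounded_linear[THEN iffD1])
      from bounded_linear.has_vector_derivative[OF this dM[of a]] show ?thesis by simp
    qed
    have dF: "((\<lambda>t. F (e (fs ! j) (\<rho>W (kt t) y))) has_vector_derivative F (e (fs ! j) (\<pi>W D p y))) (at 0)" for j
      using Cons.IH[OF Vector_Spaces.linear_compose[OF linear_e Cons.prems(1)] xy(3) gs] by (simp add: o_def)
    have "((\<lambda>t. \<Sum>j<length fs. h (M (kt t) a) (fs ! j) * F (e (fs ! j) (\<rho>W (kt t) y))) has_vector_derivative
      (\<Sum>j<length fs. h (M (kt 0) a) (fs ! j) * F (e (fs ! j) (\<pi>W D p y)) + h (D a) (fs ! j) * F (e (fs ! j) (\<rho>W (kt 0) y)))) (at 0)"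
      by (intro has_vector_derivative_sum has_vector_derivative_mult dh dF)
    then have "((\<lambda>t. F (e (M (kt t) a) (\<rho>W (kt t) y))) has_vector_derivative F (e a (\<pi>W D p y)) + F (e (D a) y)) (at 0)"
      by (simp add: id M0 sum.distrib exp[OF M_span[OF kt a(2)]] exp[OF a(2)] exp[OF D[OF a(2)]])
    from has_vector_derivative_add[OF Cons.IH[OF Cons.prems(1) xy(2) gs] this]
    show ?case
      by (simp add: xy(1) linF linearD[OF linear_\<rho>W[OF kt]] \<rho>W_e[OF kt] linearD[OF linear_\<pi>W[OF p]] \<pi>W_e[OF p a(1)] add.assoc)
  qed
  then show ?thesis using F \<Phi> by blast
qed

text \<open>Otherwise some functional vanishes on \<open>Y\<close> but not on the derivative,
  although its value along the whole curve is 0.\<close>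

lemma derivative_stable:
  fixes kt :: "real \<Rightarrow> 'g"
  assumes kt: "\<And>t. kt t \<in> K" and \<rho>0: "\<And>v. \<rho> (kt 0) v = v" and M0: "\<And>x. M (kt 0) x = x"
    and p: "Vector_Spaces.linear s s p" and D: "\<And>x. x \<in> u \<Longrightarrow> D x \<in> u"
    and d\<rho>: "\<And>v f. Vector_Spaces.linear s (*) f \<Longrightarrow>
      ((\<lambda>t. f (\<rho> (kt t) v) :: complex) has_vector_derivative f (p v)) (at 0)"
    and dM: "\<And>x. ((\<lambda>t. M (kt t) x) has_vector_derivative D x) (at 0)"
    and Y: "FS.subspace Y" "Y \<subseteq> W" "\<And>k \<Phi>. k \<in> K \<Longrightarrow> \<Phi> \<in> Y \<Longrightarrow> \<rho>W k \<Phi> \<in> Y" and \<Phi>: "\<Phi> \<in> Y"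
  shows "\<pi>W D p \<Phi> \<in> Y"
proof (rule ccontr)
  assume n: "\<pi>W D p \<Phi> \<notin> Y"
  obtain F :: "_ \<Rightarrow> complex" where F: "Vector_Spaces.linear (fun_scale s) (*) F" "\<And>x. x \<in> Y \<Longrightarrow> F x = 0" "F (\<pi>W D p \<Phi>) \<noteq> 0"
    using FS.separating_functional[OF Y(1) n] by blast
  have "((\<lambda>t. F (\<rho>W (kt t) \<Phi>)) has_vector_derivative F (\<pi>W D p \<Phi>)) (at 0)"
    using Y(2) \<Phi> by (intro weak_derivative[OF kt \<rho>0 M0 p D d\<rho> dM F(1)]) auto
  moreover have "(\<lambda>t. F (\<rho>W (kt t) \<Phi>)) = (\<lambda>t. 0)" using F(2) Y(3)[OF kt \<Phi>] by blast
  ultimately have "((\<lambda>t::real. 0 :: complex) has_vector_derivative F (\<pi>W D p \<Phi>)) (at 0)" by simp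
  then show False using vector_derivative_unique_at[OF _ has_vector_derivative_const] F(3) by blast
qed

text \<open>The sum is a contraction of dual bases, hence invariant under isometries.\<close>
lemma invariant_sum_commutes:
  assumes lin\<pi>: "\<And>x. Vector_Spaces.linear s s (\<pi> x)" and lin\<pi>': "\<And>v. Vector_Spaces.linear (*s) s (\<lambda>x. \<pi> x v)"
    and eq: "\<And>k x v. k \<in> K \<Longrightarrow> \<rho> k (\<pi> x v) = \<pi> (M k x) (\<rho> k v)"
    and J: "\<And>x y. J (x + y) = J x + J y" "\<And>c x. J (c *s x) = cnj c *s J x"
    and MJ: "\<And>k x. k \<in> K \<Longrightarrow> M k (J x) = J (M k x)"
    and k: "k \<in> K"
  shows "(\<Sum>a<length fs. e (fs ! a) (vmap (\<pi> (J (fs ! a))) (\<rho>W k \<Phi>))) =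
    \<rho>W k (\<Sum>a<length fs. e (fs ! a) (vmap (\<pi> (J (fs ! a))) \<Phi>))"
proof -
  let ?n = "length fs" and ?M = "\<lambda>a. M k (fs ! a)"
  have J0: "J 0 = 0" using J(1)[of 0 0] by simp
  have Jsum: "J (\<Sum>a<l. c a *s z a) = (\<Sum>a<l. cnj (c a) *s J (z a))" for c l and z :: "nat \<Rightarrow> complex ^ 'n"
    by (induction l) (simp_all add: J J0)
  have vl: "Vector_Spaces.linear (*s) (fun_scale s) (\<lambda>x. vmap (\<pi> x) \<Psi>)" for \<Psi>
    unfolding Vector_Spaces.linear_iff
    by (auto simp: FS.vector_space_axioms vec.vector_space_axioms vmap_def fun_eq_iff fun_apply fun_scale_apply linearD[OF lin\<pi>'])
  have fu: "fs ! a \<in> u" if "a < ?n" for a using that set_fs_u by auto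
  have exp: "?M a = (\<Sum>b<?n. h (?M a) (fs ! b) *s fs ! b)" if "a < ?n" for a
    by (rule U.orthonormal_expansion[OF orthonormal_fs M_span[OF k fu[OF that]]]) simp
  \<comment> \<open>The images of the frame under \<open>M k\<close> form a frame of the same span;
    the right inverse of \<open>M k\<close> provides the preimage to be expanded.\<close>
  have exp': "fs ! b = (\<Sum>a<?n. h (fs ! b) (?M a) *s ?M a)" if b: "b < ?n" for b
  proof -
    obtain k' where k': "k' \<in> K" "\<And>x. M k (M k' x) = x" using right_inverse[OF k] by blast
    let ?y = "M k' (fs ! b)"
    have yu: "?y \<in> u" by (rule M_span[OF k'(1) fu[OF b]])
    have "M k ?y = M k (\<Sum>a<?n. h ?y (fs ! a) *s fs ! a)"
      by (rule arg_cong[OF U.orthonormal_expansion[OF orthonormal_fs yu]]) simp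
    also have "\<dots> = (\<Sum>a<?n. h ?y (fs ! a) *s ?M a)"
      by (simp only: linearD(5,6)[OF linear_M[OF k]])
    also have "\<dots> = (\<Sum>a<?n. h (fs ! b) (?M a) *s ?M a)"
    proof (intro sum.cong refl)
      fix a assume "a \<in> {..<?n}"
      then have "h (M k ?y) (?M a) = h ?y (fs ! a)" using M_isometry[OF k yu fu] by simp
      then show "h ?y (fs ! a) *s ?M a = h (fs ! b) (?M a) *s ?M a" using k'(2) by simp
    qed
    finally show ?thesis using k'(2) by simp
  qed
  have com: "\<rho>W k (vmap (\<pi> x) \<Phi>) = vmap (\<pi> (M k x)) (\<rho>W k \<Phi>)" for x \<Phi>
    by (simp add: \<rho>W_def vmap_def precompose_def eq[OF k])
  have "\<rho>W k (\<Sum>a<?n. e (fs ! a) (vmap (\<pi> (J (fs ! a))) \<Phi>)) = (\<Sum>a<?n. e (?M a) (vmap (\<pi> (J (?M a))) (\<rho>W k \<Phi>)))"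
    by (simp add: linearD[OF linear_\<rho>W[OF k]] \<rho>W_e[OF k] com MJ[OF k])
  also have "\<dots> = (\<Sum>a<?n. \<Sum>b<?n. fun_scale s (h (?M a) (fs ! b)) (e (fs ! b) (vmap (\<pi> (J (?M a))) (\<rho>W k \<Phi>))))"
  proof (intro sum.cong refl)
    fix a assume a: "a \<in> {..<?n}"
    have "e (?M a) \<Psi> = (\<Sum>b<?n. fun_scale s (h (?M a) (fs ! b)) (e (fs ! b) \<Psi>))" for \<Psi>
      using arg_cong[OF exp, of a "\<lambda>z. e z \<Psi>"] a by (simp add: e_sum_left)
    then show "e (?M a) (vmap (\<pi> (J (?M a))) (\<rho>W k \<Phi>)) =
      (\<Sum>b<?n. fun_scale s (h (?M a) (fs ! b)) (e (fs ! b) (vmap (\<pi> (J (?M a))) (\<rho>W k \<Phi>))))" .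
  qed
  also have "\<dots> = (\<Sum>b<?n. e (fs ! b) (vmap (\<pi> (\<Sum>a<?n. h (?M a) (fs ! b) *s J (?M a))) (\<rho>W k \<Phi>)))"
    by (subst sum.swap) (simp add: linearD[OF vl] e_sum)
  also have "\<dots> = (\<Sum>b<?n. e (fs ! b) (vmap (\<pi> (J (fs ! b))) (\<rho>W k \<Phi>)))"
  proof (intro sum.cong refl)
    fix b assume b: "b \<in> {..<?n}"
    have "J (fs ! b) = (\<Sum>a<?n. cnj (h (fs ! b) (?M a)) *s J (?M a))"
      using arg_cong[OF exp', of b J] b by (simp add: Jsum)
    also have "\<dots> = (\<Sum>a<?n. h (?M a) (fs ! b) *s J (?M a))"
      by (intro sum.cong refl arg_cong2[where f = "(*s)"]) (rule U.herm[symmetric])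
    finally show "e (fs ! b) (vmap (\<pi> (\<Sum>a<?n. h (?M a) (fs ! b) *s J (?M a))) (\<rho>W k \<Phi>)) =
      e (fs ! b) (vmap (\<pi> (J (fs ! b))) (\<rho>W k \<Phi>))" by simp
  qed
  finally show ?thesis by simp
qed

end

section \<open>Hodge decomposition for the cohomology differential\<close>

text \<open>\<open>A_stable\<close> ranges over all stable subspaces, not only finite-dimensional
  ones, because it is applied to an orthogonal complement.\<close>

locale hodge_setting = cohomology_operator s H h "fP @ fQ" c p p' + T: twisted_rep s H h K \<rho> fP M
  for s :: "complex \<Rightarrow> 'v::ab_group_add \<Rightarrow> 'v" and H
    and h :: "complex ^ 'n \<Rightarrow> complex ^ 'n \<Rightarrow> complex" and fP fQ c p p' and K :: "'g set" and \<rho> M +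
  assumes cPP: "a < length fP \<Longrightarrow> b < length fP \<Longrightarrow> k < length (fP @ fQ) \<Longrightarrow> c a b k = 0"
    and cPQ: "a < length fP \<Longrightarrow> b < length (fP @ fQ) \<Longrightarrow> k \<in> {length fP..<length (fP @ fQ)} \<Longrightarrow> c a b k = 0"
    and cQQ: "a \<in> {length fP..<length (fP @ fQ)} \<Longrightarrow> b \<in> {length fP..<length (fP @ fQ)} \<Longrightarrow> k < length fP \<Longrightarrow> c a b k = 0"
    and dP_equivariant: "g \<in> K \<Longrightarrow> \<Phi> \<in> fock vac fP \<Longrightarrow> dP (length fP) (T.\<rho>W g \<Phi>) = T.\<rho>W g (dP (length fP) \<Phi>)"
    and A_stable: "b \<in> {length fP..<length (fP @ fQ)} \<Longrightarrow> FS.subspace Y \<Longrightarrow> Y \<subseteq> fock vac fP \<Longrightarrow>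
      (\<And>g \<Phi>. g \<in> K \<Longrightarrow> \<Phi> \<in> Y \<Longrightarrow> T.\<rho>W g \<Phi> \<in> Y) \<Longrightarrow> \<Phi> \<in> Y \<Longrightarrow> A (length fP) b \<Phi> \<in> Y"
begin

abbreviation "m \<equiv> length fP"

lemma fP_nth: "a < m \<Longrightarrow> (fP @ fQ) ! a = fP ! a"
  by (simp add: nth_append)

lemma ops_W:
  assumes "\<Phi> \<in> T.W"
  shows "dP m \<Phi> \<in> T.W" "dP' m \<Phi> \<in> T.W" "A m b \<Phi> \<in> T.W" "A' m b \<Phi> \<in> T.W"
proof -
  have E: "E a \<Psi> \<in> T.W" if "a < m" "\<Psi> \<in> T.W" for a \<Psi>
    unfolding fP_nth[OF that(1)] using that by (intro fock_e[OF subspace_vac] vec.span_base) auto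
  note intros = FS.subspace_diff[OF T.subspace_W] FS.subspace_scale[OF T.subspace_W]
    FS.subspace_sum[OF T.subspace_W] fock_vac_contract fock_P E
  show "dP m \<Phi> \<in> T.W" "dP' m \<Phi> \<in> T.W" "A m b \<Phi> \<in> T.W" "A' m b \<Phi> \<in> T.W"
    unfolding dP_def dP'_def A_def A'_def by (intro intros assms; simp)+
qed

lemma adjoints_W:
  assumes "\<Phi> \<in> T.W" "\<Psi> \<in> T.W"
  shows "form fP (dP m \<Phi>) \<Psi> = form fP \<Phi> (dP' m \<Psi>)" "form fP (A m b \<Phi>) \<Psi> = form fP \<Phi> (A' m b \<Psi>)"
proof -
  interpret F: hermitian_space "fun_scale s" "form fP" T.W by (rule hermitian_form[OF T.orthonormal_fs])
  have E: "form fP (E a \<Phi>') \<Psi>' = form fP \<Phi>' (I a \<Psi>')" if "a < m" "\<Psi>' \<in> T.W" for a \<Phi>' \<Psi>'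
    unfolding fP_nth[OF that(1)] using that by (intro form_e[OF T.orthonormal_fs]) auto
  have I: "form fP (I a \<Phi>') \<Psi>' = form fP \<Phi>' (E a \<Psi>')" if "a < m" "\<Phi>' \<in> T.W" for a \<Phi>' \<Psi>'
    unfolding fP_nth[OF that(1)] using that by (intro form_e_right[OF T.orthonormal_fs, symmetric]) auto
  have EW: "E a \<Psi> \<in> T.W" if "a < m" "\<Psi> \<in> T.W" for a \<Psi>
    unfolding fP_nth[OF that(1)] using that by (intro fock_e[OF subspace_vac] vec.span_base) auto
  note P = form_vmap[of "p _" "p' _", OF p_adjoint]
  show "form fP (dP m \<Phi>) \<Psi> = form fP \<Phi> (dP' m \<Psi>)"
    unfolding dP_def dP'_def using assms by (simp add: F.h_sum E P)
  show "form fP (A m b \<Phi>) \<Psi> = form fP \<Phi> (A' m b \<Psi>)"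
    unfolding A_def A'_def using assms by (simp add: F.h_sum E I P EW)
qed

text \<open>Hulls are found for vectors of the bottom layer, joined by spans along the creation
  operators of \<open>fQ\<close>, and the result becomes the bottom of a finite-dimensional Fock
  space.\<close>

lemma locally_finite_d:
  assumes "x \<in> fock vac (fP @ fQ)"
  shows "\<exists>E. FS.subspace E \<and> fin_dim (fun_scale s) E \<and> E \<subseteq> fock vac (fP @ fQ) \<and> x \<in> E \<and> d ` E \<subseteq> E \<and> d_adj ` E \<subseteq> E"
proof -
  have VQ: "fock vac (fP @ fQ) = fock T.W fQ"
  proof -
    have "fock T.W fQ = fock vac (fQ @ fP)" by (simp add: fock_append)
    then show ?thesis unfolding VS_space_eq_fock[symmetric] by (simp add: Un_commute)
  qed
  have hull: "\<exists>X. FS.subspace X \<and> fin_dim (fun_scale s) X \<and> X \<subseteq> T.W \<and> x \<in> fock X gs \<and>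
      (\<forall>\<Phi>\<in>X. dP m \<Phi> \<in> X \<and> dP' m \<Phi> \<in> X \<and> (\<forall>b\<in>{m..<length (fP @ fQ)}. A m b \<Phi> \<in> X \<and> A' m b \<Phi> \<in> X))"
    if "x \<in> fock T.W gs" for gs x
    using that
  proof (induction gs arbitrary: x)
    case Nil
    then have x: "x \<in> T.W" by simp
    obtain X where X: "FS.subspace X" "fin_dim (fun_scale s) X" "X \<subseteq> T.W" "x \<in> X"
      "\<And>k \<Phi>. k \<in> K \<Longrightarrow> \<Phi> \<in> X \<Longrightarrow> T.\<rho>W k \<Phi> \<in> X" "\<And>T \<Phi>. T \<in> T.homs T.W \<Longrightarrow> \<Phi> \<in> X \<Longrightarrow> T \<Phi> \<in> X"
      using T.finite_hull[OF x] by metis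
    interpret F: hermitian_space "fun_scale s" "form fP" T.W by (rule hermitian_form[OF T.orthonormal_fs])
    have dPh: "dP m \<in> T.homs T.W"
      unfolding T.homs_def using linear_dP dP_equivariant ops_W by auto
    then have dP'h: "dP' m \<in> T.homs T.W"
      by (rule T.adjoint_homs) (use linear_dP' ops_W adjoints_W in auto)
    have A'X: "A' m b \<Phi> \<in> X" if b: "b \<in> {m..<length (fP @ fQ)}" and \<Phi>: "\<Phi> \<in> X" for b \<Phi>
    proof -
      \<comment> \<open>The orthogonal complement of \<open>X\<close> is stable under
        \<open>K\<close>, hence under \<open>A m b\<close>, so the adjoint maps \<open>X\<close>
        into vectors orthogonal to that complement. The error \<open>?r\<close> of projecting to
        \<open>X\<close> lies in the complement and is therefore orthogonal to itself.\<close>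
      let ?Y = "{y \<in> T.W. \<forall>z\<in>X. form fP y z = 0}"
      have Ysub: "FS.subspace ?Y"
        unfolding FS.subspace_def using F.subspace_W FS.subspace_def by auto
      have Yst: "T.\<rho>W k y \<in> ?Y" if "k \<in> K" "y \<in> ?Y" for k y
        using that T.perp_stable[OF that(1) X(3,5)] T.\<rho>W_W by auto
      have W: "A' m b \<Phi> \<in> T.W" using ops_W \<Phi> X(3) by blast
      obtain q where q: "q \<in> X" "A' m b \<Phi> - q \<in> T.W" "\<And>y. y \<in> X \<Longrightarrow> form fP (A' m b \<Phi> - q) y = 0"
        using F.orthogonal_decomposition[OF X(2,1,3) W] by blast
      let ?r = "A' m b \<Phi> - q"
      have r: "?r \<in> ?Y" using q by blast
      have "A m b ?r \<in> ?Y" by (rule A_stable[OF b Ysub _ Yst r]) auto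
      then have "form fP (A m b ?r) \<Phi> = 0" using \<Phi> by blast
      then have "form fP ?r (A' m b \<Phi>) = 0" using adjoints_W(2)[OF q(2)] \<Phi> X(3) by auto
      moreover have "form fP ?r q = 0" using q by blast
      ultimately have "form fP ?r ?r = 0" by (simp only: F.h_diff diff_self)
      then have "?r = 0" using F.h_self_eq_0[OF q(2)] by blast
      then show ?thesis using q(1) by simp
    qed
    have "\<forall>\<Phi>\<in>X. dP m \<Phi> \<in> X \<and> dP' m \<Phi> \<in> X \<and> (\<forall>b\<in>{m..<length (fP @ fQ)}. A m b \<Phi> \<in> X \<and> A' m b \<Phi> \<in> X)"
      using X(6)[OF dPh] X(6)[OF dP'h] A'X A_stable[OF _ X(1,3,5)] by blast
    then show ?case using X(1-4) by auto
  next
    case (Cons a gs)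
    then obtain y z where yz: "x = y + e a z" "y \<in> fock T.W gs" "z \<in> fock T.W gs" by auto
    let ?st = "\<lambda>X. \<forall>\<Phi>\<in>X. dP m \<Phi> \<in> X \<and> dP' m \<Phi> \<in> X \<and> (\<forall>b\<in>{m..<length (fP @ fQ)}. A m b \<Phi> \<in> X \<and> A' m b \<Phi> \<in> X)"
    obtain X where X: "FS.subspace X" "fin_dim (fun_scale s) X" "X \<subseteq> T.W" "y \<in> fock X gs" "?st X"
      using Cons.IH[OF yz(2)] by blast
    obtain Z where Z: "FS.subspace Z" "fin_dim (fun_scale s) Z" "Z \<subseteq> T.W" "z \<in> fock Z gs" "?st Z"
      using Cons.IH[OF yz(3)] by blast
    let ?U = "FS.span (X \<union> Z)"
    have lin: "L \<Phi> \<in> ?U" if "Vector_Spaces.linear (fun_scale s) (fun_scale s) L" "\<And>\<Phi>. \<Phi> \<in> X \<Longrightarrow> L \<Phi> \<in> X"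
      "\<And>\<Phi>. \<Phi> \<in> Z \<Longrightarrow> L \<Phi> \<in> Z" "\<Phi> \<in> ?U" for L \<Phi>
    proof (rule linear_span_image[OF that(1) _ that(4)])
      show "L ` (X \<union> Z) \<subseteq> ?U" using that(2,3) FS.span_superset by blast
    qed
    have "?st ?U"
    proof (intro ballI conjI)
      fix \<Phi> b assume \<Phi>: "\<Phi> \<in> ?U"
      show "dP m \<Phi> \<in> ?U" by (rule lin[OF linear_dP _ _ \<Phi>]) (use X(5) Z(5) in blast)+
      show "dP' m \<Phi> \<in> ?U" by (rule lin[OF linear_dP' _ _ \<Phi>]) (use X(5) Z(5) in blast)+
      assume b: "b \<in> {m..<length (fP @ fQ)}"
      show "A m b \<Phi> \<in> ?U" by (rule lin[OF linear_A _ _ \<Phi>]) (use X(5) Z(5) b in blast)+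
      show "A' m b \<Phi> \<in> ?U" by (rule lin[OF linear_A' _ _ \<Phi>]) (use X(5) Z(5) b in blast)+
    qed
    moreover have "X \<subseteq> ?U" "Z \<subseteq> ?U" using FS.span_superset by blast+
    then have "x \<in> fock ?U (a # gs)"
      unfolding fock.simps using yz(1) X(4) Z(4) fock_mono[of X ?U gs] fock_mono[of Z ?U gs] by blast
    moreover have "?U \<subseteq> T.W" using X(3) Z(3) FS.span_minimal[OF _ T.subspace_W] by simp
    moreover have "FS.subspace ?U" by simp
    ultimately show ?case using FS.fin_dim_Un[OF X(2) Z(2)] by blast
  qed
  obtain X where X: "FS.subspace X" "fin_dim (fun_scale s) X" "X \<subseteq> T.W" "x \<in> fock X fQ"
    and st: "\<And>\<Phi>. \<Phi> \<in> X \<Longrightarrow> dP m \<Phi> \<in> X" "\<And>\<Phi>. \<Phi> \<in> X \<Longrightarrow> dP' m \<Phi> \<in> X"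
      "\<And>b \<Phi>. b \<in> {m..<length (fP @ fQ)} \<Longrightarrow> \<Phi> \<in> X \<Longrightarrow> A m b \<Phi> \<in> X"
      "\<And>b \<Phi>. b \<in> {m..<length (fP @ fQ)} \<Longrightarrow> \<Phi> \<in> X \<Longrightarrow> A' m b \<Phi> \<in> X"
    using hull[of x fQ] assms VQ by metis
  have "FS.subspace (fock X fQ)" "fin_dim (fun_scale s) (fock X fQ)"
    using subspace_fock fin_dim_fock X by blast+
  moreover have "fock X fQ \<subseteq> fock vac (fP @ fQ)" unfolding VQ by (rule fock_mono[OF X(3)])
  moreover have "d ` fock X fQ \<subseteq> fock X fQ" "d_adj ` fock X fQ \<subseteq> fock X fQ"
    using fock_stable[OF refl refl cPP cPQ cQQ X(1,3) st] by blast+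
  ultimately show ?thesis using X(4) by blast
qed

theorem hodge:
  defines "\<Delta> \<equiv> \<lambda>x. d (d_adj x) + d_adj (d x)" and "VS \<equiv> fock vac (fP @ fQ)"
  shows "{x \<in> VS. \<Delta> x = 0} = {x \<in> VS. d x = 0} \<inter> {x \<in> VS. d_adj x = 0}"
    and "internal_direct_sum [{x \<in> VS. \<Delta> x = 0}, d ` VS, d_adj ` VS] VS"
    and "internal_direct_sum [{x \<in> VS. \<Delta> x = 0}, d ` VS] {x \<in> VS. d x = 0}"
    and "internal_direct_sum [{x \<in> VS. \<Delta> x = 0}, d_adj ` VS] {x \<in> VS. d_adj x = 0}"
proof -
  interpret F: hermitian_space "fun_scale s" "form (fP @ fQ)" VS
    unfolding VS_def by (rule hermitian_form[OF orthonormal_fs])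
  note H = F.hodge_decomposition[unfolded VS_def, OF linear_d d_fock linear_d_adj d_adj_fock form_d d_d locally_finite_d]
  show "{x \<in> VS. \<Delta> x = 0} = {x \<in> VS. d x = 0} \<inter> {x \<in> VS. d_adj x = 0}"
    and "internal_direct_sum [{x \<in> VS. \<Delta> x = 0}, d ` VS, d_adj ` VS] VS"
    and "internal_direct_sum [{x \<in> VS. \<Delta> x = 0}, d ` VS] {x \<in> VS. d x = 0}"
    and "internal_direct_sum [{x \<in> VS. \<Delta> x = 0}, d_adj ` VS] {x \<in> VS. d_adj x = 0}"
    unfolding \<Delta>_def VS_def by (rule H; assumption)+
qed

end

section \<open>The adjoint representation of a Lie group\<close>

lemma smooth_on_differentiable: "smooth_on S f \<Longrightarrow> x \<in> S \<Longrightarrow> f differentiable (at x)"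
  unfolding smooth_on_def using Ck_on.simps(2) by blast

lemma smooth_on_frechet_derivative:
  "smooth_on S f \<Longrightarrow> smooth_on S (\<lambda>x. frechet_derivative f (at x) v)"
  unfolding smooth_on_def using Ck_on.simps(2) by blast

lemma has_derivative_eventually_cong:
  assumes "(f has_derivative D) (at x)" "\<forall>\<^sub>F y in nhds x. f y = g y"
  shows "(g has_derivative D) (at x)"
  using has_derivative_transform_eventually[of f D x UNIV g] assms
  by (auto simp: eventually_nhds_conv_at)

lemma differentiable_eventually_cong:
  "f differentiable (at x) \<Longrightarrow> \<forall>\<^sub>F y in nhds x. f y = g y \<Longrightarrow> g differentiable (at x)"
  using has_derivative_eventually_cong unfolding differentiable_def by fast

lemma eventually_isCont:
  assumes "isCont f x" "open V" "f x \<in> V"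
  shows "\<forall>\<^sub>F y in nhds x. f y \<in> V"
proof -
  have "(f \<longlongrightarrow> f x) (nhds x)"
    using assms(1) unfolding isCont_def tendsto_at_iff_tendsto_nhds .
  then show ?thesis using assms(2,3) by (rule topological_tendstoD)
qed

lemma frechet_derivativeI: "(f has_derivative D) (at x) \<Longrightarrow> frechet_derivative f (at x) = D"
  using frechet_derivative_at by metis

lemma differentiable_has: "f differentiable (at x) \<Longrightarrow> (f has_derivative frechet_derivative f (at x)) (at x)"
  using frechet_derivative_works by blast

locale lie_chart =
  fixes G :: "('g, 'm) monoid_scheme" (structure) and T :: "'g topology"
    and A :: "('g set \<times> ('g \<Rightarrow> real ^ 'n)) set" and U :: "'g set" and \<phi> :: "'g \<Rightarrow> real ^ 'n"
  assumes lie_group: "lie_group G T A" and chart_U: "(U, \<phi>) \<in> A" and one_U: "\<one> \<in> U"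
begin

sublocale group G using lie_group unfolding lie_group_def by blast

abbreviation \<kappa> where "\<kappa> \<equiv> inv_into U \<phi>"
abbreviation o' where "o' \<equiv> \<phi> \<one>"

lemma topspace_T: "topspace T = carrier G"
  using lie_group unfolding lie_group_def by blast

lemma manifold: "smooth_manifold T A"
  using lie_group unfolding lie_group_def by blast

lemma exists_chart: "g \<in> carrier G \<Longrightarrow> \<exists>W \<psi>. (W, \<psi>) \<in> A \<and> g \<in> W"
proof -
  assume "g \<in> carrier G"
  then have "g \<in> (\<Union>(W, \<psi>)\<in>A. W)"
    using manifold topspace_T unfolding smooth_manifold_def by simp
  then show ?thesis by auto
qed

lemma chart:
  assumes "(W, \<psi>) \<in> A"
  shows "openin T W" "W \<subseteq> carrier G" "inj_on \<psi> W" "open (\<psi> ` W)"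
    "openin T V \<Longrightarrow> open (\<psi> ` (V \<inter> W))"
proof -
  have c: "openin T W" "open (\<psi> ` W)" "homeomorphic_map (subtopology T W) (top_of_set (\<psi> ` W)) \<psi>"
    using manifold assms unfolding smooth_manifold_def by auto
  show "openin T W" "open (\<psi> ` W)" by fact+
  show sub: "W \<subseteq> carrier G" using openin_subset[OF c(1)] topspace_T by simp
  then have "topspace (subtopology T W) = W" using topspace_T by auto
  then show "inj_on \<psi> W" using homeomorphic_imp_injective_map[OF c(3)] by simp
  show "open (\<psi> ` (V \<inter> W))" if "openin T V"
  proof -
    have "openin (subtopology T W) (V \<inter> W)" using that by (auto simp: openin_subtopology)
    then have "openin (top_of_set (\<psi> ` W)) (\<psi> ` (V \<inter> W))"
      using homeomorphic_imp_open_map[OF c(3)] unfolding open_map_def by blast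
    then show ?thesis using c(2) openin_open_eq by blast
  qed
qed

lemma inv_chart:
  assumes "(W, \<psi>) \<in> A"
  shows "x \<in> W \<Longrightarrow> inv_into W \<psi> (\<psi> x) = x" "a \<in> \<psi> ` W \<Longrightarrow> \<psi> (inv_into W \<psi> a) = a"
    "a \<in> \<psi> ` W \<Longrightarrow> inv_into W \<psi> a \<in> W"
  using chart(3)[OF assms] by (simp_all add: f_inv_into_f inv_into_into)

lemma eventually_chart:
  assumes "(W, \<psi>) \<in> A" "p \<in> W" "openin T V" "p \<in> V"
  shows "\<forall>\<^sub>F a in nhds (\<psi> p). a \<in> \<psi> ` W \<and> inv_into W \<psi> a \<in> V \<inter> W"
proof -
  have "\<forall>\<^sub>F a in nhds (\<psi> p). a \<in> \<psi> ` (V \<inter> W)"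
    using chart(5)[OF assms(1,3)] assms by (intro eventually_nhds_in_open) auto
  then show ?thesis
    by (rule eventually_mono) (use inv_chart[OF assms(1)] in auto)
qed

lemma continuous_mult: "continuous_map (prod_topology T T) T (\<lambda>(x, y). x \<otimes> y)"
  using lie_group unfolding lie_group_def smooth_map_def by blast

lemma continuous_inv: "continuous_map T T (\<lambda>x. inv x)"
  using lie_group unfolding lie_group_def smooth_map_def by blast

lemma continuous_map_mult:
  assumes "continuous_map T T f" "continuous_map T T g"
  shows "continuous_map T T (\<lambda>x. f x \<otimes> g x)"
proof -
  have "continuous_map T (prod_topology T T) (\<lambda>x. (f x, g x))"
    using assms by (simp add: continuous_map_paired)
  from continuous_map_compose[OF this continuous_mult] show ?thesis by (simp add: o_def)
qed

lemma continuous_map_carrier_const: "g \<in> carrier G \<Longrightarrow> continuous_map T T (\<lambda>x. g)"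
  using topspace_T by simp

lemma continuous_map_T_id: "continuous_map T T (\<lambda>x. x)"
  using continuous_map_id by (simp add: id_def)

lemmas cont_intros = continuous_map_mult continuous_map_carrier_const continuous_map_T_id continuous_inv

lemma eventually_chart_map:
  assumes "(W, \<psi>) \<in> A" "p \<in> W" "continuous_map T T f" "openin T V" "f p \<in> V"
  shows "\<forall>\<^sub>F a in nhds (\<psi> p). a \<in> \<psi> ` W \<and> inv_into W \<psi> a \<in> W \<and> f (inv_into W \<psi> a) \<in> V"
proof -
  have "openin T {x \<in> topspace T. f x \<in> V}" by (rule openin_continuous_map_preimage[OF assms(3,4)])
  moreover have "p \<in> {x \<in> topspace T. f x \<in> V}"
    using assms chart(2)[OF assms(1)] topspace_T by auto
  ultimately have "\<forall>\<^sub>F a in nhds (\<psi> p). a \<in> \<psi> ` W \<and> inv_into W \<psi> a \<in> {x \<in> topspace T. f x \<in> V} \<inter> W"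
    by (rule eventually_chart[OF assms(1,2)])
  then show ?thesis by (rule eventually_mono) auto
qed

section \<open>Multiplication and conjugation in coordinates\<close>

definition chart_mult where
  "chart_mult W1 \<psi>1 W2 \<psi>2 \<psi> = (\<lambda>p. \<psi> ((\<lambda>(x, y). x \<otimes> y) (inv_into (W1 \<times> W2) (map_prod \<psi>1 \<psi>2) p)))"

lemma chart_mult_eq:
  assumes "(W1, \<psi>1) \<in> A" "(W2, \<psi>2) \<in> A" "x \<in> W1" "y \<in> W2"
  shows "chart_mult W1 \<psi>1 W2 \<psi>2 \<psi> (\<psi>1 x, \<psi>2 y) = \<psi> (x \<otimes> y)"
proof -
  have "inj_on (map_prod \<psi>1 \<psi>2) (W1 \<times> W2)"
    using chart(3)[OF assms(1)] chart(3)[OF assms(2)] by (rule map_prod_inj_on)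
  then have "inv_into (W1 \<times> W2) (map_prod \<psi>1 \<psi>2) (map_prod \<psi>1 \<psi>2 (x, y)) = (x, y)"
    by (rule inv_into_f_f) (use assms in auto)
  then show ?thesis by (simp add: chart_mult_def)
qed

lemma smooth_chart_mult:
  assumes "(W1, \<psi>1) \<in> A" "(W2, \<psi>2) \<in> A" "(W, \<psi>) \<in> A"
  shows "smooth_on {(\<psi>1 x, \<psi>2 y) | x y. x \<in> W1 \<and> y \<in> W2 \<and> x \<otimes> y \<in> W} (chart_mult W1 \<psi>1 W2 \<psi>2 \<psi>)"
proof -
  have "smooth_map (prod_topology T T) (product_atlas A A) T A (\<lambda>(x, y). x \<otimes> y)"
    using lie_group unfolding lie_group_def by blast
  moreover have "(W1 \<times> W2, map_prod \<psi>1 \<psi>2) \<in> product_atlas A A"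
    using assms unfolding product_atlas_def by blast
  ultimately have "smooth_on (map_prod \<psi>1 \<psi>2 ` {x \<in> W1 \<times> W2. (\<lambda>(x, y). x \<otimes> y) x \<in> W}) (chart_mult W1 \<psi>1 W2 \<psi>2 \<psi>)"
    using assms(3) unfolding smooth_map_def chart_mult_def by blast
  moreover have "map_prod \<psi>1 \<psi>2 ` {x \<in> W1 \<times> W2. (\<lambda>(x, y). x \<otimes> y) x \<in> W} =
      {(\<psi>1 x, \<psi>2 y) | x y. x \<in> W1 \<and> y \<in> W2 \<and> x \<otimes> y \<in> W}"
    by force
  ultimately show ?thesis by simp
qed

lemma chart_mult_differentiable:
  assumes "(W1, \<psi>1) \<in> A" "(W2, \<psi>2) \<in> A" "(W, \<psi>) \<in> A" "x \<in> W1" "y \<in> W2" "x \<otimes> y \<in> W"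
  shows "chart_mult W1 \<psi>1 W2 \<psi>2 \<psi> differentiable (at (\<psi>1 x, \<psi>2 y))"
  by (rule smooth_on_differentiable[OF smooth_chart_mult[OF assms(1-3)]]) (use assms in blast)

lemma \<kappa>_one: "\<kappa> o' = \<one>"
  by (rule inv_chart(1)[OF chart_U one_U])

definition conj_chart where "conj_chart g = (\<lambda>a. \<phi> (g \<otimes> \<kappa> a \<otimes> inv g))"

lemma Ad_conj_chart: "Ad G U \<phi> g = frechet_derivative (conj_chart g) (at o')"
  by (simp add: Ad_def diff_at_one_def conj_chart_def)

lemma conj_chart_one: "g \<in> carrier G \<Longrightarrow> conj_chart g o' = o'"
  by (simp add: conj_chart_def \<kappa>_one)

text \<open>The element \<open>g\<close> need not lie in \<open>U\<close>, so conjugation is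
  factored as left multiplication into a chart around \<open>g\<close>, followed by right
  multiplication by \<open>inv g\<close>, which is read in a further chart.\<close>

lemma conj_chart_differentiable:
  assumes g: "g \<in> carrier G"
  shows "conj_chart g differentiable (at o')"
proof -
  obtain W \<psi> where W: "(W, \<psi>) \<in> A" "g \<in> W" using exists_chart[OF g] by blast
  obtain W' \<psi>' where W': "(W', \<psi>') \<in> A" "inv g \<in> W'" using exists_chart[of "inv g"] g by auto
  define f1 where "f1 = chart_mult W \<psi> U \<phi> \<psi>"
  define f2 where "f2 = chart_mult W \<psi> W' \<psi>' \<phi>"
  have d1: "f1 differentiable (at (\<psi> g, o'))"
    unfolding f1_def by (rule chart_mult_differentiable[OF W(1) chart_U W(1) W(2) one_U]) (use W g in simp)
  have d2: "f2 differentiable (at (\<psi> g, \<psi>' (inv g)))"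
    unfolding f2_def by (rule chart_mult_differentiable[OF W(1) W'(1) chart_U W(2) W'(2)]) (use one_U g in simp)
  have f1e: "f1 (\<psi> g, o') = \<psi> g" unfolding f1_def using chart_mult_eq[OF W(1) chart_U W(2) one_U] g by simp
  have "(\<lambda>a. f1 (\<psi> g, a)) differentiable (at o')"
    using differentiable_chain_at[of "\<lambda>a. (\<psi> g, a)" o' f1] d1
    by (simp add: o_def differentiable_Pair)
  then have "(\<lambda>a. (f1 (\<psi> g, a), \<psi>' (inv g))) differentiable (at o')"
    by (intro differentiable_Pair) simp_all
  then have "(\<lambda>a. f2 (f1 (\<psi> g, a), \<psi>' (inv g))) differentiable (at o')"
    using differentiable_chain_at[of "\<lambda>a. (f1 (\<psi> g, a), \<psi>' (inv g))" o' f2] d2 f1e by (simp add: o_def)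
  moreover have "\<forall>\<^sub>F a in nhds o'. f2 (f1 (\<psi> g, a), \<psi>' (inv g)) = conj_chart g a"
  proof -
    have "\<forall>\<^sub>F a in nhds o'. a \<in> \<phi> ` U \<and> \<kappa> a \<in> U \<and> g \<otimes> \<kappa> a \<in> W"
      using g W chart(1)[OF W(1)] by (intro eventually_chart_map chart_U one_U cont_intros) auto
    then show ?thesis
    proof (rule eventually_mono)
      fix a assume a: "a \<in> \<phi> ` U \<and> \<kappa> a \<in> U \<and> g \<otimes> \<kappa> a \<in> W"
      then have "f1 (\<psi> g, \<phi> (\<kappa> a)) = \<psi> (g \<otimes> \<kappa> a)"
        unfolding f1_def by (intro chart_mult_eq W chart_U) auto
      moreover have "\<phi> (\<kappa> a) = a" using a inv_chart(2)[OF chart_U] by blast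
      moreover have "f2 (\<psi> (g \<otimes> \<kappa> a), \<psi>' (inv g)) = \<phi> (g \<otimes> \<kappa> a \<otimes> inv g)"
        unfolding f2_def using a by (intro chart_mult_eq W W') auto
      ultimately show "f2 (f1 (\<psi> g, a), \<psi>' (inv g)) = conj_chart g a" by (simp add: conj_chart_def)
    qed
  qed
  ultimately show ?thesis by (rule differentiable_eventually_cong)
qed

lemma conj_chart_has_derivative: "g \<in> carrier G \<Longrightarrow> (conj_chart g has_derivative Ad G U \<phi> g) (at o')"
  unfolding Ad_conj_chart by (rule differentiable_has[OF conj_chart_differentiable])

lemma linear_Ad: "g \<in> carrier G \<Longrightarrow> linear (Ad G U \<phi> g)"
  using conj_chart_has_derivative has_derivative_linear by blast

lemma eventually_conj:
  assumes g: "g \<in> carrier G"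
  shows "\<forall>\<^sub>F a in nhds o'. \<kappa> a \<in> carrier G \<and> \<kappa> (conj_chart g a) = g \<otimes> \<kappa> a \<otimes> inv g"
proof -
  have "\<forall>\<^sub>F a in nhds o'. a \<in> \<phi> ` U \<and> \<kappa> a \<in> U \<and> g \<otimes> \<kappa> a \<otimes> inv g \<in> U"
    using g one_U chart(1)[OF chart_U] by (intro eventually_chart_map chart_U one_U cont_intros) auto
  then show ?thesis
    by (rule eventually_mono) (use inv_chart(1)[OF chart_U] chart(2)[OF chart_U] in \<open>auto simp: conj_chart_def\<close>)
qed

lemma Ad_mult:
  assumes g: "g \<in> carrier G" and h: "h \<in> carrier G"
  shows "Ad G U \<phi> (g \<otimes> h) = Ad G U \<phi> g \<circ> Ad G U \<phi> h"
proof -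
  have "(conj_chart g \<circ> conj_chart h has_derivative Ad G U \<phi> g \<circ> Ad G U \<phi> h) (at o')"
    using conj_chart_has_derivative[OF h] conj_chart_has_derivative[OF g]
    by (intro diff_chain_at) (simp_all add: conj_chart_one[OF h])
  moreover have "\<forall>\<^sub>F a in nhds o'. (conj_chart g \<circ> conj_chart h) a = conj_chart (g \<otimes> h) a"
    using eventually_conj[OF h]
  proof (rule eventually_mono)
    fix a assume a: "\<kappa> a \<in> carrier G \<and> \<kappa> (conj_chart h a) = h \<otimes> \<kappa> a \<otimes> inv h"
    have "conj_chart g (conj_chart h a) = \<phi> (g \<otimes> (h \<otimes> \<kappa> a \<otimes> inv h) \<otimes> inv g)"
      using a by (simp add: conj_chart_def)
    also have "g \<otimes> (h \<otimes> \<kappa> a \<otimes> inv h) \<otimes> inv g = g \<otimes> h \<otimes> \<kappa> a \<otimes> inv (g \<otimes> h)"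
      using a g h by (simp add: m_assoc inv_mult_group)
    finally show "(conj_chart g \<circ> conj_chart h) a = conj_chart (g \<otimes> h) a" by (simp add: conj_chart_def)
  qed
  ultimately have "(conj_chart (g \<otimes> h) has_derivative Ad G U \<phi> g \<circ> Ad G U \<phi> h) (at o')"
    by (rule has_derivative_eventually_cong)
  then show ?thesis unfolding Ad_conj_chart[of "g \<otimes> h"] by (rule frechet_derivativeI)
qed

lemma Ad_one: "Ad G U \<phi> \<one> = (\<lambda>x. x)"
proof -
  have "\<forall>\<^sub>F a in nhds o'. a = conj_chart \<one> a"
    using eventually_chart[OF chart_U one_U chart(1)[OF chart_U] one_U]
    by (rule eventually_mono)
      (use inv_chart(2)[OF chart_U] chart(2)[OF chart_U] in \<open>auto simp: conj_chart_def subset_iff\<close>)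
  then have "(conj_chart \<one> has_derivative (\<lambda>x. x)) (at o')"
    by (rule has_derivative_eventually_cong[OF has_derivative_ident])
  then show ?thesis unfolding Ad_conj_chart by (rule frechet_derivativeI)
qed

abbreviation "f\<^sub>m \<equiv> chart_mult U \<phi> U \<phi> \<phi>"

text \<open>Near the identity a single chart suffices, and \<open>Ad\<close> becomes a composition
  of derivatives of one fixed smooth map; in this form its dependence on \<open>x\<close> can be
  differentiated.\<close>

lemma Ad_formula:
  assumes x: "x \<in> U" "inv x \<in> U"
  shows "Ad G U \<phi> x Y = frechet_derivative f\<^sub>m (at (\<phi> x, \<phi> (inv x)))
    (frechet_derivative f\<^sub>m (at (\<phi> x, o')) (0, Y), 0)"
proof -
  have xc: "x \<in> carrier G" using x chart(2)[OF chart_U] by blast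
  have D1: "(f\<^sub>m has_derivative frechet_derivative f\<^sub>m (at (\<phi> x, o'))) (at (\<phi> x, o'))"
    by (rule differentiable_has, rule chart_mult_differentiable[OF chart_U chart_U chart_U x(1) one_U]) (use x xc in simp)
  have D2: "(f\<^sub>m has_derivative frechet_derivative f\<^sub>m (at (\<phi> x, \<phi> (inv x)))) (at (\<phi> x, \<phi> (inv x)))"
    by (rule differentiable_has, rule chart_mult_differentiable[OF chart_U chart_U chart_U x]) (use one_U xc in simp)
  have e1: "f\<^sub>m (\<phi> x, o') = \<phi> x" using chart_mult_eq[OF chart_U chart_U x(1) one_U] xc by simp
  have "((\<lambda>b. (\<phi> x, b)) has_derivative (\<lambda>Y. (0, Y))) (at o')"
    by (intro has_derivative_Pair has_derivative_const has_derivative_ident)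
  from has_derivative_compose[OF this D1]
  have "((\<lambda>b. (f\<^sub>m (\<phi> x, b), \<phi> (inv x))) has_derivative
     (\<lambda>Y. (frechet_derivative f\<^sub>m (at (\<phi> x, o')) (0, Y), 0))) (at o')"
    by (intro has_derivative_Pair has_derivative_const)
  moreover have "(f\<^sub>m has_derivative frechet_derivative f\<^sub>m (at (\<phi> x, \<phi> (inv x)))) (at (f\<^sub>m (\<phi> x, o'), \<phi> (inv x)))"
    using D2 by (simp only: e1)
  ultimately have "((\<lambda>b. f\<^sub>m (f\<^sub>m (\<phi> x, b), \<phi> (inv x))) has_derivative
     (\<lambda>Y. frechet_derivative f\<^sub>m (at (\<phi> x, \<phi> (inv x))) (frechet_derivative f\<^sub>m (at (\<phi> x, o')) (0, Y), 0))) (at o')"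
    by (rule has_derivative_compose)
  moreover have "\<forall>\<^sub>F b in nhds o'. f\<^sub>m (f\<^sub>m (\<phi> x, b), \<phi> (inv x)) = conj_chart x b"
  proof -
    have "\<forall>\<^sub>F b in nhds o'. b \<in> \<phi> ` U \<and> \<kappa> b \<in> U \<and> x \<otimes> \<kappa> b \<in> U"
      using x xc chart(1)[OF chart_U] by (intro eventually_chart_map chart_U one_U cont_intros) auto
    then show ?thesis
    proof (rule eventually_mono)
      fix b assume b: "b \<in> \<phi> ` U \<and> \<kappa> b \<in> U \<and> x \<otimes> \<kappa> b \<in> U"
      have "f\<^sub>m (\<phi> x, \<phi> (\<kappa> b)) = \<phi> (x \<otimes> \<kappa> b)" using b x by (intro chart_mult_eq chart_U) auto
      moreover have "\<phi> (\<kappa> b) = b" using b inv_chart(2)[OF chart_U] by blast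
      moreover have "f\<^sub>m (\<phi> (x \<otimes> \<kappa> b), \<phi> (inv x)) = \<phi> (x \<otimes> \<kappa> b \<otimes> inv x)"
        using b x by (intro chart_mult_eq chart_U) auto
      ultimately show "f\<^sub>m (f\<^sub>m (\<phi> x, b), \<phi> (inv x)) = conj_chart x b" by (simp add: conj_chart_def)
    qed
  qed
  ultimately have "(conj_chart x has_derivative
     (\<lambda>Y. frechet_derivative f\<^sub>m (at (\<phi> x, \<phi> (inv x))) (frechet_derivative f\<^sub>m (at (\<phi> x, o')) (0, Y), 0))) (at o')"
    by (rule has_derivative_eventually_cong)
  then show ?thesis unfolding Ad_conj_chart by (simp add: frechet_derivativeI)
qed

lemma Ad_differentiable: "(\<lambda>a. Ad G U \<phi> (\<kappa> a) Y) differentiable (at o')"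
proof -
  let ?S = "{(\<phi> x, \<phi> y) | x y. x \<in> U \<and> y \<in> U \<and> x \<otimes> y \<in> U}"
  define I where "I = (\<lambda>a. \<phi> (inv (\<kappa> a)))"
  have smI: "smooth_on (\<phi> ` {x \<in> U. inv x \<in> U}) I"
    using lie_group chart_U unfolding lie_group_def smooth_map_def I_def by blast
  have dI: "I differentiable (at o')"
    by (rule smooth_on_differentiable[OF smI]) (use one_U in auto)
  have Io: "I o' = o'" by (simp add: I_def \<kappa>_one)
  have oo: "(o', o') \<in> ?S" using one_U by force
  have dD: "(\<lambda>p. frechet_derivative f\<^sub>m (at p) v) differentiable (at (o', o'))" for v
    by (rule smooth_on_differentiable[OF smooth_on_frechet_derivative[OF smooth_chart_mult[OF chart_U chart_U chart_U]] oo])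
  define w where "w = (\<lambda>a. frechet_derivative f\<^sub>m (at (a, o')) (0, Y))"
  have dw: "w differentiable (at o')"
    using differentiable_chain_at[of "\<lambda>a. (a, o')" o' "\<lambda>p. frechet_derivative f\<^sub>m (at p) (0, Y)"] dD
    by (simp add: w_def o_def differentiable_Pair)
  have dI2: "(\<lambda>a. frechet_derivative f\<^sub>m (at (a, I a)) v) differentiable (at o')" for v
    using differentiable_chain_at[of "\<lambda>a. (a, I a)" o' "\<lambda>p. frechet_derivative f\<^sub>m (at p) v"] dD Io dI
    by (simp add: o_def differentiable_Pair)
  \<comment> \<open>Smoothness gives differentiability of directional derivatives in a fixed
    direction; the moving direction \<open>w a\<close> is therefore expanded in the standard
    basis.\<close>
  have "(\<lambda>a. \<Sum>b\<in>Basis. (w a \<bullet> b) *\<^sub>R frechet_derivative f\<^sub>m (at (a, I a)) (b, 0)) differentiable (at o')"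
  proof (intro differentiable_sum ballI)
    fix b :: "real ^ 'n"
    have "((\<lambda>a. w a \<bullet> b) has_derivative (\<lambda>v. frechet_derivative w (at o') v \<bullet> b)) (at o')"
      by (intro has_derivative_inner_left differentiable_has dw)
    from has_derivative_scaleR[OF this differentiable_has[OF dI2[of "(b, 0)"]]]
    show "(\<lambda>a. (w a \<bullet> b) *\<^sub>R frechet_derivative f\<^sub>m (at (a, I a)) (b, 0)) differentiable (at o')"
      unfolding differentiable_def by blast
  qed simp
  moreover have "\<forall>\<^sub>F a in nhds o'. (\<Sum>b\<in>Basis. (w a \<bullet> b) *\<^sub>R frechet_derivative f\<^sub>m (at (a, I a)) (b, 0)) = Ad G U \<phi> (\<kappa> a) Y"
  proof -
    have "\<forall>\<^sub>F a in nhds o'. a \<in> \<phi> ` U \<and> \<kappa> a \<in> U \<and> inv (\<kappa> a) \<in> U"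
      using one_U chart(1)[OF chart_U] by (intro eventually_chart_map chart_U one_U cont_intros) auto
    then show ?thesis
    proof (rule eventually_mono)
      fix a assume a: "a \<in> \<phi> ` U \<and> \<kappa> a \<in> U \<and> inv (\<kappa> a) \<in> U"
      have ka: "\<phi> (\<kappa> a) = a" using a inv_chart(2)[OF chart_U] by blast
      have xc: "\<kappa> a \<in> carrier G" using a chart(2)[OF chart_U] by blast
      have "f\<^sub>m differentiable (at (\<phi> (\<kappa> a), \<phi> (inv (\<kappa> a))))"
        by (rule chart_mult_differentiable[OF chart_U chart_U chart_U]) (use a one_U xc in simp_all)
      then have "(f\<^sub>m has_derivative frechet_derivative f\<^sub>m (at (a, I a))) (at (a, I a))"
        using ka unfolding I_def by (intro differentiable_has) simp
      then have lin: "linear (frechet_derivative f\<^sub>m (at (a, I a)))" by (rule has_derivative_linear)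
      have "(w a, 0) = (\<Sum>b\<in>Basis. (w a \<bullet> b) *\<^sub>R (b, 0 :: real ^ 'n))"
        by (simp add: prod_eq_iff fst_sum snd_sum euclidean_representation)
      then have "frechet_derivative f\<^sub>m (at (a, I a)) (w a, 0) =
          (\<Sum>b\<in>Basis. (w a \<bullet> b) *\<^sub>R frechet_derivative f\<^sub>m (at (a, I a)) (b, 0))"
        by (simp only: linear_sum[OF lin] linear_cmul[OF lin])
      then show "(\<Sum>b\<in>Basis. (w a \<bullet> b) *\<^sub>R frechet_derivative f\<^sub>m (at (a, I a)) (b, 0)) = Ad G U \<phi> (\<kappa> a) Y"
        using Ad_formula[of "\<kappa> a" Y] a ka unfolding I_def w_def by simp
    qed
  qed
  ultimately show ?thesis by (rule differentiable_eventually_cong)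
qed

lemma Ad_has_derivative:
  "((\<lambda>a. Ad G U \<phi> (\<kappa> a) Y) has_derivative (\<lambda>X. lie_bracket G U \<phi> X Y)) (at o')"
  using differentiable_has[OF Ad_differentiable] by (simp add: lie_bracket_def)

text \<open>For fixed \<open>g\<close> and \<open>Y\<close>, compare the derivatives at the identity
  of two expressions in x: Ad of g applied to Ad of x applied to Y, and Ad of the conjugate of x by
  g, applied to Ad of g applied to Y.\<close>

theorem Ad_lie_bracket:
  assumes g: "g \<in> carrier G"
  shows "Ad G U \<phi> g (lie_bracket G U \<phi> X Y) = lie_bracket G U \<phi> (Ad G U \<phi> g X) (Ad G U \<phi> g Y)"
proof -
  let ?Z = "Ad G U \<phi> g Y"
  have bl: "bounded_linear (Ad G U \<phi> g)" using linear_Ad[OF g] linear_conv_bounded_linear by blast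
  have "((\<lambda>a. Ad G U \<phi> g (Ad G U \<phi> (\<kappa> a) Y)) has_derivative (\<lambda>X. Ad G U \<phi> g (lie_bracket G U \<phi> X Y))) (at o')"
    by (rule bounded_linear.has_derivative[OF bl Ad_has_derivative])
  moreover have "\<forall>\<^sub>F a in nhds o'. Ad G U \<phi> g (Ad G U \<phi> (\<kappa> a) Y) = Ad G U \<phi> (\<kappa> (conj_chart g a)) ?Z"
    using eventually_conj[OF g]
  proof (rule eventually_mono)
    fix a assume a: "\<kappa> a \<in> carrier G \<and> \<kappa> (conj_chart g a) = g \<otimes> \<kappa> a \<otimes> inv g"
    have "Ad G U \<phi> (g \<otimes> \<kappa> a \<otimes> inv g) ?Z = Ad G U \<phi> ((g \<otimes> \<kappa> a \<otimes> inv g) \<otimes> g) Y"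
      using a g by (simp add: Ad_mult)
    also have "(g \<otimes> \<kappa> a \<otimes> inv g) \<otimes> g = g \<otimes> \<kappa> a" using a g by (simp add: m_assoc)
    also have "Ad G U \<phi> (g \<otimes> \<kappa> a) Y = Ad G U \<phi> g (Ad G U \<phi> (\<kappa> a) Y)" using a g by (simp add: Ad_mult)
    finally show "Ad G U \<phi> g (Ad G U \<phi> (\<kappa> a) Y) = Ad G U \<phi> (\<kappa> (conj_chart g a)) ?Z" using a by simp
  qed
  ultimately have 1: "((\<lambda>a. Ad G U \<phi> (\<kappa> (conj_chart g a)) ?Z) has_derivative (\<lambda>X. Ad G U \<phi> g (lie_bracket G U \<phi> X Y))) (at o')"
    by (rule has_derivative_eventually_cong)
  have "((\<lambda>a. Ad G U \<phi> (\<kappa> a) ?Z) has_derivative (\<lambda>X. lie_bracket G U \<phi> X ?Z)) (at (conj_chart g o'))"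
    using Ad_has_derivative by (simp only: conj_chart_one[OF g])
  from has_derivative_compose[OF conj_chart_has_derivative[OF g] this]
  have 2: "((\<lambda>a. Ad G U \<phi> (\<kappa> (conj_chart g a)) ?Z) has_derivative (\<lambda>X. lie_bracket G U \<phi> (Ad G U \<phi> g X) ?Z)) (at o')" .
  show ?thesis using has_derivative_unique[OF 1 2] by metis
qed

text \<open>
  The average of \<open>a\<close> and \<open>d\<Theta> (\<Theta> a)\<close> is a local coordinate in which \<open>\<Theta>\<close> becomes linear; a straight line
  in this coordinate is a curve of fixed points.
\<close>
lemma fixed_point_curve:
  assumes \<Theta>: "\<Theta> \<in> iso G G" "smooth_map T A T A \<Theta>" "\<forall>x\<in>carrier G. \<Theta> (\<Theta> x) = x"
  defines "\<theta> \<equiv> diff_at_one G U \<phi> \<Theta>"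
  assumes \<theta>\<theta>: "\<And>x. \<theta> (\<theta> x) = x" and X: "\<theta> X = X"
  obtains c :: "real \<Rightarrow> 'g" where "\<And>t. c t \<in> U" "\<And>t. \<Theta> (c t) = c t" "c 0 = \<one>"
    "((\<lambda>t. \<phi> (c t)) has_vector_derivative X) (at 0)"
    "\<And>Y. ((\<lambda>t. Ad G U \<phi> (c t) Y) has_vector_derivative lie_bracket G U \<phi> X Y) (at 0)"
proof -
  define t\<Theta> where "t\<Theta> = (\<lambda>a. \<phi> (\<Theta> (\<kappa> a)))"
  define S where "S = \<phi> ` {x \<in> U. \<Theta> x \<in> U}"
  have \<Theta>1: "\<Theta> \<one> = \<one>"
    using \<Theta>(1) hom_one[of \<Theta> G G] unfolding iso_def by (simp add: group_axioms)
  have cont: "continuous_map T T \<Theta>" using \<Theta>(2) unfolding smooth_map_def by blast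
  have sm: "smooth_on S t\<Theta>" using \<Theta>(2) chart_U unfolding smooth_map_def S_def t\<Theta>_def by blast
  have Sopen: "open S"
  proof -
    have "openin T {x \<in> topspace T. \<Theta> x \<in> U}" by (rule openin_continuous_map_preimage[OF cont chart(1)[OF chart_U]])
    then have "open (\<phi> ` ({x \<in> topspace T. \<Theta> x \<in> U} \<inter> U))" by (rule chart(5)[OF chart_U])
    moreover have "{x \<in> topspace T. \<Theta> x \<in> U} \<inter> U = {x \<in> U. \<Theta> x \<in> U}"
      using chart(2)[OF chart_U] topspace_T by auto
    ultimately show ?thesis by (simp add: S_def)
  qed
  have oS: "o' \<in> S" using one_U \<Theta>1 by (auto simp: S_def)
  have t\<Theta>o: "t\<Theta> o' = o'" by (simp add: t\<Theta>_def \<kappa>_one \<Theta>1)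
  have dt: "(t\<Theta> has_derivative frechet_derivative t\<Theta> (at a)) (at a)" if "a \<in> S" for a
    by (rule differentiable_has[OF smooth_on_differentiable[OF sm that]])
  have \<theta>_eq: "frechet_derivative t\<Theta> (at o') = \<theta>" by (simp add: \<theta>_def diff_at_one_def t\<Theta>_def)
  have lin\<theta>: "linear \<theta>" using has_derivative_linear[OF dt[OF oS]] \<theta>_eq by simp
  have bl\<theta>: "bounded_linear \<theta>" using lin\<theta> linear_conv_bounded_linear by blast
  have t\<Theta>S: "\<Theta> (\<kappa> a) \<in> U" "\<kappa> a \<in> U" "\<phi> (\<kappa> a) = a" "t\<Theta> (t\<Theta> a) = a" if a: "a \<in> S" for a
  proof -
    obtain x where x: "x \<in> U" "\<Theta> x \<in> U" "a = \<phi> x" using a unfolding S_def by blast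
    have k: "\<kappa> a = x" "\<kappa> (\<phi> (\<Theta> x)) = \<Theta> x" using inv_chart(1)[OF chart_U] x by auto
    have "x \<in> carrier G" using x chart(2)[OF chart_U] by blast
    then show "\<Theta> (\<kappa> a) \<in> U" "\<kappa> a \<in> U" "\<phi> (\<kappa> a) = a" "t\<Theta> (t\<Theta> a) = a" using x k \<Theta>(3) by (auto simp: t\<Theta>_def)
  qed
  \<comment> \<open>\<open>\<psi>\<close> carries the chart form of \<open>\<Theta>\<close> to the
    affine map fixing \<open>o'\<close> with linear part \<open>\<theta>\<close>. Its derivative at
    \<open>o'\<close> is the identity because \<open>\<theta>\<close> is an involution.\<close>
  define \<psi> where "\<psi> = (\<lambda>a. (1/2) *\<^sub>R (a + o' + \<theta> (t\<Theta> a - o')))"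
  define D where "D = (\<lambda>a v. (1/2) *\<^sub>R (v + \<theta> (frechet_derivative t\<Theta> (at a) v)))"
  have d\<psi>: "(\<psi> has_derivative D a) (at a)" if "a \<in> S" for a
  proof -
    have "((\<lambda>a. t\<Theta> a - o') has_derivative frechet_derivative t\<Theta> (at a)) (at a)"
      using has_derivative_diff[OF dt[OF that] has_derivative_const[of o']] by simp
    then have "((\<lambda>a. a + o' + \<theta> (t\<Theta> a - o')) has_derivative (\<lambda>v. v + 0 + \<theta> (frechet_derivative t\<Theta> (at a) v))) (at a)"
      by (intro has_derivative_add has_derivative_ident has_derivative_const bounded_linear.has_derivative[OF bl\<theta>])
    then show ?thesis unfolding \<psi>_def D_def by (intro has_derivative_scaleR_right) simp
  qed
  have bD: "blinfun_apply (Blinfun (D a)) = D a" if "a \<in> S" for a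
    by (rule bounded_linear_Blinfun_apply[OF has_derivative_bounded_linear[OF d\<psi>[OF that]]])
  have D_o: "D o' = (\<lambda>v. v)"
  proof
    fix v show "D o' v = v" unfolding D_def \<theta>_eq \<theta>\<theta> by (simp flip: scaleR_2)
  qed
  have contD: "continuous_on S (\<lambda>a. Blinfun (D a))"
  proof (rule continuous_on_blinfun_componentwise)
    fix b :: "real ^ 'n" assume "b \<in> Basis"
    have "continuous_on S (\<lambda>a. frechet_derivative t\<Theta> (at a) b)"
    proof (rule continuous_at_imp_continuous_on, rule ballI)
      fix a assume "a \<in> S"
      then show "isCont (\<lambda>a. frechet_derivative t\<Theta> (at a) b) a"
        by (intro differentiable_imp_continuous_within smooth_on_differentiable[OF smooth_on_frechet_derivative[OF sm]])
    qed
    then have "continuous_on S (\<lambda>a. D a b)"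
      unfolding D_def by (intro continuous_intros bounded_linear.continuous_on[OF bl\<theta>])
    then show "continuous_on S (\<lambda>a. blinfun_apply (Blinfun (D a)) b)"
      by (rule continuous_on_cong[THEN iffD1, rotated 2]) (auto simp: bD)
  qed
  have inv_o: "id_blinfun o\<^sub>L Blinfun (D o') = id_blinfun"
    by (rule blinfun_eqI) (simp only: blinfun_apply_blinfun_compose bD[OF oS], simp add: D_o)
  have d\<psi>': "(\<psi> has_derivative blinfun_apply (Blinfun (D a))) (at a)" if "a \<in> S" for a
    using d\<psi>[OF that] bD[OF that] by simp
  obtain U' V g g' where IF: "open U'" "U' \<subseteq> S" "o' \<in> U'" "open V" "\<psi> o' \<in> V" "homeomorphism U' V \<psi> g"
    "\<And>y. y \<in> V \<Longrightarrow> (g has_derivative (g' y)) (at y)"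
    "\<And>y. y \<in> V \<Longrightarrow> g' y = inv_into UNIV (blinfun_apply (Blinfun (D (g y))))"
    using inverse_function_theorem[OF Sopen d\<psi>' contD oS inv_o] by metis
  have \<psi>o: "\<psi> o' = o'" unfolding \<psi>_def t\<Theta>o using linear_0[OF lin\<theta>] by (simp flip: scaleR_2)
  have g\<psi>: "a \<in> U' \<Longrightarrow> g (\<psi> a) = a" "y \<in> V \<Longrightarrow> \<psi> (g y) = y" "y \<in> V \<Longrightarrow> g y \<in> U'" for a y
    using IF(6) unfolding homeomorphism_def by auto
  have go: "g o' = o'" using g\<psi>(1)[OF IF(3)] \<psi>o by simp
  have "g' o' = inv_into UNIV (D o')" using IF(8)[of o'] IF(5) \<psi>o go bD[OF oS] by simp
  also have "\<dots> = (\<lambda>v. v)" unfolding D_o by (simp add: inv_id[unfolded id_def])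
  finally have dg: "(g has_derivative (\<lambda>v. v)) (at o')" using IF(7)[of o'] IF(5) \<psi>o by simp
  define a where "a = (\<lambda>t::real. g (o' + t *\<^sub>R X))"
  have da: "(a has_vector_derivative X) (at 0)"
  proof -
    have l: "((\<lambda>t::real. o' + t *\<^sub>R X) has_vector_derivative X) (at 0)"
      by (auto intro!: derivative_eq_intros)
    have "(g \<circ> (\<lambda>t::real. o' + t *\<^sub>R X) has_vector_derivative (\<lambda>v. v) X) (at 0)"
      by (rule vector_derivative_diff_chain_within[OF l]) (use dg in \<open>simp add: has_derivative_at_withinI\<close>)
    then show ?thesis by (simp add: a_def o_def)
  qed
  have a0: "a 0 = o'" by (simp add: a_def go)
  have ca: "isCont a 0" using has_vector_derivative_continuous[OF da] .
  have ct: "isCont t\<Theta> o'" using has_derivative_continuous[OF dt[OF oS]] .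
  have "\<forall>\<^sub>F t in nhds 0. o' + t *\<^sub>R X \<in> V"
  proof -
    have "isCont (\<lambda>t::real. o' + t *\<^sub>R X) 0" by (intro continuous_intros)
    then show ?thesis by (rule eventually_isCont) (use IF(4,5) \<psi>o in auto)
  qed
  moreover have "\<forall>\<^sub>F t in nhds 0. t\<Theta> (a t) \<in> U'"
  proof -
    have "isCont (\<lambda>t. t\<Theta> (a t)) 0" by (rule isCont_o2[OF ca]) (simp add: a0 ct)
    then show ?thesis by (rule eventually_isCont) (use IF(1,3) t\<Theta>o a0 in auto)
  qed
  ultimately have ev: "\<forall>\<^sub>F t in nhds 0. o' + t *\<^sub>R X \<in> V \<and> t\<Theta> (a t) \<in> U'" by (rule eventually_conj_iff[THEN iffD2, OF conjI])
  define P where "P = (\<lambda>t. o' + t *\<^sub>R X \<in> V \<and> t\<Theta> (a t) \<in> U')"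
  have fixed: "t\<Theta> (a t) = a t" "a t \<in> S" if "P t" for t
  proof -
    have aU: "a t \<in> U'" "\<psi> (a t) = o' + t *\<^sub>R X" using that g\<psi> unfolding P_def a_def by auto
    then show aS: "a t \<in> S" using IF(2) by blast
    \<comment> \<open>The point \<open>\<psi> (a t)\<close> lies on the line through
      \<open>o'\<close> in the direction \<open>X\<close>, which is fixed by the affine map. So
      \<open>a t\<close> and its image have the same \<open>\<psi>\<close> coordinate, and
      injectivity of \<open>\<psi>\<close> near \<open>o'\<close> makes them equal.\<close>
    have "\<psi> (t\<Theta> (a t)) = (1/2) *\<^sub>R (t\<Theta> (a t) + o' + \<theta> (a t - o'))" by (simp add: \<psi>_def t\<Theta>S(4)[OF aS])
    also have "\<dots> = o' + \<theta> (\<psi> (a t) - o')"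
    proof -
      have "\<psi> (a t) - o' = (1/2) *\<^sub>R ((a t - o') + \<theta> (t\<Theta> (a t) - o'))"
        by (simp add: \<psi>_def algebra_simps flip: scaleR_2)
      then have "\<theta> (\<psi> (a t) - o') = (1/2) *\<^sub>R (\<theta> (a t - o') + (t\<Theta> (a t) - o'))"
        by (simp only: linear_cmul[OF lin\<theta>] linear_add[OF lin\<theta>] \<theta>\<theta>)
      then show ?thesis by (simp only:) (simp add: vec_eq_iff field_simps)
    qed
    also have "\<dots> = \<psi> (a t)" using aU(2) X linear_cmul[OF lin\<theta>, of t X] by simp
    finally show "t\<Theta> (a t) = a t" using g\<psi>(1) aU(1) that unfolding P_def by metis
  qed
  \<comment> \<open>The curve must consist of fixed points inside the chart for every real
    parameter, hence the value \<open>\<one>\<close> away from 0; near 0 the default is never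
    taken.\<close>
  define c where "c = (\<lambda>t. if P t then \<kappa> (a t) else \<one>)"
  have cU: "c t \<in> U" for t using fixed(2) t\<Theta>S(2) one_U by (simp add: c_def)
  have c\<Theta>: "\<Theta> (c t) = c t" for t
  proof (cases "P t")
    case True
    have "\<phi> (\<Theta> (\<kappa> (a t))) = \<phi> (\<kappa> (a t))"
      using fixed[OF True] t\<Theta>S(3)[OF fixed(2)[OF True]] by (simp add: t\<Theta>_def)
    then show ?thesis
      using inj_onD[OF chart(3)[OF chart_U]] t\<Theta>S(1,2)[OF fixed(2)[OF True]] True by (simp add: c_def)
  qed (simp add: c_def \<Theta>1)
  have c0: "c 0 = \<one>" by (simp add: c_def a0 \<kappa>_one)
  have dc: "((\<lambda>t. \<phi> (c t)) has_vector_derivative X) (at 0)"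
  proof -
    have "\<forall>\<^sub>F t in nhds 0. a t = \<phi> (c t)"
      using ev by (rule eventually_mono) (use fixed(2) t\<Theta>S(3) in \<open>auto simp: c_def P_def\<close>)
    with da show ?thesis unfolding has_vector_derivative_def by (rule has_derivative_eventually_cong)
  qed
  have "((\<lambda>t. Ad G U \<phi> (c t) Y) has_vector_derivative lie_bracket G U \<phi> X Y) (at 0)" for Y
  proof -
    have "((\<lambda>a. Ad G U \<phi> (\<kappa> a) Y) \<circ> (\<lambda>t. \<phi> (c t)) has_vector_derivative (\<lambda>X. lie_bracket G U \<phi> X Y) X) (at 0)"
      by (rule vector_derivative_diff_chain_within[OF dc])
        (use Ad_has_derivative c0 in \<open>simp add: has_derivative_at_withinI\<close>)
    then show ?thesis using inv_chart(1)[OF chart_U cU] by (simp add: o_def)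
  qed
  then show ?thesis using that[of c] cU c\<Theta> c0 dc by blast
qed

end

section \<open>Complexified Lie algebras and the Killing form\<close>

lemma re_im_simps [simp]:
  "re_part (x + y) = re_part x + re_part y" "im_part (x + y) = im_part x + im_part y"
  "re_part (x - y) = re_part x - re_part y" "im_part (x - y) = im_part x - im_part y"
  "re_part (c *s x) = Re c *\<^sub>R re_part x - Im c *\<^sub>R im_part x"
  "im_part (c *s x) = Re c *\<^sub>R im_part x + Im c *\<^sub>R re_part x"
  "re_part (cplx a) = a" "im_part (cplx a) = 0" "re_part (conj_vec x) = re_part x" "im_part (conj_vec x) = - im_part x"
  "cplx (a + b) = cplx a + cplx b" "cplx (a - b) = cplx a - cplx b" "cplx (- a) = - cplx a" "cplx 0 = 0"
  "cplx (r *\<^sub>R a) = of_real r *s cplx a"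
  by (auto simp: re_part_def im_part_def cplx_def conj_vec_def vec_eq_iff)

lemma conj_vec_simps [simp]:
  "conj_vec (x + y) = conj_vec x + conj_vec y" "conj_vec (x - y) = conj_vec x - conj_vec y"
  "conj_vec (- x) = - conj_vec x" "conj_vec 0 = 0"
  "conj_vec (c *s x) = cnj c *s conj_vec x" "conj_vec (conj_vec x) = x" "conj_vec (cplx a) = cplx a"
  by (auto simp: cplx_def conj_vec_def vec_eq_iff)

lemma cplx_decomposition: "z = cplx (re_part z) + \<i> *s cplx (im_part z)"
  by (simp add: re_part_def im_part_def cplx_def vec_eq_iff complex_eq)

lemma cplx_inject: "cplx a + \<i> *s cplx b = cplx a' + \<i> *s cplx b' \<longleftrightarrow> a = a' \<and> b = b'"
  by (auto simp: cplx_def vec_eq_iff complex_eq_iff)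

lemma linear_complexify:
  assumes "linear f"
  shows "Vector_Spaces.linear (*s) (*s) (complexify f)"
  unfolding Vector_Spaces.linear_iff complexify_def
  by (auto simp: vec.vector_space_axioms linear_add[OF assms] linear_diff[OF assms] linear_cmul[OF assms]
      algebra_simps complex_eq_iff vec_eq_iff)

lemma complexify_cplx: "linear f \<Longrightarrow> complexify f (cplx a) = cplx (f a)"
  by (simp add: complexify_def linear_0)

lemma complexify_conj: "linear f \<Longrightarrow> complexify f (conj_vec x) = conj_vec (complexify f x)"
  by (simp add: complexify_def linear_neg)

lemma complexify_comp:
  "complexify f (complexify g x) = complexify (\<lambda>a. f (g a)) x"
  by (simp add: complexify_def)

lemma complexify_ident: "complexify (\<lambda>a. a) x = x"
  using cplx_decomposition[of x] by (simp add: complexify_def)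

lemma matrix_mult_diff:
  fixes X Y Z :: "'a::comm_ring_1 ^ 'n ^ 'n"
  shows "(X - Y) ** Z = X ** Z - Y ** Z" "X ** (Y - Z) = X ** Y - X ** Z"
  by (simp_all add: matrix_matrix_mult_def vec_eq_iff left_diff_distrib right_diff_distrib sum_subtractf)

locale real_lie_algebra =
  fixes br0 :: "real ^ 'n \<Rightarrow> real ^ 'n \<Rightarrow> real ^ 'n"
  assumes lie: "lie_algebra (*\<^sub>R) br0"
begin

abbreviation br where "br \<equiv> complexify2 br0"
abbreviation B where "B \<equiv> killing_form br"

lemma linear_br0: "linear (br0 x)" "linear (\<lambda>x. br0 x y)"
proof -
  have "Modules.module_hom (*\<^sub>R) (*\<^sub>R) (br0 x)" "Modules.module_hom (*\<^sub>R) (*\<^sub>R) (\<lambda>x. br0 x y)"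
    using lie unfolding lie_algebra_def by blast+
  then show "linear (br0 x)" "linear (\<lambda>x. br0 x y)"
    using module_hom.add module_hom.scale by (blast intro!: linearI)+
qed

lemmas br0_simps [simp] = linear_add[OF linear_br0(1)] linear_add[OF linear_br0(2)]
  linear_diff[OF linear_br0(1)] linear_diff[OF linear_br0(2)] linear_cmul[OF linear_br0(1)] linear_cmul[OF linear_br0(2)]
  linear_0[OF linear_br0(1)] linear_0[OF linear_br0(2)] linear_neg[OF linear_br0(1)] linear_neg[OF linear_br0(2)]

lemma br0_self: "br0 x x = 0"
  using lie unfolding lie_algebra_def by blast

lemma br0_antisym: "br0 x y = - br0 y x"
  using br0_self[of "x + y"] by (simp add: br0_self[of x] br0_self[of y] eq_neg_iff_add_eq_0 add.commute)

lemma br0_jacobi: "br0 x (br0 y z) + br0 y (br0 z x) + br0 z (br0 x y) = 0"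
  using lie unfolding lie_algebra_def by blast

lemma linear_br: "Vector_Spaces.linear (*s) (*s) (br x)"
  unfolding Vector_Spaces.linear_iff complexify2_def
  by (auto simp: vec.vector_space_axioms algebra_simps complex_eq_iff vec_eq_iff)

lemma br_antisym: "br x y = - br y x"
  unfolding complexify2_def
  using br0_antisym[of "re_part x"] br0_antisym[of "im_part x"]
  by (subst (1 2) br0_antisym[of "re_part x"], subst (1 2) br0_antisym[of "im_part x"])
    (simp add: algebra_simps vec_eq_iff)

lemma linear_br_left: "Vector_Spaces.linear (*s) (*s) (\<lambda>x. br x y)"
  unfolding Vector_Spaces.linear_iff complexify2_def
  by (auto simp: vec.vector_space_axioms algebra_simps complex_eq_iff vec_eq_iff)

lemmas br_simps = linearD[OF linear_br] linearD[OF linear_br_left]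

lemma br_cplx: "br (cplx a) (cplx b) = cplx (br0 a b)"
  by (simp add: complexify2_def)

lemma br_jacobi: "br x (br y z) + br y (br z x) + br z (br x y) = 0"
proof -
  have r: "br (cplx a) (br (cplx b) (cplx c)) + br (cplx b) (br (cplx c) (cplx a)) + br (cplx c) (br (cplx a) (cplx b)) = 0" for a b c
    unfolding br_cplx by (simp add: br0_jacobi flip: re_im_simps(11))
  have r': "br (cplx a) (br (cplx b) (cplx c)) = - (br (cplx b) (br (cplx c) (cplx a)) + br (cplx c) (br (cplx a) (cplx b)))" for a b c
    using r[of a b c] by (simp only: eq_neg_iff_add_eq_0 add.assoc)
  show ?thesis
    by (subst (1 2 3) cplx_decomposition[of x], subst (1 2 3) cplx_decomposition[of y], subst (1 2 3) cplx_decomposition[of z])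
      (simp add: br_simps r'[of _ "re_part y"] r'[of _ "im_part y"] algebra_simps)
qed

lemma br_bracket: "br (br x y) z = br x (br y z) - br y (br x z)"
proof -
  have "br x (br y z) + br y (br z x) + br z (br x y) = 0" by (rule br_jacobi)
  moreover have "br y (br z x) = - br y (br x z)" using br_antisym[of z x] by (simp add: br_simps)
  moreover have "br z (br x y) = - br (br x y) z" by (rule br_antisym)
  ultimately show ?thesis by (simp add: algebra_simps)
qed

lemma br_conj: "br (conj_vec x) (conj_vec y) = conj_vec (br x y)"
  by (simp add: complexify2_def algebra_simps)

lemma complexify_automorphism:
  assumes "linear f" "\<And>x y. f (br0 x y) = br0 (f x) (f y)"
  shows "complexify f (br x y) = br (complexify f x) (complexify f y)"
  by (simp add: complexify_def complexify2_def assms(2) linear_add[OF assms(1)] linear_diff[OF assms(1)])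

lemma B_sum: "B x y = (\<Sum>k\<in>UNIV. br x (br y (axis k 1)) $ k)"
  by (simp add: killing_form_def trace_def matrix_def)

lemma B_trace: "B x y = trace (matrix (br x) ** matrix (br y))"
  unfolding killing_form_def using matrix_compose_gen[OF linear_br[of y] linear_br[of x]] by (simp add: o_def)

lemma B_sym: "B x y = B y x"
  unfolding B_trace by (rule trace_mul_sym)

lemma linear_B: "Vector_Spaces.linear (*s) (*) (B x)"
  unfolding Vector_Spaces.linear_iff
  by (auto simp: vec.vector_space_axioms vector_space_complex B_sum br_simps sum.distrib sum_distrib_left)

lemma linear_B_left: "Vector_Spaces.linear (*s) (*) (\<lambda>x. B x y)"
  using linear_B[of y] by (simp add: B_sym[of _ y])

lemmas B_simps = linearD[OF linear_B] linearD[OF linear_B_left]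

text \<open>The operator of a bracket is a commutator of matrices, and the trace is cyclic.\<close>

lemma B_invariant: "B (br x y) z = B x (br y z)"
proof -
  have m: "matrix (br (br x y)) = matrix (br x) ** matrix (br y) - matrix (br y) ** matrix (br x)" for x y
  proof -
    have "matrix (br (br x y)) = matrix (br x \<circ> br y) - matrix (br y \<circ> br x)"
      by (simp add: matrix_def vec_eq_iff br_bracket)
    then show ?thesis
      using matrix_compose_gen[OF linear_br[of y] linear_br[of x]] matrix_compose_gen[OF linear_br[of x] linear_br[of y]] by simp
  qed
  have "trace (Y ** X ** Z) = trace (X ** (Z ** Y))" for X Y Z :: "complex ^ 'n ^ 'n"
    using trace_mul_sym[of Y "X ** Z"] by (simp add: matrix_mul_assoc)
  then show ?thesis
    unfolding B_trace m by (simp add: matrix_mult_diff trace_sub matrix_mul_assoc)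
qed

text \<open>An automorphism conjugates the operators \<open>br x\<close>, and traces do not change
  under conjugation.\<close>

lemma B_automorphism:
  assumes lin: "Vector_Spaces.linear (*s) (*s) f" "Vector_Spaces.linear (*s) (*s) f'"
    and inv: "\<And>x. f (f' x) = x" "\<And>x. f' (f x) = x"
    and aut: "\<And>x y. f (br x y) = br (f x) (f y)"
  shows "B (f x) (f y) = B x y"
proof -
  have m: "matrix (br (f x)) = matrix f ** matrix (br x) ** matrix f'" for x
  proof -
    have "br (f x) = f \<circ> (br x \<circ> f')" by (simp add: fun_eq_iff aut inv)
    then show ?thesis
      using matrix_compose_gen[OF lin(2) linear_br[of x]]
        matrix_compose_gen[OF Vector_Spaces.linear_compose[OF lin(2) linear_br[of x]] lin(1)]
      by (simp add: matrix_mul_assoc)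
  qed
  have "f' \<circ> f = id" by (simp add: fun_eq_iff inv)
  then have id: "matrix f' ** matrix f = mat 1"
    using matrix_compose_gen[OF lin] by (metis matrix_id_mat_1)
  have "B (f x) (f y) = trace (matrix f ** (matrix (br x) ** (matrix f' ** matrix f) ** matrix (br y) ** matrix f'))"
    unfolding B_trace m by (simp only: matrix_mul_assoc)
  also have "\<dots> = trace (matrix (br x) ** matrix (br y) ** matrix f' ** matrix f)"
    unfolding id matrix_mul_rid by (rule trace_mul_sym)
  also have "\<dots> = trace (matrix (br x) ** matrix (br y) ** (matrix f' ** matrix f))" by (simp only: matrix_mul_assoc)
  also have "\<dots> = B x y" unfolding id matrix_mul_rid B_trace ..
  finally show ?thesis .
qed

lemma B_conj: "B (conj_vec x) (conj_vec y) = cnj (B x y)"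
proof -
  have "conj_vec (axis k 1) = axis k 1" for k :: 'n
    by (simp add: conj_vec_def axis_def vec_eq_iff)
  then have "br (conj_vec x) (br (conj_vec y) (axis k 1)) = conj_vec (br x (br y (axis k 1)))" for k
    using br_conj by metis
  then show ?thesis by (simp add: B_sum conj_vec_def)
qed

lemma B_cplx: "B (cplx a) (cplx b) = of_real (killing_form br0 a b)"
proof -
  have "axis k 1 = cplx (axis k 1)" for k :: 'n
    by (simp add: cplx_def axis_def vec_eq_iff)
  then have "br (cplx a) (br (cplx b) (axis k 1)) = cplx (br0 a (br0 b (axis k 1)))" for k
    using br_cplx by metis
  then show ?thesis by (simp add: B_sum killing_form_def trace_def matrix_def cplx_def)
qed

end

locale cartan_pair = real_lie_algebra br0 for br0 :: "real ^ 'n \<Rightarrow> real ^ 'n \<Rightarrow> real ^ 'n" +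
  fixes \<theta>0 :: "real ^ 'n \<Rightarrow> real ^ 'n"
  assumes cartan: "cartan_involution br0 \<theta>0"
begin

abbreviation \<theta> where "\<theta> \<equiv> complexify \<theta>0"
abbreviation h where "h \<equiv> u_form br \<theta>"

lemma linear_\<theta>0: "linear \<theta>0" and \<theta>0_\<theta>0: "\<theta>0 (\<theta>0 x) = x"
  and \<theta>0_br0: "\<theta>0 (br0 x y) = br0 (\<theta>0 x) (\<theta>0 y)" and \<theta>0_neg: "x \<noteq> 0 \<Longrightarrow> killing_form br0 x (\<theta>0 x) < 0"
  using cartan unfolding cartan_involution_def by auto

lemma linear_\<theta>: "Vector_Spaces.linear (*s) (*s) \<theta>"
  by (rule linear_complexify[OF linear_\<theta>0])

lemmas \<theta>_simps = linearD[OF linear_\<theta>]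

lemma \<theta>_\<theta>: "\<theta> (\<theta> x) = x"
  by (simp add: complexify_comp \<theta>0_\<theta>0 complexify_ident)

lemma \<theta>_br: "\<theta> (br x y) = br (\<theta> x) (\<theta> y)"
  by (rule complexify_automorphism[OF linear_\<theta>0 \<theta>0_br0])

lemma \<theta>_conj: "\<theta> (conj_vec x) = conj_vec (\<theta> x)"
  by (rule complexify_conj[OF linear_\<theta>0])

lemma B_\<theta>: "B (\<theta> x) (\<theta> y) = B x y"
  by (rule B_automorphism[OF linear_\<theta> linear_\<theta> \<theta>_\<theta> \<theta>_\<theta> \<theta>_br])

lemma B_\<theta>_orthogonal: "\<theta> x = - x \<Longrightarrow> \<theta> y = y \<Longrightarrow> B x y = 0"
  using B_\<theta>[of x y] by (simp add: B_simps)

lemma h_eq: "h x y = B x ((- 2) *s \<theta> (conj_vec y))"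
  by (simp add: u_form_def B_simps)

text \<open>Positivity holds on the whole complexified algebra. Splitting \<open>x\<close> into real
  and imaginary parts, the mixed terms drop out of the real part, and by the Cartan condition the
  remaining ones are negative unless zero before the factor -2 is applied.\<close>

lemma hermitian_h: "hermitian_space (*s) h UNIV"
proof unfold_locales
  show "sesquilinear_on (*s) UNIV h"
    unfolding sesquilinear_on_def u_form_def by (auto simp: B_simps \<theta>_simps algebra_simps)
  show "h y x = cnj (h x y)" for x y
  proof -
    have "cnj (B x (\<theta> (conj_vec y))) = B (conj_vec x) (\<theta> y)"
      by (simp add: \<theta>_conj flip: B_conj)
    also have "\<dots> = B (\<theta> (conj_vec x)) y" using B_\<theta>[of "conj_vec x" "\<theta> y"] by (simp add: \<theta>_\<theta>)
    also have "\<dots> = B y (\<theta> (conj_vec x))" by (rule B_sym)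
    finally show ?thesis by (simp add: u_form_def)
  qed
  show "vec.subspace UNIV" by simp
  show "0 < Re (h x x)" if "x \<noteq> 0" for x
  proof -
    define a where "a = re_part x"
    define b where "b = im_part x"
    have x: "x = cplx a + \<i> *s cplx b" unfolding a_def b_def by (rule cplx_decomposition)
    have t: "\<theta> (cplx a) = cplx (\<theta>0 a)" "\<theta> (cplx b) = cplx (\<theta>0 b)" by (simp_all add: complexify_cplx linear_\<theta>0)
    have "Re (B x (\<theta> (conj_vec x))) = killing_form br0 a (\<theta>0 a) + killing_form br0 b (\<theta>0 b)"
      unfolding x by (simp add: \<theta>_simps t B_simps B_cplx)
    moreover have "a \<noteq> 0 \<or> b \<noteq> 0" using that x by auto
    moreover have "killing_form br0 y (\<theta>0 y) \<le> 0" for y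
    proof (cases "y = 0")
      case True
      then show ?thesis using B_cplx[of 0 "\<theta>0 0"] by (simp add: B_simps)
    qed (use \<theta>0_neg[of y] in simp)
    ultimately have "Re (B x (\<theta> (conj_vec x))) < 0" using \<theta>0_neg by (smt (verit))
    then show ?thesis by (simp add: u_form_def)
  qed
qed

end

section \<open>The Hermitian symmetric case\<close>

lemma bracket_span_image:
  assumes f: "Vector_Spaces.linear (*s) (*s) f" and aut: "\<And>x y. f (br x y) = br (f x) (f y)"
  shows "f ` bracket_span (*s) br X Y = bracket_span (*s) br (f ` X) (f ` Y)"
proof -
  interpret Vector_Spaces.linear "(*s)" "(*s)" f by (rule f)
  have "f ` {br a b | a b. a \<in> X \<and> b \<in> Y} = {br a b | a b. a \<in> f ` X \<and> b \<in> f ` Y}"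
  proof (intro subset_antisym subsetI)
    fix z assume "z \<in> {br a b | a b. a \<in> f ` X \<and> b \<in> f ` Y}"
    then obtain a b where "a \<in> X" "b \<in> Y" "z = f (br a b)" by (auto simp: aut)
    then show "z \<in> f ` {br a b | a b. a \<in> X \<and> b \<in> Y}" by blast
  next
    fix z assume "z \<in> f ` {br a b | a b. a \<in> X \<and> b \<in> Y}"
    then obtain a b where "a \<in> X" "b \<in> Y" "z = br (f a) (f b)" by (auto simp: aut)
    then show "z \<in> {br a b | a b. a \<in> f ` X \<and> b \<in> f ` Y}" by blast
  qed
  then show ?thesis unfolding bracket_span_def by (simp flip: span_image)
qed

lemma lie_nilpotent_image:
  assumes f: "Vector_Spaces.linear (*s) (*s) f" and aut: "\<And>x y. f (br x y) = br (f x) (f y)"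
    and "lie_nilpotent (*s) br X"
  shows "lie_nilpotent (*s) br (f ` X)"
proof -
  have "((\<lambda>A. bracket_span (*s) br (f ` X) A) ^^ m) (f ` X) = f ` ((\<lambda>A. bracket_span (*s) br X A) ^^ m) X" for m
    by (induction m) (simp_all only: funpow.simps o_apply id_apply bracket_span_image[of f br, OF f aut])
  moreover obtain m where "((\<lambda>A. bracket_span (*s) br X A) ^^ m) X = {0}"
    using assms(3) unfolding lie_nilpotent_def by blast
  ultimately have "((\<lambda>A. bracket_span (*s) br (f ` X) A) ^^ m) (f ` X) = {0}"
    by (simp only: image_insert image_empty linearD(1)[OF f])
  then show ?thesis unfolding lie_nilpotent_def by blast
qed

lemma nilradicalD:
  assumes "is_nilradical s br q u"
  shows "module.subspace s u" "u \<subseteq> q" "x \<in> q \<Longrightarrow> y \<in> u \<Longrightarrow> br x y \<in> u" "lie_nilpotent s br u"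
    "lie_ideal s br q I \<Longrightarrow> lie_nilpotent s br I \<Longrightarrow> I \<subseteq> u"
  using assms by (simp_all add: is_nilradical_def lie_ideal_def)

locale hermitian_parabolic = cartan_pair br0 \<theta>0
  for br0 :: "real ^ 'n \<Rightarrow> real ^ 'n \<Rightarrow> real ^ 'n" and \<theta>0 +
  fixes K :: "'g set" and AdK :: "'g \<Rightarrow> complex ^ 'n \<Rightarrow> complex ^ 'n"
    and pplus pminus q l u :: "(complex ^ 'n) set"
  assumes hermitian: "hermitian_symmetric br \<theta> K AdK pplus pminus"
    and parabolic: "theta_stable_parabolic br \<theta> q l u"
    and u_sup: "pplus \<subseteq> u"
begin

sublocale U: hermitian_space "(*s)" h UNIV by (rule hermitian_h)

lemma pminus_eq: "pminus = conj_vec ` pplus"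
  and subspace_pplus: "vec.subspace pplus" and subspace_pminus: "vec.subspace pminus"
  and p_decomposition: "internal_direct_sum [pplus, pminus] {x. \<theta> x = - x}"
  and AdK_p: "k \<in> K \<Longrightarrow> AdK k ` pplus \<subseteq> pplus \<and> AdK k ` pminus \<subseteq> pminus"
  and pminus_abelian: "x \<in> pminus \<Longrightarrow> y \<in> pminus \<Longrightarrow> br x y = 0"
  and levi: "levi_decomposition (*s) br {x + y | x y. \<theta> x = x \<and> y \<in> pplus} {x. \<theta> x = x} pplus"
  using hermitian unfolding hermitian_symmetric_def lie_subalgebra_def Let_def by blast+

lemma \<theta>_pplus: "y \<in> pplus \<Longrightarrow> \<theta> y = - y"
  using internal_direct_sum_2D(1)[OF p_decomposition, of y 0] vec.subspace_0[OF subspace_pminus] by simp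

lemma \<theta>_pminus: "y \<in> pminus \<Longrightarrow> \<theta> y = - y"
  using internal_direct_sum_2D(1)[OF p_decomposition, of 0 y] vec.subspace_0[OF subspace_pplus] by simp

lemma conj_fixed: "\<theta> x = x \<Longrightarrow> \<theta> (conj_vec x) = conj_vec x"
  by (simp add: \<theta>_conj)

lemma br_k_pplus: "\<theta> x = x \<Longrightarrow> y \<in> pplus \<Longrightarrow> br x y \<in> pplus"
proof -
  assume x: "\<theta> x = x" and y: "y \<in> pplus"
  have "x \<in> {x + y | x y. \<theta> x = x \<and> y \<in> pplus}"
    by (intro CollectI exI[of _ x] exI[of _ "0 :: complex ^ 'n"]) (use x vec.subspace_0[OF subspace_pplus] in simp)
  then show ?thesis
    using y by (rule nilradicalD(3)[OF conjunct1[OF conjunct2[OF levi[unfolded levi_decomposition_def]]]])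
qed

lemma br_k_pminus: "\<theta> x = x \<Longrightarrow> y \<in> pminus \<Longrightarrow> br x y \<in> pminus"
proof -
  assume x: "\<theta> x = x" and "y \<in> pminus"
  then obtain z where z: "z \<in> pplus" "y = conj_vec z" unfolding pminus_eq by blast
  have "br x y = conj_vec (br (conj_vec x) z)" using br_conj[of "conj_vec x" z] z by simp
  then show ?thesis using br_k_pplus[OF conj_fixed[OF x] z(1)] unfolding pminus_eq by blast
qed

lemma u_nilradical: "is_nilradical (*s) br q u" and \<theta>_q: "\<theta> ` q = q"
  and u_direct_sum: "internal_direct_sum [conj_vec ` u, l, u] UNIV" and subspace_l: "vec.subspace l"
  using parabolic unfolding theta_stable_parabolic_def levi_decomposition_def lie_subalgebra_def
  by - (elim conjE, assumption)+

lemma subspace_u: "vec.subspace u" and u_q: "u \<subseteq> q" and u_ideal: "x \<in> q \<Longrightarrow> y \<in> u \<Longrightarrow> br x y \<in> u"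
  using nilradicalD(1-3)[OF u_nilradical] by blast+

text \<open>The nilradical is the largest nilpotent ideal of \<open>q\<close>, so the automorphism
  \<open>\<theta>\<close>, which preserves \<open>q\<close>, preserves it as well.\<close>

lemma \<theta>_u: "x \<in> u \<Longrightarrow> \<theta> x \<in> u"
proof -
  assume "x \<in> u"
  interpret L: Vector_Spaces.linear "(*s)" "(*s)" \<theta> by (rule linear_\<theta>)
  have "lie_ideal (*s) br q (\<theta> ` u)"
    unfolding lie_ideal_def
  proof (intro conjI ballI)
    show "vec.subspace (\<theta> ` u)" by (rule L.subspace_image[OF subspace_u])
    show "\<theta> ` u \<subseteq> q" using u_q \<theta>_q by blast
    fix x y assume "x \<in> q" "y \<in> \<theta> ` u"
    then obtain x' y' where "x' \<in> q" "x = \<theta> x'" "y' \<in> u" "y = \<theta> y'" using \<theta>_q by blast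
    then have "br x y = \<theta> (br x' y')" "br x' y' \<in> u" using u_ideal by (simp_all add: \<theta>_br)
    then show "br x y \<in> \<theta> ` u" by blast
  qed
  moreover have "lie_nilpotent (*s) br (\<theta> ` u)"
    by (rule lie_nilpotent_image[of \<theta> br, OF linear_\<theta> \<theta>_br nilradicalD(4)[OF u_nilradical]])
  ultimately have "\<theta> ` u \<subseteq> u" by (rule nilradicalD(5)[OF u_nilradical])
  then show ?thesis using \<open>x \<in> u\<close> by blast
qed

lemma u_conj_u: "x \<in> u \<Longrightarrow> x \<in> conj_vec ` u \<Longrightarrow> x = 0"
proof -
  assume x: "x \<in> u" "x \<in> conj_vec ` u"
  have "0 \<in> conj_vec ` u" using vec.subspace_0[OF subspace_u] by force
  then show ?thesis
    using internal_direct_sum_3D[OF u_direct_sum, of x 0 0 0 0 x] x vec.subspace_0[OF subspace_u] vec.subspace_0[OF subspace_l]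
    by auto
qed

text \<open>Split \<open>x\<close> into eigenvectors of \<open>\<theta>\<close>. The
  \<open>pminus\<close> component of the part with eigenvalue -1 lies in \<open>u\<close>, because
  the \<open>pplus\<close> component does, and also in the conjugate of \<open>u\<close>; these two
  spaces meet in 0.\<close>

lemma u_decomposition:
  assumes x: "x \<in> u"
  shows "\<exists>y\<in>pplus. \<exists>z\<in>u. \<theta> z = z \<and> x = y + z"
proof -
  define z where "z = (1/2) *s (x + \<theta> x)"
  define p where "p = (1/2) *s (x - \<theta> x)"
  have zu: "z \<in> u" "p \<in> u" unfolding z_def p_def
    using x \<theta>_u[OF x] subspace_u by (auto intro: vec.subspace_scale vec.subspace_add vec.subspace_diff)
  have xz: "x = p + z" by (simp add: z_def p_def vec_eq_iff field_simps)
  have "\<theta> z = z" "\<theta> p = - p" by (simp_all add: z_def p_def \<theta>_simps \<theta>_\<theta> add.commute vec_eq_iff field_simps)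
  then obtain y w where yw: "y \<in> pplus" "w \<in> pminus" "p = y + w"
    using internal_direct_sum_2D(2)[OF p_decomposition, of p] by auto
  have "w = p - y" using yw by simp
  then have "w \<in> u" using zu yw u_sup subspace_u vec.subspace_diff by blast
  moreover have "w \<in> conj_vec ` u" using yw(2) u_sup unfolding pminus_eq by blast
  ultimately have "w = 0" by (rule u_conj_u)
  then show ?thesis using yw zu xz \<open>\<theta> z = z\<close> by auto
qed

text \<open>The eigenspaces of \<open>\<theta>\<close> are orthogonal for the Killing form, so
  orthonormal bases of \<open>pplus\<close> and of the fixed part of \<open>u\<close> can be
  concatenated.\<close>

lemma exists_frame:
  obtains fP fQ where "U.orthonormal fP" "vec.span (set fP) = pplus" "\<And>f. f \<in> set fQ \<Longrightarrow> \<theta> f = f"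
    "U.orthonormal (fP @ fQ)" "vec.span (set (fP @ fQ)) = u"
proof -
  have fd: "fin_dim (*s) X" for X :: "(complex ^ 'n) set"
    unfolding fin_dim_def using finite_cart_basis span_cart_basis by blast
  let ?uk = "{z \<in> u. \<theta> z = z}"
  have suk: "vec.subspace ?uk"
    using subspace_u unfolding vec.subspace_def by (auto simp: \<theta>_simps)
  obtain fP where fP: "U.orthonormal fP" "vec.span (set fP) = pplus"
    using U.orthonormal_basis[OF fd subspace_pplus] by blast
  obtain fQ where fQ: "U.orthonormal fQ" "vec.span (set fQ) = ?uk"
    using U.orthonormal_basis[OF fd suk] by blast
  have P: "set fP \<subseteq> pplus" and Q: "set fQ \<subseteq> ?uk" using fP(2) fQ(2) vec.span_superset by blast+
  have orth: "h x y = 0" "h y x = 0" if "x \<in> set fP" "y \<in> set fQ" for x y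
  proof -
    have "\<theta> x = - x" "\<theta> (\<theta> (conj_vec y)) = \<theta> (conj_vec y)" using that P Q \<theta>_pplus by (auto simp: \<theta>_conj)
    then have "B x (\<theta> (conj_vec y)) = 0" by (rule B_\<theta>_orthogonal)
    then show "h x y = 0" by (simp add: u_form_def)
    then show "h y x = 0" by (rule U.h_eq_0_swap)
  qed
  have disj: "x \<noteq> y" if "x \<in> set fP" "y \<in> set fQ" for x y
    using orth[OF that] U.orthonormalD(2)[OF fP(1) that(1) that(1)] by auto
  have "U.orthonormal (fP @ fQ)"
  proof (rule U.orthonormalI)
    show "distinct (fP @ fQ)" using U.orthonormalD(1)[OF fP(1)] U.orthonormalD(1)[OF fQ(1)] disj by auto
    show "h a b = (if a = b then 1 else 0)" if "a \<in> set (fP @ fQ)" "b \<in> set (fP @ fQ)" for a b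
      using that U.orthonormalD(2)[OF fP(1)] U.orthonormalD(2)[OF fQ(1)] orth disj by auto
  qed
  moreover have "vec.span (set (fP @ fQ)) = u"
  proof
    show "vec.span (set (fP @ fQ)) \<subseteq> u"
      using P Q u_sup by (intro vec.span_minimal subspace_u) auto
    show "u \<subseteq> vec.span (set (fP @ fQ))"
    proof
      fix x assume "x \<in> u"
      then obtain y z where "y \<in> vec.span (set fP)" "z \<in> vec.span (set fQ)" "x = y + z"
        using u_decomposition[of x] fP(2) fQ(2) by auto
      moreover have "vec.span (set fP) \<subseteq> vec.span (set (fP @ fQ))" "vec.span (set fQ) \<subseteq> vec.span (set (fP @ fQ))"
        by (intro vec.span_mono; simp)+
      ultimately show "x \<in> vec.span (set (fP @ fQ))" using vec.span_add by blast
    qed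
  qed
  ultimately show ?thesis using that fP Q by blast
qed

end

locale cohomology_setting = lie_chart G T A U \<phi> +
  hermitian_parabolic "lie_bracket G U \<phi>" "diff_at_one G U \<phi> \<Theta>" "{k \<in> carrier G. \<Theta> k = k}"
    "\<lambda>k. complexify (Ad G U \<phi> k)" pplus pminus q l u
  for G :: "('g, 'm) monoid_scheme" (structure) and T :: "'g topology"
    and A :: "('g set \<times> ('g \<Rightarrow> real ^ 'n)) set" and U :: "'g set" and \<phi> :: "'g \<Rightarrow> real ^ 'n"
    and \<Theta> :: "'g \<Rightarrow> 'g" and pplus pminus q l u :: "(complex ^ 'n) set" +
  fixes s :: "complex \<Rightarrow> 'v::ab_group_add \<Rightarrow> 'v"
    and \<pi> :: "complex ^ 'n \<Rightarrow> 'v \<Rightarrow> 'v" and \<rho> :: "'g \<Rightarrow> 'v \<Rightarrow> 'v" and H :: "'v \<Rightarrow> 'v \<Rightarrow> complex"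
    and us ds :: "(complex ^ 'n) list"
  assumes Theta: "\<Theta> \<in> iso G G" "smooth_map T A T A \<Theta>" "\<forall>x\<in>carrier G. \<Theta> (\<Theta> x) = x"
    and V: "gK_module G T U \<phi> {k \<in> carrier G. \<Theta> k = k} s \<pi> \<rho>" "admissible s {k \<in> carrier G. \<Theta> k = k} \<rho>"
      "unitary_form {k \<in> carrier G. \<Theta> k = k} s \<pi> \<rho> H"
    and bases: "dual_bases B u (conj_vec ` u) us ds"
begin

abbreviation K where "K \<equiv> {k \<in> carrier G. \<Theta> k = k}"
abbreviation M where "M k \<equiv> complexify (Ad G U \<phi> k)"

lemma K_inv: "k \<in> K \<Longrightarrow> inv k \<in> K"
proof -
  assume k: "k \<in> K"
  interpret \<Theta>: group_hom G G \<Theta>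
    using Theta(1) unfolding iso_def by unfold_locales simp
  show ?thesis using k by simp
qed

lemma linear_M: "k \<in> K \<Longrightarrow> Vector_Spaces.linear (*s) (*s) (M k)"
  using linear_complexify[OF linear_Ad] by simp

lemma M_inverse:
  assumes "k \<in> K"
  shows "M k (M (inv k) x) = x" "M (inv k) (M k x) = x"
proof -
  have k: "k \<in> carrier G" using assms by simp
  have "(\<lambda>a. Ad G U \<phi> k (Ad G U \<phi> (inv k) a)) = (\<lambda>a. a)" "(\<lambda>a. Ad G U \<phi> (inv k) (Ad G U \<phi> k a)) = (\<lambda>a. a)"
    using Ad_mult[of k "inv k"] Ad_mult[of "inv k" k] k Ad_one by (simp_all add: o_def)
  then show "M k (M (inv k) x) = x" "M (inv k) (M k x) = x"
    by (simp_all add: complexify_comp complexify_ident)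
qed

lemma B_M:
  assumes k: "k \<in> K"
  shows "B (M k x) (M k y) = B x y"
proof (rule B_automorphism[OF linear_M[OF k] linear_M[OF K_inv[OF k]] M_inverse[OF k]])
  have "k \<in> carrier G" using k by simp
  then show "M k (br x y) = br (M k x) (M k y)" for x y
    by (intro complexify_automorphism linear_Ad Ad_lie_bracket)
qed

lemma vector_space_s: "vector_space s"
  and linear_\<pi>: "Vector_Spaces.linear s s (\<pi> x)" and linear_\<pi>_left: "Vector_Spaces.linear (*s) s (\<lambda>x. \<pi> x v)"
  and \<pi>_br: "\<pi> (br x y) v = \<pi> x (\<pi> y v) - \<pi> y (\<pi> x v)"
  and linear_\<rho>: "k \<in> K \<Longrightarrow> Vector_Spaces.linear s s (\<rho> k)" and \<rho>_one: "\<rho> \<one> v = v"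
  and \<rho>_mult: "k \<in> K \<Longrightarrow> k' \<in> K \<Longrightarrow> \<rho> (k \<otimes> k') v = \<rho> k (\<rho> k' v)"
  and \<rho>_fin: "fin_dim s ((\<lambda>k. \<rho> k v) ` K)"
  and \<rho>_\<pi>: "k \<in> K \<Longrightarrow> \<rho> k (\<pi> x v) = \<pi> (M k x) (\<rho> k v)"
  using V(1) by (simp_all add: gK_module_def)

lemma \<rho>_derivative:
  fixes c :: "real \<Rightarrow> 'g"
  assumes "\<And>t. c t \<in> K \<inter> U" "c 0 = \<one>" "((\<lambda>t. \<phi> (c t)) has_vector_derivative X) (at 0)"
    "Vector_Spaces.linear s (*) f"
  shows "((\<lambda>t. f (\<rho> (c t) v) :: complex) has_vector_derivative f (\<pi> (cplx X) v)) (at 0)"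
  using V(1) assms unfolding gK_module_def by blast

sublocale V: hermitian_space s H UNIV
  by (rule pos_def_hermitian_space[OF vector_space_s]) (use V(3) in \<open>auto simp: unitary_form_def\<close>)

text \<open>The skew-Hermitian condition for real vectors, extended to complex ones; the conjugate
  of \<open>z\<close> appears because \<open>H\<close> is conjugate-linear in its second
  argument.\<close>

lemma \<pi>_adjoint: "H (\<pi> z v) w = H v (- \<pi> (conj_vec z) w)"
proof -
  have u: "H (\<pi> (cplx X) v) w = - H v (\<pi> (cplx X) w)" for X v w
    using V(3) unfolding unitary_form_def by blast
  define a where "a = cplx (re_part z)"
  define b where "b = cplx (im_part z)"
  have z: "z = a + \<i> *s b" "conj_vec z = a + (- \<i>) *s b"
    unfolding a_def b_def using cplx_decomposition[of z] cplx_decomposition[of "conj_vec z"] by simp_all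
  show ?thesis
    unfolding z linearD(2,5)[OF linear_\<pi>_left] by (simp add: a_def b_def u linearD[OF linear_\<pi>_left])
qed

lemma \<rho>_locally_finite: "\<exists>X. K_stable s K \<rho> X \<and> fin_dim s X \<and> v \<in> X"
proof (intro exI conjI)
  let ?X = "V.span ((\<lambda>k. \<rho> k v) ` K)"
  have one: "\<one> \<in> K"
    using Theta(1) hom_one[of \<Theta> G G] unfolding iso_def by (simp add: group_axioms)
  show "fin_dim s ?X" by (rule V.fin_dim_span[OF \<rho>_fin])
  show "v \<in> ?X" by (intro V.span_base image_eqI[OF _ one]) (simp add: \<rho>_one)
  have "\<rho> k x \<in> ?X" if k: "k \<in> K" and "x \<in> ?X" for k x
  proof (rule linear_span_image[OF linear_\<rho>[OF k] _ that(2)])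
    have "k \<otimes> k' \<in> K" if "k' \<in> K" for k'
      using k that Theta(1) hom_mult[of \<Theta> G G k k'] unfolding iso_def by simp
    then have "\<rho> k (\<rho> k' v) \<in> (\<lambda>k. \<rho> k v) ` K" if "k' \<in> K" for k'
      using that \<rho>_mult[OF k that] by (intro image_eqI[where x = "k \<otimes> k'"]) simp_all
    then have "\<rho> k ` (\<lambda>k. \<rho> k v) ` K \<subseteq> (\<lambda>k. \<rho> k v) ` K" by blast
    then show "\<rho> k ` (\<lambda>k. \<rho> k v) ` K \<subseteq> ?X" using V.span_superset by blast
  qed
  then show "K_stable s K \<rho> ?X" unfolding K_stable_def by auto
qed

end

section \<open>The adapted frame and its structure constants\<close>

locale cohomology_frame = cohomology_setting G T A U \<phi> \<Theta> pplus pminus q l u s \<pi> \<rho> H us ds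
  for G :: "('g, 'm) monoid_scheme" (structure) and T :: "'g topology"
    and A :: "('g set \<times> ('g \<Rightarrow> real ^ 'n)) set" and U :: "'g set" and \<phi> :: "'g \<Rightarrow> real ^ 'n"
    and \<Theta> :: "'g \<Rightarrow> 'g" and pplus pminus q l u :: "(complex ^ 'n) set"
    and s :: "complex \<Rightarrow> 'v::ab_group_add \<Rightarrow> 'v"
    and \<pi> :: "complex ^ 'n \<Rightarrow> 'v \<Rightarrow> 'v" and \<rho> :: "'g \<Rightarrow> 'v \<Rightarrow> 'v" and H :: "'v \<Rightarrow> 'v \<Rightarrow> complex"
    and us ds :: "(complex ^ 'n) list" +
  fixes fP fQ :: "(complex ^ 'n) list"
  assumes orthonormal_fP: "U.orthonormal fP" and span_fP: "vec.span (set fP) = pplus"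
    and \<theta>_fQ: "f \<in> set fQ \<Longrightarrow> \<theta> f = f"
    and orthonormal_fs: "U.orthonormal (fP @ fQ)" and span_fs: "vec.span (set (fP @ fQ)) = u"
begin

abbreviation "fs \<equiv> fP @ fQ"
abbreviation "mP \<equiv> length fP"
abbreviation "nn \<equiv> length (fP @ fQ)"

text \<open>The basis of the conjugate of \<open>u\<close> that is dual to the frame under the
  Killing form: by \<open>B_g\<close>, orthonormality of \<open>fs\<close> is exactly this duality.
  The factor -2 is the one in \<open>u_form\<close>.\<close>

definition g :: "nat \<Rightarrow> complex ^ 'n" where "g a = (- 2) *s \<theta> (conj_vec (fs ! a))"
definition c :: "nat \<Rightarrow> nat \<Rightarrow> nat \<Rightarrow> complex" where "c a b k = B (br (g a) (g b)) (fs ! k)"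

lemma B_g: "B x (g a) = h x (fs ! a)"
  by (simp add: h_eq g_def)

lemma fs_u: "a < nn \<Longrightarrow> fs ! a \<in> u"
  using span_fs vec.span_superset nth_mem by blast

lemma fs_P: "a < mP \<Longrightarrow> fs ! a \<in> pplus"
  using span_fP vec.span_superset[of "set fP"] by (auto simp: nth_append)

lemma fs_Q: "a \<in> {mP..<nn} \<Longrightarrow> \<theta> (fs ! a) = fs ! a"
  by (intro \<theta>_fQ) (auto simp: nth_append)

lemma g_conj_u: "a < nn \<Longrightarrow> g a \<in> conj_vec ` u"
proof -
  assume "a < nn"
  then have "(- 2) *s \<theta> (fs ! a) \<in> u" using fs_u \<theta>_u vec.subspace_scale[OF subspace_u] by blast
  moreover have "g a = conj_vec ((- 2) *s \<theta> (fs ! a))" by (simp add: g_def \<theta>_conj)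
  ultimately show ?thesis by blast
qed

lemma g_P: "a < mP \<Longrightarrow> g a = 2 *s conj_vec (fs ! a)"
proof -
  assume "a < mP"
  then have "\<theta> (conj_vec (fs ! a)) = - conj_vec (fs ! a)" by (simp add: \<theta>_conj \<theta>_pplus fs_P)
  then show ?thesis unfolding g_def by (simp only:) (simp add: vec_eq_iff)
qed

lemma g_pminus: "a < mP \<Longrightarrow> g a \<in> pminus"
  using fs_P vec.subspace_scale[OF subspace_pminus] by (simp add: g_P pminus_eq)

lemma g_Q: "a \<in> {mP..<nn} \<Longrightarrow> \<theta> (g a) = g a"
  using fs_Q[of a] by (simp add: g_def \<theta>_simps \<theta>_conj)

text \<open>The orthonormal expansion in \<open>u\<close>, transported by the conjugate-linear map
  that sends each frame vector \<open>fs ! k\<close> to \<open>g k\<close>.\<close>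

lemma expand_conj_u:
  assumes "z \<in> conj_vec ` u"
  shows "z = (\<Sum>k<nn. B z (fs ! k) *s g k)"
proof -
  obtain w where w: "w \<in> u" "z = conj_vec w" using assms by blast
  define y where "y = (- 1/2) *s \<theta> w"
  have yu: "y \<in> vec.span (set fs)" unfolding span_fs y_def by (intro vec.subspace_scale subspace_u \<theta>_u w)
  have zy: "z = (- 2) *s \<theta> (conj_vec y)"
    using w by (simp add: y_def \<theta>_simps \<theta>_conj \<theta>_\<theta>)
  have "y = (\<Sum>k<nn. h y (fs ! k) *s fs ! k)"
    by (rule U.orthonormal_expansion[OF orthonormal_fs yu]) simp
  then have "z = (- 2) *s \<theta> (conj_vec (\<Sum>k<nn. h y (fs ! k) *s fs ! k))" using zy by simp
  also have "\<dots> = (\<Sum>k<nn. cnj (h y (fs ! k)) *s g k)"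
  proof -
    have cs: "conj_vec (\<Sum>k\<in>I. f k) = (\<Sum>k\<in>I. conj_vec (f k))" for I :: "nat set" and f :: "nat \<Rightarrow> complex ^ 'n"
      by (induction I rule: infinite_finite_induct) auto
    show ?thesis by (simp add: cs \<theta>_simps g_def vec.scale_sum_right mult.commute)
  qed
  also have "\<dots> = (\<Sum>k<nn. B z (fs ! k) *s g k)"
  proof (intro sum.cong refl)
    fix k
    have "cnj (h y (fs ! k)) = h (fs ! k) y" by (rule U.herm[symmetric])
    also have "\<dots> = B z (fs ! k)" unfolding zy h_eq by (rule B_sym)
    finally show "cnj (h y (fs ! k)) *s g k = B z (fs ! k) *s g k" by simp
  qed
  finally show ?thesis .
qed

lemma br_conj_u: "x \<in> conj_vec ` u \<Longrightarrow> y \<in> conj_vec ` u \<Longrightarrow> br x y \<in> conj_vec ` u"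
  using u_ideal u_q br_conj by (auto simp: image_iff) (metis subsetD)

lemma br_g: "a < nn \<Longrightarrow> b < nn \<Longrightarrow> br (g a) (g b) = (\<Sum>k<nn. c a b k *s g k)"
  unfolding c_def by (rule expand_conj_u[OF br_conj_u[OF g_conj_u g_conj_u]])

lemma c_jacobi:
  assumes "a < nn" "b < nn" "d < nn"
  shows "(\<Sum>k<nn. c a b k * c k d m + c b d k * c k a m + c d a k * c k b m) = 0"
proof -
  have s: "(\<Sum>k<nn. c a b k * c k d m) = B (br (br (g a) (g b)) (g d)) (fs ! m)" if "a < nn" "b < nn" for a b d
    unfolding br_g[OF that] by (simp add: br_simps B_simps c_def)
  have "br (br (g a) (g b)) (g d) + br (br (g b) (g d)) (g a) + br (br (g d) (g a)) (g b) = 0"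
  proof -
    have "br (br x y) z = - br z (br x y)" for x y z by (rule br_antisym)
    then show ?thesis
      using br_jacobi[of "g d" "g a" "g b"] by (simp add: neg_eq_iff_add_eq_0 algebra_simps)
  qed
  then have "B (br (br (g a) (g b)) (g d)) (fs ! m) + B (br (br (g b) (g d)) (g a)) (fs ! m) + B (br (br (g d) (g a)) (g b)) (fs ! m) = 0"
    by (metis B_simps(7,8))
  then show ?thesis unfolding sum.distrib s[OF assms(1,2)] s[OF assms(2,3)] s[OF assms(3,1)] by simp
qed

text \<open>This lemma, \<open>c_PQ\<close> and \<open>c_QQ\<close> express that the vectors
  \<open>g a\<close> with \<open>a < mP\<close> span an abelian ideal and the others a subalgebra:
  \<open>pminus\<close> is abelian and stable under k, and brackets of \<open>\<theta>\<close>-fixed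
  vectors are fixed. Orthogonality of the eigenspaces translates this into vanishing
  constants.\<close>

lemma c_PP: "a < mP \<Longrightarrow> b < mP \<Longrightarrow> c a b k = 0"
  using pminus_abelian[OF g_pminus g_pminus] by (simp add: c_def B_simps)

lemma br_g_PQ:
  assumes "a < mP" "b < nn"
  shows "br (g a) (g b) \<in> pminus"
proof (cases "b < mP")
  case True
  then show ?thesis
    using pminus_abelian[OF g_pminus[OF assms(1)] g_pminus[OF True]] vec.subspace_0[OF subspace_pminus] by simp
next
  case False
  then have "br (g b) (g a) \<in> pminus" using assms by (intro br_k_pminus g_Q g_pminus) auto
  then show ?thesis using br_antisym[of "g a" "g b"] vec.subspace_neg[OF subspace_pminus] by simp
qed

lemma c_PQ: "a < mP \<Longrightarrow> b < nn \<Longrightarrow> k \<in> {mP..<nn} \<Longrightarrow> c a b k = 0"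
  unfolding c_def by (rule B_\<theta>_orthogonal[OF \<theta>_pminus[OF br_g_PQ] fs_Q])

lemma c_QQ:
  assumes "a \<in> {mP..<nn}" "b \<in> {mP..<nn}" "k < mP"
  shows "c a b k = 0"
proof -
  have "\<theta> (br (g a) (g b)) = br (g a) (g b)" using g_Q[OF assms(1)] g_Q[OF assms(2)] by (simp add: \<theta>_br)
  then have "B (fs ! k) (br (g a) (g b)) = 0" using \<theta>_pplus[OF fs_P[OF assms(3)]] by (intro B_\<theta>_orthogonal)
  then show ?thesis by (simp add: c_def B_sym)
qed

sublocale C: cohomology_operator s H h fs c "\<lambda>a. \<pi> (g a)" "\<lambda>a v. - \<pi> (conj_vec (g a)) v"
proof (intro cohomology_operator.intro cohomology_operator_axioms.intro)
  show "exterior_form s H h"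
    unfolding exterior_form_def complex_space_def
    by (intro conjI vector_space_s V.hermitian_space_axioms U.hermitian_space_axioms)
  show "U.orthonormal fs" by (rule orthonormal_fs)
  show "Vector_Spaces.linear s s (\<pi> (g a))" for a by (rule linear_\<pi>)
  show "Vector_Spaces.linear s s (\<lambda>v. - \<pi> (conj_vec (g a)) v)" for a
    using linear_\<pi>[of "conj_vec (g a)"] unfolding Vector_Spaces.linear_iff by simp
  show "H (\<pi> (g a) v) w = H v (- \<pi> (conj_vec (g a)) w)" for a v w by (rule \<pi>_adjoint)
  show "c a b k = - c b a k" for a b k
    unfolding c_def by (subst br_antisym) (simp add: B_simps)
  show "(\<Sum>k<nn. c a b k * c k d m + c b d k * c k a m + c d a k * c k b m) = 0"
    if "a < nn" "b < nn" "d < nn" "m < nn" for a b d m by (rule c_jacobi[OF that(1-3)])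
  show "\<pi> (g a) (\<pi> (g b) v) - \<pi> (g b) (\<pi> (g a) v) = (\<Sum>k<nn. s (c a b k) (\<pi> (g k) v))"
    if "a < nn" "b < nn" for a b v
    unfolding \<pi>_br[symmetric] br_g[OF that] by (simp add: linearD[OF linear_\<pi>_left])
qed

sublocale T: twisted_rep s H h K \<rho> fP M
proof (intro twisted_rep.intro twisted_rep_axioms.intro admissible_rep.intro admissible_rep_axioms.intro)
  show "exterior_form s H h" by (rule C.exterior_form_axioms)
  show "hermitian_space s H UNIV" by (rule V.hermitian_space_axioms)
  show "Vector_Spaces.linear s s (\<rho> k)" if "k \<in> K" for k by (rule linear_\<rho>[OF that])
  show "H (\<rho> k v) (\<rho> k w) = H v w" if "k \<in> K" for k v w
    using V(3) that unfolding unitary_form_def by blast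
  have rinv: "\<rho> k (\<rho> (inv k) v) = v" if "k \<in> K" for k v
    using \<rho>_mult[OF that K_inv[OF that]] \<rho>_one that by simp
  then show "\<exists>k'\<in>K. \<forall>v. \<rho> k (\<rho> k' v) = v" if "k \<in> K" for k using K_inv[OF that] that by blast
  show "admissible s K \<rho>" by (rule V(2))
  show "U.orthonormal fP" by (rule orthonormal_fP)
  show "Vector_Spaces.linear (*s) (*s) (M k)" if "k \<in> K" for k by (rule linear_M[OF that])
  show Mp: "M k x \<in> vec.span (set fP)" if "k \<in> K" "x \<in> vec.span (set fP)" for k x
    using AdK_p[OF that(1)] that(2) unfolding span_fP by blast
  \<comment> \<open>On \<open>pplus\<close> and its conjugate the involution is -1, and
    \<open>M k\<close> preserves \<open>pplus\<close>, so isometry reduces to the invariance of the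
    Killing form.\<close>
  show "h (M k x) (M k y) = h x y" if k: "k \<in> K" and "x \<in> vec.span (set fP)" and y: "y \<in> vec.span (set fP)" for k x y
  proof -
    have kc: "k \<in> carrier G" using k by simp
    have "\<theta> (conj_vec (M k y)) = - M k (conj_vec y)" "\<theta> (conj_vec y) = - conj_vec y"
      using \<theta>_pplus Mp[OF k y] y unfolding span_fP
      by (simp_all add: \<theta>_conj complexify_conj[OF linear_Ad[OF kc]])
    then show ?thesis by (simp add: u_form_def B_simps B_M[OF k])
  qed
  show "\<exists>k'\<in>K. (\<forall>v. \<rho> k (\<rho> k' v) = v) \<and> (\<forall>x. M k (M k' x) = x)" if "k \<in> K" for k
    using K_inv[OF that] rinv[OF that] M_inverse(1)[OF that] by blast
  show "\<exists>X. K_stable s K \<rho> X \<and> fin_dim s X \<and> v \<in> X" for v by (rule \<rho>_locally_finite)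
qed

text \<open>For a real fixed vector \<open>X\<close>, differentiate along a curve of fixed points of
  \<open>\<Theta>\<close> with tangent \<open>X\<close>. A complex fixed vector has fixed real and
  imaginary parts, and the infinitesimal action is complex linear in it.\<close>

lemma \<pi>W_stable:
  assumes z: "\<theta> z = z" and Y: "C.FS.subspace Y" "Y \<subseteq> C.fock C.vac fP"
    "\<And>k \<Phi>. k \<in> K \<Longrightarrow> \<Phi> \<in> Y \<Longrightarrow> T.\<rho>W k \<Phi> \<in> Y" and \<Phi>: "\<Phi> \<in> Y"
  shows "T.\<pi>W (br z) (\<pi> z) \<Phi> \<in> Y"
proof -
  have real: "T.\<pi>W (br (cplx X)) (\<pi> (cplx X)) \<Phi> \<in> Y" if X: "diff_at_one G U \<phi> \<Theta> X = X" for X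
  proof -
    obtain k :: "real \<Rightarrow> 'g" where k: "\<And>t. k t \<in> U" "\<And>t. \<Theta> (k t) = k t" "k 0 = \<one>"
      "((\<lambda>t. \<phi> (k t)) has_vector_derivative X) (at 0)"
      "\<And>Y. ((\<lambda>t. Ad G U \<phi> (k t) Y) has_vector_derivative lie_bracket G U \<phi> X Y) (at 0)"
      by (rule fixed_point_curve[OF Theta \<theta>0_\<theta>0 X], rule that)
    have kK: "k t \<in> K" for t using k(1,2) chart(2)[OF chart_U] by auto
    show ?thesis
    proof (rule T.derivative_stable[of k, OF kK _ _ linear_\<pi> _ _ _ Y \<Phi>])
      show "\<rho> (k 0) v = v" for v by (simp add: k(3) \<rho>_one)
      show "M (k 0) x = x" for x by (simp add: k(3) Ad_one complexify_ident)
      show "br (cplx X) x \<in> vec.span (set fP)" if "x \<in> vec.span (set fP)" for x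
        using br_k_pplus[of "cplx X" x] that X unfolding span_fP by (simp add: complexify_cplx[OF linear_\<theta>0])
      show "((\<lambda>t. f (\<rho> (k t) v)) has_vector_derivative f (\<pi> (cplx X) v)) (at 0)"
        if "Vector_Spaces.linear s (*) f" for v and f :: "'v \<Rightarrow> complex"
        by (rule \<rho>_derivative[OF _ k(3,4) that]) (use kK k(1) in auto)
      show "((\<lambda>t. M (k t) x) has_vector_derivative br (cplx X) x) (at 0)" for x
      proof -
        have 1: "bounded_linear (cplx :: real ^ 'n \<Rightarrow> complex ^ 'n)" "bounded_linear (\<lambda>v :: real ^ 'n. \<i> *s cplx v)"
          unfolding linear_conv_bounded_linear[symmetric]
          by (auto intro!: linearI simp: vec_eq_iff complex_eq_iff)
        have "((\<lambda>t. cplx (Ad G U \<phi> (k t) (re_part x)) + \<i> *s cplx (Ad G U \<phi> (k t) (im_part x))) has_vector_derivative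
          cplx (lie_bracket G U \<phi> X (re_part x)) + \<i> *s cplx (lie_bracket G U \<phi> X (im_part x))) (at 0)"
          by (intro has_vector_derivative_add bounded_linear.has_vector_derivative[OF 1(1)]
              bounded_linear.has_vector_derivative[OF 1(2)] k(5))
        then show ?thesis by (simp add: complexify_def complexify2_def)
      qed
    qed
  qed
  define a where "a = re_part z"
  define b where "b = im_part z"
  have zab: "z = cplx a + \<i> *s cplx b" unfolding a_def b_def by (rule cplx_decomposition)
  have "cplx (diff_at_one G U \<phi> \<Theta> a) + \<i> *s cplx (diff_at_one G U \<phi> \<Theta> b) = cplx a + \<i> *s cplx b"
    using z unfolding zab by (simp add: \<theta>_simps complexify_cplx[OF linear_\<theta>0])
  then have ab: "diff_at_one G U \<phi> \<Theta> a = a" "diff_at_one G U \<phi> \<Theta> b = b" unfolding cplx_inject by auto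
  have "T.\<pi>W (br z) (\<pi> z) \<Phi> = T.\<pi>W (br (cplx a)) (\<pi> (cplx a)) \<Phi> + fun_scale s \<i> (T.\<pi>W (br (cplx b)) (\<pi> (cplx b)) \<Phi>)"
  proof -
    have "vmap (\<pi> z) \<Phi> = vmap (\<pi> (cplx a)) \<Phi> + fun_scale s \<i> (vmap (\<pi> (cplx b)) \<Phi>)"
      unfolding zab by (rule ext) (simp add: vmap_def fun_apply fun_scale_apply linearD[OF linear_\<pi>_left])
    then show ?thesis
      unfolding T.\<pi>W_def
      by (simp add: zab br_simps C.FS.scale_right_distrib C.FS.scale_sum_right sum.distrib algebra_simps)
  qed
  then show ?thesis
    using real[OF ab(1)] real[OF ab(2)] C.FS.subspace_add[OF Y(1)] C.FS.subspace_scale[OF Y(1)] by simp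
qed

text \<open>Moving the contraction to the right in \<open>A\<close> leaves a scalar trace term,
  harmless for the stability of subspaces, and the derivation that extends \<open>br (g b)\<close>
  on \<open>pplus\<close>.\<close>

lemma A_eq_\<pi>W:
  assumes b: "b \<in> {mP..<nn}"
  shows "C.A mP b \<Phi> = T.\<pi>W (br (g b)) (\<pi> (g b)) \<Phi> - fun_scale s (\<Sum>a<mP. c a b a) \<Phi>"
proof -
  have "C.I k (C.E a \<Phi>) = (if a = k then \<Phi> else 0) - C.E a (C.I k \<Phi>)" if "a < mP" "k < mP" for a k
    using C.I_E[of k a \<Phi>] that by simp
  then have "(\<Sum>a<mP. \<Sum>k<mP. fun_scale s (c a b k) (C.I k (C.E a \<Phi>))) =
     (\<Sum>a<mP. \<Sum>k<mP. (if a = k then fun_scale s (c a b k) \<Phi> else 0) - fun_scale s (c a b k) (C.E a (C.I k \<Phi>)))"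
    by (intro sum.cong refl) (simp add: C.FS.scale_right_diff_distrib)
  also have "\<dots> = fun_scale s (\<Sum>a<mP. c a b a) \<Phi> - (\<Sum>a<mP. \<Sum>k<mP. fun_scale s (c a b k) (C.E a (C.I k \<Phi>)))"
    by (simp add: sum_subtractf C.FS.scale_sum_left)
  also have "(\<Sum>a<mP. \<Sum>k<mP. fun_scale s (c a b k) (C.E a (C.I k \<Phi>))) = (\<Sum>j<mP. C.e (br (g b) (fP ! j)) (C.i (fP ! j) \<Phi>))"
  proof -
    have "C.e (br (g b) (fP ! j)) \<Psi> = (\<Sum>a<mP. fun_scale s (c a b j) (C.E a \<Psi>))" if j: "j < mP" for j \<Psi>
    proof -
      have fj: "fs ! j = fP ! j" using j by (simp add: nth_append)
      have "br (g b) (fP ! j) \<in> vec.span (set fP)"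
        unfolding span_fP using br_k_pplus[OF g_Q[OF b] fs_P[OF j]] fj by simp
      then have "br (g b) (fP ! j) = (\<Sum>a<mP. h (br (g b) (fP ! j)) (fP ! a) *s fP ! a)"
        by (rule U.orthonormal_expansion[OF orthonormal_fP]) simp
      also have "\<dots> = (\<Sum>a<mP. c a b j *s fs ! a)"
      proof (intro sum.cong refl)
        fix a assume "a \<in> {..<mP}"
        then have fa: "fs ! a = fP ! a" by (simp add: nth_append)
        \<comment> \<open>Invariance of the Killing form identifies a structure constant of the
          conjugate of \<open>u\<close> with a matrix entry of \<open>br (g b)\<close> on
          \<open>pplus\<close>.\<close>
        have "c a b j = B (br (g b) (fs ! j)) (g a)" unfolding c_def by (subst B_invariant) (rule B_sym)
        then show "h (br (g b) (fP ! j)) (fP ! a) *s fP ! a = c a b j *s fs ! a" by (simp add: B_g fa fj)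
      qed
      finally have "br (g b) (fP ! j) = (\<Sum>a<mP. c a b j *s fs ! a)" .
      then show ?thesis by (simp add: C.e_sum_left)
    qed
    moreover have "C.i (fP ! j) = C.I j" if "j < mP" for j using that by (simp add: nth_append)
    ultimately show ?thesis by (subst sum.swap) simp
  qed
  finally show ?thesis unfolding C.A_def T.\<pi>W_def by simp
qed

sublocale HS: hodge_setting s H h fP fQ c "\<lambda>a. \<pi> (g a)" "\<lambda>a v. - \<pi> (conj_vec (g a)) v" K \<rho> M
proof unfold_locales
  show "c a b k = 0" if "a < mP" "b < mP" "k < nn" for a b k by (rule c_PP[OF that(1,2)])
  show "c a b k = 0" if "a < mP" "b < nn" "k \<in> {mP..<nn}" for a b k by (rule c_PQ[OF that])
  show "c a b k = 0" if "a \<in> {mP..<nn}" "b \<in> {mP..<nn}" "k < mP" for a b k by (rule c_QQ[OF that])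
  show "C.dP mP (T.\<rho>W k \<Phi>) = T.\<rho>W k (C.dP mP \<Phi>)" if k: "k \<in> K" for k \<Phi>
  proof -
    \<comment> \<open>For \<open>a < mP\<close> the vector \<open>g a\<close> is twice the conjugate
      of the frame vector, so \<open>dP\<close> is an invariant contraction with the
      conjugate-linear map \<open>J\<close>, which commutes with the operators \<open>M k\<close>
      because these come from real ones.\<close>
    have dP: "C.dP mP \<Psi> = (\<Sum>a<mP. C.e (fP ! a) (vmap (\<pi> (2 *s conj_vec (fP ! a))) \<Psi>))" for \<Psi>
      unfolding C.dP_def by (intro sum.cong refl) (simp add: g_P, simp add: nth_append)
    have kc: "k \<in> carrier G" if "k \<in> K" for k using that by simp
    show ?thesis
      unfolding dP
      by (rule T.invariant_sum_commutes[where J = "\<lambda>x. 2 *s conj_vec x", OF linear_\<pi> linear_\<pi>_left \<rho>_\<pi> _ _ _ k])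
        (auto simp: vec.scale_right_distrib linearD(5)[OF linear_M] complexify_conj[OF linear_Ad] mult.commute)
  qed
  show "C.A mP b \<Phi> \<in> Y" if b: "b \<in> {mP..<nn}" and Y: "C.FS.subspace Y" "Y \<subseteq> C.fock C.vac fP"
    "\<And>k \<Phi>. k \<in> K \<Longrightarrow> \<Phi> \<in> Y \<Longrightarrow> T.\<rho>W k \<Phi> \<in> Y" and \<Phi>: "\<Phi> \<in> Y" for b Y \<Phi>
    unfolding A_eq_\<pi>W[OF b]
    by (intro C.FS.subspace_diff C.FS.subspace_scale Y(1) \<pi>W_stable g_Q b Y(2,3) \<Phi>)
qed

text \<open>Both \<open>us\<close>, \<open>ds\<close> and \<open>fs\<close>, \<open>g\<close> are
  pairs of dual bases, so a bilinear contraction has the same value on them: the same coefficients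
  \<open>B (us ! j) (g a)\<close> expand \<open>us\<close> in \<open>fs\<close> and \<open>g\<close>
  in \<open>ds\<close>.\<close>

lemma dual_bases_sum:
  assumes Q1: "\<And>y. Vector_Spaces.linear (*s) t (\<lambda>x. Q x y)" and Q2: "\<And>x. Vector_Spaces.linear (*s) t (Q x)"
  shows "(\<Sum>j<length us. Q (us ! j) (ds ! j)) = (\<Sum>a<nn. Q (fs ! a) (g a))"
proof -
  interpret t: vector_space t using Q2 unfolding Vector_Spaces.linear_iff by blast
  have b: "vec.span (set us) = u" "distinct ds" "vec.span (set ds) = conj_vec ` u" "length ds = length us"
    "\<And>j k. j < length us \<Longrightarrow> k < length us \<Longrightarrow> B (us ! j) (ds ! k) = (if j = k then 1 else 0)"
    using bases unfolding dual_bases_def by auto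
  have us: "us ! j = (\<Sum>a<nn. B (us ! j) (g a) *s fs ! a)" if "j < length us" for j
  proof -
    have "us ! j \<in> vec.span (set fs)" unfolding span_fs b(1)[symmetric] using that by (intro vec.span_base) simp
    then show ?thesis unfolding B_g by (rule U.orthonormal_expansion[OF orthonormal_fs]) simp
  qed
  have ga: "g a = (\<Sum>j<length us. B (us ! j) (g a) *s ds ! j)" if "a < nn" for a
  proof -
    have "g a \<in> vec.span (set ds)" unfolding b(3) by (rule g_conj_u[OF that])
    then obtain w where "g a = (\<Sum>v\<in>set ds. w v *s v)" by (auto simp: vec.span_finite)
    also have "\<dots> = (\<Sum>j<length ds. w (ds ! j) *s ds ! j)"
      by (rule sum.reindex_bij_betw[symmetric]) (use b(2) bij_betw_nth in blast)
    finally have w: "g a = (\<Sum>j<length us. w (ds ! j) *s ds ! j)" unfolding b(4) .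
    have "B (us ! j) (g a) = w (ds ! j)" if "j < length us" for j
    proof -
      have "B (us ! j) (g a) = (\<Sum>k<length us. w (ds ! k) * B (us ! j) (ds ! k))"
        unfolding w by (simp add: B_simps)
      also have "\<dots> = (\<Sum>k<length us. w (ds ! k) * (if j = k then 1 else 0))"
        by (intro sum.cong refl) (use b(5)[OF that] in simp)
      finally show ?thesis using that by (simp add: if_distrib cong: if_cong)
    qed
    then show ?thesis by (subst w) simp
  qed
  have "(\<Sum>j<length us. Q (us ! j) (ds ! j)) = (\<Sum>j<length us. \<Sum>a<nn. t (B (us ! j) (g a)) (Q (fs ! a) (ds ! j)))"
  proof (intro sum.cong refl)
    fix j assume "j \<in> {..<length us}"
    then have "Q (us ! j) (ds ! j) = Q (\<Sum>a<nn. B (us ! j) (g a) *s fs ! a) (ds ! j)" using us by simp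
    then show "Q (us ! j) (ds ! j) = (\<Sum>a<nn. t (B (us ! j) (g a)) (Q (fs ! a) (ds ! j)))"
      by (simp only: linearD(5,6)[OF Q1])
  qed
  also have "\<dots> = (\<Sum>a<nn. \<Sum>j<length us. t (B (us ! j) (g a)) (Q (fs ! a) (ds ! j)))" by (rule sum.swap)
  also have "\<dots> = (\<Sum>a<nn. Q (fs ! a) (g a))"
  proof (intro sum.cong refl)
    fix a assume "a \<in> {..<nn}"
    then have "Q (fs ! a) (g a) = Q (fs ! a) (\<Sum>j<length us. B (us ! j) (g a) *s ds ! j)" using ga by simp
    then show "(\<Sum>j<length us. t (B (us ! j) (g a)) (Q (fs ! a) (ds ! j))) = Q (fs ! a) (g a)"
      by (simp only: linearD(5,6)[OF Q2])
  qed
  finally show ?thesis .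
qed

lemma us_u:
  assumes "j < length us"
  shows "us ! j \<in> u" "ds ! j \<in> conj_vec ` u"
proof -
  have b: "vec.span (set us) = u" "vec.span (set ds) = conj_vec ` u" "length ds = length us"
    using bases unfolding dual_bases_def by auto
  show "us ! j \<in> u" unfolding b(1)[symmetric] using assms by (intro vec.span_base) simp
  show "ds ! j \<in> conj_vec ` u" unfolding b(2)[symmetric] using assms b(3) by (intro vec.span_base) simp
qed

text \<open>The covector of \<open>B z\<close> is a combination of the Riesz covectors of the frame,
  with the coordinates of \<open>z\<close> in the dual basis \<open>g\<close> as coefficients.
  Splitting the contraction accordingly uses linearity in the covector, hence the Fock
  space.\<close>

lemma cliff_opp_eq:
  assumes "z \<in> conj_vec ` u" "\<Psi> \<in> C.fock C.vac fs"
  shows "cliff_opp s B z \<Psi> = fun_scale s 2 (\<Sum>k<nn. fun_scale s (B z (fs ! k)) (C.I k \<Psi>))"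
proof -
  have "covector (B z) = (\<Sum>k<nn. B z (fs ! k) *s C.flat (fs ! k))"
  proof -
    have bz: "B z y = (\<Sum>k<nn. B z (fs ! k) * h y (fs ! k))" for y
    proof -
      have "B z y = B (\<Sum>k<nn. B z (fs ! k) *s g k) y"
        by (rule arg_cong[OF expand_conj_u[OF assms(1)]])
      also have "\<dots> = (\<Sum>k<nn. B z (fs ! k) * B (g k) y)" by (simp add: B_simps)
      also have "\<dots> = (\<Sum>k<nn. B z (fs ! k) * h y (fs ! k))"
        unfolding B_g[symmetric] by (intro sum.cong refl arg_cong2[where f = "(*)"] B_sym)
      finally show ?thesis .
    qed
    show ?thesis
    proof (rule vec_eq_iff[THEN iffD2], rule allI)
      fix j
      have "covector (B z) $ j = B z (axis j 1)" by (simp add: covector_def)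
      also have "\<dots> = (\<Sum>k<nn. B z (fs ! k) * h (axis j 1) (fs ! k))" by (rule bz)
      also have "\<dots> = (\<Sum>k<nn. B z (fs ! k) *s C.flat (fs ! k)) $ j" by (simp add: C.flat_def covector_def)
      finally show "covector (B z) $ j = (\<Sum>k<nn. B z (fs ! k) *s C.flat (fs ! k)) $ j" .
    qed
  qed
  then have "contract (covector (B z)) \<Psi> = (\<Sum>k<nn. fun_scale s (B z (fs ! k)) (C.I k \<Psi>))"
    using C.contract_fock_sum[OF assms(2)] by simp
  moreover have "cliff_opp s B z \<Psi> = fun_scale s 2 (contract (covector (B z)) \<Psi>)"
    by (simp add: cliff_opp_def fun_scale_def contract_def)
  ultimately show ?thesis by simp
qed

text \<open>The given bases enter only through contractions of dual pairs, once in the first term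
  and twice in the second, so they can be replaced by the frame and its dual.\<close>

lemma C_op_eq:
  assumes \<Phi>: "\<Phi> \<in> C.fock C.vac fs"
  shows "C_op s br \<pi> us ds \<Phi> = C.d \<Phi>"
proof -
  have lin\<pi>: "Vector_Spaces.linear (*s) (fun_scale s) (\<lambda>y. vmap (\<pi> y) \<Phi>)" for \<Phi> :: "(complex ^ 'n) list \<Rightarrow> 'v"
    unfolding Vector_Spaces.linear_iff
    by (auto simp: C.FS.vector_space_axioms vec.vector_space_axioms vmap_def fun_eq_iff fun_apply fun_scale_apply linearD[OF linear_\<pi>_left])
  have 1: "(\<Sum>j<length us. wedge_mult s (us ! j) (\<lambda>as. \<pi> (ds ! j) (\<Phi> as))) = (\<Sum>a<nn. C.E a (C.P a \<Phi>))"
  proof -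
    have "Vector_Spaces.linear (*s) (fun_scale s) (\<lambda>y. C.e x (vmap (\<pi> y) \<Phi>))" for x
      using Vector_Spaces.linear_compose[OF lin\<pi> C.linear_e] by (simp only: o_def)
    from dual_bases_sum[of "fun_scale s" "\<lambda>x y. C.e x (vmap (\<pi> y) \<Phi>)", OF C.linear_e_left this]
    show ?thesis unfolding vmap_def .
  qed
  have eu: "C.e x \<Psi> \<in> C.fock C.vac fs" if "x \<in> u" "\<Psi> \<in> C.fock C.vac fs" for x \<Psi>
    using that by (intro C.fock_e[OF C.subspace_vac]) (simp_all only: span_fs)
  \<comment> \<open>The four basis slots are kept separate so that the change of basis can be made
    for one dual pair at a time.\<close>
  define F where "F x y z w = (\<Sum>k<nn. fun_scale s (B (br y w) (fs ! k)) (C.I k (C.e x (C.e z \<Phi>))))" for x y z w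
  have F1: "Vector_Spaces.linear (*s) (fun_scale s) (\<lambda>x. F x y z w)" and F2: "Vector_Spaces.linear (*s) (fun_scale s) (\<lambda>y. F x y z w)"
    and F3: "Vector_Spaces.linear (*s) (fun_scale s) (\<lambda>z. F x y z w)" and F4: "Vector_Spaces.linear (*s) (fun_scale s) (\<lambda>w. F x y z w)" for x y z w
    unfolding F_def Vector_Spaces.linear_iff
    by (auto simp: C.FS.vector_space_axioms vec.vector_space_axioms sum.distrib C.FS.scale_right_distrib
        C.FS.scale_left_distrib C.FS.scale_sum_right br_simps B_simps mult.commute)
  have lsum: "Vector_Spaces.linear (*s) (fun_scale s) (\<lambda>x. \<Sum>j\<in>J. f j x)"
    if "\<And>j. Vector_Spaces.linear (*s) (fun_scale s) (f j)" for J :: "nat set" and f :: "nat \<Rightarrow> complex ^ 'n \<Rightarrow> (complex ^ 'n) list \<Rightarrow> 'v"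
    using that unfolding Vector_Spaces.linear_iff by (simp add: sum.distrib C.FS.scale_sum_right)
  have "(\<Sum>j<length us. \<Sum>k<length us. cliff_opp s B (br (ds ! j) (ds ! k)) (wedge_mult s (us ! j) (wedge_mult s (us ! k) \<Phi>))) =
     fun_scale s 2 (\<Sum>j<length us. \<Sum>k<length us. F (us ! j) (ds ! j) (us ! k) (ds ! k))"
    unfolding C.FS.scale_sum_right F_def
    by (intro sum.cong refl, subst cliff_opp_eq)
      (auto simp: C.FS.scale_sum_right intro!: br_conj_u us_u eu \<Phi>)
  also have "(\<Sum>j<length us. \<Sum>k<length us. F (us ! j) (ds ! j) (us ! k) (ds ! k)) =
      (\<Sum>j<length us. \<Sum>b<nn. F (us ! j) (ds ! j) (fs ! b) (g b))"
  proof (rule sum.cong[OF refl])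
    fix j
    show "(\<Sum>k<length us. F (us ! j) (ds ! j) (us ! k) (ds ! k)) = (\<Sum>b<nn. F (us ! j) (ds ! j) (fs ! b) (g b))"
      by (rule dual_bases_sum[of "fun_scale s" "F (us ! j) (ds ! j)", OF F3 F4])
  qed
  also have "\<dots> = (\<Sum>a<nn. \<Sum>b<nn. F (fs ! a) (g a) (fs ! b) (g b))"
    by (rule dual_bases_sum[of "fun_scale s" "\<lambda>x y. \<Sum>b<nn. F x y (fs ! b) (g b)"]) (intro lsum F1 F2)+
  finally show ?thesis
    unfolding C_op_def 1 C.d_def F_def c_def by simp
qed

lemma VS_eq: "VS_space s u = C.fock C.vac fs"
  using C.VS_space_eq_fock[of fs] unfolding span_fs .

text \<open>On \<open>VS\<close> the chosen form is \<open>C.form fs\<close>, and its definiteness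
  forces the chosen adjoint to coincide with \<open>C.d_adj\<close> there. All sets in the claim
  depend only on these values, so \<open>HS.hodge\<close> applies.\<close>

lemma hodge_C_op:
  defines "VS \<equiv> VS_space s u" and "C' \<equiv> C_op s br \<pi> us ds"
  defines "Cadj \<equiv> adjoint_op VS (VS_form s H h u) C'"
  defines "\<Delta> \<equiv> \<lambda>x. C' (Cadj x) + Cadj (C' x)"
  shows "{x \<in> VS. \<Delta> x = 0} = {x \<in> VS. C' x = 0} \<inter> {x \<in> VS. Cadj x = 0} \<and>
    internal_direct_sum [{x \<in> VS. \<Delta> x = 0}, C' ` VS, Cadj ` VS] VS \<and>
    internal_direct_sum [{x \<in> VS. \<Delta> x = 0}, C' ` VS] {x \<in> VS. C' x = 0} \<and>
    internal_direct_sum [{x \<in> VS. \<Delta> x = 0}, Cadj ` VS] {x \<in> VS. Cadj x = 0}"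
proof -
  interpret F: hermitian_space "fun_scale s" "C.form fs" VS
    unfolding VS_def VS_eq by (rule C.hermitian_form[OF orthonormal_fs])
  have dVS: "C.d x \<in> VS" "C.d_adj x \<in> VS" if "x \<in> VS" for x
    using C.d_fock C.d_adj_fock that unfolding VS_def VS_eq by blast+
  have C': "C' x = C.d x" if "x \<in> VS" for x
    using C_op_eq that unfolding VS_def VS_eq C'_def by blast
  have form: "VS_form s H h u x y = C.form fs x y" if "x \<in> VS" "y \<in> VS" for x y
    using C.VS_form_eq[OF orthonormal_fs span_fs[symmetric]] that unfolding VS_def by blast
  let ?P = "\<lambda>A. (\<forall>y\<in>VS. A y \<in> VS) \<and> (\<forall>x\<in>VS. \<forall>y\<in>VS. VS_form s H h u (C' x) y = VS_form s H h u x (A y))"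
  have fd: "C.form fs (C.d x) y = C.form fs x (C.d_adj y)" if "x \<in> VS" "y \<in> VS" for x y
    using C.form_d that unfolding VS_def VS_eq by blast
  have "?P C.d_adj" using dVS fd by (simp add: C' form)
  then have P: "?P Cadj" unfolding Cadj_def adjoint_op_def by (rule someI[of ?P])
  have Cadj: "Cadj y = C.d_adj y" if y: "y \<in> VS" for y
  proof -
    have mem: "Cadj y \<in> VS" "C.d_adj y \<in> VS" using P y dVS by blast+
    have "C.form fs x (Cadj y - C.d_adj y) = 0" if x: "x \<in> VS" for x
    proof -
      have "C.form fs x (Cadj y) = C.form fs (C.d x) y"
        using P x y mem dVS by (metis C' form)
      then show ?thesis using fd[OF x y] by simp
    qed
    moreover have "Cadj y - C.d_adj y \<in> VS" using mem C.FS.subspace_diff[OF F.subspace_W] by blast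
    ultimately have "Cadj y - C.d_adj y = 0" using F.h_self_eq_0 by blast
    then show ?thesis by simp
  qed
  have im: "C' ` VS = C.d ` VS" "Cadj ` VS = C.d_adj ` VS"
    using C' Cadj by (auto simp: image_iff)
  have sets: "{x \<in> VS. \<Delta> x = 0} = {x \<in> VS. C.d (C.d_adj x) + C.d_adj (C.d x) = 0}"
    "{x \<in> VS. C' x = 0} = {x \<in> VS. C.d x = 0}" "{x \<in> VS. Cadj x = 0} = {x \<in> VS. C.d_adj x = 0}"
    using C' Cadj dVS by (auto simp: \<Delta>_def)
  show ?thesis
    unfolding im sets using HS.hodge unfolding VS_def VS_eq by blast
qed

end

theorem theorem7p2:
  fixes G :: "('g, 'm) monoid_scheme"
    and T :: "'g topology"
    and A :: "('g set \<times> ('g \<Rightarrow> real ^ 'n)) set"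
    and U :: "'g set" and \<phi> :: "'g \<Rightarrow> real ^ 'n"
    and \<Theta> :: "'g \<Rightarrow> 'g"
    and pplus pminus q l u :: "(complex ^ 'n) set"
    and s :: "complex \<Rightarrow> 'v::ab_group_add \<Rightarrow> 'v"
    and \<pi> :: "complex ^ 'n \<Rightarrow> 'v \<Rightarrow> 'v"
    and \<rho> :: "'g \<Rightarrow> 'v \<Rightarrow> 'v"
    and H :: "'v \<Rightarrow> 'v \<Rightarrow> complex"
    and us ds :: "(complex ^ 'n) list"
  defines "K \<equiv> {k \<in> carrier G. \<Theta> k = k}"
    and "br0 \<equiv> lie_bracket G U \<phi>"
    and "\<theta>0 \<equiv> diff_at_one G U \<phi> \<Theta>"
    and "VS \<equiv> VS_space s u"
  defines "br \<equiv> complexify2 br0"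
    and "\<theta> \<equiv> complexify \<theta>0"
  defines "C \<equiv> C_op s br \<pi> us ds"
    and "form \<equiv> VS_form s H (u_form br \<theta>) u"
  defines "Cadj \<equiv> adjoint_op VS form C"
  defines "\<Delta> \<equiv> \<lambda>x. C (Cadj x) + Cadj (C x)"
  assumes G: "lie_group G T A" "connected_space T" "finite (group_center G)"
    and chart: "(U, \<phi>) \<in> A" "\<one>\<^bsub>G\<^esub> \<in> U"
    and semisimple: "semisimple_lie_algebra (*\<^sub>R) br0"
    and Theta: "\<Theta> \<in> iso G G" "smooth_map T A T A \<Theta>" "\<forall>x\<in>carrier G. \<Theta> (\<Theta> x) = x"
    and cartan: "cartan_involution br0 \<theta>0"
    and hermitian: "hermitian_symmetric br \<theta> K (\<lambda>k. complexify (Ad G U \<phi> k)) pplus pminus"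
    and parabolic: "theta_stable_parabolic br \<theta> q l u"
    and l_sub: "l \<subseteq> {x. \<theta> x = x}"
    and u_sup: "pplus \<subseteq> u"
    and V: "gK_module G T U \<phi> K s \<pi> \<rho>" "admissible s K \<rho>" "unitary_form K s \<pi> \<rho> H"
    and bases: "dual_bases (killing_form br) u (conj_vec ` u) us ds"
  shows "{x \<in> VS. \<Delta> x = 0} = {x \<in> VS. C x = 0} \<inter> {x \<in> VS. Cadj x = 0} \<and>
    internal_direct_sum [{x \<in> VS. \<Delta> x = 0}, C ` VS, Cadj ` VS] VS \<and>
    internal_direct_sum [{x \<in> VS. \<Delta> x = 0}, C ` VS] {x \<in> VS. C x = 0} \<and>
    internal_direct_sum [{x \<in> VS. \<Delta> x = 0}, Cadj ` VS] {x \<in> VS. Cadj x = 0}"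
proof -
  note defs = K_def br_def \<theta>_def br0_def \<theta>0_def
  interpret S: cohomology_setting G T A U \<phi> \<Theta> pplus pminus q l u s \<pi> \<rho> H us ds
  proof unfold_locales
    show "lie_algebra (*\<^sub>R) (lie_bracket G U \<phi>)"
      using semisimple unfolding semisimple_lie_algebra_def br0_def by blast
  qed (use G(1) chart Theta cartan hermitian parabolic u_sup V bases in \<open>simp_all only: defs\<close>)
  obtain fP fQ where frame: "S.U.orthonormal fP" "vec.span (set fP) = pplus" "\<And>f. f \<in> set fQ \<Longrightarrow> \<theta> f = f"
    "S.U.orthonormal (fP @ fQ)" "vec.span (set (fP @ fQ)) = u"
    using S.exists_frame unfolding defs by metis
  interpret F: cohomology_frame G T A U \<phi> \<Theta> pplus pminus q l u s \<pi> \<rho> H us ds fP fQ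
    by unfold_locales (use frame in \<open>simp_all only: defs\<close>)
  show ?thesis
    unfolding \<Delta>_def Cadj_def form_def C_def VS_def defs by (rule F.hodge_C_op)
qed

end
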